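(* Let $\mathbf{k}$ be a field, $\mathcal{R}$ a finite-dimensional $\mathbf{k}$-algebra, and $n\ge1$ an integer such that $\mathrm{char}\,\mathbf{k}\mid n$ (so $\mathrm{char}\,\mathbf{k}>0$). Then there is a graded algebra $\mathcal{A}_n$ such that $\mathrm{HH}^*(\mathcal{R}_n)$ is a trivial singular extension of $\mathcal{A}_n$ by $\mathcal{A}_n[-1]$ and $\mathrm{HH}^*(T\mathcal{R})_0$ is some singular extension of $\mathcal{A}_n$ by $\mathcal{A}_n[-1]$. In other words, there is an isomorphism of graded algebras $$\mathrm{HH}^*(\mathcal{R}_n)\cong\mathcal{A}_n[x,0]/\langle x^2\rangle,$$ and there is an exact sequence $$0\to\mathcal{A}_n[-1]\to\mathrm{HH}^*(T\mathcal{R})_0\to\mathcal{A}_n\to0$$ in which $\mathrm{HH}^*(T\mathcal{R})_0\to\mathcal{A}_n$ is a homomorphism of graded algebras whose kernel has zero multiplication and is isomorphic, as a graded $\mathcal{A}_n$-bimodule, to $\mathcal{A}_n[-1]$.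
   Context: $D\mathcal{R}=\mathrm{Hom}_{\mathbf{k}}(\mathcal{R},\mathbf{k})$ as an $\mathcal{R}$-bimodule. $T\mathcal{R}=\mathcal{R}\oplus D\mathcal{R}$ is the trivial extension algebra: $(a,\hat u)(b,\hat v)=(ab,a\hat v+\hat ub)$. It is $\mathbb{Z}$-graded with $(T\mathcal{R})_0=\mathcal{R}$, $(T\mathcal{R})_1=D\mathcal{R}$ and all other components zero; via the projection $\mathbb{Z}\to C_n$ onto the cyclic group of order $n$ it is $C_n$-graded. For a finite group $G$ and a $G$-graded algebra $B=\bigoplus_{\alpha\in G}B_\alpha$, the algebra $BG^*=B\#\mathbf{k}G^*$ has underlying space $\bigoplus_{\alpha\in G}Bp_\alpha$ and multiplication $(ap_\alpha)(bp_\beta)=(ab_{\alpha\beta^{-1}})p_\beta$, where $b_\gamma$ is the $\gamma$-component of $b$. Put $\mathcal{R}_n=T\mathcal{R}\#\mathbf{k}C_n^*$ (in particular $\mathcal{R}_1=T\mathcal{R}$). $\mathrm{HH}^*(B)=\mathrm{HH}^*(B,B)$ with the cup product. For a $G$-graded algebra $B$, $\mathrm{HH}^*(B)_0$ is the subalgebra of $\mathrm{HH}^*(B)$ given by the cohomology of the direct summand of the Hochschild cochain complex consisting of the grading-preserving cochains ($f:B^{\otimes m}\to B$ with $f(B_{\alpha_1}\otimes\cdots\otimes B_{\alpha_m})\subset B_{\alpha_1\cdots\alpha_m}$). Here $\mathrm{HH}^*(T\mathcal{R})_0$ is taken with respect to the $C_n$-grading on $T\mathcal{R}$. A graded algebra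 $E$ is a singular extension of a graded algebra $B$ by a graded $B$-bimodule $X$ if there is a surjective homomorphism of graded algebras $E\to B$ whose kernel has square zero and is isomorphic to $X$ as a graded $B$-bimodule; it is trivial if $E\cong B\oplus X$ with $(b,x)(b',x')=(bb',bx'+xb')$. For a graded $B$-bimodule $L$, $L[t]$ has $L[t]_n=L_{n+t}$ and bimodule structure $a\,l[t]\,b=(-1)^{it}(alb)[t]$ for $b\in B_i$. $B[x,0]$ is the graded algebra with underlying space $B[x]$, $x$ of degree $1$, containing $B$ and $\mathbf{k}[x]$ as subalgebras, with $xb=(-1)^ibx$ for $b\in B_i$. *)

theory Defs
  imports
    "HOL-Algebra.FiniteProduct"
    "HOL-Algebra.Elementary_Groups"
    "HOL-Computational_Algebra.Computational_Algebra"
    "HOL-Library.Function_Algebras"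
    "HOL-Library.Product_Plus"
begin

section \<open>Algebras over a field\<close>

text \<open>
  The ground field is a type of class \<open>field\<close>. An algebra is a linear subspace of an ambient
  vector space, whose addition is that of the type class, together with a (not necessarily
  commutative, possibly zero) unital multiplication on this subspace.
\<close>

record ('k, 'a) kalg = "'a monoid" +
  scale :: "'k \<Rightarrow> 'a \<Rightarrow> 'a"

locale kalgebra = monoid A
  for A :: "('k::field, 'a::ab_group_add, 'z) kalg_scheme" (structure) +
  assumes vector_space_scale: "vector_space (scale A)"
    and subspace_carrier: "module.subspace (scale A) (carrier A)"
    and l_distrib: "\<lbrakk>x \<in> carrier A; y \<in> carrier A; z \<in> carrier A\<rbrakk> \<Longrightarrow> (x + y) \<otimes> z = x \<otimes> z + y \<otimes> z"
    and r_distrib: "\<lbrakk>x \<in> carrier A; y \<in> carrier A; z \<in> carrier A\<rbrakk> \<Longrightarrow> z \<otimes> (x + y) = z \<otimes> x + z \<otimes> y"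
    and scale_l: "\<lbrakk>x \<in> carrier A; y \<in> carrier A\<rbrakk> \<Longrightarrow> scale A c x \<otimes> y = scale A c (x \<otimes> y)"
    and scale_r: "\<lbrakk>x \<in> carrier A; y \<in> carrier A\<rbrakk> \<Longrightarrow> x \<otimes> scale A c y = scale A c (x \<otimes> y)"

locale fd_kalgebra = kalgebra +
  assumes finite_dim: "\<exists>S. finite S \<and> module.span (scale A) S = carrier A"

text \<open>Linear forms on the carrier are represented by functions that vanish outside of it.\<close>

definition dual_space :: "('k::field, 'a::ab_group_add, 'z) kalg_scheme \<Rightarrow> ('a \<Rightarrow> 'k) set" where
  "dual_space A = {u. (\<forall>x. x \<notin> carrier A \<longrightarrow> u x = 0)
     \<and> (\<forall>x\<in>carrier A. \<forall>y\<in>carrier A. u (x + y) = u x + u y)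
     \<and> (\<forall>c. \<forall>x\<in>carrier A. u (scale A c x) = c * u x)}"

definition dual_lact :: "('k::field, 'a::ab_group_add, 'z) kalg_scheme \<Rightarrow> 'a \<Rightarrow> ('a \<Rightarrow> 'k) \<Rightarrow> 'a \<Rightarrow> 'k" where
  "dual_lact A a u = (\<lambda>x. if x \<in> carrier A then u (x \<otimes>\<^bsub>A\<^esub> a) else 0)"

definition dual_ract :: "('k::field, 'a::ab_group_add, 'z) kalg_scheme \<Rightarrow> ('a \<Rightarrow> 'k) \<Rightarrow> 'a \<Rightarrow> 'a \<Rightarrow> 'k" where
  "dual_ract A u a = (\<lambda>x. if x \<in> carrier A then u (a \<otimes>\<^bsub>A\<^esub> x) else 0)"

definition trivial_ext :: "('k::field, 'a::ab_group_add, 'z) kalg_scheme \<Rightarrow> ('k, 'a \<times> ('a \<Rightarrow> 'k)) kalg" where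
  "trivial_ext A =
     \<lparr>carrier = carrier A \<times> dual_space A,
      monoid.mult = (\<lambda>(a, u) (b, v). (a \<otimes>\<^bsub>A\<^esub> b, dual_lact A a v + dual_ract A u b)),
      one = (\<one>\<^bsub>A\<^esub>, 0),
      scale = (\<lambda>c (a, u). (scale A c a, \<lambda>x. c * u x))\<rparr>"


section \<open>Gradings by groups and smash products\<close>

definition trivial_ext_grading ::
    "('k::field, 'a::ab_group_add, 'z) kalg_scheme \<Rightarrow> int \<Rightarrow> ('a \<times> ('a \<Rightarrow> 'k)) set" where
  "trivial_ext_grading A i =
     (if i = 0 then carrier A \<times> {0} else if i = 1 then {0} \<times> dual_space A else {0})"

definition push_grading ::
    "('k::field, 'a::ab_group_add, 'z) kalg_scheme \<Rightarrow> ('h \<Rightarrow> 'g) \<Rightarrow> ('h \<Rightarrow> 'a set) \<Rightarrow> 'g \<Rightarrow> 'a set" where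
  "push_grading B \<pi> D \<gamma> = module.span (scale B) (\<Union>i\<in>{i. \<pi> i = \<gamma>}. D i)"

text \<open>\<open>integer_mod_group n\<close> has carrier \<open>{0..<int n}\<close> for \<open>n \<ge> 1\<close>.\<close>

definition trivial_ext_cyclic_grading ::
    "('k::field, 'a::ab_group_add, 'z) kalg_scheme \<Rightarrow> nat \<Rightarrow> int \<Rightarrow> ('a \<times> ('a \<Rightarrow> 'k)) set" where
  "trivial_ext_cyclic_grading A n =
     push_grading (trivial_ext A) (\<lambda>i. i mod int n) (trivial_ext_grading A)"

text \<open>The \<open>\<gamma>\<close>-component of \<open>b\<close>, for a grading \<open>D\<close> by a finite group \<open>G\<close>.\<close>

definition component :: "('g, 'm) monoid_scheme \<Rightarrow> ('g \<Rightarrow> 'a set) \<Rightarrow> 'g \<Rightarrow> 'a \<Rightarrow> 'a::ab_group_add" where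
  "component G D \<gamma> b =
     (THE s. (\<forall>\<alpha>\<in>carrier G. s \<alpha> \<in> D \<alpha>) \<and> (\<forall>\<alpha>. \<alpha> \<notin> carrier G \<longrightarrow> s \<alpha> = 0)
        \<and> (\<Sum>\<alpha>\<in>carrier G. s \<alpha>) = b) \<gamma>"

text \<open>The function \<open>\<phi>\<close> represents the element \<open>\<Sum>\<alpha>\<in>G. \<phi>(\<alpha>) p\<^sub>\<alpha>\<close>.\<close>

definition smash :: "('g, 'm) monoid_scheme \<Rightarrow> ('g \<Rightarrow> 'a set) \<Rightarrow>
    ('k::field, 'a::ab_group_add, 'z) kalg_scheme \<Rightarrow> ('k, 'g \<Rightarrow> 'a) kalg" where
  "smash G D B =
     \<lparr>carrier = {\<phi>. (\<forall>\<alpha>\<in>carrier G. \<phi> \<alpha> \<in> carrier B) \<and> (\<forall>\<alpha>. \<alpha> \<notin> carrier G \<longrightarrow> \<phi> \<alpha> = 0)},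
      monoid.mult = (\<lambda>\<phi> \<psi> \<beta>. if \<beta> \<in> carrier G
        then \<Sum>\<alpha>\<in>carrier G. \<phi> \<alpha> \<otimes>\<^bsub>B\<^esub> component G D (\<alpha> \<otimes>\<^bsub>G\<^esub> inv\<^bsub>G\<^esub> \<beta>) (\<psi> \<beta>) else 0),
      one = (\<lambda>\<alpha>. if \<alpha> \<in> carrier G then \<one>\<^bsub>B\<^esub> else 0),
      scale = (\<lambda>c \<phi> \<alpha>. scale B c (\<phi> \<alpha>))\<rparr>"

definition smash_trivial_ext :: "('k::field, 'a::ab_group_add, 'z) kalg_scheme \<Rightarrow> nat \<Rightarrow>
    ('k, int \<Rightarrow> 'a \<times> ('a \<Rightarrow> 'k)) kalg" where
  "smash_trivial_ext A n =
     smash (integer_mod_group n) (trivial_ext_cyclic_grading A n) (trivial_ext A)"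


section \<open>Graded algebras and graded bimodules\<close>

text \<open>
  A graded object is the family of its homogeneous components; these need not be disjoint, so
  every operation takes the degrees of its arguments as parameters: \<open>gmult A i j\<close> is the
  multiplication \<open>A\<^sub>i \<times> A\<^sub>j \<rightarrow> A\<^sub>i\<^sub>+\<^sub>j\<close>, \<open>lact L i j\<close> is the left action \<open>B\<^sub>i \<times> L\<^sub>j \<rightarrow> L\<^sub>i\<^sub>+\<^sub>j\<close>, and
  \<open>ract L j i\<close> is the right action \<open>L\<^sub>j \<times> B\<^sub>i \<rightarrow> L\<^sub>j\<^sub>+\<^sub>i\<close>.
\<close>

record ('k, 'a) gvs =
  gcomp :: "int \<Rightarrow> 'a set"
  gadd :: "int \<Rightarrow> 'a \<Rightarrow> 'a \<Rightarrow> 'a"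
  gzero :: "int \<Rightarrow> 'a"
  gscale :: "int \<Rightarrow> 'k \<Rightarrow> 'a \<Rightarrow> 'a"

record ('k, 'a) galg = "('k, 'a) gvs" +
  gmult :: "int \<Rightarrow> int \<Rightarrow> 'a \<Rightarrow> 'a \<Rightarrow> 'a"
  gone :: 'a

record ('k, 'b, 'a) gbimod = "('k, 'a) gvs" +
  lact :: "int \<Rightarrow> int \<Rightarrow> 'b \<Rightarrow> 'a \<Rightarrow> 'a"
  ract :: "int \<Rightarrow> int \<Rightarrow> 'a \<Rightarrow> 'b \<Rightarrow> 'a"

definition ggroup :: "('k, 'a, 'z) gvs_scheme \<Rightarrow> int \<Rightarrow> 'a monoid" where
  "ggroup V m = \<lparr>carrier = gcomp V m, monoid.mult = gadd V m, one = gzero V m\<rparr>"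

locale graded_vector_space =
  fixes V :: "('k::field, 'a, 'z) gvs_scheme"
  assumes comm_group_ggroup: "comm_group (ggroup V m)"
    and gscale_closed: "x \<in> gcomp V m \<Longrightarrow> gscale V m c x \<in> gcomp V m"
    and gscale_gadd: "\<lbrakk>x \<in> gcomp V m; y \<in> gcomp V m\<rbrakk> \<Longrightarrow>
      gscale V m c (gadd V m x y) = gadd V m (gscale V m c x) (gscale V m c y)"
    and gscale_add: "x \<in> gcomp V m \<Longrightarrow>
      gscale V m (c + d) x = gadd V m (gscale V m c x) (gscale V m d x)"
    and gscale_gscale: "x \<in> gcomp V m \<Longrightarrow> gscale V m c (gscale V m d x) = gscale V m (c * d) x"
    and gscale_one: "x \<in> gcomp V m \<Longrightarrow> gscale V m 1 x = x"

definition bilinear_graded :: "('k, 'a, 'y) gvs_scheme \<Rightarrow> ('k, 'b, 'z) gvs_scheme \<Rightarrow>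
    ('k, 'c, 'w) gvs_scheme \<Rightarrow> (int \<Rightarrow> int \<Rightarrow> 'a \<Rightarrow> 'b \<Rightarrow> 'c) \<Rightarrow> bool" where
  "bilinear_graded U V W p \<longleftrightarrow>
    (\<forall>i j. \<forall>x\<in>gcomp U i. \<forall>y\<in>gcomp V j.
       p i j x y \<in> gcomp W (i + j)
       \<and> (\<forall>x'\<in>gcomp U i. p i j (gadd U i x x') y = gadd W (i + j) (p i j x y) (p i j x' y))
       \<and> (\<forall>y'\<in>gcomp V j. p i j x (gadd V j y y') = gadd W (i + j) (p i j x y) (p i j x y'))
       \<and> (\<forall>c. p i j (gscale U i c x) y = gscale W (i + j) c (p i j x y)
            \<and> p i j x (gscale V j c y) = gscale W (i + j) c (p i j x y)))"

locale graded_algebra = graded_vector_space A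
  for A :: "('k::field, 'a, 'z) galg_scheme" +
  assumes gmult_bilinear: "bilinear_graded A A A (gmult A)"
    and gmult_assoc: "\<lbrakk>x \<in> gcomp A i; y \<in> gcomp A j; z \<in> gcomp A k\<rbrakk> \<Longrightarrow>
      gmult A (i + j) k (gmult A i j x y) z = gmult A i (j + k) x (gmult A j k y z)"
    and gone_closed: "gone A \<in> gcomp A 0"
    and gone_l: "x \<in> gcomp A i \<Longrightarrow> gmult A 0 i (gone A) x = x"
    and gone_r: "x \<in> gcomp A i \<Longrightarrow> gmult A i 0 x (gone A) = x"

locale graded_bimodule = B: graded_algebra B + graded_vector_space L
  for B :: "('k::field, 'b, 'y) galg_scheme" and L :: "('k, 'b, 'a, 'z) gbimod_scheme" +
  assumes lact_bilinear: "bilinear_graded B L L (lact L)"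
    and ract_bilinear: "bilinear_graded L B L (ract L)"
    and lact_assoc: "\<lbrakk>a \<in> gcomp B i; b \<in> gcomp B j; l \<in> gcomp L k\<rbrakk> \<Longrightarrow>
      lact L (i + j) k (gmult B i j a b) l = lact L i (j + k) a (lact L j k b l)"
    and ract_assoc: "\<lbrakk>l \<in> gcomp L k; a \<in> gcomp B i; b \<in> gcomp B j\<rbrakk> \<Longrightarrow>
      ract L k (i + j) l (gmult B i j a b) = ract L (k + i) j (ract L k i l a) b"
    and lact_ract: "\<lbrakk>a \<in> gcomp B i; l \<in> gcomp L k; b \<in> gcomp B j\<rbrakk> \<Longrightarrow>
      ract L (i + k) j (lact L i k a l) b = lact L i (k + j) a (ract L k j l b)"
    and lact_one: "l \<in> gcomp L k \<Longrightarrow> lact L 0 k (gone B) l = l"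
    and ract_one: "l \<in> gcomp L k \<Longrightarrow> ract L k 0 l (gone B) = l"

definition linear_graded :: "('k, 'a, 'y) gvs_scheme \<Rightarrow> ('k, 'b, 'z) gvs_scheme \<Rightarrow>
    (int \<Rightarrow> 'a \<Rightarrow> 'b) \<Rightarrow> bool" where
  "linear_graded V W h \<longleftrightarrow>
    (\<forall>m. \<forall>x\<in>gcomp V m. h m x \<in> gcomp W m
       \<and> (\<forall>y\<in>gcomp V m. h m (gadd V m x y) = gadd W m (h m x) (h m y))
       \<and> (\<forall>c. h m (gscale V m c x) = gscale W m c (h m x)))"

definition galg_hom :: "('k, 'a, 'y) galg_scheme \<Rightarrow> ('k, 'b, 'z) galg_scheme \<Rightarrow>
    (int \<Rightarrow> 'a \<Rightarrow> 'b) \<Rightarrow> bool" where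
  "galg_hom A B h \<longleftrightarrow> linear_graded A B h \<and> h 0 (gone A) = gone B
     \<and> (\<forall>i j. \<forall>x\<in>gcomp A i. \<forall>y\<in>gcomp A j.
          h (i + j) (gmult A i j x y) = gmult B i j (h i x) (h j y))"

definition galg_isomorphic :: "('k, 'a, 'y) galg_scheme \<Rightarrow> ('k, 'b, 'z) galg_scheme \<Rightarrow> bool"
    (infix \<open>\<cong>\<^sub>g\<close> 50) where
  "A \<cong>\<^sub>g B \<longleftrightarrow> (\<exists>h. galg_hom A B h \<and> (\<forall>m. bij_betw (h m) (gcomp A m) (gcomp B m)))"

definition regular_bimodule :: "('k, 'a, 'z) galg_scheme \<Rightarrow> ('k, 'a, 'a) gbimod" where
  "regular_bimodule A =
     \<lparr>gcomp = gcomp A, gadd = gadd A, gzero = gzero A, gscale = gscale A,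
      lact = gmult A, ract = gmult A\<rparr>"

text \<open>The sign of \<open>L[t]\<close> depends on the degree of the element acting from the right.\<close>

definition gshift :: "int \<Rightarrow> ('k::field, 'b, 'a, 'z) gbimod_scheme \<Rightarrow> ('k, 'b, 'a) gbimod" where
  "gshift t L =
     \<lparr>gcomp = (\<lambda>m. gcomp L (m + t)), gadd = (\<lambda>m. gadd L (m + t)), gzero = (\<lambda>m. gzero L (m + t)),
      gscale = (\<lambda>m. gscale L (m + t)),
      lact = (\<lambda>i j. lact L i (j + t)),
      ract = (\<lambda>j i l b. gscale L (j + i + t) ((-1) powi (i * t)) (ract L (j + t) i l b))\<rparr>"

definition galg_trivial_ext :: "('k, 'b, 'y) galg_scheme \<Rightarrow> ('k, 'b, 'a, 'z) gbimod_scheme \<Rightarrow>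
    ('k, 'b \<times> 'a) galg" where
  "galg_trivial_ext B X =
     \<lparr>gcomp = (\<lambda>m. gcomp B m \<times> gcomp X m),
      gadd = (\<lambda>m (b, x) (b', x'). (gadd B m b b', gadd X m x x')),
      gzero = (\<lambda>m. (gzero B m, gzero X m)),
      gscale = (\<lambda>m c (b, x). (gscale B m c b, gscale X m c x)),
      gmult = (\<lambda>i j (b, x) (b', x').
        (gmult B i j b b', gadd X (i + j) (lact X i j b x') (ract X i j x b'))),
      gone = (gone B, gzero X 0)\<rparr>"

definition gkernel :: "('k, 'a, 'y) gvs_scheme \<Rightarrow> ('k, 'b, 'z) gvs_scheme \<Rightarrow>
    (int \<Rightarrow> 'a \<Rightarrow> 'b) \<Rightarrow> int \<Rightarrow> 'a set" where
  "gkernel V W h m = {x \<in> gcomp V m. h m x = gzero W m}"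

text \<open>
  Since \<open>p\<close> is surjective with kernel of square zero, the \<open>B\<close>-bimodule structure of the kernel is
  given by \<open>p(e) \<cdot> y = e y\<close> and \<open>y \<cdot> p(e) = y e\<close>; the last two conjuncts say that the graded linear
  isomorphism \<open>\<theta>\<close> from \<open>X\<close> onto the kernel respects it.
\<close>

definition singular_extension :: "('k::field, 'e, 'w) galg_scheme \<Rightarrow> ('k, 'b, 'y) galg_scheme \<Rightarrow>
    ('k, 'b, 'a, 'z) gbimod_scheme \<Rightarrow> bool" where
  "singular_extension E B X \<longleftrightarrow> graded_algebra E \<and> graded_bimodule B X \<and>
    (\<exists>p \<theta>. galg_hom E B p \<and> (\<forall>m. p m ` gcomp E m = gcomp B m)
       \<and> (\<forall>i j. \<forall>x\<in>gkernel E B p i. \<forall>y\<in>gkernel E B p j. gmult E i j x y = gzero E (i + j))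
       \<and> linear_graded X E \<theta> \<and> (\<forall>m. bij_betw (\<theta> m) (gcomp X m) (gkernel E B p m))
       \<and> (\<forall>i j. \<forall>e\<in>gcomp E i. \<forall>x\<in>gcomp X j.
            \<theta> (i + j) (lact X i j (p i e) x) = gmult E i j e (\<theta> j x))
       \<and> (\<forall>i j. \<forall>e\<in>gcomp E i. \<forall>x\<in>gcomp X j.
            \<theta> (j + i) (ract X j i x (p i e)) = gmult E j i (\<theta> j x) e))"

definition trivial_singular_extension :: "('k::field, 'e, 'w) galg_scheme \<Rightarrow>
    ('k, 'b, 'y) galg_scheme \<Rightarrow> ('k, 'b, 'a, 'z) gbimod_scheme \<Rightarrow> bool" where
  "trivial_singular_extension E B X \<longleftrightarrow> singular_extension E B X \<and> E \<cong>\<^sub>g galg_trivial_ext B X"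


section \<open>Quotients and skew polynomials\<close>

definition gcoset :: "('k, 'a, 'z) gvs_scheme \<Rightarrow> (int \<Rightarrow> 'a set) \<Rightarrow> int \<Rightarrow> 'a \<Rightarrow> 'a set" where
  "gcoset A J m x = (\<lambda>y. gadd A m x y) ` J m"

definition gquotient :: "('k, 'a, 'z) galg_scheme \<Rightarrow> (int \<Rightarrow> 'a set) \<Rightarrow> ('k, 'a set) galg" where
  "gquotient A J =
     \<lparr>gcomp = (\<lambda>m. gcoset A J m ` gcomp A m),
      gadd = (\<lambda>m X Y. \<Union>x\<in>X. \<Union>y\<in>Y. gcoset A J m (gadd A m x y)),
      gzero = (\<lambda>m. gcoset A J m (gzero A m)),
      gscale = (\<lambda>m c X. \<Union>x\<in>X. gcoset A J m (gscale A m c x)),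
      gmult = (\<lambda>i j X Y. \<Union>x\<in>X. \<Union>y\<in>Y. gcoset A J (i + j) (gmult A i j x y)),
      gone = gcoset A J 0 (gone A)\<rparr>"

definition graded_ideal :: "('k, 'a, 'z) galg_scheme \<Rightarrow> (int \<Rightarrow> 'a set) \<Rightarrow> bool" where
  "graded_ideal A J \<longleftrightarrow>
     (\<forall>m. J m \<subseteq> gcomp A m \<and> gzero A m \<in> J m
        \<and> (\<forall>x\<in>J m. \<forall>y\<in>J m. gadd A m x y \<in> J m) \<and> (\<forall>c. \<forall>x\<in>J m. gscale A m c x \<in> J m))
     \<and> (\<forall>i j. \<forall>a\<in>gcomp A i. \<forall>x\<in>J j.
          gmult A i j a x \<in> J (i + j) \<and> gmult A j i x a \<in> J (j + i))"

text \<open>The two-sided ideal generated by a homogeneous element \<open>s\<close> of degree \<open>d\<close>.\<close>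

definition gideal_generated :: "('k, 'a, 'z) galg_scheme \<Rightarrow> int \<Rightarrow> 'a \<Rightarrow> int \<Rightarrow> 'a set" where
  "gideal_generated A d s m = \<Inter> {J m | J. graded_ideal A J \<and> s \<in> J d}"

text \<open>
  \<open>gpoly B\<close> is \<open>B[x,0]\<close>. A homogeneous element of degree \<open>m\<close> is represented by its coefficients
  \<open>f j \<in> B\<^bsub>m-j\<^esub>\<close>, standing for \<open>\<Sum>j. (f j) x\<^sup>j\<close>; the sign in the product comes from
  \<open>x\<^sup>i b = (-1)\<^bsup>iq\<^esup> b x\<^sup>i\<close> for \<open>b \<in> B\<^sub>q\<close>.
\<close>

definition gpoly :: "('k::field, 'a, 'z) galg_scheme \<Rightarrow> ('k, nat \<Rightarrow> 'a) galg" where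
  "gpoly B =
     \<lparr>gcomp = (\<lambda>m. {f. (\<forall>j. f j \<in> gcomp B (m - int j)) \<and> finite {j. f j \<noteq> gzero B (m - int j)}}),
      gadd = (\<lambda>m f g j. gadd B (m - int j) (f j) (g j)),
      gzero = (\<lambda>m j. gzero B (m - int j)),
      gscale = (\<lambda>m c f j. gscale B (m - int j) c (f j)),
      gmult = (\<lambda>m k f g l.
        finprod (ggroup B (m + k - int l))
          (\<lambda>i. gscale B (m + k - int l) ((-1) powi (int i * (k - int (l - i))))
                 (gmult B (m - int i) (k - int (l - i)) (f i) (g (l - i)))) {..l}),
      gone = (\<lambda>j. if j = 0 then gone B else gzero B (- int j))\<rparr>"

definition gpoly_x :: "('k, 'a, 'z) galg_scheme \<Rightarrow> nat \<Rightarrow> 'a" where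
  "gpoly_x B = (\<lambda>j. if j = 1 then gone B else gzero B (1 - int j))"

definition gpoly_mod_x2 :: "('k::field, 'a, 'z) galg_scheme \<Rightarrow> ('k, (nat \<Rightarrow> 'a) set) galg" where
  "gpoly_mod_x2 B = gquotient (gpoly B)
     (gideal_generated (gpoly B) 2 (gmult (gpoly B) 1 1 (gpoly_x B) (gpoly_x B)))"


section \<open>Hochschild cohomology\<close>

definition hargs :: "('k, 'a, 'z) kalg_scheme \<Rightarrow> nat \<Rightarrow> 'a list set" where
  "hargs B m = {xs. length xs = m \<and> set xs \<subseteq> carrier B}"

text \<open>
  A linear map on the \<open>m\<close>-fold tensor power of \<open>B\<close> is represented by the corresponding multilinear
  function of \<open>m\<close> arguments in \<open>B\<close>, extended by \<open>0\<close>.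
\<close>

definition hcochains :: "('k, 'a::ab_group_add, 'z) kalg_scheme \<Rightarrow> nat \<Rightarrow> ('a list \<Rightarrow> 'a) set" where
  "hcochains B m = {f.
     (\<forall>xs. xs \<notin> hargs B m \<longrightarrow> f xs = 0) \<and>
     (\<forall>xs\<in>hargs B m. f xs \<in> carrier B) \<and>
     (\<forall>xs\<in>hargs B m. \<forall>i<m. \<forall>x\<in>carrier B.
        (\<forall>y\<in>carrier B. f (xs[i := x + y]) = f (xs[i := x]) + f (xs[i := y])) \<and>
        (\<forall>c. f (xs[i := scale B c x]) = scale B c (f (xs[i := x]))))}"

definition hdiff :: "('k::field, 'a::ab_group_add, 'z) kalg_scheme \<Rightarrow> nat \<Rightarrow>
    ('a list \<Rightarrow> 'a) \<Rightarrow> 'a list \<Rightarrow> 'a" where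
  "hdiff B m f = (\<lambda>xs. if xs \<in> hargs B (Suc m) then
       hd xs \<otimes>\<^bsub>B\<^esub> f (tl xs)
       + (\<Sum>i<m. scale B ((-1) ^ Suc i)
            (f (take i xs @ [(xs ! i) \<otimes>\<^bsub>B\<^esub> (xs ! Suc i)] @ drop (i + 2) xs)))
       + scale B ((-1) ^ Suc m) (f (butlast xs) \<otimes>\<^bsub>B\<^esub> last xs)
     else 0)"

definition hcup :: "('k, 'a::ab_group_add, 'z) kalg_scheme \<Rightarrow> nat \<Rightarrow> nat \<Rightarrow>
    ('a list \<Rightarrow> 'a) \<Rightarrow> ('a list \<Rightarrow> 'a) \<Rightarrow> 'a list \<Rightarrow> 'a" where
  "hcup B m k f g = (\<lambda>xs. if xs \<in> hargs B (m + k)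
     then f (take m xs) \<otimes>\<^bsub>B\<^esub> g (drop m xs) else 0)"

definition hcocycles :: "('k::field, 'a::ab_group_add, 'z) kalg_scheme \<Rightarrow> int \<Rightarrow> ('a list \<Rightarrow> 'a) set" where
  "hcocycles B m = (if m < 0 then {0} else {f \<in> hcochains B (nat m). hdiff B (nat m) f = 0})"

definition hcoboundaries :: "('k::field, 'a::ab_group_add, 'z) kalg_scheme \<Rightarrow> int \<Rightarrow> ('a list \<Rightarrow> 'a) set" where
  "hcoboundaries B m = (if m \<le> 0 then {0} else hdiff B (nat (m - 1)) ` hcochains B (nat (m - 1)))"

definition cocycle_algebra :: "('k::field, 'a::ab_group_add, 'z) kalg_scheme \<Rightarrow>
    ('k, 'a list \<Rightarrow> 'a) galg" where
  "cocycle_algebra B =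
     \<lparr>gcomp = hcocycles B,
      gadd = (\<lambda>m f g. f + g),
      gzero = (\<lambda>m. 0),
      gscale = (\<lambda>m c f xs. scale B c (f xs)),
      gmult = (\<lambda>i j f g. if i < 0 \<or> j < 0 then 0 else hcup B (nat i) (nat j) f g),
      gone = (\<lambda>xs. if xs = [] then \<one>\<^bsub>B\<^esub> else 0)\<rparr>"

definition HH :: "('k::field, 'a::ab_group_add, 'z) kalg_scheme \<Rightarrow> ('k, ('a list \<Rightarrow> 'a) set) galg" where
  "HH B = gquotient (cocycle_algebra B) (hcoboundaries B)"

definition grading_preserving :: "('g, 'm) monoid_scheme \<Rightarrow> ('g \<Rightarrow> 'a set) \<Rightarrow> ('a list \<Rightarrow> 'a) \<Rightarrow> bool" where
  "grading_preserving G D f \<longleftrightarrow>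
     (\<forall>\<alpha>s xs. set \<alpha>s \<subseteq> carrier G \<longrightarrow> list_all2 (\<lambda>x \<alpha>. x \<in> D \<alpha>) xs \<alpha>s \<longrightarrow>
        f xs \<in> D (foldr (monoid.mult G) \<alpha>s \<one>\<^bsub>G\<^esub>))"

text \<open>
  As the grading-preserving cochains form a direct summand of the Hochschild complex, their
  cohomology is the subalgebra of the classes of grading-preserving cocycles.
\<close>

definition HH_0 :: "('g, 'm) monoid_scheme \<Rightarrow> ('g \<Rightarrow> 'a set) \<Rightarrow>
    ('k::field, 'a::ab_group_add, 'z) kalg_scheme \<Rightarrow> ('k, ('a list \<Rightarrow> 'a) set) galg" where
  "HH_0 G D B = (HH B)
     \<lparr>gcomp := (\<lambda>m. gcoset (cocycle_algebra B) (hcoboundaries B) m `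
        {f \<in> hcocycles B m. grading_preserving G D f})\<rparr>"

end

theory Submission
  imports Defs
begin

text \<open>
  Write \<open>T\<close> for the trivial extension and \<open>L\<close> for the smash product. The projection of \<open>T\<close> onto
  the dual bimodule is a derivation, because the product of two dual elements vanishes; let \<open>E\<close> be
  its class. The algebra \<open>L\<close> is a cyclic covering of \<open>T\<close>: its elements are matrices over \<open>T\<close> with
  rows and columns indexed by the cyclic group, elements of degree zero on the diagonal and
  elements of degree one next to it. Restricting cochains of \<open>L\<close> to constant arguments and
  extending them back along paths of matrix entries are inverse to each other up to homotopy
  (\<open>Q_hdiff\<close>, \<open>J_dl\<close>, \<open>Q_J\<close>, \<open>J_Q_cocycle\<close>). So the cohomology of \<open>L\<close> is that of the \<open>n\<close>-periodic
  families \<open>f\<close> of degree-preserving cochains of \<open>T\<close>, with a differential that sends \<open>f\<close> to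
  \<open>d (f b)\<close> plus or minus the cup product of \<open>f (b + 1) - f b\<close> with \<open>E\<close>. Constant families give
  the homomorphism from the degree-preserving cohomology of \<open>T\<close> to the cohomology of \<open>L\<close>, and its
  image is the graded algebra of the theorem.

  The second ingredient is that \<open>T\<close> is symmetric. Hence \<open>L\<close> is a Frobenius algebra whose Nakayama
  automorphism rotates the indices, and a Nakayama automorphism acts trivially on Hochschild
  cohomology (\<open>nakayama_trivial\<close>). A cocycle family and its shift therefore differ by the
  boundary of some family \<open>h\<close>. Summing \<open>h\<close> along the cycle, every class becomes a constant
  family plus a constant multiple of the class \<open>Y\<close> that counts how often a path runs through the
  arrow closing the cycle (\<open>cocycle_decomposition\<close>).

  The characteristic enters twice. The family \<open>b v\<close> is \<open>n\<close>-periodic when \<open>n = 0\<close> in the field, and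
  its boundary is the product of \<open>v\<close> with \<open>E\<close>; so these products are sent to zero, and the shift
  argument shows that they are the whole kernel and vanish only if \<open>v\<close> itself is in the kernel
  (\<open>constant_coboundary\<close>, \<open>R_coboundary\<close>, \<open>R_boundary_imp\<close>). A sum of \<open>n\<close> equal classes vanishes,
  which makes the multiples of \<open>Y\<close> independent of the constant families (\<open>turn_boundary_imp\<close>).

  Both \<open>E\<close> and \<open>Y\<close> are classes of derivations, so they commute with all classes up to sign
  (\<open>derivation_cup_commute\<close>), and their squares are zero. Multiplication by \<open>E\<close> thus identifies
  the shifted regular bimodule with the kernel, and multiplication by \<open>Y\<close> identifies it with a
  complement of the image (\<open>extension_data\<close>, \<open>cover_extension\<close>). A trivial extension by the
  shifted regular bimodule is the skew polynomial algebra modulo the square of its variable,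
  which stands for \<open>Y\<close> (\<open>trivial_ext_iso_gpoly_mod_x2\<close>).
\<close>

section \<open>Multilinear maps and cochains\<close>

sublocale kalgebra \<subseteq> vs: vector_space "scale A"
  by (rule vector_space_scale)

context kalgebra
begin

lemma zero_closed [simp]: "0 \<in> carrier A"
  using subspace_carrier by (rule vs.subspace_0)

lemma add_closed [simp]: "x \<in> carrier A \<Longrightarrow> y \<in> carrier A \<Longrightarrow> x + y \<in> carrier A"
  using subspace_carrier by (rule vs.subspace_add)

lemma diff_closed [simp]: "x \<in> carrier A \<Longrightarrow> y \<in> carrier A \<Longrightarrow> x - y \<in> carrier A"
  using subspace_carrier by (rule vs.subspace_diff)

lemma neg_closed [simp]: "x \<in> carrier A \<Longrightarrow> - x \<in> carrier A"
  using subspace_carrier by (rule vs.subspace_neg)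

lemma scale_closed [simp]: "x \<in> carrier A \<Longrightarrow> scale A c x \<in> carrier A"
  using subspace_carrier by (rule vs.subspace_scale)

lemma sum_closed: "(\<And>i. i \<in> I \<Longrightarrow> f i \<in> carrier A) \<Longrightarrow> sum f I \<in> carrier A"
  using subspace_carrier by (rule vs.subspace_sum)

lemma mult_zero_l [simp]: "x \<in> carrier A \<Longrightarrow> 0 \<otimes> x = 0"
  using l_distrib[of 0 0 x] by simp

lemma mult_zero_r [simp]: "x \<in> carrier A \<Longrightarrow> x \<otimes> 0 = 0"
  using r_distrib[of 0 0 x] by simp

lemma mult_neg_l: "x \<in> carrier A \<Longrightarrow> y \<in> carrier A \<Longrightarrow> (- x) \<otimes> y = - (x \<otimes> y)"
  using l_distrib[of x "- x" y] by (simp add: eq_neg_iff_add_eq_0 add.commute)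

lemma mult_neg_r: "x \<in> carrier A \<Longrightarrow> y \<in> carrier A \<Longrightarrow> x \<otimes> (- y) = - (x \<otimes> y)"
  using r_distrib[of y "- y" x] by (simp add: eq_neg_iff_add_eq_0 add.commute)

lemma l_diff_distrib:
  "\<lbrakk>x \<in> carrier A; y \<in> carrier A; z \<in> carrier A\<rbrakk> \<Longrightarrow> (x - y) \<otimes> z = x \<otimes> z - y \<otimes> z"
  using l_distrib[of x "- y" z] by (simp add: mult_neg_l)

lemma r_diff_distrib:
  "\<lbrakk>x \<in> carrier A; y \<in> carrier A; z \<in> carrier A\<rbrakk> \<Longrightarrow> z \<otimes> (x - y) = z \<otimes> x - z \<otimes> y"
  using r_distrib[of x "- y" z] by (simp add: mult_neg_r)

lemma sum_mult_l:
  assumes "\<And>i. i \<in> I \<Longrightarrow> f i \<in> carrier A" "y \<in> carrier A"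
  shows "sum f I \<otimes> y = (\<Sum>i\<in>I. f i \<otimes> y)"
  using assms
proof (induction I rule: infinite_finite_induct)
  case (insert x F)
  then have "sum f F \<in> carrier A" by (intro sum_closed) auto
  then show ?case using insert by (simp add: l_distrib)
qed auto

lemma sum_mult_r:
  assumes "\<And>i. i \<in> I \<Longrightarrow> f i \<in> carrier A" "y \<in> carrier A"
  shows "y \<otimes> sum f I = (\<Sum>i\<in>I. y \<otimes> f i)"
  using assms
proof (induction I rule: infinite_finite_induct)
  case (insert x F)
  then have "sum f F \<in> carrier A" by (intro sum_closed) auto
  then show ?case using insert by (simp add: r_distrib)
qed auto

end

lemma hargs_0 [simp]: "xs \<in> hargs A 0 \<longleftrightarrow> xs = []"
  by (auto simp: hargs_def)

lemma hargs_Nil_iff [simp]: "[] \<in> hargs A m \<longleftrightarrow> m = 0"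
  by (auto simp: hargs_def)

lemma hargs_Cons [simp]: "a # r \<in> hargs A (Suc m) \<longleftrightarrow> a \<in> carrier A \<and> r \<in> hargs A m"
  by (auto simp: hargs_def)

lemma hargs_Suc_iff: "xs \<in> hargs A (Suc m) \<longleftrightarrow> (\<exists>a r. xs = a # r \<and> a \<in> carrier A \<and> r \<in> hargs A m)"
  by (cases xs) (auto simp: hargs_def)

lemma hargs_length: "xs \<in> hargs A m \<Longrightarrow> length xs = m"
  by (simp add: hargs_def)

lemma hargs_append: "us @ vs \<in> hargs A m \<longleftrightarrow>
    us \<in> hargs A (length us) \<and> vs \<in> hargs A (length vs) \<and> length us + length vs = m"
  by (auto simp: hargs_def)

lemma hargs_take: "xs \<in> hargs A (m + k) \<Longrightarrow> take m xs \<in> hargs A m"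
  by (auto simp: hargs_def dest: in_set_takeD)

lemma hargs_drop: "xs \<in> hargs A (m + k) \<Longrightarrow> drop m xs \<in> hargs A k"
  by (auto simp: hargs_def dest: in_set_dropD)

text \<open>
  Arguments and values may lie in different algebras because cochains of the covering algebra are
  restricted along an embedding of the base: the arguments then come from the base, while the
  values stay in the covering.
\<close>

definition mlin :: "('k, 'a::ab_group_add, 'y) kalg_scheme \<Rightarrow> ('k, 'b::ab_group_add, 'z) kalg_scheme \<Rightarrow>
    nat \<Rightarrow> ('a list \<Rightarrow> 'b) \<Rightarrow> bool" where
  "mlin A B m f \<longleftrightarrow> (\<forall>xs\<in>hargs A m. f xs \<in> carrier B) \<and>
     (\<forall>us vs. \<forall>x\<in>carrier A. us @ x # vs \<in> hargs A m \<longrightarrow>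
        (\<forall>y\<in>carrier A. f (us @ (x + y) # vs) = f (us @ x # vs) + f (us @ y # vs)) \<and>
        (\<forall>c. f (us @ scale A c x # vs) = scale B c (f (us @ x # vs))))"

lemma mlin_closed: "mlin A B m f \<Longrightarrow> xs \<in> hargs A m \<Longrightarrow> f xs \<in> carrier B"
  by (simp add: mlin_def)

lemma mlin_add_arg: "\<lbrakk>mlin A B m f; us @ x # vs \<in> hargs A m; y \<in> carrier A\<rbrakk> \<Longrightarrow>
    f (us @ (x + y) # vs) = f (us @ x # vs) + f (us @ y # vs)"
  unfolding mlin_def hargs_def by auto

lemma mlin_scale_arg: "\<lbrakk>mlin A B m f; us @ x # vs \<in> hargs A m\<rbrakk> \<Longrightarrow>
    f (us @ scale A c x # vs) = scale B c (f (us @ x # vs))"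
  unfolding mlin_def hargs_def by auto

lemma mlin_add_hd: "\<lbrakk>mlin A B (Suc m) f; x \<in> carrier A; y \<in> carrier A; r \<in> hargs A m\<rbrakk> \<Longrightarrow>
    f ((x + y) # r) = f (x # r) + f (y # r)"
  using mlin_add_arg[of A B "Suc m" f "[]" x r y] by simp

lemma mlin_scale_hd: "\<lbrakk>mlin A B (Suc m) f; x \<in> carrier A; r \<in> hargs A m\<rbrakk> \<Longrightarrow>
    f (scale A c x # r) = scale B c (f (x # r))"
  using mlin_scale_arg[of A B "Suc m" f "[]" x r c] by simp

lemma mlin_cong:
  assumes "kalgebra A" "\<And>xs. xs \<in> hargs A m \<Longrightarrow> f xs = g xs"
  shows "mlin A B m f \<longleftrightarrow> mlin A B m g"
proof -
  interpret kalgebra A by fact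
  show ?thesis
    unfolding mlin_def
  proof (intro conj_cong ball_cong all_cong1 imp_cong refl arg_cong2[where f = "(=)"], goal_cases)
    case (1 xs) then show ?case using assms by simp
  qed (auto simp: assms hargs_append hargs_def intro!: assms(2) arg_cong2[where f="(+)"] arg_cong[where f="scale B _"])
qed

lemma mlin_Suc:
  "mlin A B (Suc m) h \<longleftrightarrow> (\<forall>a\<in>carrier A. mlin A B m (\<lambda>r. h (a # r))) \<and>
     (\<forall>a\<in>carrier A. \<forall>r\<in>hargs A m. (\<forall>b\<in>carrier A. h ((a + b) # r) = h (a # r) + h (b # r)) \<and>
        (\<forall>c. h (scale A c a # r) = scale B c (h (a # r))))" (is "?l \<longleftrightarrow> ?r")
proof
  assume l: ?l
  show ?r
  proof (intro conjI ballI allI)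
    fix a assume a: "a \<in> carrier A"
    show "mlin A B m (\<lambda>r. h (a # r))"
      using a mlin_closed[OF l] mlin_add_arg[OF l, of "a # us" for us]
        mlin_scale_arg[OF l, of "a # us" for us] unfolding mlin_def by auto
  qed (use l in \<open>auto simp: mlin_add_hd mlin_scale_hd\<close>)
next
  assume r: ?r
  show ?l
    unfolding mlin_def
  proof (intro conjI ballI allI impI)
    fix xs assume "xs \<in> hargs A (Suc m)"
    then show "h xs \<in> carrier B" using r by (auto simp: hargs_Suc_iff mlin_def)
  next
    fix us vs x y assume "x \<in> carrier A" "us @ x # vs \<in> hargs A (Suc m)" "y \<in> carrier A"
    then show "h (us @ (x + y) # vs) = h (us @ x # vs) + h (us @ y # vs)"
      using r by (cases us) (auto intro: mlin_add_arg)
  next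
    fix us vs x c assume "x \<in> carrier A" "us @ x # vs \<in> hargs A (Suc m)"
    then show "h (us @ scale A c x # vs) = scale B c (h (us @ x # vs))"
      using r by (cases us) (auto intro: mlin_scale_arg)
  qed
qed

lemma mlin_0: "mlin A B 0 f \<longleftrightarrow> f [] \<in> carrier B"
  by (auto simp: mlin_def)

lemma mlin_tail: "mlin A B (Suc m) h \<Longrightarrow> a \<in> carrier A \<Longrightarrow> mlin A B m (\<lambda>r. h (a # r))"
  by (simp add: mlin_Suc)

lemma hcochains_iff:
  assumes "kalgebra A"
  shows "f \<in> hcochains A m \<longleftrightarrow> mlin A A m f \<and> (\<forall>xs. xs \<notin> hargs A m \<longrightarrow> f xs = 0)"
proof -
  interpret kalgebra A by fact
  have 1: "us @ x # vs = (us @ z # vs)[length us := x]" for us vs x z by simp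
  have 2: "xs[i := x] = take i xs @ x # drop (Suc i) xs" if "i < length xs" for xs i x
    using that by (rule upd_conv_take_nth_drop)
  have 3: "take i xs @ x # drop (Suc i) xs \<in> hargs A m" if "xs \<in> hargs A m" "i < m" "x \<in> carrier A" for xs i x
    using that by (auto simp: hargs_def dest: in_set_takeD in_set_dropD)
  show ?thesis
  proof
    assume f: "f \<in> hcochains A m"
    then have a: "f (xs[i := x + y]) = f (xs[i := x]) + f (xs[i := y])"
      and b: "f (xs[i := scale A c x]) = scale A c (f (xs[i := x]))"
      if "xs \<in> hargs A m" "i < m" "x \<in> carrier A" "y \<in> carrier A" for xs i x y c
      using that by (auto simp: hcochains_def)
    have "mlin A A m f"
      unfolding mlin_def
    proof (intro conjI ballI allI impI)
      fix xs assume "xs \<in> hargs A m"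
      then show "f xs \<in> carrier A" using f by (simp add: hcochains_def)
    next
      fix us vs x y assume *: "x \<in> carrier A" "us @ x # vs \<in> hargs A m" "y \<in> carrier A"
      then have "length us < m" by (auto simp: hargs_def)
      then show "f (us @ (x + y) # vs) = f (us @ x # vs) + f (us @ y # vs)"
        using a[OF *(2) _ *(1) *(3), of "length us"] by simp
    next
      fix us vs x c assume *: "x \<in> carrier A" "us @ x # vs \<in> hargs A m"
      then have "length us < m" by (auto simp: hargs_def)
      then show "f (us @ scale A c x # vs) = scale A c (f (us @ x # vs))"
        using b[OF *(2) _ *(1) *(1), of "length us"] by simp
    qed
    then show "mlin A A m f \<and> (\<forall>xs. xs \<notin> hargs A m \<longrightarrow> f xs = 0)"
      using f by (simp add: hcochains_def)
  next
    assume f: "mlin A A m f \<and> (\<forall>xs. xs \<notin> hargs A m \<longrightarrow> f xs = 0)"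
    show "f \<in> hcochains A m"
      unfolding hcochains_def mem_Collect_eq
    proof (intro conjI ballI allI impI)
      fix xs i x y assume *: "xs \<in> hargs A m" "i < m" "x \<in> carrier A" "y \<in> carrier A"
      then have "i < length xs" by (simp add: hargs_def)
      with * f 3 show "f (xs[i := x + y]) = f (xs[i := x]) + f (xs[i := y])"
        by (auto simp: 2 intro: mlin_add_arg)
    next
      fix xs i x c assume *: "xs \<in> hargs A m" "i < m" "x \<in> carrier A"
      then have "i < length xs" by (simp add: hargs_def)
      with * f 3 show "f (xs[i := scale A c x]) = scale A c (f (xs[i := x]))"
        by (auto simp: 2 intro: mlin_scale_arg)
    qed (use f in \<open>auto simp: mlin_def\<close>)
  qed
qed

context
  fixes A :: "('k::field, 'a::ab_group_add, 'y) kalg_scheme"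
    and B :: "('k, 'b::ab_group_add, 'z) kalg_scheme"
  assumes A: "kalgebra A" and B: "kalgebra B"
begin

interpretation A: kalgebra A by (rule A)
interpretation B: kalgebra B by (rule B)

lemma mlin_zero: "mlin A B m (\<lambda>xs. 0)"
  by (simp add: mlin_def)

lemma mlin_add: "mlin A B m f \<Longrightarrow> mlin A B m g \<Longrightarrow> mlin A B m (\<lambda>xs. f xs + g xs)"
  unfolding mlin_def by (auto simp: algebra_simps B.vs.scale_right_distrib)

lemma mlin_diff: "mlin A B m f \<Longrightarrow> mlin A B m g \<Longrightarrow> mlin A B m (\<lambda>xs. f xs - g xs)"
  unfolding mlin_def by (auto simp: algebra_simps B.vs.scale_right_diff_distrib)

lemma mlin_scale: "mlin A B m f \<Longrightarrow> mlin A B m (\<lambda>xs. scale B c (f xs))"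
  unfolding mlin_def by (auto simp: B.vs.scale_right_distrib mult.commute)

lemma mlin_neg: "mlin A B m f \<Longrightarrow> mlin A B m (\<lambda>xs. - f xs)"
  using mlin_diff[OF mlin_zero] by simp

lemma mlin_sum: "(\<And>i. i \<in> I \<Longrightarrow> mlin A B m (f i)) \<Longrightarrow> mlin A B m (\<lambda>xs. \<Sum>i\<in>I. f i xs)"
  by (induction I rule: infinite_finite_induct) (auto simp: mlin_zero mlin_add)

end

lemma mlin_post:
  assumes "mlin A B m f"
    and "\<And>x. x \<in> carrier B \<Longrightarrow> h x \<in> carrier C"
    and "\<And>x y. x \<in> carrier B \<Longrightarrow> y \<in> carrier B \<Longrightarrow> h (x + y) = h x + h y"
    and "\<And>c x. x \<in> carrier B \<Longrightarrow> h (scale B c x) = scale C c (h x)"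
  shows "mlin A C m (\<lambda>xs. h (f xs))"
  unfolding mlin_def
proof (intro conjI ballI allI impI)
  fix us vs x y assume *: "x \<in> carrier A" "us @ x # vs \<in> hargs A m" "y \<in> carrier A"
  then have "us @ y # vs \<in> hargs A m" by (auto simp: hargs_def)
  with * show "h (f (us @ (x + y) # vs)) = h (f (us @ x # vs)) + h (f (us @ y # vs))"
    by (simp add: mlin_add_arg[OF assms(1)] assms mlin_closed[OF assms(1)])
qed (use assms in \<open>auto simp: mlin_closed mlin_scale_arg\<close>)

lemma map_hargs:
  assumes "\<And>x. x \<in> carrier A \<Longrightarrow> h x \<in> carrier B" "xs \<in> hargs A m"
  shows "map h xs \<in> hargs B m"
  using assms by (auto simp: hargs_def)

lemma mlin_pre:
  assumes f: "mlin B C m f"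
    and h: "\<And>x. x \<in> carrier A \<Longrightarrow> h x \<in> carrier B"
    and "\<And>x y. x \<in> carrier A \<Longrightarrow> y \<in> carrier A \<Longrightarrow> h (x + y) = h x + h y"
    and "\<And>c x. x \<in> carrier A \<Longrightarrow> h (scale A c x) = scale B c (h x)"
  shows "mlin A C m (\<lambda>xs. f (map h xs))"
  unfolding mlin_def
proof (intro conjI ballI allI impI)
  fix us vs x y assume *: "x \<in> carrier A" "us @ x # vs \<in> hargs A m" "y \<in> carrier A"
  then have "map h us @ h x # map h vs \<in> hargs B m"
    using map_hargs[of A h B "us @ x # vs" m] h by simp
  with * show "f (map h (us @ (x + y) # vs)) = f (map h (us @ x # vs)) + f (map h (us @ y # vs))"
    by (simp add: mlin_add_arg[OF f] assms)
next
  fix us vs x c assume *: "x \<in> carrier A" "us @ x # vs \<in> hargs A m"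
  then have "map h us @ h x # map h vs \<in> hargs B m"
    using map_hargs[of A h B "us @ x # vs" m] h by simp
  with * show "f (map h (us @ scale A c x # vs)) = scale C c (f (map h (us @ x # vs)))"
    by (simp add: mlin_scale_arg[OF f] assms)
qed (use map_hargs h f in \<open>auto simp: mlin_closed intro!: mlin_closed[OF f] map_hargs\<close>)

text \<open>
  The Hochschild differential without its first summand, in which the first argument multiplies
  from the left, and with all signs reversed. As a recursion on the argument list it replaces the
  manipulation of indices by induction. The right action \<open>ra\<close> on the values is a parameter; with
  the zero action one obtains the bar differential.
\<close>

fun rdiff :: "('a \<Rightarrow> 'a \<Rightarrow> 'a) \<Rightarrow> ('b \<Rightarrow> 'a \<Rightarrow> 'b) \<Rightarrow> ('a list \<Rightarrow> 'b::ab_group_add) \<Rightarrow> 'a list \<Rightarrow> 'b" where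
  "rdiff mu ra f [] = 0"
| "rdiff mu ra f [a] = ra (f []) a"
| "rdiff mu ra f (a # b # s) = f (mu a b # s) - rdiff mu ra (\<lambda>t. f (a # t)) (b # s)"

locale right_action = A: kalgebra A + V: kalgebra V
  for A :: "('k::field, 'a::ab_group_add, 'y) kalg_scheme"
    and V :: "('k, 'b::ab_group_add, 'z) kalg_scheme" +
  fixes ra :: "'b \<Rightarrow> 'a \<Rightarrow> 'b"
  assumes ra_closed: "v \<in> carrier V \<Longrightarrow> a \<in> carrier A \<Longrightarrow> ra v a \<in> carrier V"
    and ra_add: "v \<in> carrier V \<Longrightarrow> w \<in> carrier V \<Longrightarrow> a \<in> carrier A \<Longrightarrow> ra (v + w) a = ra v a + ra w a"
    and ra_scale: "v \<in> carrier V \<Longrightarrow> a \<in> carrier A \<Longrightarrow> ra (scale V c v) a = scale V c (ra v a)"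
    and ra_add_r: "v \<in> carrier V \<Longrightarrow> a \<in> carrier A \<Longrightarrow> b \<in> carrier A \<Longrightarrow> ra v (a + b) = ra v a + ra v b"
    and ra_scale_r: "v \<in> carrier V \<Longrightarrow> a \<in> carrier A \<Longrightarrow> ra v (scale A c a) = scale V c (ra v a)"
    and ra_mult: "v \<in> carrier V \<Longrightarrow> a \<in> carrier A \<Longrightarrow> b \<in> carrier A \<Longrightarrow>
      ra v (a \<otimes>\<^bsub>A\<^esub> b) = ra (ra v a) b"
begin

abbreviation rd where "rd \<equiv> rdiff (monoid.mult A) ra"

lemma rd_cong:
  assumes "\<And>xs. xs \<in> hargs A m \<Longrightarrow> f xs = g xs" "xs \<in> hargs A (Suc m)"
  shows "rd f xs = rd g xs"
  using assms
proof (induction m arbitrary: f g xs)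
  case 0
  then show ?case by (auto simp: hargs_Suc_iff)
next
  case (Suc m)
  from Suc.prems(2) obtain a b s where xs: "xs = a # b # s" "a \<in> carrier A" "b \<in> carrier A" "s \<in> hargs A m"
    by (auto simp: hargs_Suc_iff)
  have "rd (\<lambda>t. f (a # t)) (b # s) = rd (\<lambda>t. g (a # t)) (b # s)"
    by (rule Suc.IH) (use xs Suc.prems in auto)
  with xs Suc.prems(1) show ?case by simp
qed

lemma rd_add:
  assumes "mlin A V m f" "mlin A V m g" "xs \<in> hargs A (Suc m)"
  shows "rd (\<lambda>t. f t + g t) xs = rd f xs + rd g xs"
  using assms
proof (induction m arbitrary: f g xs)
  case 0
  then show ?case by (auto simp: hargs_Suc_iff mlin_0 ra_add)
next
  case (Suc m)
  from Suc.prems(3) obtain a b s where xs: "xs = a # b # s" "a \<in> carrier A" "b \<in> carrier A" "s \<in> hargs A m"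
    by (auto simp: hargs_Suc_iff)
  have "rd (\<lambda>t. f (a # t) + g (a # t)) (b # s) = rd (\<lambda>t. f (a # t)) (b # s) + rd (\<lambda>t. g (a # t)) (b # s)"
    by (rule Suc.IH) (use xs Suc.prems in \<open>auto intro: mlin_tail\<close>)
  with xs show ?case by simp
qed

lemma rd_scale:
  assumes "mlin A V m f" "xs \<in> hargs A (Suc m)"
  shows "rd (\<lambda>t. scale V c (f t)) xs = scale V c (rd f xs)"
  using assms
proof (induction m arbitrary: f xs)
  case 0
  then show ?case by (auto simp: hargs_Suc_iff mlin_0 ra_scale)
next
  case (Suc m)
  from Suc.prems(2) obtain a b s where xs: "xs = a # b # s" "a \<in> carrier A" "b \<in> carrier A" "s \<in> hargs A m"
    by (auto simp: hargs_Suc_iff)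
  have "rd (\<lambda>t. scale V c (f (a # t))) (b # s) = scale V c (rd (\<lambda>t. f (a # t)) (b # s))"
    by (rule Suc.IH) (use xs Suc.prems in \<open>auto intro: mlin_tail\<close>)
  with xs show ?case by (simp add: V.vs.scale_right_diff_distrib)
qed

lemma rd_zero: "xs \<in> hargs A (Suc m) \<Longrightarrow> rd (\<lambda>t. 0) xs = 0"
  using rd_add[of m "\<lambda>t. 0" "\<lambda>t. 0" xs] by (simp add: mlin_zero[OF A.kalgebra_axioms V.kalgebra_axioms])

lemma rd_neg:
  assumes "mlin A V m f" "xs \<in> hargs A (Suc m)"
  shows "rd (\<lambda>t. - f t) xs = - rd f xs"
  using rd_scale[OF assms, of "-1"] by simp

lemma rd_diff:
  assumes "mlin A V m f" "mlin A V m g" "xs \<in> hargs A (Suc m)"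
  shows "rd (\<lambda>t. f t - g t) xs = rd f xs - rd g xs"
  using rd_add[OF assms(1) mlin_neg[OF A.kalgebra_axioms V.kalgebra_axioms assms(2)] assms(3)]
    rd_neg[OF assms(2,3)] by simp

lemma rd_sum:
  assumes "\<And>i. i \<in> I \<Longrightarrow> mlin A V m (f i)" "xs \<in> hargs A (Suc m)"
  shows "rd (\<lambda>t. \<Sum>i\<in>I. f i t) xs = (\<Sum>i\<in>I. rd (f i) xs)"
  using assms
proof (induction I rule: infinite_finite_induct)
  case (insert i I)
  have "mlin A V m (\<lambda>t. \<Sum>i\<in>I. f i t)"
    by (rule mlin_sum[OF A.kalgebra_axioms V.kalgebra_axioms]) (use insert.prems in auto)
  then show ?case
    using insert rd_add[of m "f i" "\<lambda>t. \<Sum>i\<in>I. f i t" xs] by simp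
qed (auto simp: rd_zero)

lemma mlin_rd:
  assumes "mlin A V m f"
  shows "mlin A V (Suc m) (rd f)"
  using assms
proof (induction m arbitrary: f)
  case 0
  then show ?case
    by (auto simp: mlin_Suc mlin_0 ra_closed ra_add_r ra_scale_r)
next
  case (Suc m)
  note k = A.kalgebra_axioms V.kalgebra_axioms
  have 1: "mlin A V (Suc m) (\<lambda>r. f ((a \<otimes>\<^bsub>A\<^esub> hd r) # tl r) - rd (\<lambda>t. f (a # t)) r)"
    if a: "a \<in> carrier A" for a
  proof (rule mlin_diff[OF k])
    show "mlin A V (Suc m) (rd (\<lambda>t. f (a # t)))"
      by (rule Suc.IH) (use Suc.prems a in \<open>rule mlin_tail\<close>)
    show "mlin A V (Suc m) (\<lambda>r. f ((a \<otimes>\<^bsub>A\<^esub> hd r) # tl r))"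
      using a Suc.prems by (auto simp: mlin_Suc[of A V m "\<lambda>r. f ((a \<otimes>\<^bsub>A\<^esub> hd r) # tl r)"]
        A.r_distrib A.scale_r mlin_add_hd mlin_scale_hd mlin_tail[OF Suc.prems])
  qed
  have "mlin A V (Suc m) (\<lambda>r. rd f (a # r))" if a: "a \<in> carrier A" for a
  proof -
    have "rd f (a # r) = f ((a \<otimes>\<^bsub>A\<^esub> hd r) # tl r) - rd (\<lambda>t. f (a # t)) r" if "r \<in> hargs A (Suc m)" for r
      using that by (auto simp: hargs_Suc_iff)
    then show ?thesis using 1[OF a] by (rule iffD2[OF mlin_cong[OF k(1)]])
  qed
  moreover have "rd f ((a + b) # r) = rd f (a # r) + rd f (b # r)"
    if "a \<in> carrier A" "b \<in> carrier A" "r \<in> hargs A (Suc m)" for a b r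
  proof -
    from that obtain c s where r: "r = c # s" "c \<in> carrier A" "s \<in> hargs A m" by (auto simp: hargs_Suc_iff)
    have "rd (\<lambda>t. f ((a + b) # t)) (c # s) = rd (\<lambda>t. f (a # t) + f (b # t)) (c # s)"
      by (rule rd_cong) (use Suc.prems that r in \<open>auto simp: mlin_add_hd\<close>)
    also have "\<dots> = rd (\<lambda>t. f (a # t)) (c # s) + rd (\<lambda>t. f (b # t)) (c # s)"
      by (rule rd_add) (use Suc.prems that r in \<open>auto intro: mlin_tail\<close>)
    finally show ?thesis
      using r that Suc.prems by (simp add: A.l_distrib mlin_add_hd)
  qed
  moreover have "rd f (scale A c a # r) = scale V c (rd f (a # r))"
    if "a \<in> carrier A" "r \<in> hargs A (Suc m)" for a c r
  proof -
    from that obtain b s where r: "r = b # s" "b \<in> carrier A" "s \<in> hargs A m" by (auto simp: hargs_Suc_iff)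
    have "rd (\<lambda>t. f (scale A c a # t)) (b # s) = rd (\<lambda>t. scale V c (f (a # t))) (b # s)"
      by (rule rd_cong) (use Suc.prems that r in \<open>auto simp: mlin_scale_hd\<close>)
    also have "\<dots> = scale V c (rd (\<lambda>t. f (a # t)) (b # s))"
      by (rule rd_scale) (use Suc.prems that r in \<open>auto intro: mlin_tail\<close>)
    finally show ?thesis
      using r that Suc.prems by (simp add: A.scale_l mlin_scale_hd V.vs.scale_right_diff_distrib)
  qed
  ultimately show ?case unfolding mlin_Suc[of A V "Suc m" "rd f"] by blast
qed

lemma rd_rd:
  assumes "mlin A V m f" "xs \<in> hargs A (Suc (Suc m))"
  shows "rd (rd f) xs = 0"
  using assms
proof (induction m arbitrary: f xs)
  case 0
  then show ?case by (auto simp: hargs_Suc_iff mlin_0 ra_mult)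
next
  case (Suc m)
  from Suc.prems(2) obtain a b c s where xs: "xs = a # b # c # s" "a \<in> carrier A" "b \<in> carrier A"
    "c \<in> carrier A" "s \<in> hargs A m"
    by (auto simp: hargs_Suc_iff)
  have fa: "mlin A V m (\<lambda>t. f (a # t))" using Suc.prems xs by (auto intro: mlin_tail)
  have m1: "mlin A V (Suc m) (\<lambda>t. f (a \<otimes>\<^bsub>A\<^esub> hd t # tl t))"
    using xs(2) Suc.prems by (auto simp: mlin_Suc[of A V m "\<lambda>r. f ((a \<otimes>\<^bsub>A\<^esub> hd r) # tl r)"]
        A.r_distrib A.scale_r mlin_add_hd mlin_scale_hd mlin_tail[OF Suc.prems(1)])
  have "rd (\<lambda>t. rd f (a # t)) (b # c # s) = rd (\<lambda>t. f (a \<otimes>\<^bsub>A\<^esub> hd t # tl t) - rd (\<lambda>t. f (a # t)) t) (b # c # s)"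
    by (rule rd_cong[of "Suc m"]) (use xs in \<open>auto simp: hargs_Suc_iff\<close>)
  also have "\<dots> = rd (\<lambda>t. f (a \<otimes>\<^bsub>A\<^esub> hd t # tl t)) (b # c # s) - rd (rd (\<lambda>t. f (a # t))) (b # c # s)"
    by (rule rd_diff[OF m1 mlin_rd[OF fa]]) (use xs in auto)
  also have "rd (rd (\<lambda>t. f (a # t))) (b # c # s) = 0"
    by (rule Suc.IH[OF fa]) (use xs in auto)
  finally show ?case using xs by (simp add: A.m_assoc)
qed

end

sublocale kalgebra \<subseteq> reg: right_action A A "monoid.mult A"
  by unfold_locales (auto simp: l_distrib r_distrib scale_l scale_r m_assoc)

context kalgebra
begin

lemma rd_unfold:
  assumes "length xs = Suc m"
  shows "rdiff (monoid.mult A) (monoid.mult A) f xs =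
    - (\<Sum>i<m. scale A ((-1) ^ Suc i) (f (take i xs @ [(xs ! i) \<otimes> (xs ! Suc i)] @ drop (i + 2) xs)))
    - scale A ((-1) ^ Suc m) (f (butlast xs) \<otimes> last xs)"
  using assms
proof (induction m arbitrary: f xs)
  case 0
  then show ?case by (auto simp: length_Suc_conv)
next
  case (Suc m)
  then obtain a b s where xs: "xs = a # b # s" "length s = m" by (auto simp: length_Suc_conv)
  show ?case
    using xs Suc.IH[of "b # s" "\<lambda>t. f (a # t)"]
    by (simp add: sum.lessThan_Suc_shift sum_negf del: sum.lessThan_Suc)
qed

text \<open>
  The summand in which the first argument acts from the left is all that separates \<open>rdiff\<close> from
  the differential. Inductions on cochains use this form.
\<close>

lemma hdiff_rec:
  assumes "a # r \<in> hargs A (Suc m)"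
  shows "hdiff A m f (a # r) = a \<otimes> f r - rdiff (monoid.mult A) (monoid.mult A) f (a # r)"
  unfolding hdiff_def if_P[OF assms] rd_unfold[OF hargs_length[OF assms]] by simp

lemma hdiff_outside: "xs \<notin> hargs A (Suc m) \<Longrightarrow> hdiff A m f xs = 0"
  by (simp add: hdiff_def)

lemma hc_mlin: "f \<in> hcochains A m \<Longrightarrow> mlin A A m f"
  by (simp add: hcochains_iff[OF kalgebra_axioms])

lemma hc_out: "f \<in> hcochains A m \<Longrightarrow> xs \<notin> hargs A m \<Longrightarrow> f xs = 0"
  by (simp add: hcochains_iff[OF kalgebra_axioms])

lemma hc_closed: "f \<in> hcochains A m \<Longrightarrow> xs \<in> hargs A m \<Longrightarrow> f xs \<in> carrier A"
  by (simp add: hcochains_def)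

lemma hc_in: "f \<in> hcochains A m \<Longrightarrow> f xs \<in> carrier A"
  by (cases "xs \<in> hargs A m") (auto simp: hc_closed hc_out)

lemma hc_mlinI:
  assumes "mlin A A m f"
  shows "(\<lambda>xs. if xs \<in> hargs A m then f xs else 0) \<in> hcochains A m"
proof -
  have "mlin A A m (\<lambda>xs. if xs \<in> hargs A m then f xs else 0)"
    using assms by (subst mlin_cong[OF kalgebra_axioms, of _ _ f]) auto
  then show ?thesis by (simp add: hcochains_iff[OF kalgebra_axioms])
qed

lemma rd_lmult:
  assumes "mlin A A m f" "x \<in> carrier A" "xs \<in> hargs A (Suc m)"
  shows "x \<otimes> reg.rd f xs = reg.rd (\<lambda>t. x \<otimes> f t) xs"
  using assms(1,3)
proof (induction m arbitrary: f xs)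
  case 0 then show ?case using assms(2) by (auto simp: hargs_Suc_iff mlin_0 m_assoc)
next
  case (Suc m)
  then obtain b c s where xs: "xs = b # c # s" "b \<in> carrier A" "c \<in> carrier A" "s \<in> hargs A m"
    by (auto simp: hargs_Suc_iff)
  have fb: "mlin A A m (\<lambda>t. f (b # t))" using Suc.prems xs by (auto intro: mlin_tail)
  have "x \<otimes> reg.rd (\<lambda>t. f (b # t)) (c # s) = reg.rd (\<lambda>t. x \<otimes> f (b # t)) (c # s)"
    by (rule Suc.IH[OF fb]) (use xs in auto)
  moreover have "reg.rd (\<lambda>t. f (b # t)) (c # s) \<in> carrier A"
    using mlin_closed[OF reg.mlin_rd[OF fb]] xs by simp
  ultimately show ?case using xs assms(2) Suc.prems by (simp add: r_diff_distrib mlin_closed)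
qed

lemma mlin_left:
  assumes "mlin A A m f"
  shows "mlin A A (Suc m) (\<lambda>xs. hd xs \<otimes> f (tl xs))"
proof -
  have "mlin A A m (\<lambda>r. a \<otimes> f r)" if "a \<in> carrier A" for a
    by (rule mlin_post[OF assms]) (use that in \<open>auto simp: r_distrib scale_r\<close>)
  then show ?thesis
    using assms by (auto simp: mlin_Suc l_distrib scale_l mlin_closed)
qed

lemma hdiff_closed:
  assumes "f \<in> hcochains A m"
  shows "hdiff A m f \<in> hcochains A (Suc m)"
proof -
  let ?r = "rdiff (monoid.mult A) (monoid.mult A) f"
  have "mlin A A (Suc m) (\<lambda>xs. hd xs \<otimes> f (tl xs) - ?r xs)"
    by (rule mlin_diff[OF kalgebra_axioms kalgebra_axioms mlin_left reg.mlin_rd]) (use assms in \<open>auto simp: hc_mlin\<close>)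
  moreover have "hdiff A m f = (\<lambda>xs. if xs \<in> hargs A (Suc m) then hd xs \<otimes> f (tl xs) - ?r xs else 0)"
  proof
    fix xs show "hdiff A m f xs = (if xs \<in> hargs A (Suc m) then hd xs \<otimes> f (tl xs) - ?r xs else 0)"
      by (cases xs) (auto simp: hdiff_rec hdiff_outside)
  qed
  ultimately show ?thesis by (simp add: hc_mlinI)
qed

lemma hdiff_hdiff:
  assumes f: "f \<in> hcochains A m"
  shows "hdiff A (Suc m) (hdiff A m f) = 0"
proof
  fix xs
  show "hdiff A (Suc m) (hdiff A m f) xs = 0 xs"
  proof (cases "xs \<in> hargs A (Suc (Suc m))")
    case False
    then show ?thesis by (simp add: hdiff_outside)
  next
    case True
    then obtain a b r where xs: "xs = a # b # r" "a \<in> carrier A" "b \<in> carrier A" "r \<in> hargs A m"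
      by (auto simp: hargs_Suc_iff)
    let ?r = "rdiff (monoid.mult A) (monoid.mult A)"
    have fm: "mlin A A m f" using f by (rule hc_mlin)
    note cl = hc_closed[OF f]
    have rb: "?r f (b # r) \<in> carrier A" using mlin_closed[OF reg.mlin_rd[OF fm]] xs by simp
    have "?r (hdiff A m f) xs = ?r (\<lambda>xs. hd xs \<otimes> f (tl xs) - ?r f xs) xs"
      by (rule reg.rd_cong[OF _ True]) (auto simp: hargs_Suc_iff hdiff_rec)
    also have "\<dots> = ?r (\<lambda>xs. hd xs \<otimes> f (tl xs)) xs - ?r (?r f) xs"
      by (rule reg.rd_diff[OF mlin_left[OF fm] reg.mlin_rd[OF fm] True])
    also have "?r (?r f) xs = 0" by (rule reg.rd_rd[OF fm True])
    also have "?r (\<lambda>xs. hd xs \<otimes> f (tl xs)) xs = (a \<otimes> b) \<otimes> f r - ?r (\<lambda>t. a \<otimes> f t) (b # r)"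
      using xs by simp
    also have "?r (\<lambda>t. a \<otimes> f t) (b # r) = a \<otimes> ?r f (b # r)"
      by (rule rd_lmult[OF fm, symmetric]) (use xs in auto)
    finally have 1: "?r (hdiff A m f) xs = (a \<otimes> b) \<otimes> f r - a \<otimes> ?r f (b # r)" by simp
    have "hdiff A (Suc m) (hdiff A m f) xs = a \<otimes> hdiff A m f (b # r) - ?r (hdiff A m f) xs"
      using True xs(1) hdiff_rec by simp
    also have "\<dots> = 0"
      using 1 xs rb cl by (simp add: hdiff_rec r_diff_distrib m_assoc)
    finally show ?thesis by simp
  qed
qed

section \<open>Cup products\<close>

lemma mlin_cup:
  assumes "mlin A A m f" "mlin A A k g"
  shows "mlin A A (m + k) (\<lambda>xs. f (take m xs) \<otimes> g (drop m xs))"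
  using assms(1)
proof (induction m arbitrary: f)
  case 0
  have "mlin A A k (\<lambda>xs. f [] \<otimes> g xs)"
    by (rule mlin_post[OF assms(2)]) (use 0 in \<open>auto simp: r_distrib scale_r mlin_0\<close>)
  then show ?case by simp
next
  case (Suc m)
  have "mlin A A (m + k) (\<lambda>xs. f (a # take m xs) \<otimes> g (drop m xs))" if "a \<in> carrier A" for a
    using that Suc.prems by (intro Suc.IH) (rule mlin_tail)
  then show ?case
    using Suc.prems assms(2)
    by (auto simp: mlin_Suc[of _ _ "m + k"] mlin_add_hd mlin_scale_hd hargs_take hargs_drop mlin_closed l_distrib scale_l)
qed

lemma hcup_closed:
  assumes "f \<in> hcochains A m" "g \<in> hcochains A k"
  shows "hcup A m k f g \<in> hcochains A (m + k)"
  using hc_mlinI[OF mlin_cup[OF hc_mlin[OF assms(1)] hc_mlin[OF assms(2)]]] by (simp add: hcup_def)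

lemma rd_cup:
  assumes "mlin A A m f" "mlin A A k g" "xs \<in> hargs A (Suc (m + k))"
  shows "rdiff (monoid.mult A) (monoid.mult A) (\<lambda>xs. f (take m xs) \<otimes> g (drop m xs)) xs =
    rdiff (monoid.mult A) (monoid.mult A) f (take (Suc m) xs) \<otimes> g (drop (Suc m) xs)
    - (if even m then id else uminus) (f (take m xs) \<otimes> hdiff A k g (drop m xs))"
  using assms(1,3)
proof (induction m arbitrary: f xs)
  case 0
  then obtain a r where xs: "xs = a # r" "a \<in> carrier A" "r \<in> hargs A k" by (auto simp: hargs_Suc_iff)
  let ?r = "rdiff (monoid.mult A) (monoid.mult A)"
  have f: "f [] \<in> carrier A" using 0 by (simp add: mlin_0)
  have rc: "?r g (a # r) \<in> carrier A" using mlin_closed[OF reg.mlin_rd[OF assms(2)]] xs by simp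
  have "?r (\<lambda>xs. f [] \<otimes> g xs) (a # r) = f [] \<otimes> ?r g (a # r)"
    by (rule rd_lmult[OF assms(2) f, symmetric]) (use xs in auto)
  then show ?case
    using xs f rc mlin_closed[OF assms(2)] by (simp add: hdiff_rec r_diff_distrib m_assoc)
next
  case (Suc m)
  then obtain a b s where xs: "xs = a # b # s" "a \<in> carrier A" "b \<in> carrier A" "s \<in> hargs A (m + k)"
    by (auto simp: hargs_Suc_iff)
  let ?r = "rdiff (monoid.mult A) (monoid.mult A)"
  have fa: "mlin A A m (\<lambda>t. f (a # t))" using Suc.prems xs by (auto intro: mlin_tail)
  have IH: "?r (\<lambda>t. f (a # take m t) \<otimes> g (drop m t)) (b # s) =
    ?r (\<lambda>t. f (a # t)) (b # take m s) \<otimes> g (drop m s) -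
     (if even m then id else uminus) (f (a # take m (b # s)) \<otimes> hdiff A k g (drop m (b # s)))"
    using Suc.IH[OF fa, of "b # s"] xs by simp
  have c: "?r (\<lambda>t. f (a # t)) (b # take m s) \<in> carrier A"
    using mlin_closed[OF reg.mlin_rd[OF fa]] xs by (simp add: hargs_take)
  have "g (drop m s) \<in> carrier A" "f (a \<otimes> b # take m s) \<in> carrier A"
    using xs mlin_closed[OF assms(2)] mlin_closed[OF Suc.prems(1)] by (auto simp: hargs_take hargs_drop)
  with c IH xs show ?case by (simp add: l_diff_distrib)
qed

lemma hdiff_cup:
  assumes f: "f \<in> hcochains A m" and g: "g \<in> hcochains A k"
  shows "hdiff A (m + k) (hcup A m k f g) =
    hcup A (Suc m) k (hdiff A m f) g + (if even m then id else uminus) (hcup A m (Suc k) f (hdiff A k g))"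
proof
  fix xs
  show "hdiff A (m + k) (hcup A m k f g) xs =
    (hcup A (Suc m) k (hdiff A m f) g + (if even m then id else uminus) (hcup A m (Suc k) f (hdiff A k g))) xs"
  proof (cases "xs \<in> hargs A (Suc (m + k))")
    case False
    then show ?thesis by (simp add: hdiff_outside hcup_def)
  next
    case True
    let ?r = "rdiff (monoid.mult A) (monoid.mult A)"
    note fm = hc_mlin[OF f] and gm = hc_mlin[OF g]
    from True obtain a r where xs: "xs = a # r" "a \<in> carrier A" "r \<in> hargs A (m + k)" by (auto simp: hargs_Suc_iff)
    have "?r (hcup A m k f g) xs = ?r (\<lambda>xs. f (take m xs) \<otimes> g (drop m xs)) xs"
      by (rule reg.rd_cong[OF _ True]) (simp add: hcup_def)
    then have "hdiff A (m + k) (hcup A m k f g) xs = a \<otimes> (f (take m r) \<otimes> g (drop m r)) -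
       (?r f (take (Suc m) xs) \<otimes> g (drop (Suc m) xs)
        - (if even m then id else uminus) (f (take m xs) \<otimes> hdiff A k g (drop m xs)))"
      using xs rd_cup[OF fm gm True] by (simp add: hdiff_rec hcup_def)
    moreover have "hdiff A m f (take (Suc m) xs) = a \<otimes> f (take m r) - ?r f (take (Suc m) xs)"
      using xs by (simp add: hdiff_rec hargs_take)
    moreover have "?r f (take (Suc m) xs) \<in> carrier A" "f (take m r) \<in> carrier A" "g (drop m r) \<in> carrier A"
      using mlin_closed[OF reg.mlin_rd[OF fm], of "take (Suc m) xs"] mlin_closed[OF fm] mlin_closed[OF gm] xs
      by (auto simp: hargs_take hargs_drop)
    ultimately show ?thesis
      using xs by (simp add: hcup_def l_diff_distrib m_assoc)
  qed
qed

lemma hcup_assoc: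
  assumes "f \<in> hcochains A m" "g \<in> hcochains A k" "h \<in> hcochains A l"
  shows "hcup A (m + k) l (hcup A m k f g) h = hcup A m (k + l) f (hcup A k l g h)"
proof
  fix xs
  show "hcup A (m + k) l (hcup A m k f g) h xs = hcup A m (k + l) f (hcup A k l g h) xs"
  proof (cases "xs \<in> hargs A (m + k + l)")
    case True
    have 1: "take (m + k) xs \<in> hargs A (m + k)" by (rule hargs_take) (use True in simp)
    have 2: "drop m xs \<in> hargs A (k + l)" by (rule hargs_drop) (use True in \<open>simp add: add.assoc\<close>)
    have 3: "f (take m xs) \<in> carrier A" "g (take k (drop m xs)) \<in> carrier A" "h (drop (m + k) xs) \<in> carrier A"
      using assms by (auto intro: hc_in)
    have 4: "drop m (take (m + k) xs) = take k (drop m xs)" "drop k (drop m xs) = drop (m + k) xs"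
      by (simp_all add: drop_take add.commute)
    show ?thesis using True 1 2 3 by (simp add: hcup_def 4 m_assoc add.assoc add.commute[of k m])
  qed (simp add: hcup_def add.assoc)
qed

lemma hcup_add_l: "\<lbrakk>f \<in> hcochains A m; f' \<in> hcochains A m; g \<in> hcochains A k\<rbrakk> \<Longrightarrow>
    hcup A m k (f + f') g = hcup A m k f g + hcup A m k f' g"
  by (rule ext) (simp add: hcup_def l_distrib hc_in)

lemma hcup_add_r: "\<lbrakk>f \<in> hcochains A m; g \<in> hcochains A k; g' \<in> hcochains A k\<rbrakk> \<Longrightarrow>
    hcup A m k f (g + g') = hcup A m k f g + hcup A m k f g'"
  by (rule ext) (simp add: hcup_def r_distrib hc_in)

lemma hcup_scale_l: "\<lbrakk>f \<in> hcochains A m; g \<in> hcochains A k\<rbrakk> \<Longrightarrow>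
    hcup A m k (\<lambda>xs. scale A c (f xs)) g = (\<lambda>xs. scale A c (hcup A m k f g xs))"
  by (rule ext) (simp add: hcup_def scale_l hc_in)

lemma hcup_scale_r: "\<lbrakk>f \<in> hcochains A m; g \<in> hcochains A k\<rbrakk> \<Longrightarrow>
    hcup A m k f (\<lambda>xs. scale A c (g xs)) = (\<lambda>xs. scale A c (hcup A m k f g xs))"
  by (rule ext) (simp add: hcup_def scale_r hc_in)

end

context kalgebra
begin

lemma hc_zero: "0 \<in> hcochains A m"
  by (simp add: hcochains_iff[OF kalgebra_axioms] mlin_def)

lemma hc_add: "f \<in> hcochains A m \<Longrightarrow> g \<in> hcochains A m \<Longrightarrow> f + g \<in> hcochains A m"
  using mlin_add[OF kalgebra_axioms kalgebra_axioms, of m f g]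
  by (simp add: hcochains_iff[OF kalgebra_axioms] plus_fun_def)

lemma hc_scale: "f \<in> hcochains A m \<Longrightarrow> (\<lambda>xs. scale A c (f xs)) \<in> hcochains A m"
  using mlin_scale[OF kalgebra_axioms kalgebra_axioms, of m f c]
  by (simp add: hcochains_iff[OF kalgebra_axioms])

lemma hc_neg: "f \<in> hcochains A m \<Longrightarrow> - f \<in> hcochains A m"
  using hc_scale[of f m "-1"] by (simp add: fun_Compl_def)

lemma hc_diff: "f \<in> hcochains A m \<Longrightarrow> g \<in> hcochains A m \<Longrightarrow> f - g \<in> hcochains A m"
  using hc_add[OF _ hc_neg, of f m g] by simp

lemma hdiff_add:
  assumes "f \<in> hcochains A m" "g \<in> hcochains A m"
  shows "hdiff A m (f + g) = hdiff A m f + hdiff A m g"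
proof
  fix xs show "hdiff A m (f + g) xs = (hdiff A m f + hdiff A m g) xs"
  proof (cases "xs \<in> hargs A (Suc m)")
    case True
    then obtain a r where a: "xs = a # r" "a \<in> carrier A" "r \<in> hargs A m" by (auto simp: hargs_Suc_iff)
    have "reg.rd (\<lambda>t. f t + g t) xs = reg.rd f xs + reg.rd g xs"
      by (rule reg.rd_add[OF hc_mlin[OF assms(1)] hc_mlin[OF assms(2)] True])
    then show ?thesis using a assms by (simp add: hdiff_rec r_distrib hc_in plus_fun_def)
  qed (simp add: hdiff_outside)
qed

lemma hdiff_scale:
  assumes "f \<in> hcochains A m"
  shows "hdiff A m (\<lambda>xs. scale A c (f xs)) = (\<lambda>xs. scale A c (hdiff A m f xs))"
proof
  fix xs show "hdiff A m (\<lambda>xs. scale A c (f xs)) xs = scale A c (hdiff A m f xs)"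
  proof (cases "xs \<in> hargs A (Suc m)")
    case True
    then obtain a r where a: "xs = a # r" "a \<in> carrier A" "r \<in> hargs A m" by (auto simp: hargs_Suc_iff)
    have "reg.rd (\<lambda>t. scale A c (f t)) xs = scale A c (reg.rd f xs)"
      by (rule reg.rd_scale[OF hc_mlin[OF assms(1)] True])
    then show ?thesis using a assms by (simp add: hdiff_rec scale_r hc_in vs.scale_right_diff_distrib)
  qed (simp add: hdiff_outside)
qed

lemma hdiff_zero [simp]: "hdiff A m 0 = 0"
  using hdiff_scale[OF hc_zero, of m 0] by (simp add: zero_fun_def)

lemma hdiff_neg: "f \<in> hcochains A m \<Longrightarrow> hdiff A m (- f) = - hdiff A m f"
  using hdiff_scale[of f m "-1"] by (simp add: fun_Compl_def)

lemma hdiff_diff: "f \<in> hcochains A m \<Longrightarrow> g \<in> hcochains A m \<Longrightarrow> hdiff A m (f - g) = hdiff A m f - hdiff A m g"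
  using hdiff_add[of f m "- g"] by (simp add: hc_neg hdiff_neg)

lemma hc_sum: "(\<And>i. i \<in> K \<Longrightarrow> f i \<in> hcochains A m) \<Longrightarrow> (\<Sum>i\<in>K. f i) \<in> hcochains A m"
  by (induction K rule: infinite_finite_induct) (auto simp: hc_zero hc_add)

end

section \<open>Derivations\<close>

locale derivation = kalgebra +
  fixes D
  assumes D_closed: "x \<in> carrier A \<Longrightarrow> D x \<in> carrier A"
    and D_add: "x \<in> carrier A \<Longrightarrow> y \<in> carrier A \<Longrightarrow> D (x + y) = D x + D y"
    and D_scale: "x \<in> carrier A \<Longrightarrow> D (scale A c x) = scale A c (D x)"
    and D_mult: "x \<in> carrier A \<Longrightarrow> y \<in> carrier A \<Longrightarrow> D (x \<otimes> y) = D x \<otimes> y + x \<otimes> D y"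
begin

definition D1 where "D1 = (\<lambda>xs. if xs \<in> hargs A 1 then D (hd xs) else 0)"

lemma D_0 [simp]: "D 0 = 0"
  using D_add[of 0 0] by simp

lemma D_diff: "x \<in> carrier A \<Longrightarrow> y \<in> carrier A \<Longrightarrow> D (x - y) = D x - D y"
  using D_add[of "x - y" y] by (simp add: eq_diff_eq)

lemma D1_closed: "D1 \<in> hcochains A 1"
proof -
  have "mlin A A 1 (\<lambda>xs. D (hd xs))"
    unfolding One_nat_def by (auto simp: mlin_Suc mlin_0 D_closed D_add D_scale)
  then show ?thesis unfolding D1_def by (rule hc_mlinI)
qed

lemma D1_cocycle: "hdiff A 1 D1 = 0"
proof
  fix xs show "hdiff A 1 D1 xs = 0 xs"
  proof (cases "xs \<in> hargs A (Suc 1)")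
    case True
    then obtain a b where "xs = [a, b]" "a \<in> carrier A" "b \<in> carrier A" by (auto simp: hargs_Suc_iff)
    then show ?thesis using hdiff_rec[of a "[b]" 1 D1] by (simp add: D1_def D_mult)
  qed (simp add: hdiff_outside)
qed

lemma D_post: "f \<in> hcochains A m \<Longrightarrow> (\<lambda>xs. D (f xs)) \<in> hcochains A m"
  by (auto simp: hcochains_iff[OF kalgebra_axioms] D_closed D_add D_scale intro: mlin_post)

lemma D_rd:
  assumes "mlin A A m f" "xs \<in> hargs A (Suc m)"
  shows "D (reg.rd f xs) = reg.rd (\<lambda>t. D (f t)) xs
    + (if even m then id else uminus) (f (butlast xs) \<otimes> D (last xs))"
  using assms
proof (induction m arbitrary: f xs)
  case 0
  then show ?case by (auto simp: hargs_Suc_iff mlin_0 D_mult)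
next
  case (Suc m)
  then obtain a b s where xs: "xs = a # b # s" "a \<in> carrier A" "b \<in> carrier A" "s \<in> hargs A m"
    by (auto simp: hargs_Suc_iff)
  have fa: "mlin A A m (\<lambda>t. f (a # t))" using Suc.prems xs by (auto intro: mlin_tail)
  have "reg.rd (\<lambda>t. f (a # t)) (b # s) \<in> carrier A"
    using mlin_closed[OF reg.mlin_rd[OF fa]] xs by simp
  then show ?case
    using Suc.IH[OF fa, of "b # s"] xs Suc.prems by (simp add: D_diff mlin_closed)
qed

text \<open>
  Composing a cocycle with a derivation provides the homotopy that makes the class of the
  derivation graded-central.
\<close>

lemma derivation_cup_commute:
  assumes f: "f \<in> hcochains A m" and df: "hdiff A m f = 0"
  shows "hcup A 1 m D1 f = (if even m then id else uminus) (hcup A m 1 f D1) - hdiff A m (\<lambda>xs. D (f xs))"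
proof
  fix xs
  show "hcup A 1 m D1 f xs = ((if even m then id else uminus) (hcup A m 1 f D1) - hdiff A m (\<lambda>xs. D (f xs))) xs"
  proof (cases "xs \<in> hargs A (Suc m)")
    case True
    then obtain a r where xs: "xs = a # r" "a \<in> carrier A" "r \<in> hargs A m" by (auto simp: hargs_Suc_iff)
    note fm = hc_mlin[OF f]
    have l: "length r = m" using xs by (simp add: hargs_length)
    have "a \<otimes> f r - reg.rd f (a # r) = 0"
      using True df hdiff_rec[of a r m f] by (simp add: xs)
    then have "D (a \<otimes> f r) = D (reg.rd f (a # r))" by simp
    then have "D a \<otimes> f r + a \<otimes> D (f r) = reg.rd (\<lambda>t. D (f t)) (a # r)
        + (if even m then id else uminus) (f (butlast xs) \<otimes> D (last xs))"
      using True xs fm by (simp add: D_rd D_mult mlin_closed)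
    moreover have "take m xs = butlast xs" using l xs by (simp add: butlast_conv_take)
    moreover have "drop m xs = [last xs]" using l xs by (cases r rule: rev_cases) auto
    moreover have "last xs \<in> carrier A" using True last_in_set[of xs] xs(1) unfolding hargs_def by blast
    ultimately show ?thesis using xs True
      by (simp add: hcup_def D1_def hdiff_rec algebra_simps split: if_splits)
  qed (simp add: hcup_def hdiff_outside)
qed

end

section \<open>Rotation in Frobenius algebras\<close>

abbreviation bar :: "('a \<Rightarrow> 'a \<Rightarrow> 'a) \<Rightarrow> ('a list \<Rightarrow> 'k::field) \<Rightarrow> 'a list \<Rightarrow> 'k" where
  "bar mu \<equiv> rdiff mu (\<lambda>_ _. 0)"

lemma bar_sum: "bar mu (\<lambda>xs. \<Sum>i\<in>I. c i * f i xs) xs = (\<Sum>i\<in>I. c i * bar mu (f i) xs)"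
  by (induction xs arbitrary: f rule: induct_list012) (auto simp: sum_subtractf right_diff_distrib)

text \<open>
  Two neighbours that are merged both lie among the letters \<open>0..k\<close> or both among the letters from
  \<open>k\<close> on; the letter \<open>k\<close> belongs to both ranges.
\<close>

lemma bar_split:
  assumes "k < length as"
  shows "bar mu (\<lambda>as'. K (take k as') (drop k as')) as =
    bar mu (\<lambda>u. K u (drop (Suc k) as)) (take (Suc k) as)
    + (-1) ^ k * bar mu (\<lambda>v. K (take k as) v) (drop k as)"
  using assms
proof (induction k arbitrary: as K)
  case 0
  then show ?case by (cases as) auto
next
  case (Suc k)
  then obtain a b r where as: "as = a # b # r" "k \<le> length r"
    by (cases as; cases "tl as") auto
  show ?case
    using Suc.IH[of "b # r" "\<lambda>u v. K (a # u) v"] as by simp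
qed

text \<open>
  Two neighbours of a word with a marked letter \<open>x\<close> are merged to the left of \<open>x\<close>, into \<open>x\<close> from
  one of its two sides, or to the right of \<open>x\<close>.
\<close>

lemma bar_append:
  "bar mu G (p @ x # u) = bar mu (\<lambda>p'. G (p' @ x # u)) p
    + (if p = [] then 0 else (-1) ^ (length p - 1) * G (butlast p @ mu (last p) x # u))
    + (if u = [] then 0 else (-1) ^ length p * G (p @ mu x (hd u) # tl u))
    - (-1) ^ length p * bar mu (\<lambda>u'. G (p @ x # u')) u"
proof (induction p arbitrary: G)
  case Nil
  then show ?case by (cases u) auto
next
  case (Cons a p)
  then show ?case
    by (cases p) (auto simp: algebra_simps)
qed

lemma bar_cong:
  assumes "\<And>a b. a \<in> S \<Longrightarrow> b \<in> S \<Longrightarrow> mu a b \<in> S" "set xs \<subseteq> S"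
    and "\<And>ys. set ys \<subseteq> S \<Longrightarrow> Suc (length ys) = length xs \<Longrightarrow> f ys = g ys"
  shows "bar mu f xs = bar mu g xs"
  using assms(2,3)
proof (induction xs arbitrary: f g rule: induct_list012)
  case (3 a b s)
  have "bar mu (\<lambda>t. f (a # t)) (b # s) = bar mu (\<lambda>t. g (a # t)) (b # s)"
    by (rule 3(2)) (use 3(3,4) in auto)
  then show ?case using 3(3,4) assms(1) by simp
qed auto

lemma bar_map:
  assumes "\<And>a b. a \<in> S \<Longrightarrow> b \<in> S \<Longrightarrow> mu a b \<in> S"
    "\<And>a b. a \<in> S \<Longrightarrow> b \<in> S \<Longrightarrow> h (mu a b) = mu (h a) (h b)" "set xs \<subseteq> S"
  shows "bar mu G (map h xs) = bar mu (\<lambda>ys. G (map h ys)) xs"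
  using assms(3)
proof (induction xs arbitrary: G rule: induct_list012)
  case (3 a b s)
  have "bar mu (\<lambda>t. G (h a # t)) (map h (b # s)) = bar mu (\<lambda>t. G (h a # map h t)) (b # s)"
    by (rule 3(2)) (use 3(3) in auto)
  then show ?case using 3(3) assms(2) by simp
qed auto

text \<open>
  A linear form \<open>eps\<close> through which the algebra represents its own dual, with Nakayama
  automorphism \<open>nu\<close> and its inverse \<open>nu'\<close>. In the intended examples \<open>eps_represents\<close> is where
  finite dimension enters.
\<close>

locale frobenius_algebra = kalgebra A
  for A :: "('k::field, 'a::ab_group_add, 'z) kalg_scheme" (structure) +
  fixes eps :: "'a \<Rightarrow> 'k" and nu nu' :: "'a \<Rightarrow> 'a"
  assumes eps_add: "x \<in> carrier A \<Longrightarrow> y \<in> carrier A \<Longrightarrow> eps (x + y) = eps x + eps y"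
    and eps_scale: "x \<in> carrier A \<Longrightarrow> eps (scale A c x) = c * eps x"
    and nu_closed: "x \<in> carrier A \<Longrightarrow> nu x \<in> carrier A"
    and nu'_closed: "x \<in> carrier A \<Longrightarrow> nu' x \<in> carrier A"
    and nu_nu': "x \<in> carrier A \<Longrightarrow> nu (nu' x) = x"
    and nu'_add: "x \<in> carrier A \<Longrightarrow> y \<in> carrier A \<Longrightarrow> nu' (x + y) = nu' x + nu' y"
    and nu'_scale: "x \<in> carrier A \<Longrightarrow> nu' (scale A c x) = scale A c (nu' x)"
    and nu'_mult: "x \<in> carrier A \<Longrightarrow> y \<in> carrier A \<Longrightarrow> nu' (x \<otimes> y) = nu' x \<otimes> nu' y"
    and eps_nu: "x \<in> carrier A \<Longrightarrow> y \<in> carrier A \<Longrightarrow> eps (x \<otimes> y) = eps (y \<otimes> nu x)"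
    and eps_nondegenerate: "x \<in> carrier A \<Longrightarrow> (\<And>y. y \<in> carrier A \<Longrightarrow> eps (y \<otimes> x) = 0) \<Longrightarrow> x = 0"
    and eps_represents: "(\<And>x y. x \<in> carrier A \<Longrightarrow> y \<in> carrier A \<Longrightarrow> l (x + y) = l x + l y) \<Longrightarrow>
      (\<And>c x. x \<in> carrier A \<Longrightarrow> l (scale A c x) = c * l x) \<Longrightarrow>
      \<exists>z\<in>carrier A. \<forall>x\<in>carrier A. l x = eps (x \<otimes> z)"
begin

lemma eps_0 [simp]: "eps 0 = 0"
  using eps_scale[of 0 0] by simp

lemma eps_neg: "x \<in> carrier A \<Longrightarrow> eps (- x) = - eps x"
  using eps_scale[of x "-1"] by simp

lemma eps_diff: "x \<in> carrier A \<Longrightarrow> y \<in> carrier A \<Longrightarrow> eps (x - y) = eps x - eps y"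
  using eps_add[of x "- y"] by (simp add: eps_neg)

lemma eps_nu': "x \<in> carrier A \<Longrightarrow> y \<in> carrier A \<Longrightarrow> eps (y \<otimes> x) = eps (nu' x \<otimes> y)"
  using eps_nu[of "nu' x" y] by (simp add: nu_nu' nu'_closed)

lemma eps_eqI:
  assumes "x \<in> carrier A" "y \<in> carrier A" "\<And>z. z \<in> carrier A \<Longrightarrow> eps (z \<otimes> x) = eps (z \<otimes> y)"
  shows "x = y"
  using eps_nondegenerate[of "x - y"] assms by (simp add: r_diff_distrib eps_diff)

text \<open>
  The cyclic sum of \<open>eps \<circ> f\<close> over all ways of moving the last arguments in front of \<open>x\<close>, twisted
  by the inverse Nakayama automorphism.
\<close>

definition rot_sum :: "nat \<Rightarrow> ('a list \<Rightarrow> 'a) \<Rightarrow> 'a \<Rightarrow> 'a list \<Rightarrow> 'k" where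
  "rot_sum m f x as =
     (\<Sum>i<m. (-1) ^ ((m + 1) * i) * eps (f (map nu' (drop i as) @ x # take i as)))"

lemma bar_eps:
  assumes "mlin A A m f" "xs \<in> hargs A (Suc m)"
  shows "bar (\<otimes>) (\<lambda>t. eps (f t)) xs =
    eps (reg.rd f xs) - (-1) ^ m * eps (f (butlast xs) \<otimes> last xs)"
  using assms
proof (induction m arbitrary: f xs)
  case 0
  then show ?case by (auto simp: hargs_Suc_iff)
next
  case (Suc m)
  then obtain a b s where xs: "xs = a # b # s" "a \<in> carrier A" "b \<in> carrier A" "s \<in> hargs A m"
    by (auto simp: hargs_Suc_iff)
  have fa: "mlin A A m (\<lambda>t. f (a # t))" using Suc.prems xs by (auto intro: mlin_tail)
  have "reg.rd (\<lambda>t. f (a # t)) (b # s) \<in> carrier A"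
    using mlin_closed[OF reg.mlin_rd[OF fa]] xs by simp
  then show ?case
    using Suc.IH[OF fa, of "b # s"] xs Suc.prems by (simp add: eps_diff mlin_closed)
qed

lemma bar_eps_cocycle:
  assumes f: "f \<in> hcochains A m" and df: "hdiff A m f = 0" and y: "y \<in> hargs A (Suc m)"
  shows "bar (\<otimes>) (\<lambda>t. eps (f t)) y =
    eps (hd y \<otimes> f (tl y)) - (-1) ^ m * eps (f (butlast y) \<otimes> last y)"
proof -
  obtain a r where a: "y = a # r" using y by (auto simp: hargs_Suc_iff)
  have "a \<otimes> f r - reg.rd f (a # r) = 0"
    using hdiff_rec[of a r m f] df y unfolding a by simp
  then show ?thesis using bar_eps[OF hc_mlin[OF f] y] by (simp add: a)
qed

lemma rot_word: "as \<in> hargs A m \<Longrightarrow> x \<in> carrier A \<Longrightarrow> map nu' (drop i as) @ x # take i as \<in> hargs A (Suc m)"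
  by (auto simp: hargs_def nu'_closed dest: in_set_takeD in_set_dropD)

lemma rot_sum_linear:
  assumes f: "mlin A A m f" and as: "Suc (length as) = m" "set as \<subseteq> carrier A"
  shows "x \<in> carrier A \<Longrightarrow> y \<in> carrier A \<Longrightarrow> rot_sum m f (x + y) as = rot_sum m f x as + rot_sum m f y as"
    and "x \<in> carrier A \<Longrightarrow> rot_sum m f (scale A c x) as = c * rot_sum m f x as"
proof -
  have w: "map nu' (drop i as) @ x # take i as \<in> hargs A m" if "x \<in> carrier A" for x i
    using rot_word[of as "length as" x i] as that by (auto simp: hargs_def)
  show "rot_sum m f (x + y) as = rot_sum m f x as + rot_sum m f y as"
    if "x \<in> carrier A" "y \<in> carrier A"
    using that w by (simp add: rot_sum_def mlin_add_arg[OF f] eps_add mlin_closed[OF f]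
        distrib_left sum.distrib)
  show "rot_sum m f (scale A c x) as = c * rot_sum m f x as" if "x \<in> carrier A"
    using that w by (simp add: rot_sum_def mlin_scale_arg[OF f] eps_scale mlin_closed[OF f]
        sum_distrib_left mult.left_commute)
qed

lemma rot_sum_linear_args:
  assumes f: "mlin A A m f" and x: "x \<in> carrier A" and as: "Suc (Suc (length us + length vs)) = m"
    "set us \<subseteq> carrier A" "set vs \<subseteq> carrier A"
  shows "a \<in> carrier A \<Longrightarrow> b \<in> carrier A \<Longrightarrow>
      rot_sum m f x (us @ (a + b) # vs) = rot_sum m f x (us @ a # vs) + rot_sum m f x (us @ b # vs)"
    and "a \<in> carrier A \<Longrightarrow> rot_sum m f x (us @ scale A c a # vs) = c * rot_sum m f x (us @ a # vs)"
proof -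
  have 1: "map nu' (drop i (us @ a # vs)) @ x # take i (us @ a # vs) =
     (if i \<le> length us then map nu' (drop i us) @ nu' a # (map nu' vs @ x # take i us)
      else (map nu' (drop (i - Suc (length us)) vs) @ x # us) @ a # take (i - Suc (length us)) vs)" for i a
    by (simp add: drop_Cons' take_Cons')
  have 2: "map nu' (drop i us) @ a # (map nu' vs @ x # take i us) \<in> hargs A m"
    if "a \<in> carrier A" "i \<le> length us" for i a
    using that x as by (auto simp: hargs_def nu'_closed dest: in_set_takeD in_set_dropD)
  have 3: "(map nu' (drop (i - Suc (length us)) vs) @ x # us) @ a # take (i - Suc (length us)) vs \<in> hargs A m"
    if "a \<in> carrier A" for i a
    using that x as by (auto simp: hargs_def nu'_closed dest: in_set_takeD in_set_dropD)
  have 4: "eps (f (map nu' (drop i (us @ (a + b) # vs)) @ x # take i (us @ (a + b) # vs))) =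
      eps (f (map nu' (drop i (us @ a # vs)) @ x # take i (us @ a # vs))) +
      eps (f (map nu' (drop i (us @ b # vs)) @ x # take i (us @ b # vs)))"
    if "a \<in> carrier A" "b \<in> carrier A" for i a b
    unfolding 1 using 2 3 that nu'_closed
    by (auto simp: nu'_add mlin_add_arg[OF f] eps_add mlin_closed[OF f] simp del: append_assoc append_Cons)
  have 5: "eps (f (map nu' (drop i (us @ scale A c a # vs)) @ x # take i (us @ scale A c a # vs))) =
      c * eps (f (map nu' (drop i (us @ a # vs)) @ x # take i (us @ a # vs)))"
    if "a \<in> carrier A" for i a
    unfolding 1 using 2 3 that nu'_closed
    by (auto simp: nu'_scale mlin_scale_arg[OF f] eps_scale mlin_closed[OF f] simp del: append_assoc append_Cons)
  show "rot_sum m f x (us @ (a + b) # vs) = rot_sum m f x (us @ a # vs) + rot_sum m f x (us @ b # vs)"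
    if "a \<in> carrier A" "b \<in> carrier A"
    unfolding rot_sum_def 4[OF that] by (simp only: distrib_left sum.distrib)
  show "rot_sum m f x (us @ scale A c a # vs) = c * rot_sum m f x (us @ a # vs)" if "a \<in> carrier A"
    unfolding rot_sum_def 5[OF that] by (simp only: sum_distrib_left mult.left_commute)
qed

text \<open>
  Consider all rotations of the word formed by \<open>x\<close> and \<open>as\<close>, and sum the bar differential of
  \<open>eps \<circ> f\<close> over them with signs. Sorting the merges by their position relative to \<open>x\<close> gives the
  terms of the differential of \<open>rot_sum\<close>. On the other hand the cocycle condition expresses each
  summand by two products of the outermost letter with a value of \<open>f\<close>, and \<open>eps_nu'\<close> identifies
  the second product of one rotation with the first product of the preceding one, so the sum
  telescopes.
\<close>

lemma rot_sum_cocycle: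
  assumes f: "f \<in> hcochains A m" and df: "hdiff A m f = 0" and m: "m = Suc k"
    and x: "x \<in> carrier A" and as: "as \<in> hargs A m"
  shows "rot_sum m f (x \<otimes> hd as) (tl as) - bar (\<otimes>) (rot_sum m f x) as
      + (-1) ^ m * rot_sum m f (nu' (last as) \<otimes> x) (butlast as)
    = (-1) ^ m * (eps (f (map nu' as) \<otimes> x) - eps (x \<otimes> f as))"
proof -
  define G where "G = (\<lambda>xs. eps (f xs))"
  define y where "y = (\<lambda>i. map nu' (drop i as) @ x # take i as)"
  define c :: "nat \<Rightarrow> 'k" where "c = (\<lambda>i. (-1) ^ (m * i))"
  define s :: "nat \<Rightarrow> 'k" where "s = (\<lambda>i. (-1) ^ ((m + 1) * i))"
  define b1 where "b1 = (\<lambda>i. bar (\<otimes>) (\<lambda>v. G (map nu' v @ x # take i as)) (drop i as))"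
  define b4 where "b4 = (\<lambda>i. bar (\<otimes>) (\<lambda>u. G (map nu' (drop i as) @ x # u)) (take i as))"
  define t2 where "t2 = (\<lambda>i. G (map nu' (drop i (butlast as)) @ (nu' (last as) \<otimes> x) # take i (butlast as)))"
  define t3 where "t3 = (\<lambda>i. G (map nu' (drop i (tl as)) @ (x \<otimes> hd as) # take i (tl as)))"
  have las: "length as = Suc k" and sas: "set as \<subseteq> carrier A" using as m by (auto simp: hargs_def)
  then have ne: "as \<noteq> []" by auto
  then have asc: "as = hd as # tl as" "as = butlast as @ [last as]" by simp_all
  have y_in: "y i \<in> hargs A (Suc m)" for i unfolding y_def by (rule rot_word[OF as x])
  have b1_k: "b1 (Suc k) = 0" and b4_0: "b4 0 = 0" by (simp_all add: b1_def b4_def las)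
  have S: "rot_sum m f z bs = (\<Sum>i<m. s i * G (map nu' (drop i bs) @ z # take i bs))" for z bs
    by (simp add: rot_sum_def s_def G_def)
  \<comment> \<open>the merges in a rotated word, by their position relative to \<open>x\<close>\<close>
  have bar_y: "bar (\<otimes>) G (y i) = b1 i
      + (if i = m then 0 else (-1) ^ (m - i - 1) * t2 i)
      + (if i = 0 then 0 else (-1) ^ (m - i) * t3 (i - 1))
      - (-1) ^ (m - i) * b4 i" if i: "i \<le> m" for i
  proof -
    have 1: "bar (\<otimes>) (\<lambda>p. G (p @ x # take i as)) (map nu' (drop i as)) = b1 i"
      unfolding b1_def
      by (rule bar_map[where S = "carrier A"]) (use sas in \<open>auto simp: nu'_mult dest: in_set_dropD\<close>)
    have 2: "(drop i as = []) = (i = m)" using i las m by auto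
    have 3: "(take i as = []) = (i = 0)" using ne by auto
    have 4: "butlast (map nu' (drop i as)) = map nu' (drop i (butlast as))" "last (map nu' (drop i as)) = nu' (last as)"
      "take i (butlast as) = take i as" if "i \<noteq> m"
      using that i las m by (auto simp: map_butlast[symmetric] last_map drop_butlast take_butlast)
    have 5: "drop (i - 1) (tl as) = drop i as" "hd (take i as) = hd as" "tl (take i as) = take (i - 1) (tl as)" if "i \<noteq> 0"
      using that ne by (auto simp: drop_Suc[symmetric] tl_take)
    show ?thesis
      unfolding y_def bar_append 1
      using 4 5 las m i ne by (cases "i = m"; cases "i = 0") (simp_all add: 2 3 t2_def t3_def b4_def)
  qed
  have signs: "c i * (-1) ^ (m - i - 1) = - ((-1) ^ m * s i)" "c i = s i * (-1) ^ i"
     "c (Suc i) * (-1) ^ (m - Suc i) = - s i" if i: "i < m" for i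
  proof -
    obtain t where t: "m = i + 1 + t" using less_imp_Suc_add[OF i] by auto
    show "c i * (-1) ^ (m - i - 1) = - ((-1) ^ m * s i)"
      "c i = s i * (-1) ^ i" "c (Suc i) * (-1) ^ (m - Suc i) = - s i"
      unfolding c_def s_def t by (auto simp: minus_one_power_iff)
  qed
  have "(\<Sum>i\<le>m. c i * bar (\<otimes>) G (y i)) =
      (\<Sum>i\<le>m. c i * b1 i) + (\<Sum>i\<le>m. if i = m then 0 else c i * (-1) ^ (m - i - 1) * t2 i)
      + (\<Sum>i\<le>m. if i = 0 then 0 else c i * (-1) ^ (m - i) * t3 (i - 1))
      - (\<Sum>i\<le>m. c i * (-1) ^ (m - i) * b4 i)"
    unfolding sum.distrib[symmetric] sum_subtractf[symmetric]
    by (rule sum.cong) (auto simp: bar_y algebra_simps)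
  also have "(\<Sum>i\<le>m. c i * b1 i) = (\<Sum>i<m. s i * (-1) ^ i * b1 i)"
    unfolding lessThan_Suc_atMost[symmetric] sum.lessThan_Suc by (simp add: m b1_k[unfolded m] signs[unfolded m] b1_k)
  also have "(\<Sum>i\<le>m. if i = m then 0 else c i * (-1) ^ (m - i - 1) * t2 i) = (\<Sum>i<m. c i * (-1) ^ (m - i - 1) * t2 i)"
    unfolding lessThan_Suc_atMost[symmetric] sum.lessThan_Suc by simp
  also have "\<dots> = - (\<Sum>i<m. (-1) ^ m * s i * t2 i)"
    unfolding sum_negf[symmetric] by (rule sum.cong) (simp_all only: signs(1) lessThan_iff mult_minus_left)
  also have "(\<Sum>i\<le>m. if i = 0 then 0 else c i * (-1) ^ (m - i) * t3 (i - 1)) = - (\<Sum>i<m. s i * t3 i)"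
    unfolding lessThan_Suc_atMost[symmetric] sum.lessThan_Suc_shift by (simp add: signs sum_negf)
  also have "(\<Sum>i\<le>m. c i * (-1) ^ (m - i) * b4 i) = - (\<Sum>i<m. s i * b4 (Suc i))"
    unfolding lessThan_Suc_atMost[symmetric] sum.lessThan_Suc_shift by (simp add: signs sum_negf b4_0)
  finally have lhs: "(\<Sum>i\<le>m. c i * bar (\<otimes>) G (y i)) =
      (\<Sum>i<m. s i * (b4 (Suc i) + (-1) ^ i * b1 i)) - (\<Sum>i<m. (-1) ^ m * s i * t2 i) - (\<Sum>i<m. s i * t3 i)"
    by (simp add: sum.distrib algebra_simps)
  have "bar (\<otimes>) (rot_sum m f x) as = (\<Sum>i<m. s i * bar (\<otimes>) (\<lambda>as'. G (map nu' (drop i as') @ x # take i as')) as)"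
    unfolding bar_sum[symmetric] by (simp add: S[abs_def])
  also have "\<dots> = (\<Sum>i<m. s i * (b4 (Suc i) + (-1) ^ i * b1 i))"
    using las m by (intro sum.cong refl) (simp add: bar_split[of _ as _ "\<lambda>u v. G (map nu' v @ x # u)"] b1_def b4_def)
  finally have eq1: "(\<Sum>i\<le>m. c i * bar (\<otimes>) G (y i)) = bar (\<otimes>) (rot_sum m f x) as
      - (-1) ^ m * rot_sum m f (nu' (last as) \<otimes> x) (butlast as) - rot_sum m f (x \<otimes> hd as) (tl as)"
    unfolding lhs by (simp add: S t2_def t3_def sum_distrib_left mult.assoc)
  \<comment> \<open>by the cocycle condition the same sum telescopes\<close>
  define ph where "ph = (\<lambda>i. eps (hd (y i) \<otimes> f (tl (y i))))"
  have ps: "eps (f (butlast (y (Suc i))) \<otimes> last (y (Suc i))) = ph i" if "i < m" for i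
  proof -
    have i: "i < length as" using that las m by simp
    have y1: "y (Suc i) = (map nu' (drop (Suc i) as) @ x # take i as) @ [as ! i]"
      using i by (simp add: y_def take_Suc_conv_app_nth)
    have y2: "y i = nu' (as ! i) # (map nu' (drop (Suc i) as) @ x # take i as)"
      using i by (simp add: y_def Cons_nth_drop_Suc[symmetric])
    have "as ! i \<in> carrier A" using i sas by auto
    then show ?thesis
      unfolding ph_def y1 y2 using hc_in[OF f] eps_nu' by (simp add: butlast_append)
  qed
  have "(\<Sum>i\<le>m. c i * bar (\<otimes>) G (y i)) = (\<Sum>i\<le>m. c i * ph i) - (-1) ^ m * (\<Sum>i\<le>m. c i * eps (f (butlast (y i)) \<otimes> last (y i)))"
    unfolding sum_distrib_left sum_subtractf[symmetric] G_def
    by (rule sum.cong) (simp_all add: bar_eps_cocycle[OF f df y_in] ph_def algebra_simps)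
  also have "(\<Sum>i\<le>m. c i * eps (f (butlast (y i)) \<otimes> last (y i))) =
      eps (f (butlast (y 0)) \<otimes> last (y 0)) + (\<Sum>i<m. c (Suc i) * ph i)"
    unfolding lessThan_Suc_atMost[symmetric] sum.lessThan_Suc_shift by (simp add: ps c_def)
  also have "(\<Sum>i<m. c (Suc i) * ph i) = (-1) ^ m * (\<Sum>i<m. c i * ph i)"
    by (simp add: sum_distrib_left c_def power_add mult_ac)
  also have "(\<Sum>i\<le>m. c i * ph i) = c m * ph m + (\<Sum>i<m. c i * ph i)"
    unfolding lessThan_Suc_atMost[symmetric] sum.lessThan_Suc by simp
  finally have "(\<Sum>i\<le>m. c i * bar (\<otimes>) G (y i)) = c m * ph m - (-1) ^ m * eps (f (butlast (y 0)) \<otimes> last (y 0))"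
    by (simp add: algebra_simps flip: power_add mult.assoc)
  moreover have "c m = (-1) ^ m" by (simp add: c_def minus_one_power_iff)
  moreover have "ph m = eps (x \<otimes> f as)" using las m by (simp add: ph_def y_def)
  moreover have "eps (f (butlast (y 0)) \<otimes> last (y 0)) = eps (f (map nu' as) \<otimes> x)"
    by (simp add: y_def)
  ultimately show ?thesis using eq1 by (simp add: algebra_simps)
qed

text \<open>
  For fixed remaining arguments \<open>rot_sum\<close> is linear in \<open>x\<close>, hence of the form \<open>eps (x \<otimes> z)\<close>. The
  element \<open>z\<close>, as a function of the remaining arguments, is up to sign a cochain whose differential
  is the difference between \<open>f\<close> and its twist by the automorphism.
\<close>

theorem nakayama_trivial:
  assumes f: "f \<in> hcochains A (Suc k)" and df: "hdiff A (Suc k) f = 0"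
  shows "\<exists>g\<in>hcochains A k. \<forall>as\<in>hargs A (Suc k). hdiff A k g as = nu (f (map nu' as)) - f as"
proof -
  let ?m = "Suc k"
  note fm = hc_mlin[OF f]
  have "\<exists>z. z \<in> carrier A \<and> (\<forall>x\<in>carrier A. eps (x \<otimes> z) = rot_sum ?m f x as)"
    if "as \<in> hargs A k" for as
  proof -
    have "\<exists>z\<in>carrier A. \<forall>x\<in>carrier A. rot_sum ?m f x as = eps (x \<otimes> z)"
      using that by (intro eps_represents rot_sum_linear[OF fm]) (auto simp: hargs_def)
    then obtain z where "z \<in> carrier A" "\<forall>x\<in>carrier A. rot_sum ?m f x as = eps (x \<otimes> z)" by blast
    then show ?thesis by (intro exI[of _ z]) simp
  qed
  then obtain g0 where g0: "\<And>as. as \<in> hargs A k \<Longrightarrow> g0 as \<in> carrier A"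
      "\<And>as x. as \<in> hargs A k \<Longrightarrow> x \<in> carrier A \<Longrightarrow> eps (x \<otimes> g0 as) = rot_sum ?m f x as"
    by metis
  have g0m: "mlin A A k g0"
    unfolding mlin_def
  proof (intro conjI ballI allI impI)
    fix us vs a b assume *: "a \<in> carrier A" "us @ a # vs \<in> hargs A k" "b \<in> carrier A"
    then have **: "us @ b # vs \<in> hargs A k" "us @ (a + b) # vs \<in> hargs A k" by (auto simp: hargs_def)
    have "Suc (Suc (length us + length vs)) = ?m" "set us \<subseteq> carrier A" "set vs \<subseteq> carrier A"
      using * by (auto simp: hargs_def)
    note r = rot_sum_linear_args[OF fm _ this]
    show "g0 (us @ (a + b) # vs) = g0 (us @ a # vs) + g0 (us @ b # vs)"
      by (rule eps_eqI) (use * ** in \<open>simp_all add: g0 r_distrib eps_add r\<close>)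
  next
    fix us vs a c assume *: "a \<in> carrier A" "us @ a # vs \<in> hargs A k"
    then have **: "us @ scale A c a # vs \<in> hargs A k" by (auto simp: hargs_def)
    have "Suc (Suc (length us + length vs)) = ?m" "set us \<subseteq> carrier A" "set vs \<subseteq> carrier A"
      using * by (auto simp: hargs_def)
    note r = rot_sum_linear_args[OF fm _ this]
    show "g0 (us @ scale A c a # vs) = scale A c (g0 (us @ a # vs))"
      by (rule eps_eqI) (use * ** in \<open>simp_all add: g0 scale_r eps_scale r\<close>)
  qed (rule g0)
  define g where "g = (\<lambda>xs. if xs \<in> hargs A k then g0 xs else 0)"
  have gc: "g \<in> hcochains A k" unfolding g_def by (rule hc_mlinI[OF g0m])
  define h where "h = (\<lambda>xs. if xs \<in> hargs A k then (if odd k then g0 xs else - g0 xs) else 0)"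
  have hg: "h = (\<lambda>xs. scale A ((-1) ^ Suc k) (g xs))"
    by (rule ext) (simp add: h_def g_def)
  have hc: "h \<in> hcochains A k"
    unfolding h_def by (rule hc_mlinI) (use g0m mlin_neg[OF kalgebra_axioms kalgebra_axioms g0m] in \<open>cases "odd k"; simp\<close>)
  have dg: "eps (x \<otimes> hdiff A k g as) = (-1) ^ ?m * (eps (f (map nu' as) \<otimes> x) - eps (x \<otimes> f as))"
    if x: "x \<in> carrier A" and as: "as \<in> hargs A ?m" for x as
  proof -
    obtain a r where ar: "as = a # r" "a \<in> carrier A" "r \<in> hargs A k" using as by (auto simp: hargs_Suc_iff)
    define gx where "gx = (\<lambda>t. x \<otimes> g t)"
    have gxm: "mlin A A k gx" unfolding gx_def
      by (rule mlin_post[OF hc_mlin[OF gc]]) (use x in \<open>auto simp: r_distrib scale_r\<close>)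
    have gr: "reg.rd g as \<in> carrier A" using mlin_closed[OF reg.mlin_rd[OF hc_mlin[OF gc]] as] .
    have xr: "x \<otimes> reg.rd g as = reg.rd gx as"
      unfolding gx_def by (rule rd_lmult[OF hc_mlin[OF gc] x as])
    have bl: "butlast as \<in> hargs A k" "last as \<in> carrier A"
      using as last_in_set[of as] ar(1) unfolding hargs_def by (auto dest: in_set_butlastD)
    have gc2: "g (butlast as) \<in> carrier A" by (rule hc_in[OF gc])
    have "bar (\<otimes>) (\<lambda>t. eps (gx t)) as = bar (\<otimes>) (rot_sum ?m f x) as"
      by (rule bar_cong[where S = "carrier A"]) (use as x in \<open>auto simp: hargs_def gx_def g_def g0\<close>)
    then have p1: "eps (reg.rd gx as) = bar (\<otimes>) (rot_sum ?m f x) as + (-1) ^ k * eps (gx (butlast as) \<otimes> last as)"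
      using bar_eps[OF gxm as] by (simp only: diff_eq_eq)
    have p2: "eps (gx (butlast as) \<otimes> last as) = rot_sum ?m f (nu' (last as) \<otimes> x) (butlast as)"
    proof -
      have "eps (gx (butlast as) \<otimes> last as) = eps (nu' (last as) \<otimes> (x \<otimes> g (butlast as)))"
        unfolding gx_def using bl x gc2 by (intro eps_nu') auto
      also have "\<dots> = eps ((nu' (last as) \<otimes> x) \<otimes> g (butlast as))"
        using bl x gc2 by (simp add: m_assoc nu'_closed)
      finally show ?thesis using bl x by (simp add: g_def g0 nu'_closed)
    qed
    have p3: "eps (x \<otimes> (a \<otimes> g r)) = rot_sum ?m f (x \<otimes> hd as) (tl as)"
      using ar x by (simp add: g_def g0 flip: m_assoc)
    have p4: "hdiff A k g as = a \<otimes> g r - reg.rd g as"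
      using hdiff_rec[of a r k g] as by (simp add: ar)
    have "x \<otimes> hdiff A k g as = x \<otimes> (a \<otimes> g r) - reg.rd gx as"
      unfolding p4 xr[symmetric] by (rule r_diff_distrib) (use gr hc_in[OF gc] x ar(2) in auto)
    moreover have "reg.rd gx as \<in> carrier A" by (rule mlin_closed[OF reg.mlin_rd[OF gxm] as])
    ultimately have "eps (x \<otimes> hdiff A k g as) = eps (x \<otimes> (a \<otimes> g r)) - eps (reg.rd gx as)"
      using hc_in[OF gc] x ar(2) by (simp only: eps_diff m_closed)
    then have "eps (x \<otimes> hdiff A k g as) = rot_sum ?m f (x \<otimes> hd as) (tl as) - bar (\<otimes>) (rot_sum ?m f x) as
      + (-1) ^ ?m * rot_sum ?m f (nu' (last as) \<otimes> x) (butlast as)"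
      unfolding p1 p2 p3 by (simp only: power_Suc diff_diff_eq[symmetric] mult_minus1 mult_minus_left add_uminus_conv_diff mult_1_left)
    then show ?thesis using rot_sum_cocycle[OF f df refl x as] by simp
  qed
  have "hdiff A k h as = nu (f (map nu' as)) - f as" if as: "as \<in> hargs A ?m" for as
  proof (rule eps_eqI)
    have "map nu' as \<in> hargs A ?m" by (rule map_hargs[OF nu'_closed as])
    then show 1: "nu (f (map nu' as)) - f as \<in> carrier A" "hdiff A k h as \<in> carrier A"
      using hc_in[OF f] hc_in[OF hdiff_closed[OF hc]] nu_closed by auto
    have hd: "hdiff A k h as = scale A ((-1) ^ Suc k) (hdiff A k g as)"
    proof -
      obtain a r where ar: "as = a # r" "a \<in> carrier A" "r \<in> hargs A k" using as by (auto simp: hargs_Suc_iff)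
      show ?thesis unfolding hg ar
        using ar hc_in[OF gc] reg.rd_scale[OF hc_mlin[OF gc] as, of "(-1) ^ Suc k"]
        by (simp add: hdiff_rec scale_r mult_neg_r ar vs.scale_right_diff_distrib)
    qed
    fix x assume x: "x \<in> carrier A"
    have xg: "x \<otimes> hdiff A k g as \<in> carrier A" using x hc_in[OF hdiff_closed[OF gc]] by simp
    have "eps (x \<otimes> hdiff A k h as) = (-1) ^ Suc k * eps (x \<otimes> hdiff A k g as)"
      unfolding hd using x hc_in[OF hdiff_closed[OF gc]] xg by (simp only: scale_r eps_scale)
    also have "\<dots> = ((-1) ^ ?m * (-1) ^ ?m) * (eps (f (map nu' as) \<otimes> x) - eps (x \<otimes> f as))"
      unfolding dg[OF x as] by (simp only: mult.assoc)
    also have "((-1) ^ ?m * (-1) ^ ?m :: 'k) = 1" by (simp flip: power_mult_distrib)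
    finally show "eps (x \<otimes> hdiff A k h as) = eps (x \<otimes> (nu (f (map nu' as)) - f as))"
      using x hc_in[OF f] eps_nu[of "f (map nu' as)" x] by (simp add: r_diff_distrib eps_diff nu_closed)
  qed
  then show ?thesis using hc by blast
qed

lemma nakayama_trivial_0:
  assumes f: "f \<in> hcochains A 0" and df: "hdiff A 0 f = 0"
  shows "nu (f []) = f []"
proof (rule eps_eqI)
  note c = hc_in[OF f, of "[]"]
  show "f [] \<in> carrier A" "nu (f []) \<in> carrier A" using c by (auto simp: nu_closed)
  fix x assume x: "x \<in> carrier A"
  have "hdiff A 0 f [x] = 0" using df by simp
  then have "x \<otimes> f [] = f [] \<otimes> x" using hdiff_rec[of x "[]" 0 f] x by simp
  then show "eps (x \<otimes> nu (f [])) = eps (x \<otimes> f [])" using eps_nu[OF c x] by simp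
qed

end

section \<open>Cochains on an algebra with a complete set of idempotents\<close>

text \<open>
  Elements of \<open>L\<close> are matrices over \<open>T\<close> with rows and columns indexed by \<open>I\<close>: the idempotents \<open>e\<close>
  are the diagonal units, \<open>ent\<close> gives the entries, and \<open>j\<close> embeds \<open>T\<close> as scalar matrices. The
  entries of a product are those of the matrix product, but not every matrix has to occur.
\<close>

locale matrix_cover = T: kalgebra T + L: kalgebra L
  for T :: "('k::field, 't::ab_group_add, 'y) kalg_scheme"
    and L :: "('k, 'l::ab_group_add, 'z) kalg_scheme" +
  fixes I :: "'i set" and e :: "'i \<Rightarrow> 'l" and j :: "'t \<Rightarrow> 'l" and ent :: "'l \<Rightarrow> 'i \<Rightarrow> 'i \<Rightarrow> 't"
  assumes e_closed: "i \<in> I \<Longrightarrow> e i \<in> carrier L"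
    and e_idem: "i \<in> I \<Longrightarrow> e i \<otimes>\<^bsub>L\<^esub> e i = e i"
    and e_sum: "(\<Sum>i\<in>I. e i) = \<one>\<^bsub>L\<^esub>"
    and j_closed: "a \<in> carrier T \<Longrightarrow> j a \<in> carrier L"
    and j_add: "a \<in> carrier T \<Longrightarrow> b \<in> carrier T \<Longrightarrow> j (a + b) = j a + j b"
    and j_scale: "a \<in> carrier T \<Longrightarrow> j (scale T c a) = scale L c (j a)"
    and j_mult: "a \<in> carrier T \<Longrightarrow> b \<in> carrier T \<Longrightarrow> j (a \<otimes>\<^bsub>T\<^esub> b) = j a \<otimes>\<^bsub>L\<^esub> j b"
    and ent_closed: "x \<in> carrier L \<Longrightarrow> i \<in> I \<Longrightarrow> k \<in> I \<Longrightarrow> ent x i k \<in> carrier T"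
    and ent_add: "x \<in> carrier L \<Longrightarrow> y \<in> carrier L \<Longrightarrow> i \<in> I \<Longrightarrow> k \<in> I \<Longrightarrow>
      ent (x + y) i k = ent x i k + ent y i k"
    and ent_scale: "x \<in> carrier L \<Longrightarrow> i \<in> I \<Longrightarrow> k \<in> I \<Longrightarrow> ent (scale L c x) i k = scale T c (ent x i k)"
    and ent_mult: "x \<in> carrier L \<Longrightarrow> y \<in> carrier L \<Longrightarrow> i \<in> I \<Longrightarrow> l \<in> I \<Longrightarrow>
      ent (x \<otimes>\<^bsub>L\<^esub> y) i l = (\<Sum>k\<in>I. ent x i k \<otimes>\<^bsub>T\<^esub> ent y k l)"
    and ent_row: "x \<in> carrier L \<Longrightarrow> i \<in> I \<Longrightarrow> e i \<otimes>\<^bsub>L\<^esub> x = (\<Sum>k\<in>I. j (ent x i k) \<otimes>\<^bsub>L\<^esub> e k)"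
    and ent_col: "x \<in> carrier L \<Longrightarrow> k \<in> I \<Longrightarrow> x \<otimes>\<^bsub>L\<^esub> e k = (\<Sum>i\<in>I. e i \<otimes>\<^bsub>L\<^esub> j (ent x i k))"
begin

sublocale act: right_action T L "\<lambda>v a. v \<otimes>\<^bsub>L\<^esub> j a"
  by unfold_locales
    (auto simp: j_closed j_add j_scale j_mult L.l_distrib L.r_distrib L.scale_l L.scale_r L.m_assoc)

text \<open>
  The extension of a cochain from \<open>T\<close> to \<open>L\<close>: as in a product of matrices, one sums over all
  paths of indices that start at \<open>i\<close>, and on each path \<open>G\<close> is evaluated at the entries met.
\<close>

fun path :: "('t list \<Rightarrow> 'l) \<Rightarrow> 'i \<Rightarrow> 'l list \<Rightarrow> 'l" where
  "path G i [] = G [] \<otimes>\<^bsub>L\<^esub> e i"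
| "path G i (x # xs) = (\<Sum>k\<in>I. path (\<lambda>as. G (ent x i k # as)) k xs)"

definition paths :: "('t list \<Rightarrow> 'l) \<Rightarrow> 'l list \<Rightarrow> 'l" where
  "paths G xs = (\<Sum>i\<in>I. e i \<otimes>\<^bsub>L\<^esub> path G i xs)"

lemma map_j: "as \<in> hargs T m \<Longrightarrow> map j as \<in> hargs L m"
  by (rule map_hargs) (auto simp: j_closed)

lemma mlin_jpre: "mlin L L m F \<Longrightarrow> mlin T L m (\<lambda>as. F (map j as))"
  by (rule mlin_pre) (auto simp: j_closed j_add j_scale)

lemma path_cong:
  assumes "\<And>as. as \<in> hargs T m \<Longrightarrow> G as = G' as" "xs \<in> hargs L m" "i \<in> I"
  shows "path G i xs = path G' i xs"
  using assms
proof (induction m arbitrary: G G' i xs)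
  case (Suc m)
  from Suc.prems(2) obtain x r where xs: "xs = x # r" "x \<in> carrier L" "r \<in> hargs L m"
    by (auto simp: hargs_Suc_iff)
  have "path (\<lambda>as. G (ent x i k # as)) k r = path (\<lambda>as. G' (ent x i k # as)) k r" if "k \<in> I" for k
    by (rule Suc.IH) (use that xs Suc.prems ent_closed in auto)
  then show ?case by (simp add: xs)
qed auto

lemma path_add:
  assumes "mlin T L m G" "mlin T L m G'" "xs \<in> hargs L m" "i \<in> I"
  shows "path (\<lambda>as. G as + G' as) i xs = path G i xs + path G' i xs"
  using assms
proof (induction m arbitrary: G G' i xs)
  case 0
  then show ?case by (simp add: mlin_0 L.l_distrib e_closed)
next
  case (Suc m)
  from Suc.prems(3) obtain x r where xs: "xs = x # r" "x \<in> carrier L" "r \<in> hargs L m"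
    by (auto simp: hargs_Suc_iff)
  have "path (\<lambda>as. G (ent x i k # as) + G' (ent x i k # as)) k r =
     path (\<lambda>as. G (ent x i k # as)) k r + path (\<lambda>as. G' (ent x i k # as)) k r" if "k \<in> I" for k
    by (rule Suc.IH) (use that xs Suc.prems ent_closed in \<open>auto intro: mlin_tail\<close>)
  then show ?case by (simp add: xs sum.distrib)
qed

lemma path_scale:
  assumes "mlin T L m G" "xs \<in> hargs L m" "i \<in> I"
  shows "path (\<lambda>as. scale L c (G as)) i xs = scale L c (path G i xs)"
  using assms
proof (induction m arbitrary: G i xs)
  case 0
  then show ?case by (simp add: mlin_0 L.scale_l e_closed)
next
  case (Suc m)
  from Suc.prems(2) obtain x r where xs: "xs = x # r" "x \<in> carrier L" "r \<in> hargs L m"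
    by (auto simp: hargs_Suc_iff)
  have "path (\<lambda>as. scale L c (G (ent x i k # as))) k r = scale L c (path (\<lambda>as. G (ent x i k # as)) k r)"
    if "k \<in> I" for k
    by (rule Suc.IH) (use that xs Suc.prems ent_closed in \<open>auto intro: mlin_tail\<close>)
  then show ?case by (simp add: xs L.vs.scale_sum_right)
qed

lemma mlin_lmult: "mlin A L m G \<Longrightarrow> l \<in> carrier L \<Longrightarrow> mlin A L m (\<lambda>as. l \<otimes>\<^bsub>L\<^esub> G as)"
  by (erule mlin_post) (auto simp: L.r_distrib L.scale_r)

lemma path_neg:
  assumes "mlin T L m G" "xs \<in> hargs L m" "i \<in> I"
  shows "path (\<lambda>as. - G as) i xs = - path G i xs"
  using path_scale[OF assms, of "-1"] by simp

lemma path_diff: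
  assumes "mlin T L m G" "mlin T L m G'" "xs \<in> hargs L m" "i \<in> I"
  shows "path (\<lambda>as. G as - G' as) i xs = path G i xs - path G' i xs"
  using path_add[OF assms(1) mlin_neg[OF T.kalgebra_axioms L.kalgebra_axioms assms(2)] assms(3,4)]
    path_neg[OF assms(2-)] by simp

lemma path_zero: "xs \<in> hargs L m \<Longrightarrow> i \<in> I \<Longrightarrow> path (\<lambda>as. 0) i xs = 0"
  using path_scale[OF mlin_zero[OF T.kalgebra_axioms L.kalgebra_axioms], of xs m i 0] by simp

lemma path_sum:
  assumes "\<And>q. q \<in> Q \<Longrightarrow> mlin T L m (G q)" "xs \<in> hargs L m" "i \<in> I"
  shows "path (\<lambda>as. \<Sum>q\<in>Q. G q as) i xs = (\<Sum>q\<in>Q. path (G q) i xs)"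
  using assms
proof (induction Q rule: infinite_finite_induct)
  case (insert q Q)
  have "mlin T L m (\<lambda>t. \<Sum>q\<in>Q. G q t)"
    by (rule mlin_sum[OF T.kalgebra_axioms L.kalgebra_axioms]) (use insert.prems in auto)
  then show ?case using insert path_add[of m "G q" "\<lambda>t. \<Sum>q\<in>Q. G q t" xs] by simp
qed (auto simp: path_zero)

lemma mlin_path:
  assumes "mlin T L m G" "i \<in> I"
  shows "mlin L L m (path G i)"
  using assms
proof (induction m arbitrary: G i)
  case 0
  then show ?case by (simp add: mlin_0 e_closed)
next
  case (Suc m)
  have 1: "mlin T L m (\<lambda>as. G (ent x i k # as))" if "x \<in> carrier L" "k \<in> I" for x k
    using Suc.prems that ent_closed by (auto intro: mlin_tail)
  have "mlin L L m (\<lambda>r. path G i (x # r))" if "x \<in> carrier L" for x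
    unfolding path.simps
    by (rule mlin_sum[OF L.kalgebra_axioms L.kalgebra_axioms]) (use that 1 Suc.IH in auto)
  moreover have "path G i ((x + y) # r) = path G i (x # r) + path G i (y # r)"
    if "x \<in> carrier L" "y \<in> carrier L" "r \<in> hargs L m" for x y r
  proof -
    have "path (\<lambda>as. G (ent (x + y) i k # as)) k r =
        path (\<lambda>as. G (ent x i k # as) + G (ent y i k # as)) k r" if k: "k \<in> I" for k
      by (rule path_cong[of m])
        (use that \<open>x \<in> carrier L\<close> \<open>y \<in> carrier L\<close> \<open>r \<in> hargs L m\<close> Suc.prems in \<open>auto simp: ent_add ent_closed mlin_add_hd\<close>)
    then have "path (\<lambda>as. G (ent (x + y) i k # as)) k r =
        path (\<lambda>as. G (ent x i k # as)) k r + path (\<lambda>as. G (ent y i k # as)) k r" if k: "k \<in> I" for k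
      using that path_add[OF 1 1 \<open>r \<in> hargs L m\<close>] \<open>x \<in> carrier L\<close> \<open>y \<in> carrier L\<close> by simp
    then show ?thesis by (simp add: sum.distrib)
  qed
  moreover have "path G i (scale L c x # r) = scale L c (path G i (x # r))"
    if "x \<in> carrier L" "r \<in> hargs L m" for x c r
  proof -
    have "path (\<lambda>as. G (ent (scale L c x) i k # as)) k r =
        path (\<lambda>as. scale L c (G (ent x i k # as))) k r" if k: "k \<in> I" for k
      by (rule path_cong[of m])
        (use that \<open>x \<in> carrier L\<close> \<open>r \<in> hargs L m\<close> Suc.prems in \<open>auto simp: ent_scale ent_closed mlin_scale_hd\<close>)
    then have "path (\<lambda>as. G (ent (scale L c x) i k # as)) k r =
        scale L c (path (\<lambda>as. G (ent x i k # as)) k r)" if k: "k \<in> I" for k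
      using that path_scale[OF 1 \<open>r \<in> hargs L m\<close>] \<open>x \<in> carrier L\<close> by simp
    then show ?thesis by (simp add: L.vs.scale_sum_right)
  qed
  ultimately show ?case unfolding mlin_Suc[of L L m "path G i"] by blast
qed

lemma path_closed: "mlin T L m G \<Longrightarrow> i \<in> I \<Longrightarrow> xs \<in> hargs L m \<Longrightarrow> path G i xs \<in> carrier L"
  by (rule mlin_closed[OF mlin_path])

lemma path_lmult:
  assumes "mlin T L m G" "l \<in> carrier L" "xs \<in> hargs L m" "i \<in> I"
  shows "path (\<lambda>as. l \<otimes>\<^bsub>L\<^esub> G as) i xs = l \<otimes>\<^bsub>L\<^esub> path G i xs"
  using assms
proof (induction m arbitrary: G i xs)
  case 0
  then show ?case by (simp add: mlin_0 L.m_assoc e_closed)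
next
  case (Suc m)
  from Suc.prems(3) obtain x r where xs: "xs = x # r" "x \<in> carrier L" "r \<in> hargs L m"
    by (auto simp: hargs_Suc_iff)
  have t: "mlin T L m (\<lambda>as. G (ent x i k # as))" if "k \<in> I" for k
    using Suc.prems xs ent_closed that by (auto intro: mlin_tail)
  have "path (\<lambda>as. l \<otimes>\<^bsub>L\<^esub> G (ent x i k # as)) k r = l \<otimes>\<^bsub>L\<^esub> path (\<lambda>as. G (ent x i k # as)) k r"
    if "k \<in> I" for k
    by (rule Suc.IH[OF t]) (use that xs Suc.prems in auto)
  moreover have "path (\<lambda>as. G (ent x i k # as)) k r \<in> carrier L" if "k \<in> I" for k
    by (rule path_closed[OF t]) (use that xs in auto)
  ultimately show ?case using xs Suc.prems(2) by (simp add: L.sum_mult_r)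
qed

lemma path_rd:
  assumes "mlin T L m G" "xs \<in> hargs L (Suc m)" "i \<in> I"
  shows "path (act.rd G) i xs = L.reg.rd (path G i) xs"
  using assms
proof (induction m arbitrary: G i xs)
  case 0
  then obtain x where xs: "xs = [x]" "x \<in> carrier L" by (auto simp: hargs_Suc_iff)
  have G: "G [] \<in> carrier L" using 0 by (simp add: mlin_0)
  have "path (act.rd G) i xs = (\<Sum>k\<in>I. G [] \<otimes>\<^bsub>L\<^esub> (j (ent x i k) \<otimes>\<^bsub>L\<^esub> e k))"
    using xs G 0 by (simp add: L.m_assoc j_closed ent_closed e_closed)
  also have "\<dots> = G [] \<otimes>\<^bsub>L\<^esub> (e i \<otimes>\<^bsub>L\<^esub> x)"
    unfolding ent_row[OF xs(2) 0(3)] using G xs 0(3)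
    by (subst L.sum_mult_r) (auto simp: j_closed ent_closed e_closed)
  finally show ?case using G xs 0(3) by (simp add: L.m_assoc e_closed)
next
  case (Suc m)
  from Suc.prems(2) obtain x y r where xs: "xs = x # y # r" "x \<in> carrier L" "y \<in> carrier L" "r \<in> hargs L m"
    by (auto simp: hargs_Suc_iff)
  note i = \<open>i \<in> I\<close>
  have t: "mlin T L m (\<lambda>as. G (a # as))" if "a \<in> carrier T" for a
    using Suc.prems that by (auto intro: mlin_tail)
  have ex: "ent x i k \<in> carrier T" if "k \<in> I" for k using xs i that ent_closed by auto
  have ey: "ent y k l \<in> carrier T" if "k \<in> I" "l \<in> I" for k l using xs that ent_closed by auto
  have exy: "ent x i k \<otimes>\<^bsub>T\<^esub> ent y k l \<in> carrier T" if "k \<in> I" "l \<in> I" for k l using that ex ey by auto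
  have 1: "path (\<lambda>as. G (ent x i k \<otimes>\<^bsub>T\<^esub> hd as # tl as) - act.rd (\<lambda>t. G (ent x i k # t)) as) k (y # r) =
      (\<Sum>l\<in>I. path (\<lambda>as. G (ent x i k \<otimes>\<^bsub>T\<^esub> ent y k l # as)) l r) - path (act.rd (\<lambda>t. G (ent x i k # t))) k (y # r)"
    (is "?l = ?r") if k: "k \<in> I" for k
  proof -
    have "?l = (\<Sum>l\<in>I. path (\<lambda>as. G (ent x i k \<otimes>\<^bsub>T\<^esub> ent y k l # as) - act.rd (\<lambda>t. G (ent x i k # t)) (ent y k l # as)) l r)"
      by simp
    also have "\<dots> = (\<Sum>l\<in>I. path (\<lambda>as. G (ent x i k \<otimes>\<^bsub>T\<^esub> ent y k l # as)) l r
        - path (\<lambda>as. act.rd (\<lambda>t. G (ent x i k # t)) (ent y k l # as)) l r)"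
      by (intro sum.cong refl path_diff[of m])
        (use k xs ex ey exy in \<open>auto intro!: t mlin_tail[OF act.mlin_rd]\<close>)
    also have "\<dots> = ?r" by (simp add: sum_subtractf)
    finally show ?thesis .
  qed
  have "path (act.rd G) i xs = (\<Sum>k\<in>I. path (\<lambda>as. act.rd G (ent x i k # as)) k (y # r))"
    by (simp add: xs)
  also have "\<dots> = (\<Sum>k\<in>I. path (\<lambda>as. G (ent x i k \<otimes>\<^bsub>T\<^esub> hd as # tl as) - act.rd (\<lambda>t. G (ent x i k # t)) as) k (y # r))"
    by (intro sum.cong refl path_cong[of "Suc m"]) (use xs in \<open>auto simp: hargs_Suc_iff\<close>)
  also have "\<dots> = (\<Sum>k\<in>I. (\<Sum>l\<in>I. path (\<lambda>as. G (ent x i k \<otimes>\<^bsub>T\<^esub> ent y k l # as)) l r)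
      - L.reg.rd (path (\<lambda>t. G (ent x i k # t)) k) (y # r))"
    by (intro sum.cong refl) (use xs ex t in \<open>simp add: 1 Suc.IH del: path.simps(2)\<close>)
  also have "\<dots> = (\<Sum>l\<in>I. \<Sum>k\<in>I. path (\<lambda>as. G (ent x i k \<otimes>\<^bsub>T\<^esub> ent y k l # as)) l r)
      - (\<Sum>k\<in>I. L.reg.rd (path (\<lambda>t. G (ent x i k # t)) k) (y # r))"
    unfolding sum_subtractf by (subst sum.swap) simp
  also have "(\<Sum>l\<in>I. \<Sum>k\<in>I. path (\<lambda>as. G (ent x i k \<otimes>\<^bsub>T\<^esub> ent y k l # as)) l r) = path G i (x \<otimes>\<^bsub>L\<^esub> y # r)"
  proof -
    have "(\<Sum>k\<in>I. path (\<lambda>as. G (ent x i k \<otimes>\<^bsub>T\<^esub> ent y k l # as)) l r) =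
        path (\<lambda>as. \<Sum>k\<in>I. G (ent x i k \<otimes>\<^bsub>T\<^esub> ent y k l # as)) l r" if l: "l \<in> I" for l
      by (rule path_sum[symmetric, of _ m]) (use l xs exy t in auto)
    also have "\<dots> l = path (\<lambda>as. G (ent (x \<otimes>\<^bsub>L\<^esub> y) i l # as)) l r" if l: "l \<in> I" for l
    proof (rule path_cong[of m])
      fix as assume as: "as \<in> hargs T m"
      have "G ((\<Sum>k\<in>K. h k) # as) = (\<Sum>k\<in>K. G (h k # as))"
        if "\<And>k. k \<in> K \<Longrightarrow> h k \<in> carrier T" for K :: "'i set" and h
        using that
      proof (induction K rule: infinite_finite_induct)
        case (insert k K)
        have "(\<Sum>k\<in>K. h k) \<in> carrier T" by (rule T.sum_closed) (use insert in auto)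
        then show ?case using insert as Suc.prems(1) by (simp add: mlin_add_hd)
      qed (use mlin_scale_hd[OF Suc.prems(1) T.zero_closed as, of 0] in auto)
      then show "(\<Sum>k\<in>I. G (ent x i k \<otimes>\<^bsub>T\<^esub> ent y k l # as)) = G (ent (x \<otimes>\<^bsub>L\<^esub> y) i l # as)"
        unfolding ent_mult[OF xs(2,3) i l] using exy l by simp
    qed (use l xs in auto)
    finally show ?thesis by simp
  qed
  also have "(\<Sum>k\<in>I. L.reg.rd (path (\<lambda>t. G (ent x i k # t)) k) (y # r)) =
      L.reg.rd (\<lambda>s. path G i (x # s)) (y # r)"
    unfolding path.simps
    by (rule L.reg.rd_sum[symmetric, of _ m]) (use xs ex t in \<open>auto intro: mlin_path\<close>)
  finally show ?case by (simp add: xs)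
qed

lemma mlin_paths:
  assumes "mlin T L m G"
  shows "mlin L L m (paths G)"
  unfolding paths_def
  by (rule mlin_sum[OF L.kalgebra_axioms L.kalgebra_axioms])
    (use assms e_closed in \<open>auto intro: mlin_lmult mlin_path\<close>)

lemma paths_cong:
  assumes "\<And>as. as \<in> hargs T m \<Longrightarrow> G as = G' as" "xs \<in> hargs L m"
  shows "paths G xs = paths G' xs"
  using path_cong[OF assms] by (simp add: paths_def)

lemma path_left:
  assumes G: "mlin T L m G" and xs: "x \<in> carrier L" "r \<in> hargs L m"
  shows "(\<Sum>i\<in>I. e i \<otimes>\<^bsub>L\<^esub> path (\<lambda>as. j (hd as) \<otimes>\<^bsub>L\<^esub> G (tl as)) i (x # r)) = x \<otimes>\<^bsub>L\<^esub> paths G r"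
proof -
  have p: "path G k r \<in> carrier L" if "k \<in> I" for k by (rule path_closed[OF G that xs(2)])
  have c: "j (ent x i k) \<in> carrier L" if "k \<in> I" "i \<in> I" for i k using that xs by (auto intro: j_closed ent_closed)
  have "(\<Sum>i\<in>I. e i \<otimes>\<^bsub>L\<^esub> path (\<lambda>as. j (hd as) \<otimes>\<^bsub>L\<^esub> G (tl as)) i (x # r)) =
     (\<Sum>i\<in>I. \<Sum>k\<in>I. e i \<otimes>\<^bsub>L\<^esub> j (ent x i k) \<otimes>\<^bsub>L\<^esub> path G k r)"
    using G xs p c by (simp add: path_lmult[of m] L.sum_mult_r e_closed L.m_assoc)
  also have "\<dots> = (\<Sum>k\<in>I. x \<otimes>\<^bsub>L\<^esub> e k \<otimes>\<^bsub>L\<^esub> path G k r)"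
    by (subst sum.swap, rule sum.cong[OF refl])
      (use xs p c in \<open>simp add: ent_col L.sum_mult_l e_closed\<close>)
  also have "\<dots> = x \<otimes>\<^bsub>L\<^esub> paths G r"
    unfolding paths_def using xs p by (simp add: L.sum_mult_r e_closed L.m_assoc)
  finally show ?thesis .
qed

text \<open>
  The Hochschild differential of \<open>T\<close> with coefficients in the bimodule \<open>L\<close>.
\<close>

definition tdiff :: "('t list \<Rightarrow> 'l) \<Rightarrow> 't list \<Rightarrow> 'l" where
  "tdiff G as = j (hd as) \<otimes>\<^bsub>L\<^esub> G (tl as) - act.rd G as"

text \<open>
  Extension commutes with differentials: the entries of a product of two arguments are sums over
  the intermediate index, which is precisely one more step of the path.
\<close>

lemma paths_tdiff:
  assumes G: "mlin T L m G" and xs: "xs \<in> hargs L (Suc m)"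
  shows "paths (tdiff G) xs = hd xs \<otimes>\<^bsub>L\<^esub> paths G (tl xs) - L.reg.rd (paths G) xs"
proof -
  from xs obtain x r where x: "xs = x # r" "x \<in> carrier L" "r \<in> hargs L m" by (auto simp: hargs_Suc_iff)
  have 1: "mlin T L (Suc m) (\<lambda>as. j (hd as) \<otimes>\<^bsub>L\<^esub> G (tl as))"
    using G by (auto simp: mlin_Suc j_closed j_add j_scale L.l_distrib L.scale_l mlin_closed intro: mlin_lmult)
  have c1: "path (\<lambda>as. j (hd as) \<otimes>\<^bsub>L\<^esub> G (tl as)) i xs \<in> carrier L" if "i \<in> I" for i
    by (rule path_closed[OF 1 that xs])
  have c2: "path (act.rd G) i xs \<in> carrier L" if "i \<in> I" for i
    by (rule path_closed[OF act.mlin_rd[OF G] that xs])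
  have "paths (tdiff G) xs = (\<Sum>i\<in>I. e i \<otimes>\<^bsub>L\<^esub> path (\<lambda>as. j (hd as) \<otimes>\<^bsub>L\<^esub> G (tl as)) i xs)
       - (\<Sum>i\<in>I. e i \<otimes>\<^bsub>L\<^esub> L.reg.rd (path G i) xs)"
    unfolding paths_def tdiff_def[abs_def] sum_subtractf[symmetric]
    using c1 c2 by (intro sum.cong refl)
      (simp add: path_diff[OF 1 act.mlin_rd[OF G] xs] L.r_diff_distrib e_closed flip: path_rd[OF G xs])
  also have "(\<Sum>i\<in>I. e i \<otimes>\<^bsub>L\<^esub> L.reg.rd (path G i) xs) = (\<Sum>i\<in>I. L.reg.rd (\<lambda>s. e i \<otimes>\<^bsub>L\<^esub> path G i s) xs)"
  proof (rule sum.cong[OF refl])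
    fix i assume i: "i \<in> I"
    show "e i \<otimes>\<^bsub>L\<^esub> L.reg.rd (path G i) xs = L.reg.rd (\<lambda>s. e i \<otimes>\<^bsub>L\<^esub> path G i s) xs"
      using L.rd_lmult[OF mlin_path[OF G i] e_closed[OF i] xs] by simp
  qed
  also have "\<dots> = L.reg.rd (paths G) xs"
    unfolding paths_def[abs_def]
    by (rule L.reg.rd_sum[symmetric, OF _ xs]) (use G in \<open>auto intro: mlin_lmult mlin_path e_closed\<close>)
  finally show ?thesis using path_left[OF G x(2,3)] by (simp add: x)
qed

section \<open>The prism homotopy\<close>

text \<open>
  A prism operator: an idempotent is inserted at each position, and the arguments behind it are
  replaced by their matrix entries. The two ends of the prism are the identity and restriction to
  scalar matrices followed by extension.
\<close>

fun prism :: "('l list \<Rightarrow> 'l) \<Rightarrow> 'l list \<Rightarrow> 'l" where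
  "prism F [] = (\<Sum>i\<in>I. F [e i] \<otimes>\<^bsub>L\<^esub> e i)"
| "prism F (x # r) = (\<Sum>i\<in>I. path (\<lambda>as. F (e i # map j as)) i (x # r)) - prism (\<lambda>ys. F (x # ys)) r"

lemma prism_cong:
  assumes "\<And>ys. ys \<in> hargs L (Suc m) \<Longrightarrow> F ys = F' ys" "xs \<in> hargs L m"
  shows "prism F xs = prism F' xs"
  using assms
proof (induction m arbitrary: F F' xs)
  case 0
  then show ?case by (simp add: e_closed)
next
  case (Suc m)
  from Suc.prems(2) obtain x r where xs: "xs = x # r" "x \<in> carrier L" "r \<in> hargs L m"
    by (auto simp: hargs_Suc_iff)
  have "prism (\<lambda>ys. F (x # ys)) r = prism (\<lambda>ys. F' (x # ys)) r"
    by (rule Suc.IH) (use xs Suc.prems in auto)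
  moreover have "path (\<lambda>as. F (e i # map j as)) i xs = path (\<lambda>as. F' (e i # map j as)) i xs" if "i \<in> I" for i
    by (rule path_cong[of "Suc m"]) (use that Suc.prems e_closed in \<open>auto simp: map_j\<close>)
  ultimately show ?case by (simp add: xs)
qed

lemma mlin_ins: "mlin L L (Suc m) F \<Longrightarrow> l \<in> carrier L \<Longrightarrow> mlin T L m (\<lambda>as. F (l # map j as))"
  using mlin_jpre[OF mlin_tail] by blast

lemma prism_add:
  assumes "mlin L L (Suc m) F" "mlin L L (Suc m) F'" "xs \<in> hargs L m"
  shows "prism (\<lambda>ys. F ys + F' ys) xs = prism F xs + prism F' xs"
  using assms
proof (induction m arbitrary: F F' xs)
  case 0
  then show ?case by (simp add: e_closed sum.distrib mlin_closed L.l_distrib)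
next
  case (Suc m)
  from Suc.prems(3) obtain x r where xs: "xs = x # r" "x \<in> carrier L" "r \<in> hargs L m"
    by (auto simp: hargs_Suc_iff)
  have 1: "prism (\<lambda>ys. F (x # ys) + F' (x # ys)) r = prism (\<lambda>ys. F (x # ys)) r + prism (\<lambda>ys. F' (x # ys)) r"
    by (rule Suc.IH) (use xs Suc.prems in \<open>auto intro: mlin_tail\<close>)
  have "path (\<lambda>as. F (e i # map j as) + F' (e i # map j as)) i xs =
     path (\<lambda>as. F (e i # map j as)) i xs + path (\<lambda>as. F' (e i # map j as)) i xs" if "i \<in> I" for i
    by (rule path_add[of "Suc m"]) (use that Suc.prems e_closed in \<open>auto intro!: mlin_ins\<close>)
  with 1 show ?case by (simp add: xs sum.distrib del: path.simps)
qed

lemma prism_scale: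
  assumes "mlin L L (Suc m) F" "xs \<in> hargs L m"
  shows "prism (\<lambda>ys. scale L c (F ys)) xs = scale L c (prism F xs)"
  using assms
proof (induction m arbitrary: F xs)
  case 0
  then show ?case by (simp add: e_closed L.vs.scale_sum_right mlin_closed L.scale_l)
next
  case (Suc m)
  from Suc.prems(2) obtain x r where xs: "xs = x # r" "x \<in> carrier L" "r \<in> hargs L m"
    by (auto simp: hargs_Suc_iff)
  have 1: "prism (\<lambda>ys. scale L c (F (x # ys))) r = scale L c (prism (\<lambda>ys. F (x # ys)) r)"
    by (rule Suc.IH) (use xs Suc.prems in \<open>auto intro: mlin_tail\<close>)
  have "path (\<lambda>as. scale L c (F (e i # map j as))) i xs =
     scale L c (path (\<lambda>as. F (e i # map j as)) i xs)" if "i \<in> I" for i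
    by (rule path_scale[of "Suc m"]) (use that Suc.prems e_closed in \<open>auto intro!: mlin_ins\<close>)
  with 1 show ?case
    by (simp add: xs L.vs.scale_sum_right L.vs.scale_right_diff_distrib del: path.simps)
qed

lemma prism_diff:
  assumes "mlin L L (Suc m) F" "mlin L L (Suc m) F'" "xs \<in> hargs L m"
  shows "prism (\<lambda>ys. F ys - F' ys) xs = prism F xs - prism F' xs"
  using prism_add[OF assms(1) mlin_scale[OF L.kalgebra_axioms L.kalgebra_axioms assms(2), of "-1"] assms(3)]
    prism_scale[OF assms(2,3), of "-1"] by simp

lemma mlin_prism:
  assumes "mlin L L (Suc m) F"
  shows "mlin L L m (prism F)"
  using assms
proof (induction m arbitrary: F)
  case 0
  then show ?case by (auto simp: mlin_0 e_closed mlin_closed intro!: L.sum_closed)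
next
  case (Suc m)
  note k = L.kalgebra_axioms L.kalgebra_axioms
  have m1: "mlin L L (Suc m) (\<lambda>xs. \<Sum>i\<in>I. path (\<lambda>as. F (e i # map j as)) i xs)"
    by (rule mlin_sum[OF k]) (use Suc.prems e_closed in \<open>auto intro!: mlin_path mlin_ins\<close>)
  have "mlin L L m (\<lambda>r. prism F (x # r))" if "x \<in> carrier L" for x
    unfolding prism.simps
    by (rule mlin_diff[OF k mlin_tail[OF m1 that] Suc.IH]) (use Suc.prems that in \<open>auto intro: mlin_tail\<close>)
  moreover have "prism F ((x + y) # r) = prism F (x # r) + prism F (y # r)"
    if "x \<in> carrier L" "y \<in> carrier L" "r \<in> hargs L m" for x y r
  proof -
    have "prism (\<lambda>ys. F ((x + y) # ys)) r = prism (\<lambda>ys. F (x # ys) + F (y # ys)) r"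
      by (rule prism_cong[of m]) (use that Suc.prems in \<open>auto simp: mlin_add_hd\<close>)
    also have "\<dots> = prism (\<lambda>ys. F (x # ys)) r + prism (\<lambda>ys. F (y # ys)) r"
      by (rule prism_add[of m]) (use that Suc.prems in \<open>auto intro: mlin_tail\<close>)
    finally show ?thesis using mlin_add_hd[OF m1 that] by (simp del: path.simps)
  qed
  moreover have "prism F (scale L c x # r) = scale L c (prism F (x # r))"
    if "x \<in> carrier L" "r \<in> hargs L m" for x c r
  proof -
    have "prism (\<lambda>ys. F (scale L c x # ys)) r = prism (\<lambda>ys. scale L c (F (x # ys))) r"
      by (rule prism_cong[of m]) (use that Suc.prems in \<open>auto simp: mlin_scale_hd\<close>)
    also have "\<dots> = scale L c (prism (\<lambda>ys. F (x # ys)) r)"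
      by (rule prism_scale[of m]) (use that Suc.prems in \<open>auto intro: mlin_tail\<close>)
    finally show ?thesis using mlin_scale_hd[OF m1 that]
      by (simp add: L.vs.scale_right_diff_distrib del: path.simps)
  qed
  ultimately show ?case unfolding mlin_Suc[of L L m "prism F"] by blast
qed

lemma prism_lmult:
  assumes "mlin L L (Suc m) F" "l \<in> carrier L" "xs \<in> hargs L m"
  shows "prism (\<lambda>ys. l \<otimes>\<^bsub>L\<^esub> F ys) xs = l \<otimes>\<^bsub>L\<^esub> prism F xs"
  using assms
proof (induction m arbitrary: F xs)
  case 0
  then show ?case by (simp add: e_closed mlin_closed L.sum_mult_r L.m_assoc)
next
  case (Suc m)
  from Suc.prems(3) obtain x r where xs: "xs = x # r" "x \<in> carrier L" "r \<in> hargs L m"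
    by (auto simp: hargs_Suc_iff)
  have fx: "mlin L L (Suc m) (\<lambda>ys. F (x # ys))" using xs Suc.prems by (auto intro: mlin_tail)
  have 1: "prism (\<lambda>ys. l \<otimes>\<^bsub>L\<^esub> F (x # ys)) r = l \<otimes>\<^bsub>L\<^esub> prism (\<lambda>ys. F (x # ys)) r"
    by (rule Suc.IH) (use xs Suc.prems fx in auto)
  have m: "mlin T L (Suc m) (\<lambda>as. F (e i # map j as))" if "i \<in> I" for i
    using that Suc.prems e_closed by (auto intro!: mlin_ins)
  have 2: "path (\<lambda>as. l \<otimes>\<^bsub>L\<^esub> F (e i # map j as)) i xs =
     l \<otimes>\<^bsub>L\<^esub> path (\<lambda>as. F (e i # map j as)) i xs" if "i \<in> I" for i
    by (rule path_lmult[of "Suc m"]) (use that m Suc.prems in auto)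
  have c: "path (\<lambda>as. F (e i # map j as)) i xs \<in> carrier L" if "i \<in> I" for i
    by (rule path_closed[OF m[OF that] that Suc.prems(3)])
  have "(\<Sum>i\<in>I. path (\<lambda>as. F (e i # map j as)) i xs) \<in> carrier L" by (rule L.sum_closed[OF c])
  moreover have "prism (\<lambda>ys. F (x # ys)) r \<in> carrier L" by (rule mlin_closed[OF mlin_prism[OF fx] xs(3)])
  ultimately show ?case
    using 1 2 c Suc.prems(2) by (simp add: xs L.sum_mult_r L.r_diff_distrib del: path.simps)
qed

lemma rd_map:
  assumes "mlin L L m F" "as \<in> hargs T (Suc m)"
  shows "L.reg.rd F (map j as) = act.rd (\<lambda>t. F (map j t)) as"
  using assms
proof (induction m arbitrary: F as)
  case 0
  then show ?case by (auto simp: hargs_Suc_iff)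
next
  case (Suc m)
  from Suc.prems(2) obtain a b s where xs: "as = a # b # s" "a \<in> carrier T" "b \<in> carrier T" "s \<in> hargs T m"
    by (auto simp: hargs_Suc_iff)
  have "L.reg.rd (\<lambda>t. F (j a # t)) (map j (b # s)) = act.rd (\<lambda>t. F (j a # map j t)) (b # s)"
    by (rule Suc.IH) (use xs Suc.prems j_closed in \<open>auto intro: mlin_tail\<close>)
  then show ?case by (simp add: xs j_mult)
qed

lemma prism_left:
  assumes F: "mlin L L m F" and xs: "xs \<in> hargs L m"
  shows "paths (\<lambda>as. F (map j as)) xs =
    prism (\<lambda>ys. hd ys \<otimes>\<^bsub>L\<^esub> F (tl ys)) xs + (if xs = [] then 0 else hd xs \<otimes>\<^bsub>L\<^esub> prism F (tl xs))"
proof (cases m)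
  case 0
  then show ?thesis using F xs by (simp add: paths_def mlin_0 L.m_assoc e_closed)
next
  case (Suc k)
  then obtain x r where x: "xs = x # r" "x \<in> carrier L" "r \<in> hargs L k" using xs by (auto simp: hargs_Suc_iff)
  have "path (\<lambda>as. e i \<otimes>\<^bsub>L\<^esub> F (map j as)) i xs = e i \<otimes>\<^bsub>L\<^esub> path (\<lambda>as. F (map j as)) i xs" if "i \<in> I" for i
    by (rule path_lmult[OF mlin_jpre[OF F]]) (use that xs e_closed in auto)
  moreover have "prism (\<lambda>ys. x \<otimes>\<^bsub>L\<^esub> F ys) r = x \<otimes>\<^bsub>L\<^esub> prism F r"
    by (rule prism_lmult[of k]) (use F Suc x in auto)
  ultimately show ?thesis by (simp add: x paths_def del: path.simps)
qed

lemma F_sum_hd: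
  assumes "mlin A L (Suc m) F" "kalgebra A" "\<And>k. k \<in> K \<Longrightarrow> h k \<in> carrier A" "as \<in> hargs A m"
  shows "F ((\<Sum>k\<in>K. h k) # as) = (\<Sum>k\<in>K. F (h k # as))"
  using assms(3)
proof (induction K rule: infinite_finite_induct)
  case (insert k K)
  interpret A: kalgebra A by fact
  have "(\<Sum>k\<in>K. h k) \<in> carrier A" by (rule A.sum_closed) (use insert in auto)
  then show ?case using insert assms(1,4) by (simp add: mlin_add_hd)
next
  case (infinite K)
  interpret A: kalgebra A by fact
  show ?case using infinite mlin_scale_hd[OF assms(1) A.zero_closed assms(4), of 0] by simp
next
  case empty
  interpret A: kalgebra A by fact
  show ?case using mlin_scale_hd[OF assms(1) A.zero_closed assms(4), of 0] by simp
qed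

lemma prism_rd:
  assumes "mlin L L m F" "xs \<in> hargs L m"
  shows "prism (L.reg.rd F) xs + L.reg.rd (prism F) xs = F xs"
  using assms
proof (induction m arbitrary: F xs)
  case 0
  have F: "F [] \<in> carrier L" using 0 by (simp add: mlin_0)
  have "(\<Sum>i\<in>I. F [] \<otimes>\<^bsub>L\<^esub> e i \<otimes>\<^bsub>L\<^esub> e i) = F [] \<otimes>\<^bsub>L\<^esub> (\<Sum>i\<in>I. e i)"
    using F by (simp add: L.sum_mult_r e_closed L.m_assoc e_idem)
  then show ?case using 0 F by (simp add: e_sum)
next
  case (Suc m)
  from Suc.prems(2) obtain x r where xs: "xs = x # r" "x \<in> carrier L" "r \<in> hargs L m"
    by (auto simp: hargs_Suc_iff)
  note k = L.kalgebra_axioms L.kalgebra_axioms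
  note F = Suc.prems(1)
  have Fx: "mlin L L m (\<lambda>ys. F (x # ys))" using F xs by (auto intro: mlin_tail)
  have Fe: "mlin T L m (\<lambda>as. F (l # map j as))" if "l \<in> carrier L" for l by (rule mlin_ins[OF F that])
  define R where "R = (\<lambda>xs. \<Sum>i\<in>I. path (\<lambda>as. F (e i # map j as)) i xs)"
  define X where "X = (\<Sum>k\<in>I. path (\<lambda>as. F (x \<otimes>\<^bsub>L\<^esub> e k # map j as)) k r)"
  have Rm: "mlin L L m R"
    unfolding R_def by (rule mlin_sum[OF k]) (use Fe e_closed in \<open>auto intro: mlin_path\<close>)
  \<comment> \<open>inserting an idempotent in front\<close>
  have front: "(\<Sum>i\<in>I. path (\<lambda>as. L.reg.rd F (e i # map j as)) i (x # r)) = X - L.reg.rd R (x # r)"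
  proof -
    have 1: "path (\<lambda>as. L.reg.rd F (e i # map j as)) i (x # r) =
        (\<Sum>k\<in>I. path (\<lambda>as. F (e i \<otimes>\<^bsub>L\<^esub> j (ent x i k) # map j as)) k r)
        - L.reg.rd (path (\<lambda>as. F (e i # map j as)) i) (x # r)" if i: "i \<in> I" for i
    proof -
      have ei: "e i \<in> carrier L" using i by (rule e_closed)
      have m1: "mlin T L (Suc m) (\<lambda>as. F (e i \<otimes>\<^bsub>L\<^esub> j (hd as) # map j (tl as)))"
        using F ei by (auto simp: mlin_Suc[of T L m "\<lambda>as. F (e i \<otimes>\<^bsub>L\<^esub> j (hd as) # map j (tl as))"]
            j_closed j_add j_scale L.r_distrib L.scale_r
            mlin_add_hd mlin_scale_hd map_j intro!: Fe)
      have "path (\<lambda>as. L.reg.rd F (e i # map j as)) i (x # r) =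
          path (\<lambda>as. F (e i \<otimes>\<^bsub>L\<^esub> j (hd as) # map j (tl as)) - act.rd (\<lambda>t. F (e i # map j t)) as) i (x # r)"
      proof (rule path_cong[of "Suc m"])
        fix as assume as: "as \<in> hargs T (Suc m)"
        then obtain a s where a: "as = a # s" by (auto simp: hargs_Suc_iff)
        show "L.reg.rd F (e i # map j as) =
            F (e i \<otimes>\<^bsub>L\<^esub> j (hd as) # map j (tl as)) - act.rd (\<lambda>t. F (e i # map j t)) as"
          using rd_map[OF mlin_tail[OF F ei] as] by (simp add: a)
      qed (use xs i in auto)
      also have "\<dots> = path (\<lambda>as. F (e i \<otimes>\<^bsub>L\<^esub> j (hd as) # map j (tl as))) i (x # r)
          - path (act.rd (\<lambda>t. F (e i # map j t))) i (x # r)"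
        by (rule path_diff[OF m1 act.mlin_rd[OF Fe[OF ei]]]) (use xs i in auto)
      also have "path (act.rd (\<lambda>t. F (e i # map j t))) i (x # r) =
          L.reg.rd (path (\<lambda>as. F (e i # map j as)) i) (x # r)"
        by (rule path_rd[OF Fe[OF ei]]) (use xs i in auto)
      finally show ?thesis by simp
    qed
    have "(\<Sum>i\<in>I. path (\<lambda>as. L.reg.rd F (e i # map j as)) i (x # r)) =
        (\<Sum>i\<in>I. \<Sum>k\<in>I. path (\<lambda>as. F (e i \<otimes>\<^bsub>L\<^esub> j (ent x i k) # map j as)) k r)
        - (\<Sum>i\<in>I. L.reg.rd (path (\<lambda>as. F (e i # map j as)) i) (x # r))"
      unfolding sum_subtractf[symmetric] by (intro sum.cong refl 1)
    also have "(\<Sum>i\<in>I. L.reg.rd (path (\<lambda>as. F (e i # map j as)) i) (x # r)) = L.reg.rd R (x # r)"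
      unfolding R_def
      by (rule L.reg.rd_sum[symmetric, of _ m]) (use xs Fe e_closed in \<open>auto intro: mlin_path\<close>)
    also have "(\<Sum>i\<in>I. \<Sum>k\<in>I. path (\<lambda>as. F (e i \<otimes>\<^bsub>L\<^esub> j (ent x i k) # map j as)) k r) = X"
      unfolding X_def
    proof (subst sum.swap, rule sum.cong[OF refl])
      fix k assume k: "k \<in> I"
      have c: "e i \<otimes>\<^bsub>L\<^esub> j (ent x i k) \<in> carrier L" if "i \<in> I" for i
        using that k xs by (auto intro!: e_closed j_closed ent_closed)
      have "(\<Sum>i\<in>I. path (\<lambda>as. F (e i \<otimes>\<^bsub>L\<^esub> j (ent x i k) # map j as)) k r) =
          path (\<lambda>as. \<Sum>i\<in>I. F (e i \<otimes>\<^bsub>L\<^esub> j (ent x i k) # map j as)) k r"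
        by (rule path_sum[symmetric, of _ m]) (use c Fe k xs in auto)
      also have "\<dots> = path (\<lambda>as. F (x \<otimes>\<^bsub>L\<^esub> e k # map j as)) k r"
        by (rule path_cong[of m])
          (use c k xs F in \<open>auto simp: ent_col F_sum_hd[OF F L.kalgebra_axioms] map_j\<close>)
      finally show "(\<Sum>i\<in>I. path (\<lambda>as. F (e i \<otimes>\<^bsub>L\<^esub> j (ent x i k) # map j as)) k r) =
          path (\<lambda>as. F (x \<otimes>\<^bsub>L\<^esub> e k # map j as)) k r" .
    qed
    finally show ?thesis .
  qed
  have a: "prism (L.reg.rd F) (x # r) = X - L.reg.rd R (x # r) - prism (\<lambda>ys. L.reg.rd F (x # ys)) r"
    using front by (simp del: path.simps)
  show ?case
  proof (cases r)
    case Nil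
    then have m: "m = 0" using xs by simp
    have Fl: "F [l] \<in> carrier L" if "l \<in> carrier L" for l using mlin_closed[OF F] that m by simp
    have "prism (\<lambda>ys. L.reg.rd F (x # ys)) r = (\<Sum>i\<in>I. F [x \<otimes>\<^bsub>L\<^esub> e i] \<otimes>\<^bsub>L\<^esub> e i) - F [x] \<otimes>\<^bsub>L\<^esub> (\<Sum>i\<in>I. e i)"
      using xs Fl by (simp add: Nil L.l_diff_distrib e_closed L.m_assoc e_idem sum_subtractf L.sum_mult_r)
    moreover have "X = (\<Sum>i\<in>I. F [x \<otimes>\<^bsub>L\<^esub> e i] \<otimes>\<^bsub>L\<^esub> e i)" by (simp add: X_def Nil)
    moreover have "L.reg.rd R (x # r) = L.reg.rd (prism F) (x # r)" by (simp add: Nil R_def)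
    ultimately have "prism (L.reg.rd F) xs + L.reg.rd (prism F) xs = F [x] \<otimes>\<^bsub>L\<^esub> (\<Sum>i\<in>I. e i)"
      using a xs(1) by simp
    then show ?thesis using Fl xs by (simp add: e_sum Nil)
  next
    case (Cons y s)
    then obtain m' where m: "m = Suc m'" "y \<in> carrier L" "s \<in> hargs L m'" using xs by (cases m) auto
    define Fxm where "Fxm = (\<lambda>ys. F (x \<otimes>\<^bsub>L\<^esub> hd ys # tl ys))"
    have Fxm: "mlin L L (Suc m) Fxm"
      using F xs(2) unfolding Fxm_def by (auto simp: mlin_Suc[of L L m "\<lambda>ys. F (x \<otimes>\<^bsub>L\<^esub> hd ys # tl ys)"]
          L.r_distrib L.scale_r mlin_add_hd mlin_scale_hd mlin_tail[OF F])
    have "prism (\<lambda>ys. L.reg.rd F (x # ys)) r = prism (\<lambda>ys. Fxm ys - L.reg.rd (\<lambda>t. F (x # t)) ys) r"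
      by (rule prism_cong[of m]) (use xs in \<open>auto simp: hargs_Suc_iff Fxm_def\<close>)
    also have "\<dots> = prism Fxm r - prism (L.reg.rd (\<lambda>t. F (x # t))) r"
      by (rule prism_diff[OF Fxm L.reg.mlin_rd[OF Fx] xs(3)])
    also have "prism Fxm r = X - prism (\<lambda>ys. F ((x \<otimes>\<^bsub>L\<^esub> y) # ys)) s"
      by (simp add: Cons X_def Fxm_def del: path.simps)
    finally have b: "prism (\<lambda>ys. L.reg.rd F (x # ys)) r =
        X - prism (\<lambda>ys. F ((x \<otimes>\<^bsub>L\<^esub> y) # ys)) s - prism (L.reg.rd (\<lambda>t. F (x # t))) r" .
    have "L.reg.rd (prism F) (x # r) = prism F (x \<otimes>\<^bsub>L\<^esub> y # s) - L.reg.rd (\<lambda>t. prism F (x # t)) r"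
      by (simp add: Cons)
    also have "prism F (x \<otimes>\<^bsub>L\<^esub> y # s) = R (x \<otimes>\<^bsub>L\<^esub> y # s) - prism (\<lambda>ys. F ((x \<otimes>\<^bsub>L\<^esub> y) # ys)) s"
      by (simp add: R_def)
    also have "L.reg.rd (\<lambda>t. prism F (x # t)) r = L.reg.rd (\<lambda>t. R (x # t) - prism (\<lambda>ys. F (x # ys)) t) r"
      by (simp add: R_def)
    also have "\<dots> = L.reg.rd (\<lambda>t. R (x # t)) r - L.reg.rd (prism (\<lambda>ys. F (x # ys))) r"
      by (rule L.reg.rd_diff[of m']) (use Rm m xs Fx in \<open>auto intro: mlin_tail mlin_prism\<close>)
    finally have c: "L.reg.rd (prism F) (x # r) = L.reg.rd R (x # r)
        - prism (\<lambda>ys. F ((x \<otimes>\<^bsub>L\<^esub> y) # ys)) s + L.reg.rd (prism (\<lambda>ys. F (x # ys))) r"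
      by (simp add: Cons)
    show ?thesis unfolding xs(1) a b c using Suc.IH[OF Fx xs(3)] by (simp add: algebra_simps)
  qed
qed

text \<open>
  A cocycle of \<open>L\<close> is thus recovered, up to a coboundary, from its values on scalar matrices.
\<close>

lemma paths_cocycle:
  assumes F: "F \<in> hcochains L (Suc m)" and dF: "hdiff L (Suc m) F = 0" and xs: "xs \<in> hargs L (Suc m)"
  shows "paths (\<lambda>as. F (map j as)) xs - F xs = hdiff L m (\<lambda>ys. if ys \<in> hargs L m then prism F ys else 0) xs"
proof -
  note Fm = L.hc_mlin[OF F]
  from xs obtain x r where x: "xs = x # r" "x \<in> carrier L" "r \<in> hargs L m" by (auto simp: hargs_Suc_iff)
  have 1: "prism (\<lambda>ys. hd ys \<otimes>\<^bsub>L\<^esub> F (tl ys)) xs = prism (L.reg.rd F) xs"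
  proof (rule prism_cong[OF _ xs])
    fix ys assume ys: "ys \<in> hargs L (Suc (Suc m))"
    then obtain y r where y: "ys = y # r" by (auto simp: hargs_Suc_iff)
    show "hd ys \<otimes>\<^bsub>L\<^esub> F (tl ys) = L.reg.rd F ys"
      using L.hdiff_rec[of y r "Suc m" F] ys dF by (simp add: y)
  qed
  have 2: "prism (L.reg.rd F) xs = F xs - L.reg.rd (prism F) xs"
    using prism_rd[OF Fm xs] by (metis add_diff_cancel_right')
  have "paths (\<lambda>as. F (map j as)) xs = prism (L.reg.rd F) xs + hd xs \<otimes>\<^bsub>L\<^esub> prism F (tl xs)"
    unfolding prism_left[OF Fm xs] 1 using x(1) by (simp only: list.distinct if_False)
  then have "paths (\<lambda>as. F (map j as)) xs = F xs - L.reg.rd (prism F) xs + x \<otimes>\<^bsub>L\<^esub> prism F r"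
    unfolding 2 by (simp only: x(1) list.sel)
  moreover have "L.reg.rd (\<lambda>ys. if ys \<in> hargs L m then prism F ys else 0) xs = L.reg.rd (prism F) xs"
    by (rule L.reg.rd_cong[OF _ xs]) simp
  moreover have "hdiff L m (\<lambda>ys. if ys \<in> hargs L m then prism F ys else 0) xs =
      x \<otimes>\<^bsub>L\<^esub> prism F r - L.reg.rd (\<lambda>ys. if ys \<in> hargs L m then prism F ys else 0) xs"
    using L.hdiff_rec[OF xs[unfolded x(1)]] x by (simp only: if_True)
  moreover have "p - f = h" if "p = f - q + z" "q' = q" "h = z - q'" for p f q q' h z :: 'l
    unfolding that by simp
  ultimately show ?thesis by blast
qed

lemma paths_cocycle_0:
  assumes F: "F \<in> hcochains L 0" and dF: "hdiff L 0 F = 0"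
  shows "paths (\<lambda>as. F (map j as)) [] = F []"
proof -
  have Fc: "F [] \<in> carrier L" by (rule L.hc_in[OF F])
  have "x \<otimes>\<^bsub>L\<^esub> F [] = F [] \<otimes>\<^bsub>L\<^esub> x" if "x \<in> carrier L" for x
    using L.hdiff_rec[of x "[]" 0 F] dF that by simp
  then have "paths (\<lambda>as. F (map j as)) [] = (\<Sum>i\<in>I. F [] \<otimes>\<^bsub>L\<^esub> e i)"
    unfolding paths_def using Fc
    by (intro sum.cong refl) (simp add: e_closed L.m_assoc e_idem flip: L.m_assoc[OF e_closed])
  then show ?thesis using Fc by (simp add: e_sum e_closed flip: L.sum_mult_r)
qed

end

section \<open>The smash product of a two-step graded algebra with a cyclic group\<close>

text \<open>
  A grading concentrated in the degrees zero and one, given by its projections \<open>p0\<close> and \<open>p1\<close>. The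
  product of two elements of degree one has degree two and vanishes, which makes \<open>p1\<close> a
  derivation of square zero for the cup product.
\<close>

locale two_step_algebra = T: kalgebra T
  for T :: "('k::field, 't::ab_group_add, 'y) kalg_scheme" +
  fixes p0 p1 :: "'t \<Rightarrow> 't"
  assumes p0_closed: "x \<in> carrier T \<Longrightarrow> p0 x \<in> carrier T"
    and p1_closed: "x \<in> carrier T \<Longrightarrow> p1 x \<in> carrier T"
    and p0_add: "p0 (x + y) = p0 x + p0 y"
    and p1_add: "p1 (x + y) = p1 x + p1 y"
    and p0_scale: "p0 (scale T c x) = scale T c (p0 x)"
    and p1_scale: "p1 (scale T c x) = scale T c (p1 x)"
    and p0_p1: "p0 x + p1 x = x"
    and p0_p0 [simp]: "p0 (p0 x) = p0 x"
    and p1_p1 [simp]: "p1 (p1 x) = p1 x"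
    and p0_mult: "x \<in> carrier T \<Longrightarrow> y \<in> carrier T \<Longrightarrow> p0 (x \<otimes>\<^bsub>T\<^esub> y) = p0 x \<otimes>\<^bsub>T\<^esub> p0 y"
    and p1_mult: "x \<in> carrier T \<Longrightarrow> y \<in> carrier T \<Longrightarrow>
      p1 (x \<otimes>\<^bsub>T\<^esub> y) = p1 x \<otimes>\<^bsub>T\<^esub> p0 y + p0 x \<otimes>\<^bsub>T\<^esub> p1 y"
    and p1_mult_p1: "x \<in> carrier T \<Longrightarrow> y \<in> carrier T \<Longrightarrow> p1 x \<otimes>\<^bsub>T\<^esub> p1 y = 0"
    and p0_one: "p0 \<one>\<^bsub>T\<^esub> = \<one>\<^bsub>T\<^esub>"
begin

lemma p1_p0 [simp]: "p1 (p0 x) = 0"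
  using p0_p1[of "p0 x"] by simp

lemma p0_p1_zero [simp]: "p0 (p1 x) = 0"
  using p0_p1[of "p1 x"] by simp

lemma p0_zero [simp]: "p0 0 = 0"
  using p0_add[of 0 0] by simp

lemma p1_zero [simp]: "p1 0 = 0"
  using p1_add[of 0 0] by simp

lemma p1_one [simp]: "p1 \<one>\<^bsub>T\<^esub> = 0"
  using p0_p1[of "\<one>\<^bsub>T\<^esub>"] by (simp add: p0_one)

declare p0_one [simp]

lemma mult_p01: "x \<in> carrier T \<Longrightarrow> y \<in> carrier T \<Longrightarrow> x \<otimes>\<^bsub>T\<^esub> p0 y + x \<otimes>\<^bsub>T\<^esub> p1 y = x \<otimes>\<^bsub>T\<^esub> y"
  by (simp add: p0_closed p1_closed p0_p1 flip: T.r_distrib)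

lemma p1_mult_l: "x \<in> carrier T \<Longrightarrow> y \<in> carrier T \<Longrightarrow> p1 x \<otimes>\<^bsub>T\<^esub> p0 y = p1 x \<otimes>\<^bsub>T\<^esub> y"
  using mult_p01[of "p1 x" y] by (simp add: p1_mult_p1 p1_closed)

lemma p1_mult_r:
  assumes "x \<in> carrier T" "y \<in> carrier T"
  shows "p0 x \<otimes>\<^bsub>T\<^esub> p1 y = x \<otimes>\<^bsub>T\<^esub> p1 y"
proof -
  have "(p0 x + p1 x) \<otimes>\<^bsub>T\<^esub> p1 y = p0 x \<otimes>\<^bsub>T\<^esub> p1 y + p1 x \<otimes>\<^bsub>T\<^esub> p1 y"
    using assms by (intro T.l_distrib) (auto simp: p0_closed p1_closed)
  then show ?thesis using assms by (simp add: p0_p1 p1_mult_p1)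
qed

sublocale E: derivation T p1
  by unfold_locales
    (auto simp: p1_closed p1_add p1_scale p1_mult p1_mult_l p1_mult_r)

lemma E_cup_E: "hcup T 1 1 E.D1 E.D1 = 0"
proof
  fix xs show "hcup T 1 1 E.D1 E.D1 xs = 0 xs"
  proof (cases "xs \<in> hargs T 2")
    case True
    then obtain a b where "xs = [a, b]" "a \<in> carrier T" "b \<in> carrier T"
      by (auto simp: numeral_2_eq_2 hargs_Suc_iff)
    then show ?thesis by (simp add: hcup_def E.D1_def p1_mult_p1)
  qed (simp add: hcup_def numeral_2_eq_2)
qed

end

text \<open>
  \<open>\<phi> b\<close> is the coefficient of the idempotent with index \<open>b\<close>. A right factor of degree one shifts
  the index at which its left neighbour is evaluated, so that arrows of degree one lead around a
  cycle of length \<open>n\<close>.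
\<close>

locale cyclic_cover = two_step_algebra T p0 p1
  for T :: "('k::field, 't::ab_group_add, 'y) kalg_scheme" and p0 p1 +
  fixes n :: nat and L :: "('k, int \<Rightarrow> 't, 'z) kalg_scheme"
  assumes n2: "n \<ge> 2"
    and L_carrier: "carrier L = {\<phi>. (\<forall>b\<in>{0..<int n}. \<phi> b \<in> carrier T) \<and> (\<forall>b. b \<notin> {0..<int n} \<longrightarrow> \<phi> b = 0)}"
    and L_mult: "\<phi> \<in> carrier L \<Longrightarrow> \<psi> \<in> carrier L \<Longrightarrow> \<phi> \<otimes>\<^bsub>L\<^esub> \<psi> =
      (\<lambda>b. if b \<in> {0..<int n} then \<phi> b \<otimes>\<^bsub>T\<^esub> p0 (\<psi> b) + \<phi> ((b + 1) mod int n) \<otimes>\<^bsub>T\<^esub> p1 (\<psi> b) else 0)"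
    and L_one: "\<one>\<^bsub>L\<^esub> = (\<lambda>b. if b \<in> {0..<int n} then \<one>\<^bsub>T\<^esub> else 0)"
    and L_scale: "scale L c \<phi> = (\<lambda>b. scale T c (\<phi> b))"
begin

abbreviation I where "I \<equiv> {0..<int n}"
abbreviation sh :: "int \<Rightarrow> int" where "sh b \<equiv> (b + 1) mod int n"

lemma sh_I [simp]: "0 \<le> sh b" "sh b < int n"
  using n2 by auto

lemma mod_I [simp]: "0 \<le> b mod int n" "b mod int n < int n"
  using n2 by auto

lemma sh_inj: "\<lbrakk>0 \<le> a; a < int n; 0 \<le> b; b < int n\<rbrakk> \<Longrightarrow> sh a = sh b \<longleftrightarrow> a = b"
proof
  assume *: "0 \<le> a" "a < int n" "0 \<le> b" "b < int n" "sh a = sh b"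
  then have "(a + 1 - 1) mod int n = (b + 1 - 1) mod int n" by (metis mod_diff_left_eq)
  with * show "a = b" by simp
qed simp

lemma sh_ne: "\<lbrakk>0 \<le> a; a < int n\<rbrakk> \<Longrightarrow> sh a \<noteq> a"
proof
  assume *: "0 \<le> a" "a < int n" "sh a = a"
  then show False using n2 by (cases "a + 1 = int n") auto
qed

lemma sh_bij: "bij_betw sh I I"
proof -
  have "inj_on sh I" by (auto simp: inj_on_def sh_inj)
  moreover have "sh ` I \<subseteq> I" by auto
  ultimately show ?thesis using endo_inj_surj[of I sh] by (auto simp: bij_betw_def)
qed

lemma L_in: "\<phi> \<in> carrier L \<Longrightarrow> \<phi> b \<in> carrier T"
  by (cases "b \<in> I") (auto simp: L_carrier)

lemma L_out: "\<phi> \<in> carrier L \<Longrightarrow> b \<notin> I \<Longrightarrow> \<phi> b = 0"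
  by (auto simp: L_carrier)

lemma L_eqI: "\<lbrakk>\<phi> \<in> carrier L; \<psi> \<in> carrier L; \<And>b. 0 \<le> b \<Longrightarrow> b < int n \<Longrightarrow> \<phi> b = \<psi> b\<rbrakk> \<Longrightarrow> \<phi> = \<psi>"
  by (rule ext) (metis L_out atLeastLessThan_iff)

lemma L_mult_apply: "\<phi> \<in> carrier L \<Longrightarrow> \<psi> \<in> carrier L \<Longrightarrow> 0 \<le> b \<Longrightarrow> b < int n \<Longrightarrow>
    (\<phi> \<otimes>\<^bsub>L\<^esub> \<psi>) b = \<phi> b \<otimes>\<^bsub>T\<^esub> p0 (\<psi> b) + \<phi> (sh b) \<otimes>\<^bsub>T\<^esub> p1 (\<psi> b)"
  by (simp add: L_mult)

lemma L_mult_closed: "\<phi> \<in> carrier L \<Longrightarrow> \<psi> \<in> carrier L \<Longrightarrow> \<phi> \<otimes>\<^bsub>L\<^esub> \<psi> \<in> carrier L"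
  unfolding L_mult by (simp add: L_carrier p0_closed p1_closed)

lemma L_kalgebra: "kalgebra L"
proof
  fix x y z assume c: "x \<in> carrier L" "y \<in> carrier L" "z \<in> carrier L"
  note p = L_in p0_closed p1_closed
  show "x \<otimes>\<^bsub>L\<^esub> y \<otimes>\<^bsub>L\<^esub> z = x \<otimes>\<^bsub>L\<^esub> (y \<otimes>\<^bsub>L\<^esub> z)"
  proof (rule L_eqI)
    fix b assume b: "0 \<le> b" "b < int n"
    have z0: "x (sh (sh b)) \<otimes>\<^bsub>T\<^esub> p1 (y (sh b)) \<otimes>\<^bsub>T\<^esub> p1 (z b) = 0"
      using c by (simp add: p T.m_assoc p1_mult_p1)
    have "p1 (y (sh b)) \<otimes>\<^bsub>T\<^esub> p1 (z b) = 0" using c by (simp add: p p1_mult_p1)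
    then show "(x \<otimes>\<^bsub>L\<^esub> y \<otimes>\<^bsub>L\<^esub> z) b = (x \<otimes>\<^bsub>L\<^esub> (y \<otimes>\<^bsub>L\<^esub> z)) b"
      using b c z0 by (simp add: L_mult_apply L_mult_closed p p0_mult p1_mult p0_add p1_add T.l_distrib T.r_distrib T.m_assoc add_ac)
  qed (use c in \<open>auto simp: L_mult_closed\<close>)
  show "(x + y) \<otimes>\<^bsub>L\<^esub> z = x \<otimes>\<^bsub>L\<^esub> z + y \<otimes>\<^bsub>L\<^esub> z"
  proof -
    have "x + y \<in> carrier L" using c by (auto simp: L_carrier)
    then show ?thesis using c by (intro ext) (simp add: L_mult p T.l_distrib add_ac)
  qed
  show "z \<otimes>\<^bsub>L\<^esub> (x + y) = z \<otimes>\<^bsub>L\<^esub> x + z \<otimes>\<^bsub>L\<^esub> y"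
  proof -
    have "x + y \<in> carrier L" using c by (auto simp: L_carrier)
    then show ?thesis using c by (intro ext) (simp add: L_mult p p0_add p1_add T.r_distrib add_ac)
  qed
next
  fix x y c assume c: "x \<in> carrier L" "y \<in> carrier L"
  note p = L_in p0_closed p1_closed
  have s: "scale L c z \<in> carrier L" if "z \<in> carrier L" for z using that by (auto simp: L_carrier L_scale)
  show "scale L c x \<otimes>\<^bsub>L\<^esub> y = scale L c (x \<otimes>\<^bsub>L\<^esub> y)"
    using c s by (intro ext) (simp add: L_mult L_scale p T.scale_l T.vs.scale_right_distrib)
  show "x \<otimes>\<^bsub>L\<^esub> scale L c y = scale L c (x \<otimes>\<^bsub>L\<^esub> y)"
    using c s by (intro ext) (simp add: L_mult L_scale p p0_scale p1_scale T.scale_r T.vs.scale_right_distrib)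
next
  fix x assume c: "x \<in> carrier L"
  note p = L_in p0_closed p1_closed
  have o: "\<one>\<^bsub>L\<^esub> \<in> carrier L" by (simp add: L_one L_carrier)
  show "\<one>\<^bsub>L\<^esub> \<otimes>\<^bsub>L\<^esub> x = x"
    by (rule L_eqI) (use c o in \<open>auto simp: L_mult_closed L_mult_apply L_one p p0_p1\<close>)
  show "x \<otimes>\<^bsub>L\<^esub> \<one>\<^bsub>L\<^esub> = x"
    by (rule L_eqI) (use c o in \<open>auto simp: L_mult_closed L_mult_apply L_one p\<close>)
next
  show "\<one>\<^bsub>L\<^esub> \<in> carrier L" by (simp add: L_one L_carrier)
  show "module.subspace (scale L) (carrier L)"
  proof -
    have "vector_space (scale L)"
      by unfold_locales (auto simp: L_scale T.vs.scale_right_distrib T.vs.scale_left_distrib fun_eq_iff)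
    then interpret V: vector_space "scale L" .
    show ?thesis by (auto simp: V.subspace_def L_carrier L_scale)
  qed
qed (auto simp: L_mult_closed L_scale T.vs.scale_right_distrib T.vs.scale_left_distrib fun_eq_iff)

sublocale L: kalgebra L by (rule L_kalgebra)

definition diag :: "'t \<Rightarrow> int \<Rightarrow> 't" where "diag a = (\<lambda>b. if b \<in> I then a else 0)"
definition idem :: "int \<Rightarrow> int \<Rightarrow> 't" where "idem i = (\<lambda>b. if b \<in> I \<and> b = i then \<one>\<^bsub>T\<^esub> else 0)"
text \<open>
  Degree-zero parts sit on the diagonal and degree-one parts on the cyclically shifted diagonal.
  The two conditions exclude each other, as \<open>n \<ge> 2\<close>.
\<close>

definition entry :: "(int \<Rightarrow> 't) \<Rightarrow> int \<Rightarrow> int \<Rightarrow> 't" where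
  "entry x i k = (if i = k then p0 (x k) else 0) + (if i = sh k then p1 (x k) else 0)"

lemma diag_closed: "a \<in> carrier T \<Longrightarrow> diag a \<in> carrier L"
  by (simp add: diag_def L_carrier)

lemma idem_closed: "idem i \<in> carrier L"
  by (simp add: idem_def L_carrier)

lemma entry_closed: "x \<in> carrier L \<Longrightarrow> entry x i k \<in> carrier T"
  by (simp add: entry_def L_in p0_closed p1_closed)

lemma diag_mult_apply:
  assumes "a \<in> carrier T" "x \<in> carrier L" "0 \<le> b" "b < int n"
  shows "(diag a \<otimes>\<^bsub>L\<^esub> x) b = a \<otimes>\<^bsub>T\<^esub> x b"
  using assms by (simp add: L_mult_apply diag_closed) (simp add: diag_def mult_p01 L_in)

lemma mult_idem_apply:
  assumes "x \<in> carrier L" "0 \<le> b" "b < int n"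
  shows "(x \<otimes>\<^bsub>L\<^esub> idem i) b = (if b = i then x b else 0)"
  using assms by (simp add: L_mult_apply idem_closed) (simp add: idem_def L_in)

lemma idem_mult_apply:
  assumes "x \<in> carrier L" "0 \<le> b" "b < int n"
  shows "(idem i \<otimes>\<^bsub>L\<^esub> x) b = entry x i b"
  using assms by (simp add: L_mult_apply idem_closed) (auto simp: idem_def entry_def L_in p0_closed p1_closed)

lemma fun_sum_apply: "(\<Sum>i\<in>K. f i) b = (\<Sum>i\<in>K. f i b)" for f :: "'i \<Rightarrow> int \<Rightarrow> 't"
  by (induction K rule: infinite_finite_induct) auto

lemma sum_entry:
  assumes "0 \<le> k" "k < int n"
    and z: "\<And>i. i \<in> I \<Longrightarrow> h 0 i = (0::'c::comm_monoid_add)"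
  shows "(\<Sum>i\<in>I. h (entry x i k) i) = h (p0 (x k)) k + h (p1 (x k)) (sh k)"
proof -
  have "(\<Sum>i\<in>I. h (entry x i k) i) =
      (\<Sum>i\<in>I. (if i = k then h (p0 (x k)) i else 0) + (if i = sh k then h (p1 (x k)) i else 0))"
    by (rule sum.cong) (use z sh_ne[OF assms(1,2)] in \<open>auto simp: entry_def\<close>)
  also have "\<dots> = h (p0 (x k)) k + h (p1 (x k)) (sh k)"
    using assms(1,2) by (simp add: sum.distrib)
  finally show ?thesis .
qed

lemma entry_add: "entry (x + y) i k = entry x i k + entry y i k"
  by (simp add: entry_def p0_add p1_add)

lemma entry_mult:
  assumes "x \<in> carrier L" "y \<in> carrier L" "0 \<le> l" "l < int n"
  shows "entry (x \<otimes>\<^bsub>L\<^esub> y) i l = (\<Sum>k\<in>I. entry x i k \<otimes>\<^bsub>T\<^esub> entry y k l)"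
proof -
  note p = L_in p0_closed p1_closed
  have "(\<Sum>k\<in>I. entry x i k \<otimes>\<^bsub>T\<^esub> entry y k l) = entry x i l \<otimes>\<^bsub>T\<^esub> p0 (y l) + entry x i (sh l) \<otimes>\<^bsub>T\<^esub> p1 (y l)"
    by (rule sum_entry[of l "\<lambda>t k. entry x i k \<otimes>\<^bsub>T\<^esub> t"]) (use assms in \<open>auto simp: entry_closed\<close>)
  then show ?thesis using assms
    by (auto simp: entry_def L_mult_apply p p0_mult p1_mult p0_add p1_add T.l_distrib p1_mult_p1)
qed

sublocale matrix_cover T L I idem diag entry
proof (unfold_locales, goal_cases)
  case (1 i) show ?case by (rule idem_closed)
next
  case (2 i)
  show ?case by (rule L_eqI) (auto simp: mult_idem_apply idem_closed L_mult_closed, auto simp: idem_def)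
next
  case 3
  show ?case by (rule L_eqI) (auto simp: fun_sum_apply intro!: L.sum_closed idem_closed, auto simp: idem_def L_one)
next
  case (4 a) then show ?case by (rule diag_closed)
next
  case (7 a b)
  then show ?case
    by (intro L_eqI) (auto simp: diag_mult_apply diag_closed L_mult_closed, auto simp: diag_def)
next
  case (8 x i k) then show ?case by (simp add: entry_closed)
next
  case (9 x y i k) show ?case by (rule entry_add)
next
  case (11 x y i l) then show ?case by (simp add: entry_mult)
next
  case (12 x i)
  show ?case
  proof (rule L_eqI)
    fix b assume b: "0 \<le> b" "b < int n"
    have "(\<Sum>k\<in>I. diag (entry x i k) \<otimes>\<^bsub>L\<^esub> idem k) b = (\<Sum>k\<in>I. if k = b then entry x i k else 0)"
      unfolding fun_sum_apply
      by (rule sum.cong) (use b 12 in \<open>simp_all add: mult_idem_apply diag_closed entry_closed, auto simp: diag_def\<close>)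
    then show "(idem i \<otimes>\<^bsub>L\<^esub> x) b = (\<Sum>k\<in>I. diag (entry x i k) \<otimes>\<^bsub>L\<^esub> idem k) b"
      using b 12 by (simp add: idem_mult_apply)
  qed (use 12 in \<open>auto intro!: L.sum_closed L_mult_closed idem_closed diag_closed entry_closed\<close>)
next
  case (13 x k)
  show ?case
  proof (rule L_eqI)
    fix b assume b: "0 \<le> b" "b < int n"
    have "(\<Sum>i\<in>I. idem i \<otimes>\<^bsub>L\<^esub> diag (entry x i k)) b = (\<Sum>i\<in>I. entry (diag (entry x i k)) i b)"
      unfolding fun_sum_apply
      by (rule sum.cong) (use b 13 in \<open>auto simp: idem_mult_apply diag_closed entry_closed\<close>)
    also have "\<dots> = (\<Sum>i\<in>I. (if i = b then p0 (entry x i k) else 0) + (if i = sh b then p1 (entry x i k) else 0))"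
      by (rule sum.cong) (use b in \<open>auto simp: entry_def diag_def\<close>)
    also have "\<dots> = p0 (entry x b k) + p1 (entry x (sh b) k)"
      using b by (simp add: sum.distrib)
    also have "\<dots> = (if b = k then x b else 0)"
      using b 13 sh_inj[of b k] by (auto simp: entry_def p0_add p1_add p0_p1)
    finally show "(x \<otimes>\<^bsub>L\<^esub> idem k) b = (\<Sum>i\<in>I. idem i \<otimes>\<^bsub>L\<^esub> diag (entry x i k)) b"
      using b 13 by (simp add: mult_idem_apply)
  qed (use 13 in \<open>auto intro!: L.sum_closed L_mult_closed idem_closed diag_closed entry_closed\<close>)
qed (auto simp: diag_def entry_def L_scale p0_scale p1_scale T.vs.scale_right_distrib fun_eq_iff)

text \<open>Counting how often the arrow from \<open>n - 1\<close> to \<open>0\<close> occurs is a derivation.\<close>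

definition turn :: "(int \<Rightarrow> 't) \<Rightarrow> int \<Rightarrow> 't" where
  "turn x = (\<lambda>b. if b = int n - 1 then p1 (x b) else 0)"

lemma turn_closed: "x \<in> carrier L \<Longrightarrow> turn x \<in> carrier L"
  using n2 by (auto simp: turn_def L_carrier p1_closed)

lemma p0_turn: "p0 (turn x b) = 0" and p1_turn: "p1 (turn x b) = turn x b"
  by (simp_all add: turn_def)

lemma turn_mult_turn: "x \<in> carrier L \<Longrightarrow> y \<in> carrier L \<Longrightarrow> turn x \<otimes>\<^bsub>L\<^esub> turn y = 0"
  by (rule L_eqI) (auto simp: L_mult_apply turn_closed L_mult_closed p0_turn L_in, auto simp: turn_def p1_mult_p1 L_in p1_closed)

sublocale Y: derivation L turn
proof (unfold_locales, goal_cases)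
  case (1 x) then show ?case by (rule turn_closed)
next
  case (4 x y)
  note p = L_in p0_closed p1_closed
  show ?case
  proof (rule L_eqI)
    fix b assume b: "0 \<le> b" "b < int n"
    have 1: "turn x (sh b) \<otimes>\<^bsub>T\<^esub> p1 (y b) = 0"
      using 4 by (simp add: turn_def p1_mult_p1 p)
    show "turn (x \<otimes>\<^bsub>L\<^esub> y) b = (turn x \<otimes>\<^bsub>L\<^esub> y + x \<otimes>\<^bsub>L\<^esub> turn y) b"
      using b 4 1 by (simp add: L_mult_apply turn_closed p0_turn p1_turn p)
        (simp add: turn_def L_mult_apply p p1_add p1_mult p1_mult_r)
  qed (use 4 in \<open>auto simp: turn_closed L_mult_closed\<close>)
qed (auto simp: turn_def p1_add p1_scale L_scale fun_eq_iff)

lemma Y_cup_Y: "hcup L 1 1 Y.D1 Y.D1 = 0"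
proof
  fix xs show "hcup L 1 1 Y.D1 Y.D1 xs = 0 xs"
  proof (cases "xs \<in> hargs L 2")
    case True
    then obtain a b where "xs = [a, b]" "a \<in> carrier L" "b \<in> carrier L"
      by (auto simp: numeral_2_eq_2 hargs_Suc_iff)
    then show ?thesis by (simp add: hcup_def Y.D1_def turn_mult_turn)
  qed (simp add: hcup_def numeral_2_eq_2)
qed

end

section \<open>Families of cochains\<close>

context cyclic_cover
begin

text \<open>
  \<open>hpart c\<close> projects onto the component of degree \<open>c\<close> modulo \<open>n\<close>. Accordingly \<open>part c\<close> extracts
  from a cochain what raises degrees by \<open>c\<close>, and \<open>pr\<close> projects onto the degree-preserving
  cochains.
\<close>

definition hpart :: "int \<Rightarrow> 't \<Rightarrow> 't" where
  "hpart c t = (if c mod int n = 0 then p0 t else if c mod int n = 1 then p1 t else 0)"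

fun part :: "int \<Rightarrow> ('t list \<Rightarrow> 't) \<Rightarrow> 't list \<Rightarrow> 't" where
  "part c f [] = hpart c (f [])"
| "part c f (a # as) = part c (\<lambda>r. f (p0 a # r)) as + part (c + 1) (\<lambda>r. f (p1 a # r)) as"

definition pr :: "nat \<Rightarrow> ('t list \<Rightarrow> 't) \<Rightarrow> 't list \<Rightarrow> 't" where
  "pr m f = (\<lambda>xs. if xs \<in> hargs T m then part 0 f xs else 0)"

definition pack :: "(int \<Rightarrow> 't list \<Rightarrow> 't) \<Rightarrow> 't list \<Rightarrow> int \<Rightarrow> 't" where
  "pack f as = (\<lambda>b. if b \<in> I then f b as else 0)"

text \<open>
  \<open>Q\<close> restricts cochains of \<open>L\<close> to constant arguments, which turns them into \<open>n\<close>-periodic families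
  of cochains of \<open>T\<close>; \<open>J\<close> extends such families to \<open>L\<close>.
\<close>

definition Q :: "nat \<Rightarrow> ((int \<Rightarrow> 't) list \<Rightarrow> int \<Rightarrow> 't) \<Rightarrow> int \<Rightarrow> 't list \<Rightarrow> 't" where
  "Q m F b = (\<lambda>as. if as \<in> hargs T m then F (map diag as) (b mod int n) else 0)"

definition J :: "nat \<Rightarrow> (int \<Rightarrow> 't list \<Rightarrow> 't) \<Rightarrow> (int \<Rightarrow> 't) list \<Rightarrow> int \<Rightarrow> 't" where
  "J m f = (\<lambda>xs. if xs \<in> hargs L m then paths (pack f) xs else 0)"

text \<open>
  The differential that makes restriction to constant arguments a chain map. The last argument
  acts on the values from the right, and its degree-one part picks the value at the next index;
  this is where the difference \<open>f (b + 1) - f b\<close> comes from.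
\<close>

definition dl :: "nat \<Rightarrow> (int \<Rightarrow> 't list \<Rightarrow> 't) \<Rightarrow> int \<Rightarrow> 't list \<Rightarrow> 't" where
  "dl m f b = hdiff T m (f b) + (if even m then uminus else id) (hcup T m 1 (f (b + 1) - f b) E.D1)"

definition families :: "nat \<Rightarrow> (int \<Rightarrow> 't list \<Rightarrow> 't) set" where
  "families m = {f. (\<forall>b. f b \<in> hcochains T m) \<and> (\<forall>b. f (b + int n) = f b)}"

lemma families_in: "f \<in> families m \<Longrightarrow> f b \<in> hcochains T m"
  by (simp add: families_def)

lemma families_mod: "f \<in> families m \<Longrightarrow> f (b mod int n) = f b"
proof -
  assume f: "f \<in> families m"
  have "f (c + int n * int q) = f c" for q c
    by (induction q) (use f in \<open>auto simp: families_def distrib_left simp flip: add.assoc\<close>,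
      metis add.commute add.left_commute)
  then have "f (c + int n * q) = f c" for q c
    by (cases q rule: int_cases2) (simp, metis (no_types) add.commute diff_add_cancel mult_minus_right uminus_add_conv_diff)
  from this[of "b mod int n" "b div int n"] show ?thesis by simp
qed

lemma mlin_pack: "(\<And>b. mlin T T m (f b)) \<Longrightarrow> mlin T L m (pack f)"
  by (auto simp: mlin_def pack_def L_carrier L_scale fun_eq_iff)

lemma families_pack: "f \<in> families m \<Longrightarrow> mlin T L m (pack f)"
  by (rule mlin_pack[OF T.hc_mlin[OF families_in]])

lemma Q_closed: "F \<in> hcochains L m \<Longrightarrow> Q m F \<in> families m"
proof -
  assume F: "F \<in> hcochains L m"
  have 1: "mlin T L m (\<lambda>as. F (map diag as))" by (rule mlin_jpre[OF L.hc_mlin[OF F]])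
  have "mlin T T m (\<lambda>as. F (map diag as) (b mod int n))" for b
    by (rule mlin_post[OF 1]) (auto simp: L_in L_scale)
  then show ?thesis by (auto simp: families_def Q_def intro: T.hc_mlinI)
qed

lemma J_closed: "f \<in> families m \<Longrightarrow> J m f \<in> hcochains L m"
  unfolding J_def by (intro L.hc_mlinI mlin_paths mlin_pack T.hc_mlin) (auto simp: families_def)

lemma pack_Q: "F \<in> hcochains L m \<Longrightarrow> as \<in> hargs T m \<Longrightarrow> pack (Q m F) as = F (map diag as)"
  by (rule ext) (auto simp: pack_def Q_def L_out[OF L.hc_in])

lemma act_rd_apply:
  assumes "mlin T L m G" "as \<in> hargs T (Suc m)" "0 \<le> b" "b < int n"
  shows "act.rd G as b = T.reg.rd (\<lambda>t. G t b) as
    + (if even m then id else uminus) ((G (butlast as) (sh b) - G (butlast as) b) \<otimes>\<^bsub>T\<^esub> p1 (last as))"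
  using assms(1,2)
proof (induction m arbitrary: G as)
  case 0
  then obtain a where a: "as = [a]" "a \<in> carrier T" by (auto simp: hargs_Suc_iff)
  have G: "G [] \<in> carrier L" using 0 by (simp add: mlin_0)
  have "(G [] \<otimes>\<^bsub>L\<^esub> diag a) b = G [] b \<otimes>\<^bsub>T\<^esub> p0 a + G [] (sh b) \<otimes>\<^bsub>T\<^esub> p1 a"
    using G a assms(3,4) by (simp add: L_mult_apply diag_closed) (simp add: diag_def)
  also have "G [] b \<otimes>\<^bsub>T\<^esub> p0 a = G [] b \<otimes>\<^bsub>T\<^esub> a - G [] b \<otimes>\<^bsub>T\<^esub> p1 a"
    using mult_p01[of "G [] b" a] G a by (simp add: L_in eq_diff_eq)
  finally show ?case using a G by (simp add: T.l_diff_distrib L_in p1_closed)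
next
  case (Suc m)
  from Suc.prems(2) obtain a c s where xs: "as = a # c # s" "a \<in> carrier T" "c \<in> carrier T" "s \<in> hargs T m"
    by (auto simp: hargs_Suc_iff)
  have Ga: "mlin T L m (\<lambda>t. G (a # t))" using Suc.prems xs by (auto intro: mlin_tail)
  show ?case using Suc.IH[OF Ga, of "c # s"] xs by simp
qed

lemma tdiff_apply:
  assumes f: "\<And>b. f b \<in> hcochains T m" "f (sh b) = f (b + 1)" and as: "as \<in> hargs T (Suc m)" and b: "0 \<le> b" "b < int n"
  shows "tdiff (pack f) as b = dl m f b as"
proof -
  have m: "mlin T L m (pack f)" by (rule mlin_pack[OF T.hc_mlin[OF f(1)]])
  from as obtain a r where a: "as = a # r" "a \<in> carrier T" "r \<in> hargs T m" by (auto simp: hargs_Suc_iff)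
  have l: "length r = m" using a by (simp add: hargs_length)
  then have tk: "take m as = butlast as" "drop m as = [last as]"
    using a(1) by (simp add: butlast_conv_take, cases r rule: rev_cases) auto
  have la: "last as \<in> carrier T" using as last_in_set[of as] a(1) unfolding hargs_def by blast
  have "pack f r \<in> carrier L" by (rule mlin_closed[OF m a(3)])
  then have "(diag a \<otimes>\<^bsub>L\<^esub> pack f r) b = a \<otimes>\<^bsub>T\<^esub> f b r"
    using a b by (simp add: diag_mult_apply) (simp add: pack_def)
  moreover have "T.reg.rd (\<lambda>t. pack f t b) as = T.reg.rd (f b) as"
    using b by (simp add: pack_def)
  moreover have "hdiff T m (f b) as = a \<otimes>\<^bsub>T\<^esub> f b r - T.reg.rd (f b) as"
    using T.hdiff_rec[of a r m "f b"] as by (simp add: a(1))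
  moreover have "hcup T m 1 (f (b + 1) - f b) E.D1 as = (f (b + 1) (butlast as) - f b (butlast as)) \<otimes>\<^bsub>T\<^esub> p1 (last as)"
    using as la by (simp add: hcup_def tk E.D1_def)
  moreover have "pack f (butlast as) (sh b) = f (b + 1) (butlast as)" "pack f (butlast as) b = f b (butlast as)"
    using b f(2) by (simp_all add: pack_def)
  moreover have "hd as = a" "tl as = r" using a by simp_all
  ultimately show ?thesis
    using act_rd_apply[OF m as b] by (simp add: tdiff_def dl_def algebra_simps)
qed

lemma Q_hdiff:
  assumes F: "F \<in> hcochains L m"
  shows "Q (Suc m) (hdiff L m F) = dl m (Q m F)"
proof (intro ext)
  fix b as
  note q = families_in[OF Q_closed[OF F]]
  show "Q (Suc m) (hdiff L m F) b as = dl m (Q m F) b as"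
  proof (cases "as \<in> hargs T (Suc m)")
    case False
    then show ?thesis by (simp add: Q_def dl_def T.hdiff_outside hcup_def)
  next
    case True
    have Qm: "Q m F (b mod int n) = Q m F b" "Q m F (b mod int n + 1) = Q m F (b + 1)" for b
      by (simp_all add: Q_def fun_eq_iff mod_simps)
    have Qs: "Q m F (sh (b mod int n)) = Q m F (b mod int n + 1)" by (simp add: Q_def fun_eq_iff mod_simps)
    from True obtain a r where a: "as = a # r" "a \<in> carrier T" "r \<in> hargs T m" by (auto simp: hargs_Suc_iff)
    have "hdiff L m F (map diag as) = diag a \<otimes>\<^bsub>L\<^esub> F (map diag r) - L.reg.rd F (map diag as)"
      using a by (simp add: L.hdiff_rec diag_closed map_j)
    also have "L.reg.rd F (map diag as) = act.rd (\<lambda>t. F (map diag t)) as"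
      by (rule rd_map[OF L.hc_mlin[OF F] True])
    also have "\<dots> = act.rd (pack (Q m F)) as"
      by (rule act.rd_cong[OF _ True]) (simp add: pack_Q[OF F])
    finally have "hdiff L m F (map diag as) = tdiff (pack (Q m F)) as"
      using a by (simp add: tdiff_def pack_Q[OF F] fun_eq_iff)
    then have "Q (Suc m) (hdiff L m F) b as = tdiff (pack (Q m F)) as (b mod int n)"
      using True by (simp add: Q_def[of "Suc m"])
    also have "\<dots> = dl m (Q m F) (b mod int n) as"
      by (rule tdiff_apply[OF q Qs True mod_I])
    also have "\<dots> = dl m (Q m F) b as" by (simp add: dl_def Qm)
    finally show ?thesis .
  qed
qed

lemma families_sh: "f \<in> families m \<Longrightarrow> f (sh b) = f (b + 1)"
  by (rule families_mod)

lemma J_dl: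
  assumes f: "f \<in> families m"
  shows "J (Suc m) (dl m f) = hdiff L m (J m f)"
proof
  fix xs show "J (Suc m) (dl m f) xs = hdiff L m (J m f) xs"
  proof (cases "xs \<in> hargs L (Suc m)")
    case False
    then show ?thesis by (simp add: J_def L.hdiff_outside)
  next
    case True
    have m: "mlin T L m (pack f)" by (rule mlin_pack[OF T.hc_mlin[OF families_in[OF f]]])
    from True obtain x r where x: "xs = x # r" "x \<in> carrier L" "r \<in> hargs L m" by (auto simp: hargs_Suc_iff)
    have "paths (pack (dl m f)) xs = paths (tdiff (pack f)) xs"
    proof (rule paths_cong[OF _ True])
      fix as assume as: "as \<in> hargs T (Suc m)"
      show "pack (dl m f) as = tdiff (pack f) as"
      proof
        fix b show "pack (dl m f) as b = tdiff (pack f) as b"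
        proof (cases "b \<in> I")
          case True
          then show ?thesis
            using tdiff_apply[OF families_in[OF f] families_sh[OF f] as] by (simp add: pack_def)
        next
          case False
          have "tdiff (pack f) as \<in> carrier L"
            using as mlin_closed[OF act.mlin_rd[OF m] as] mlin_closed[OF m]
            by (auto simp: tdiff_def hargs_Suc_iff diag_closed intro!: L.diff_closed L.m_closed)
          then show ?thesis using False by (auto simp: pack_def L_out)
        qed
      qed
    qed
    also have "\<dots> = hd xs \<otimes>\<^bsub>L\<^esub> paths (pack f) (tl xs) - L.reg.rd (paths (pack f)) xs"
      by (rule paths_tdiff[OF m True])
    also have "L.reg.rd (paths (pack f)) xs = L.reg.rd (J m f) xs"
      by (rule L.reg.rd_cong[OF _ True]) (simp add: J_def)
    finally show ?thesis using True x L.hdiff_rec[of x r m "J m f"] by (simp add: J_def fun_eq_iff)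
  qed
qed

lemma hpart_add_n: "hpart (c + int n * q) t = hpart c t"
  by (simp add: hpart_def)

lemma one_mod [simp]: "1 mod int n = 1"
  using n2 by simp

lemma hpart_zero [simp]: "hpart c 0 = 0"
  by (simp add: hpart_def)

lemma hpart_add: "hpart c (x + y) = hpart c x + hpart c y"
  by (simp add: hpart_def p0_add p1_add)

lemma part_add: "part c (\<lambda>xs. f xs + g xs) xs = part c f xs + part c g xs"
  by (induction xs arbitrary: c f g) (auto simp: hpart_add algebra_simps)

lemma part_zero: "part c (\<lambda>xs. 0) xs = 0"
  by (induction xs arbitrary: c) auto

lemma part_neg: "part c (\<lambda>xs. - f xs) xs = - part c f xs"
  using part_add[of c f "\<lambda>xs. - f xs" xs] by (simp add: part_zero eq_neg_iff_add_eq_0 add.commute)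

lemma part_cong:
  "(\<And>ys. ys \<in> hargs T m \<Longrightarrow> f ys = g ys) \<Longrightarrow> xs \<in> hargs T m \<Longrightarrow> part c f xs = part c g xs"
proof (induction m arbitrary: f g xs c)
  case (Suc m)
  from Suc.prems(2) obtain a r where a: "xs = a # r" "a \<in> carrier T" "r \<in> hargs T m" by (auto simp: hargs_Suc_iff)
  have "part c (\<lambda>r. f (p # r)) r = part c (\<lambda>r. g (p # r)) r" if "p \<in> carrier T" for p c
    by (rule Suc.IH) (use that a Suc.prems in auto)
  then show ?case by (simp add: a p0_closed p1_closed)
qed auto

lemma idem_path_part:
  assumes "mlin T L m G" "as \<in> hargs T m" "0 \<le> b" "b < int n"
  shows "(\<Sum>i\<in>I. idem ((i + c) mod int n) \<otimes>\<^bsub>L\<^esub> path G i (map diag as)) b = part c (\<lambda>t. G t b) as"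
  using assms(1,2)
proof (induction m arbitrary: G as c)
  case 0
  have G: "G [] \<in> carrier L" using 0 by (simp add: mlin_0)
  have "(\<Sum>i\<in>I. idem ((i + c) mod int n) \<otimes>\<^bsub>L\<^esub> (G [] \<otimes>\<^bsub>L\<^esub> idem i)) b =
      (\<Sum>i\<in>I. if i = b then entry (G [] \<otimes>\<^bsub>L\<^esub> idem i) ((b + c) mod int n) b else 0)"
    unfolding fun_sum_apply
    by (rule sum.cong) (use G assms(3,4) in \<open>auto simp: idem_mult_apply idem_closed entry_def mult_idem_apply\<close>)
  also have "\<dots> = entry (G []) ((b + c) mod int n) b"
    using G assms(3,4) by (simp add: entry_def mult_idem_apply)
  also have "\<dots> = hpart c (G [] b)"
  proof -
    have 1: "(b + c) mod int n = b \<longleftrightarrow> c mod int n = 0"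
      using mod_eq_dvd_iff[of "b + c" "int n" b] assms(3,4) by (simp add: dvd_eq_mod_eq_0)
    have 2: "(b + c) mod int n = sh b \<longleftrightarrow> c mod int n = 1"
      using mod_eq_dvd_iff[of "b + c" "int n" "b + 1"] mod_eq_dvd_iff[of c "int n" 1] by simp
    show ?thesis unfolding entry_def hpart_def 1 2 by auto
  qed
  finally show ?case using 0 by simp
next
  case (Suc m)
  from Suc.prems(2) obtain a r where a: "as = a # r" "a \<in> carrier T" "r \<in> hargs T m" by (auto simp: hargs_Suc_iff)
  have Gp: "mlin T L m (\<lambda>as. G (t # as))" if "t \<in> carrier T" for t
    using Suc.prems(1) that by (rule mlin_tail)
  define h where "h = (\<lambda>k t i. idem ((i + c) mod int n) \<otimes>\<^bsub>L\<^esub> path (\<lambda>as. G (t # as)) k (map diag r))"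
  have h0: "h k 0 i = 0" if "k \<in> I" for k i
  proof -
    have "path (\<lambda>as. G (0 # as)) k (map diag r) = path (\<lambda>as. 0) k (map diag r)"
    proof (rule path_cong[of m])
      fix as assume "as \<in> hargs T m"
      then show "G (0 # as) = 0" using mlin_scale_hd[OF Suc.prems(1) T.zero_closed, of as 0] by simp
    qed (use that a map_j in auto)
    also have "\<dots> = 0" by (rule path_zero[of _ m]) (use that a map_j in auto)
    finally show ?thesis by (simp add: h_def idem_closed)
  qed
  have pc: "path (\<lambda>as. G (t # as)) k (map diag r) \<in> carrier L" if "t \<in> carrier T" "k \<in> I" for t k
    by (rule path_closed[OF Gp]) (use that a map_j in auto)
  have "(\<Sum>i\<in>I. idem ((i + c) mod int n) \<otimes>\<^bsub>L\<^esub> path G i (map diag as)) =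
     (\<Sum>i\<in>I. \<Sum>k\<in>I. h k (entry (diag a) i k) i)"
  proof (rule sum.cong[OF refl])
    fix i
    show "idem ((i + c) mod int n) \<otimes>\<^bsub>L\<^esub> path G i (map diag as) = (\<Sum>k\<in>I. h k (entry (diag a) i k) i)"
      unfolding a(1) list.map path.simps h_def
      by (rule L.sum_mult_r) (auto intro!: pc entry_closed diag_closed a idem_closed)
  qed
  also have "\<dots> = (\<Sum>k\<in>I. h k (p0 (diag a k)) k + h k (p1 (diag a k)) (sh k))"
    by (subst sum.swap, rule sum.cong[OF refl], rule sum_entry) (auto simp: h0)
  also have "\<dots> = (\<Sum>k\<in>I. h k (p0 a) k) + (\<Sum>k\<in>I. h k (p1 a) (sh k))"
    by (simp add: diag_def sum.distrib)
  also have "(\<Sum>k\<in>I. h k (p1 a) (sh k)) =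
      (\<Sum>k\<in>I. idem ((k + (c + 1)) mod int n) \<otimes>\<^bsub>L\<^esub> path (\<lambda>as. G (p1 a # as)) k (map diag r))"
    by (simp add: h_def mod_simps add_ac)
  finally show ?case
    using Suc.IH[OF Gp[OF p0_closed[OF a(2)]] a(3), of c] Suc.IH[OF Gp[OF p1_closed[OF a(2)]] a(3), of "c + 1"]
    by (simp add: a(1) h_def)
qed

text \<open>
  On constant arguments only those paths contribute whose steps match the degrees of the
  arguments, and such a path picks the part of the value whose degree is given by its first and
  last index.
\<close>

lemma Q_J:
  assumes f: "f \<in> families m"
  shows "Q m (J m f) b = pr m (f b)"
proof
  fix as show "Q m (J m f) b as = pr m (f b) as"
  proof (cases "as \<in> hargs T m")
    case True
    have m: "mlin T L m (pack f)" by (rule mlin_pack[OF T.hc_mlin[OF families_in[OF f]]])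
    have "paths (pack f) (map diag as) (b mod int n) = part 0 (\<lambda>t. pack f t (b mod int n)) as"
      using idem_path_part[OF m True, of "b mod int n" 0] by (simp add: paths_def)
    then show ?thesis using True families_mod[OF f] by (simp add: Q_def J_def pr_def map_j pack_def)
  qed (simp add: Q_def pr_def)
qed

lemma pr_closed:
  assumes f: "f \<in> hcochains T m"
  shows "pr m f \<in> hcochains T m"
proof -
  have c: "(\<lambda>_. f) \<in> families m" using f by (simp add: families_def)
  then show ?thesis using families_in[OF Q_closed[OF J_closed[OF c]]] Q_J[OF c] by simp
qed

lemma pr_add: "pr m (f + g) = pr m f + pr m g"
  by (rule ext) (simp add: pr_def plus_fun_def part_add)

lemma pr_neg: "pr m (- f) = - pr m f"
  by (rule ext) (simp add: pr_def fun_Compl_def part_neg)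

lemma pr_diff: "pr m (f - g) = pr m f - pr m g"
  using pr_add[of m f "- g"] by (simp add: pr_neg)

lemma pr_families: "f \<in> families m \<Longrightarrow> (\<lambda>b. pr m (f b)) \<in> families m"
  by (auto simp: families_def pr_closed)

lemma dl_closed:
  assumes "f \<in> families m"
  shows "dl m f \<in> families (Suc m)"
proof -
  have d: "f (b + 1) - f b \<in> hcochains T m" for b
    using families_in[OF assms] by (intro T.hc_diff)
  have "hdiff T m (f b) \<in> hcochains T (Suc m)" for b by (rule T.hdiff_closed[OF families_in[OF assms]])
  moreover have "hcup T m 1 (f (b + 1) - f b) E.D1 \<in> hcochains T (Suc m)" for b
    using T.hcup_closed[OF d E.D1_closed] by simp
  ultimately have "dl m f b \<in> hcochains T (Suc m)" for b
    unfolding dl_def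
    by (auto intro!: T.hc_add T.hc_neg T.hc_diff simp del: add_uminus_conv_diff)
  moreover have "f (b + int n + 1) = f (b + 1)" "f (b + int n) = f b" for b
    using assms by (auto simp: families_def add_ac, metis add.assoc)
  ultimately show ?thesis by (simp add: families_def dl_def)
qed

lemma dl_pr:
  assumes f: "f \<in> families m"
  shows "dl m (\<lambda>b. pr m (f b)) b = pr (Suc m) (dl m f b)"
proof -
  have 1: "(\<lambda>b. pr m (f b)) = Q m (J m f)" by (rule ext) (simp add: Q_J[OF f])
  show ?thesis unfolding 1 Q_hdiff[OF J_closed[OF f], symmetric] J_dl[OF f, symmetric] Q_J[OF dl_closed[OF f]] ..
qed

section \<open>Degree-preserving cochains\<close>

definition piece :: "int \<Rightarrow> 't set" where "piece c = {x \<in> carrier T. hpart c x = x}"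

definition degree_preserving :: "int \<Rightarrow> ('t list \<Rightarrow> 't) \<Rightarrow> bool" where
  "degree_preserving c f \<longleftrightarrow>
     (\<forall>cs xs. list_all2 (\<lambda>x c. x \<in> piece c) xs cs \<longrightarrow> f xs \<in> piece (c + sum_list cs))"

lemma piece_add_n: "piece (c + int n * q) = piece c"
  by (simp add: piece_def hpart_add_n)

lemma zero_piece [simp]: "0 \<in> piece c"
  by (simp add: piece_def)

lemma p0_piece: "x \<in> carrier T \<Longrightarrow> p0 x \<in> piece 0" and p1_piece: "x \<in> carrier T \<Longrightarrow> p1 x \<in> piece 1"
  by (simp_all add: piece_def hpart_def p0_closed p1_closed)

lemma hpart_piece: "x \<in> carrier T \<Longrightarrow> hpart c x \<in> piece c"
  using n2 by (auto simp: piece_def hpart_def p0_closed p1_closed)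

lemma list_all2_piece_hargs: "list_all2 (\<lambda>x c. x \<in> piece c) xs cs \<Longrightarrow> xs \<in> hargs T (length xs)"
  by (induction rule: list_all2_induct) (auto simp: piece_def)

lemma part_id:
  assumes "f \<in> hcochains T m" "degree_preserving c f"
  shows "xs \<in> hargs T m \<Longrightarrow> part c f xs = f xs"
proof -
  have "part c f xs = f xs" if "mlin T T m f" "xs \<in> hargs T m"
    "\<And>cs ys. list_all2 (\<lambda>x c. x \<in> piece c) ys cs \<Longrightarrow> length ys = m \<Longrightarrow> f ys \<in> piece (c + sum_list cs)" for f c xs
    using that
  proof (induction m arbitrary: f c xs)
    case 0
    then show ?case using 0(3)[of "[]" "[]"] by (simp add: piece_def)
  next
    case (Suc m)
    from Suc.prems(2) obtain a r where a: "xs = a # r" "a \<in> carrier T" "r \<in> hargs T m" by (auto simp: hargs_Suc_iff)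
    have "part c (\<lambda>r. f (p0 a # r)) r = f (p0 a # r)"
    proof (rule Suc.IH)
      fix cs ys assume "list_all2 (\<lambda>x c. x \<in> piece c) ys cs" "length ys = m"
      then show "f (p0 a # ys) \<in> piece (c + sum_list cs)"
        using Suc.prems(3)[of "p0 a # ys" "0 # cs"] p0_piece[OF a(2)] by simp
    qed (use a Suc.prems(1) p0_closed in \<open>auto intro: mlin_tail\<close>)
    moreover have "part (c + 1) (\<lambda>r. f (p1 a # r)) r = f (p1 a # r)"
    proof (rule Suc.IH)
      fix cs ys assume "list_all2 (\<lambda>x c. x \<in> piece c) ys cs" "length ys = m"
      then show "f (p1 a # ys) \<in> piece (c + 1 + sum_list cs)"
        using Suc.prems(3)[of "p1 a # ys" "1 # cs"] p1_piece[OF a(2)] by (simp add: add_ac)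
    qed (use a Suc.prems(1) p1_closed in \<open>auto intro: mlin_tail\<close>)
    ultimately show ?case
      using mlin_add_hd[OF Suc.prems(1) p0_closed[OF a(2)] p1_closed[OF a(2)] a(3)] by (simp add: a p0_p1)
  qed
  then show "xs \<in> hargs T m \<Longrightarrow> part c f xs = f xs"
    using assms by (simp add: T.hc_mlin degree_preserving_def)
qed

lemma pr_id: "f \<in> hcochains T m \<Longrightarrow> degree_preserving 0 f \<Longrightarrow> pr m f = f"
  by (rule ext) (simp add: pr_def part_id T.hc_out)

lemma part_piece:
  assumes "mlin T T m f" "list_all2 (\<lambda>x c. x \<in> piece c) xs cs" "length xs = m"
  shows "part c f xs \<in> piece (c + sum_list cs)"
  using assms
proof (induction m arbitrary: f xs cs c)
  case 0
  then show ?case by (simp add: mlin_0 hpart_piece)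
next
  case (Suc m)
  then obtain a r d ds where xs: "xs = a # r" "cs = d # ds" "a \<in> piece d" "length r = m"
    "list_all2 (\<lambda>x c. x \<in> piece c) r ds"
    by (cases xs; cases cs) auto
  have a: "a \<in> carrier T" using xs by (simp add: piece_def)
  have r: "r \<in> hargs T m" using list_all2_piece_hargs[OF xs(5)] xs(4) by simp
  have z: "part e (\<lambda>r. f (0 # r)) r = 0" for e
  proof -
    have "part e (\<lambda>r. f (0 # r)) r = part e (\<lambda>r. 0) r"
    proof (rule part_cong[OF _ r])
      fix ys assume "ys \<in> hargs T m"
      then show "f (0 # ys) = 0" using mlin_scale_hd[OF Suc.prems(1) T.zero_closed, of ys 0] by simp
    qed
    then show ?thesis by (simp add: part_zero)
  qed
  have IH: "part e (\<lambda>r. f (t # r)) r \<in> piece (e + sum_list ds)" if "t \<in> carrier T" for e t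
    by (rule Suc.IH) (use that Suc.prems(1) xs in \<open>auto intro: mlin_tail\<close>)
  have dd: "d = d mod int n + int n * (d div int n)" by simp
  have e1: "piece (c + sum_list cs) = piece (c + d mod int n + sum_list ds)"
    using piece_add_n[of "c + d mod int n + sum_list ds" "d div int n"] dd xs(2) by (simp add: algebra_simps)
  consider "d mod int n = 0" | "d mod int n = 1" | "d mod int n \<noteq> 0" "d mod int n \<noteq> 1" by blast
  then show ?case
  proof cases
    case 1
    then have "p0 a = a" using xs(3) by (simp add: piece_def hpart_def)
    moreover have "p1 a = 0" by (metis p1_p0 calculation)
    ultimately show ?thesis unfolding e1 1 using IH[OF a, of c] z xs by simp
  next
    case 2
    then have "p1 a = a" using xs(3) by (simp add: piece_def hpart_def)
    moreover have "p0 a = 0" by (metis p0_p1_zero calculation)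
    ultimately show ?thesis unfolding e1 2 using IH[OF a, of "c + 1"] z xs by simp
  next
    case 3
    then have "a = 0" using xs(3) by (simp add: piece_def hpart_def)
    then show ?thesis using z xs by simp
  qed
qed

lemma pr_degree_preserving:
  assumes "f \<in> hcochains T m"
  shows "degree_preserving 0 (pr m f)"
  unfolding degree_preserving_def pr_def
proof (intro allI impI)
  fix cs xs assume l: "list_all2 (\<lambda>x c. x \<in> piece c) xs cs"
  show "(if xs \<in> hargs T m then part 0 f xs else 0) \<in> piece (0 + sum_list cs)"
    using part_piece[OF T.hc_mlin[OF assms] l, where c = 0] by (auto dest: hargs_length)
qed

lemma pr_pr: "f \<in> hcochains T m \<Longrightarrow> pr m (pr m f) = pr m f"
  by (rule pr_id[OF pr_closed pr_degree_preserving])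

text \<open>
  By the prism homotopy restriction loses nothing but coboundaries.
\<close>

lemma J_Q_cocycle:
  assumes F: "F \<in> hcochains L (Suc m)" and dF: "hdiff L (Suc m) F = 0"
  shows "\<exists>H\<in>hcochains L m. J (Suc m) (Q (Suc m) F) = F + hdiff L m H"
proof
  let ?H = "\<lambda>ys. if ys \<in> hargs L m then prism F ys else 0"
  show H: "?H \<in> hcochains L m" by (rule L.hc_mlinI[OF mlin_prism[OF L.hc_mlin[OF F]]])
  show "J (Suc m) (Q (Suc m) F) = F + hdiff L m ?H"
  proof
    fix xs show "J (Suc m) (Q (Suc m) F) xs = (F + hdiff L m ?H) xs"
    proof (cases "xs \<in> hargs L (Suc m)")
      case True
      have "paths (pack (Q (Suc m) F)) xs = paths (\<lambda>as. F (map diag as)) xs"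
        by (rule paths_cong[OF _ True]) (simp add: pack_Q[OF F])
      then show ?thesis using paths_cocycle[OF F dF True] True by (simp add: J_def diff_eq_eq add.commute)
    qed (simp add: J_def L.hc_out[OF F] L.hdiff_outside)
  qed
qed

lemma J_Q_cocycle_0:
  assumes F: "F \<in> hcochains L 0" and dF: "hdiff L 0 F = 0"
  shows "J 0 (Q 0 F) = F"
proof
  fix xs show "J 0 (Q 0 F) xs = F xs"
  proof (cases "xs \<in> hargs L 0")
    case True
    have "paths (pack (Q 0 F)) xs = paths (\<lambda>as. F (map diag as)) xs"
      by (rule paths_cong[OF _ True]) (simp add: pack_Q[OF F])
    then show ?thesis using paths_cocycle_0[OF F dF] True by (simp add: J_def)
  qed (simp add: J_def L.hc_out[OF F])
qed

lemma paths_add: "\<lbrakk>mlin T L m G; mlin T L m G'; xs \<in> hargs L m\<rbrakk> \<Longrightarrow>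
    paths (\<lambda>as. G as + G' as) xs = paths G xs + paths G' xs"
  by (simp add: paths_def path_add L.r_distrib idem_closed path_closed sum.distrib)

lemma paths_scale: "\<lbrakk>mlin T L m G; xs \<in> hargs L m\<rbrakk> \<Longrightarrow>
    paths (\<lambda>as. scale L c (G as)) xs = scale L c (paths G xs)"
  by (simp add: paths_def path_scale L.scale_r idem_closed path_closed L.vs.scale_sum_right)

lemma J_add:
  assumes "f \<in> families m" "g \<in> families m"
  shows "J m (f + g) = J m f + J m g"
proof
  fix xs
  have "pack (f + g) = (\<lambda>as. pack f as + pack g as)" by (auto simp: pack_def fun_eq_iff)
  then show "J m (f + g) xs = (J m f + J m g) xs"
    using paths_add[OF families_pack[OF assms(1)] families_pack[OF assms(2)]] by (auto simp: J_def)
qed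

lemma J_scale:
  assumes "f \<in> families m"
  shows "J m (\<lambda>b as. scale T c (f b as)) = (\<lambda>xs. scale L c (J m f xs))"
proof
  fix xs
  have "pack (\<lambda>b as. scale T c (f b as)) = (\<lambda>as. scale L c (pack f as))"
    by (auto simp: pack_def fun_eq_iff L_scale)
  then show "J m (\<lambda>b as. scale T c (f b as)) xs = scale L c (J m f xs)"
    using paths_scale[OF families_pack[OF assms]] by (auto simp: J_def)
qed

end

section \<open>The Nakayama automorphism of the cover\<close>

lemma additive_sum:
  assumes "finite K" "\<And>x y. x \<in> C \<Longrightarrow> y \<in> C \<Longrightarrow> l (x + y) = l x + l y" "l 0 = 0"
    "0 \<in> C" "\<And>x y. x \<in> C \<Longrightarrow> y \<in> C \<Longrightarrow> x + y \<in> C" "\<And>k. k \<in> K \<Longrightarrow> f k \<in> C"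
  shows "l (\<Sum>k\<in>K. f k) = (\<Sum>k\<in>K. l (f k))"
proof -
  have "(\<Sum>k\<in>K. f k) \<in> C \<and> l (\<Sum>k\<in>K. f k) = (\<Sum>k\<in>K. l (f k))"
    using assms(1,6) by (induction K) (auto simp: assms)
  then show ?thesis ..
qed

text \<open>
  For the symmetric form \<open>tr\<close> the two degrees of \<open>T\<close> are dual to each other. On \<open>L\<close> the sum of the
  forms at all indices is no longer symmetric: moving a factor of degree one to the other side
  shifts the index. The resulting Nakayama automorphism is the rotation of the indices.
\<close>

locale symmetric_cover = cyclic_cover T p0 p1 n L
  for T :: "('k::field, 't::ab_group_add, 'y) kalg_scheme" and p0 p1 n
    and L :: "('k, int \<Rightarrow> 't, 'z) kalg_scheme" +
  fixes tr :: "'t \<Rightarrow> 'k"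
  assumes tr_add: "x \<in> carrier T \<Longrightarrow> y \<in> carrier T \<Longrightarrow> tr (x + y) = tr x + tr y"
    and tr_scale: "x \<in> carrier T \<Longrightarrow> tr (scale T c x) = c * tr x"
    and tr_sym: "x \<in> carrier T \<Longrightarrow> y \<in> carrier T \<Longrightarrow> tr (x \<otimes>\<^bsub>T\<^esub> y) = tr (y \<otimes>\<^bsub>T\<^esub> x)"
    and tr_p0: "x \<in> carrier T \<Longrightarrow> tr (p0 x) = 0"
    and tr_nondegenerate: "x \<in> carrier T \<Longrightarrow> (\<And>y. y \<in> carrier T \<Longrightarrow> tr (y \<otimes>\<^bsub>T\<^esub> x) = 0) \<Longrightarrow> x = 0"
    and tr_represents: "(\<And>x y. x \<in> carrier T \<Longrightarrow> y \<in> carrier T \<Longrightarrow> l (x + y) = l x + l y) \<Longrightarrow>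
      (\<And>c x. x \<in> carrier T \<Longrightarrow> l (scale T c x) = c * l x) \<Longrightarrow>
      \<exists>z\<in>carrier T. \<forall>x\<in>carrier T. l x = tr (x \<otimes>\<^bsub>T\<^esub> z)"
begin

definition eps :: "(int \<Rightarrow> 't) \<Rightarrow> 'k" where "eps \<phi> = (\<Sum>b\<in>I. tr (\<phi> b))"
definition rot :: "(int \<Rightarrow> 't) \<Rightarrow> int \<Rightarrow> 't" where
  "rot \<phi> = (\<lambda>b. if b \<in> I then \<phi> (sh b) else 0)"
definition rot' :: "(int \<Rightarrow> 't) \<Rightarrow> int \<Rightarrow> 't" where
  "rot' \<phi> = (\<lambda>b. if b \<in> I then \<phi> ((b - 1) mod int n) else 0)"
definition single :: "int \<Rightarrow> 't \<Rightarrow> int \<Rightarrow> 't" where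
  "single b x = (\<lambda>c. if c = b then x else 0)"

lemma tr_mult_p0:
  assumes "x \<in> carrier T" "y \<in> carrier T"
  shows "tr (x \<otimes>\<^bsub>T\<^esub> p0 y) = tr (p1 x \<otimes>\<^bsub>T\<^esub> y)"
proof -
  have xy: "x \<otimes>\<^bsub>T\<^esub> p0 y \<in> carrier T" using assms by (simp add: p0_closed)
  have "tr (x \<otimes>\<^bsub>T\<^esub> p0 y) = tr (p0 (x \<otimes>\<^bsub>T\<^esub> p0 y) + p1 (x \<otimes>\<^bsub>T\<^esub> p0 y))" by (simp add: p0_p1)
  also have "\<dots> = tr (p1 (x \<otimes>\<^bsub>T\<^esub> p0 y))" using xy tr_add tr_p0 by (simp add: p0_closed p1_closed)
  also have "\<dots> = tr (p1 x \<otimes>\<^bsub>T\<^esub> y)" using assms by (simp add: p1_mult p0_closed p1_mult_l)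
  finally show ?thesis .
qed

lemma sum_sh: "(\<Sum>b\<in>I. f (sh b)) = (\<Sum>b\<in>I. f b)"
  using sum.reindex_bij_betw[OF sh_bij] .

lemma single_closed: "b \<in> I \<Longrightarrow> x \<in> carrier T \<Longrightarrow> single b x \<in> carrier L"
  by (simp add: single_def L_carrier)

lemma eps_single_mult:
  assumes "b \<in> I" "x \<in> carrier T" "\<psi> \<in> carrier L"
  shows "eps (single b x \<otimes>\<^bsub>L\<^esub> \<psi>) = tr (x \<otimes>\<^bsub>T\<^esub> p0 (\<psi> b)) + tr (x \<otimes>\<^bsub>T\<^esub> p1 (\<psi> ((b - 1) mod int n)))"
proof -
  have 1: "tr 0 = 0" using tr_scale[of 0 0] by simp
  have "eps (single b x \<otimes>\<^bsub>L\<^esub> \<psi>) =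
      (\<Sum>c\<in>I. tr (single b x c \<otimes>\<^bsub>T\<^esub> p0 (\<psi> c)) + tr (single b x (sh c) \<otimes>\<^bsub>T\<^esub> p1 (\<psi> ((sh c - 1) mod int n))))"
    unfolding eps_def
  proof (rule sum.cong[OF refl])
    fix c assume c: "c \<in> I"
    then have "(sh c - 1) mod int n = c" by (simp add: mod_diff_left_eq)
    then show "tr ((single b x \<otimes>\<^bsub>L\<^esub> \<psi>) c) = tr (single b x c \<otimes>\<^bsub>T\<^esub> p0 (\<psi> c)) + tr (single b x (sh c) \<otimes>\<^bsub>T\<^esub> p1 (\<psi> ((sh c - 1) mod int n)))"
      using c assms single_closed[OF assms(1,2)] by (simp add: L_mult_apply tr_add L_in p0_closed p1_closed)
  qed
  also have "\<dots> = (\<Sum>c\<in>I. tr (single b x c \<otimes>\<^bsub>T\<^esub> p0 (\<psi> c))) + (\<Sum>c\<in>I. tr (single b x c \<otimes>\<^bsub>T\<^esub> p1 (\<psi> ((c - 1) mod int n))))"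
    unfolding sum.distrib by (subst sum_sh) simp
  also have "(\<Sum>c\<in>I. tr (single b x c \<otimes>\<^bsub>T\<^esub> p0 (\<psi> c))) = (\<Sum>c\<in>I. if c = b then tr (x \<otimes>\<^bsub>T\<^esub> p0 (\<psi> c)) else 0)"
    by (rule sum.cong) (use assms 1 in \<open>auto simp: single_def p0_closed L_in\<close>)
  also have "(\<Sum>c\<in>I. tr (single b x c \<otimes>\<^bsub>T\<^esub> p1 (\<psi> ((c - 1) mod int n)))) =
      (\<Sum>c\<in>I. if c = b then tr (x \<otimes>\<^bsub>T\<^esub> p1 (\<psi> ((c - 1) mod int n))) else 0)"
    by (rule sum.cong) (use assms 1 in \<open>auto simp: single_def p1_closed L_in\<close>)
  finally show ?thesis using assms(1) by simp
qed

sublocale frobenius_algebra L eps rot rot'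
proof (unfold_locales, goal_cases)
  case (1 x y)
  then show ?case by (simp add: eps_def tr_add L_in sum.distrib)
next
  case (2 x c)
  then show ?case by (simp add: eps_def L_scale tr_scale L_in sum_distrib_left)
next
  case (3 x) then show ?case by (simp add: rot_def L_carrier)
next
  case (4 x) then show ?case by (simp add: rot'_def L_carrier)
next
  case (5 x)
  show ?case
  proof
    fix b show "rot (rot' x) b = x b"
      using L_out[OF 5, of b] by (auto simp: rot_def rot'_def mod_diff_left_eq)
  qed
next
  case (6 x y) show ?case by (auto simp: rot'_def fun_eq_iff)
next
  case (7 x c) show ?case by (auto simp: rot'_def L_scale fun_eq_iff)
next
  case (8 x y)
  have r: "rot' z \<in> carrier L" if "z \<in> carrier L" for z using that by (simp add: rot'_def L_carrier)
  show ?case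
  proof (rule L_eqI)
    fix b assume b: "0 \<le> b" "b < int n"
    have 1: "((b - 1) mod int n + 1) mod int n = b" using b by (simp add: mod_add_left_eq)
    have 2: "(sh b - 1) mod int n = b" using b by (simp add: mod_diff_left_eq)
    show "rot' (x \<otimes>\<^bsub>L\<^esub> y) b = (rot' x \<otimes>\<^bsub>L\<^esub> rot' y) b"
      using b 8 r 1 2 by (simp add: L_mult_apply) (simp add: rot'_def L_mult_apply)
  qed (use 8 r in \<open>auto simp: L_mult_closed\<close>)
next
  case (9 x y)
  note p = L_in p0_closed p1_closed
  have r: "rot x \<in> carrier L" using 9 by (simp add: rot_def L_carrier)
  have "eps (x \<otimes>\<^bsub>L\<^esub> y) = (\<Sum>b\<in>I. tr (p1 (x b) \<otimes>\<^bsub>T\<^esub> y b)) + (\<Sum>b\<in>I. tr (x (sh b) \<otimes>\<^bsub>T\<^esub> p1 (y b)))"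
    using 9 by (simp add: eps_def L_mult_apply tr_add p tr_mult_p0 sum.distrib)
  also have "(\<Sum>b\<in>I. tr (p1 (x b) \<otimes>\<^bsub>T\<^esub> y b)) = (\<Sum>b\<in>I. tr (p1 (x (sh b)) \<otimes>\<^bsub>T\<^esub> y (sh b)))"
    by (rule sum_sh[symmetric])
  finally have "eps (x \<otimes>\<^bsub>L\<^esub> y) = (\<Sum>b\<in>I. tr (p1 (x (sh b)) \<otimes>\<^bsub>T\<^esub> y (sh b))) + (\<Sum>b\<in>I. tr (x (sh b) \<otimes>\<^bsub>T\<^esub> p1 (y b)))" .
  moreover have "eps (y \<otimes>\<^bsub>L\<^esub> rot x) =
     (\<Sum>b\<in>I. tr (p1 (y b) \<otimes>\<^bsub>T\<^esub> x (sh b))) + (\<Sum>b\<in>I. tr (y (sh b) \<otimes>\<^bsub>T\<^esub> p1 (x (sh b))))"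
    using 9 r by (simp add: eps_def L_mult_apply tr_add p tr_mult_p0 sum.distrib) (simp add: rot_def)
  moreover have "tr (p1 (y b) \<otimes>\<^bsub>T\<^esub> x (sh b)) = tr (x (sh b) \<otimes>\<^bsub>T\<^esub> p1 (y b))"
    "tr (y (sh b) \<otimes>\<^bsub>T\<^esub> p1 (x (sh b))) = tr (p1 (x (sh b)) \<otimes>\<^bsub>T\<^esub> y (sh b))" for b
    using 9 by (auto intro: tr_sym simp: p)
  ultimately show ?case by (simp add: add.commute)
next
  case (10 x)
  note p = L_in p0_closed p1_closed
  have z: "p0 (x b) + p1 (x ((b - 1) mod int n)) = 0" if b: "b \<in> I" for b
  proof (rule tr_nondegenerate)
    show "p0 (x b) + p1 (x ((b - 1) mod int n)) \<in> carrier T" using 10 by (simp add: p)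
    fix y assume y: "y \<in> carrier T"
    show "tr (y \<otimes>\<^bsub>T\<^esub> (p0 (x b) + p1 (x ((b - 1) mod int n)))) = 0"
      using 10(2)[OF single_closed[OF b y]] eps_single_mult[OF b y 10(1)] y 10(1)
      by (simp add: T.r_distrib tr_add p)
  qed
  show ?case
  proof (rule L_eqI)
    fix b assume b: "0 \<le> b" "b < int n"
    have "p0 (p0 (x b) + p1 (x ((b - 1) mod int n))) = 0" using z[of b] b by simp
    then have "p0 (x b) = 0" by (simp add: p0_add)
    moreover have "p1 (p0 (x (sh b)) + p1 (x ((sh b - 1) mod int n))) = 0" using z[of "sh b"] by simp
    then have "p1 (x b) = 0" using b by (simp add: p1_add mod_diff_left_eq)
    ultimately show "x b = 0 b" using p0_p1[of "x b"] by simp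
  qed (use 10 in auto)
next
  case (11 l)
  have "\<exists>z\<in>carrier T. \<forall>x\<in>carrier T. l (single b x) = tr (x \<otimes>\<^bsub>T\<^esub> z)" if b: "b \<in> I" for b
  proof (rule tr_represents)
    fix x y c assume x: "x \<in> carrier T" 
    have "single b (scale T c x) = scale L c (single b x)" by (auto simp: single_def L_scale fun_eq_iff)
    then show "l (single b (scale T c x)) = c * l (single b x)" using 11(2)[OF single_closed[OF b x]] by simp
    assume y: "y \<in> carrier T"
    have "single b (x + y) = single b x + single b y" by (auto simp: single_def fun_eq_iff)
    then show "l (single b (x + y)) = l (single b x) + l (single b y)"
      using 11(1)[OF single_closed[OF b x] single_closed[OF b y]] by simp
  qed
  then have "\<forall>b\<in>I. \<exists>z. z \<in> carrier T \<and> (\<forall>x\<in>carrier T. l (single b x) = tr (x \<otimes>\<^bsub>T\<^esub> z))" by blast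
  then obtain z where z: "\<And>b. b \<in> I \<Longrightarrow> z b \<in> carrier T"
    "\<And>b x. b \<in> I \<Longrightarrow> x \<in> carrier T \<Longrightarrow> l (single b x) = tr (x \<otimes>\<^bsub>T\<^esub> z b)" by metis
  define y where "y = (\<lambda>b. if b \<in> I then p0 (z b) + p1 (z (sh b)) else 0)"
  have y: "y \<in> carrier L" using z by (simp add: y_def L_carrier p0_closed p1_closed)
  have l0: "l 0 = 0" using 11(2)[OF L.zero_closed, of 0] by simp
  have "l x = eps (x \<otimes>\<^bsub>L\<^esub> y)" if x: "x \<in> carrier L" for x
  proof -
    have xs: "x = (\<Sum>b\<in>I. single b (x b))"
      by (rule L_eqI) (use x in \<open>auto simp: fun_sum_apply single_def L_in intro!: L.sum_closed single_closed[unfolded single_def]\<close>)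
    have "l x = (\<Sum>b\<in>I. tr (x b \<otimes>\<^bsub>T\<^esub> z b))"
    proof -
      have "l (\<Sum>b\<in>I. single b (x b)) = (\<Sum>b\<in>I. l (single b (x b)))"
        by (rule additive_sum[where C = "carrier L" and l = l])
          (simp_all only: 11(1) l0 L.zero_closed L.add_closed single_closed L_in[OF x] finite_atLeastLessThan_int)
      also have "\<dots> = (\<Sum>b\<in>I. tr (x b \<otimes>\<^bsub>T\<^esub> z b))"
        by (rule sum.cong) (simp_all only: z(2) L_in[OF x])
      finally show ?thesis by (simp only: xs[symmetric])
    qed
    also have "\<dots> = (\<Sum>b\<in>I. tr (x b \<otimes>\<^bsub>T\<^esub> p0 (z b))) + (\<Sum>b\<in>I. tr (x b \<otimes>\<^bsub>T\<^esub> p1 (z b)))"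
      unfolding sum.distrib[symmetric]
    proof (rule sum.cong[OF refl])
      fix b assume "b \<in> I"
      then have c: "x b \<in> carrier T" "z b \<in> carrier T" using x z(1) by (auto simp: L_in)
      show "tr (x b \<otimes>\<^bsub>T\<^esub> z b) = tr (x b \<otimes>\<^bsub>T\<^esub> p0 (z b)) + tr (x b \<otimes>\<^bsub>T\<^esub> p1 (z b))"
        unfolding mult_p01[OF c, symmetric] by (rule tr_add) (use c in \<open>simp_all add: p0_closed p1_closed\<close>)
    qed
    also have "(\<Sum>b\<in>I. tr (x b \<otimes>\<^bsub>T\<^esub> p1 (z b))) = (\<Sum>b\<in>I. tr (x (sh b) \<otimes>\<^bsub>T\<^esub> p1 (z (sh b))))"
      by (rule sum_sh[symmetric])
    also have "(\<Sum>b\<in>I. tr (x b \<otimes>\<^bsub>T\<^esub> p0 (z b))) + (\<Sum>b\<in>I. tr (x (sh b) \<otimes>\<^bsub>T\<^esub> p1 (z (sh b)))) = eps (x \<otimes>\<^bsub>L\<^esub> y)"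
      unfolding eps_def sum.distrib[symmetric]
      by (rule sum.cong)
        (use x y z in \<open>simp_all add: L_mult_apply tr_add L_in p0_closed p1_closed, simp add: y_def p0_add p1_add\<close>)
    finally show ?thesis .
  qed
  then show ?case using y by blast
qed

lemma J_zero: "J m 0 = 0"
proof -
  have "(0 :: int \<Rightarrow> 't list \<Rightarrow> 't) \<in> families m" by (simp add: families_def T.hc_zero)
  from J_add[OF this this] show ?thesis by simp
qed

lemma J_cocycle: "f \<in> families m \<Longrightarrow> dl m f = 0 \<Longrightarrow> hdiff L m (J m f) = 0"
  using J_dl[of f m] by (simp add: J_zero)

lemma rot'_diag: "rot' (diag a) = diag a"
  by (simp add: rot'_def diag_def fun_eq_iff)

lemma shift_trivial_0:
  assumes f: "f \<in> families 0" and df: "dl 0 f = 0" and g: "\<And>b. pr 0 (f b) = f b"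
  shows "f (b + 1) = f b"
proof -
  have "rot (J 0 f []) = J 0 f []"
    by (rule nakayama_trivial_0[OF J_closed[OF f] J_cocycle[OF f df]])
  then have "J 0 f [] (sh (b mod int n)) = J 0 f [] (b mod int n)"
    by (metis (no_types, lifting) rot_def mod_I atLeastLessThan_iff)
  then have "Q 0 (J 0 f) (b + 1) = Q 0 (J 0 f) b"
    by (auto simp: Q_def fun_eq_iff mod_simps)
  then show ?thesis by (simp add: Q_J[OF f] g)
qed

text \<open>
  Rotation of the indices fixes all cohomology classes of \<open>L\<close> by \<open>nakayama_trivial\<close>, and it leaves
  constant arguments unchanged. Restriction to constant arguments therefore exhibits the
  difference between a cocycle family and its shift as a coboundary.
\<close>

lemma shift_trivial:
  assumes f: "f \<in> families (Suc k)" and df: "dl (Suc k) f = 0" and g: "\<And>b. pr (Suc k) (f b) = f b"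
  shows "\<exists>h\<in>families k. (\<forall>b. pr k (h b) = h b) \<and> (\<forall>b. dl k h b = f (b + 1) - f b)"
proof -
  let ?F = "J (Suc k) f"
  have F: "?F \<in> hcochains L (Suc k)" by (rule J_closed[OF f])
  from nakayama_trivial[OF F J_cocycle[OF f df]] obtain G where G: "G \<in> hcochains L k"
    "\<And>as. as \<in> hargs L (Suc k) \<Longrightarrow> hdiff L k G as = rot (?F (map rot' as)) - ?F as" by blast
  let ?q = "Q k G"
  have q: "?q \<in> families k" by (rule Q_closed[OF G(1)])
  have QF: "Q (Suc k) ?F b = f b" for b by (simp add: Q_J[OF f] g)
  have dq: "dl k ?q b = f (b + 1) - f b" for b
  proof
    fix as
    show "dl k ?q b as = (f (b + 1) - f b) as"
    proof (cases "as \<in> hargs T (Suc k)")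
      case True
      have "dl k ?q b as = hdiff L k G (map diag as) (b mod int n)"
        unfolding Q_hdiff[OF G(1), symmetric] by (simp add: Q_def True)
      also have "\<dots> = rot (?F (map diag as)) (b mod int n) - ?F (map diag as) (b mod int n)"
        using G(2)[OF map_j[OF True]] by (simp add: rot'_diag o_def)
      also have "rot (?F (map diag as)) (b mod int n) = ?F (map diag as) (sh b)"
        by (simp add: rot_def mod_simps)
      also have "\<dots> - ?F (map diag as) (b mod int n) = Q (Suc k) ?F (b + 1) as - Q (Suc k) ?F b as"
        using True by (simp add: Q_def)
      finally show ?thesis by (simp add: QF)
    next
      case False
      then show ?thesis
        using T.hc_out[OF families_in[OF dl_closed[OF q]]] T.hc_out[OF families_in[OF f]] by simp
    qed
  qed
  show ?thesis
  proof (intro bexI conjI allI)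
    show "(\<lambda>b. pr k (?q b)) \<in> families k" by (rule pr_families[OF q])
    show "pr k (pr k (?q b)) = pr k (?q b)" for b by (rule pr_pr[OF families_in[OF q]])
    show "dl k (\<lambda>b. pr k (?q b)) b = f (b + 1) - f b" for b
      by (simp add: dl_pr[OF q] dq pr_diff g)
  qed
qed

end

section \<open>Trivial extensions are symmetric\<close>

context fd_kalgebra
begin

abbreviation TR where "TR \<equiv> trivial_ext A"

lemma TR_simps:
  "carrier TR = carrier A \<times> dual_space A"
  "scale TR c x = (scale A c (fst x), \<lambda>y. c * snd x y)"
  "\<one>\<^bsub>TR\<^esub> = (\<one>, 0)"
  "x \<otimes>\<^bsub>TR\<^esub> y = (fst x \<otimes> fst y, dual_lact A (fst x) (snd y) + dual_ract A (snd x) (fst y))"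
  by (simp_all add: trivial_ext_def case_prod_beta)

lemma dual_zero: "0 \<in> dual_space A"
  by (simp add: dual_space_def)

lemma dual_add: "u \<in> dual_space A \<Longrightarrow> v \<in> dual_space A \<Longrightarrow> u + v \<in> dual_space A"
  by (auto simp: dual_space_def algebra_simps)

lemma dual_scale: "u \<in> dual_space A \<Longrightarrow> (\<lambda>x. c * u x) \<in> dual_space A"
  by (auto simp: dual_space_def algebra_simps)

lemma dual_lact: "u \<in> dual_space A \<Longrightarrow> a \<in> carrier A \<Longrightarrow> dual_lact A a u \<in> dual_space A"
  by (auto simp: dual_space_def dual_lact_def l_distrib scale_l)

lemma dual_ract: "u \<in> dual_space A \<Longrightarrow> a \<in> carrier A \<Longrightarrow> dual_ract A u a \<in> dual_space A"
  by (auto simp: dual_space_def dual_ract_def r_distrib scale_r)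

lemma dual_outside: "u \<in> dual_space A \<Longrightarrow> x \<notin> carrier A \<Longrightarrow> u x = 0"
  by (simp add: dual_space_def)

lemma dual_apply_add: "u \<in> dual_space A \<Longrightarrow> x \<in> carrier A \<Longrightarrow> y \<in> carrier A \<Longrightarrow> u (x + y) = u x + u y"
  and dual_apply_scale: "u \<in> dual_space A \<Longrightarrow> x \<in> carrier A \<Longrightarrow> u (scale A c x) = c * u x"
  by (auto simp: dual_space_def)

lemma TR_vector_space: "vector_space (scale TR)"
  by unfold_locales (auto simp: TR_simps vs.scale_right_distrib vs.scale_left_distrib algebra_simps fun_eq_iff)

lemma TR_kalgebra: "kalgebra TR"
proof -
  interpret V: vector_space "scale TR" by (rule TR_vector_space)
  have sub: "module.subspace (scale TR) (carrier TR)"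
    by (auto simp: V.subspace_def TR_simps zero_prod_def dual_zero dual_add dual_scale)
  have cl: "x \<otimes>\<^bsub>TR\<^esub> y \<in> carrier TR" if "x \<in> carrier TR" "y \<in> carrier TR" for x y
    using that by (auto simp: TR_simps dual_lact dual_ract dual_add)
  have ad: "x + y \<in> carrier TR" if "x \<in> carrier TR" "y \<in> carrier TR" for x y
    using that by (auto simp: TR_simps dual_add)
  have sc: "scale TR c x \<in> carrier TR" if "x \<in> carrier TR" for x c
    using that by (auto simp: TR_simps dual_scale)
  have f: "fst (x \<otimes>\<^bsub>TR\<^esub> y) = fst x \<otimes> fst y" for x y by (simp add: TR_simps)
  have s: "snd (x \<otimes>\<^bsub>TR\<^esub> y) z = (if z \<in> carrier A then snd y (z \<otimes> fst x) + snd x (fst y \<otimes> z) else 0)" for x y z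
    by (simp add: TR_simps dual_lact_def dual_ract_def)
  have m: "fst x \<in> carrier A" "snd x \<in> dual_space A" if "x \<in> carrier TR" for x
    using that by (auto simp: TR_simps)
  have eqI: "x = y" if "fst x = fst y" "\<And>z. snd x z = snd y z" for x y
    using that by (simp add: prod_eq_iff fun_eq_iff)
  show ?thesis
  proof
    show "module.subspace (scale TR) (carrier TR)" by (rule sub)
    show "\<one>\<^bsub>TR\<^esub> \<in> carrier TR" by (simp add: TR_simps dual_zero)
    fix x y z c assume c: "x \<in> carrier TR" "y \<in> carrier TR"
    note mm = m[OF c(1)] m[OF c(2)]
    show "x \<otimes>\<^bsub>TR\<^esub> y \<in> carrier TR" by (rule cl[OF c])
    show "\<one>\<^bsub>TR\<^esub> \<otimes>\<^bsub>TR\<^esub> x = x"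
      by (rule eqI) (use mm in \<open>auto simp: f s TR_simps(3) dual_outside\<close>)
    show "x \<otimes>\<^bsub>TR\<^esub> \<one>\<^bsub>TR\<^esub> = x"
      by (rule eqI) (use mm in \<open>auto simp: f s TR_simps(3) dual_outside\<close>)
    show "scale TR c x \<otimes>\<^bsub>TR\<^esub> y = scale TR c (x \<otimes>\<^bsub>TR\<^esub> y)"
      using mm by (intro eqI) (simp_all add: TR_simps dual_lact_def dual_ract_def scale_l scale_r dual_apply_scale algebra_simps)
    show "x \<otimes>\<^bsub>TR\<^esub> scale TR c y = scale TR c (x \<otimes>\<^bsub>TR\<^esub> y)"
      using mm by (intro eqI) (simp_all add: TR_simps dual_lact_def dual_ract_def scale_l scale_r dual_apply_scale algebra_simps)
    assume z: "z \<in> carrier TR"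
    note mm = mm m[OF z]
    show "x \<otimes>\<^bsub>TR\<^esub> y \<otimes>\<^bsub>TR\<^esub> z = x \<otimes>\<^bsub>TR\<^esub> (y \<otimes>\<^bsub>TR\<^esub> z)"
      using mm by (intro eqI) (simp_all add: f s m_assoc dual_apply_add add_ac)
    show "(x + y) \<otimes>\<^bsub>TR\<^esub> z = x \<otimes>\<^bsub>TR\<^esub> z + y \<otimes>\<^bsub>TR\<^esub> z"
      using mm by (intro eqI) (simp_all add: f s l_distrib r_distrib dual_apply_add add_ac)
    show "z \<otimes>\<^bsub>TR\<^esub> (x + y) = z \<otimes>\<^bsub>TR\<^esub> x + z \<otimes>\<^bsub>TR\<^esub> y"
      using mm by (intro eqI) (simp_all add: f s l_distrib r_distrib dual_apply_add add_ac)
  qed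
qed

end

definition q0 :: "'a \<times> 'b \<Rightarrow> 'a \<times> 'b::zero" where "q0 x = (fst x, 0)"
definition q1 :: "'a \<times> 'b \<Rightarrow> 'a::zero \<times> 'b" where "q1 x = (0, snd x)"

context fd_kalgebra
begin

definition "trace x = snd x \<one>"

lemma dual_apply_zero: "u \<in> dual_space A \<Longrightarrow> u 0 = 0"
  using dual_apply_scale[of u 0 0] by simp

lemma TR_two_step: "two_step_algebra TR q0 q1"
proof -
  interpret T: kalgebra TR by (rule TR_kalgebra)
  have m: "fst x \<in> carrier A" "snd x \<in> dual_space A" if "x \<in> carrier TR" for x
    using that by (auto simp: TR_simps)
  show ?thesis
    by unfold_locales
      (auto simp: q0_def q1_def TR_simps dual_zero plus_prod_def zero_prod_def fun_eq_iff
        dual_lact_def dual_ract_def dual_apply_zero)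
qed

lemma dual_basis:
  obtains B c where "finite B" "B \<subseteq> carrier A" "\<And>b. c b \<in> dual_space A"
    "\<And>x. x \<in> carrier A \<Longrightarrow> x = (\<Sum>b\<in>B. scale A (c b x) b)"
proof -
  obtain S where S: "finite S" "vs.span S = carrier A" using finite_dim by blast
  obtain B where B: "B \<subseteq> carrier A" "vs.independent B" "carrier A \<subseteq> vs.span B"
    by (rule vs.maximal_independent_subset[of "carrier A"])
  have fin: "finite B" using vs.independent_span_bound[OF S(1) B(2)] B(1) S(2) by simp
  define c where "c = (\<lambda>b x. if x \<in> carrier A then vs.representation B x b else 0)"
  have "c b \<in> dual_space A" for b
    using B(3) by (auto simp: dual_space_def c_def vs.representation_add[OF B(2)] vs.representation_scale[OF B(2)] subset_iff)
  moreover have "x = (\<Sum>b\<in>B. scale A (c b x) b)" if "x \<in> carrier A" for x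
    using vs.sum_representation_eq[OF B(2) _ fin subset_refl, of x] that B(3) by (auto simp: c_def)
  ultimately show ?thesis using that fin B(1) by blast
qed

lemma dual_expand:
  assumes "finite B" "B \<subseteq> carrier A" "\<And>x. x \<in> carrier A \<Longrightarrow> x = (\<Sum>b\<in>B. scale A (c b x) b)"
    and "u \<in> dual_space A" "x \<in> carrier A"
  shows "u x = (\<Sum>b\<in>B. c b x * u b)"
proof -
  have "u (\<Sum>b\<in>B. scale A (c b x) b) = (\<Sum>b\<in>B. u (scale A (c b x) b))"
    by (rule additive_sum[where C = "carrier A" and l = u])
      (use assms(1,2,4) in \<open>auto simp: dual_apply_add dual_apply_zero\<close>)
  also have "\<dots> = (\<Sum>b\<in>B. c b x * u b)"
    by (rule sum.cong) (use assms(2,4) in \<open>auto simp: dual_apply_scale\<close>)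
  finally show ?thesis using assms(3)[OF assms(5)] by simp
qed

lemma trace_mult: "\<lbrakk>x \<in> carrier TR; y \<in> carrier TR\<rbrakk> \<Longrightarrow>
    trace (x \<otimes>\<^bsub>TR\<^esub> y) = snd y (fst x) + snd x (fst y)"
  by (auto simp: trace_def TR_simps dual_lact_def dual_ract_def)

lemma trace_nondegenerate:
  assumes x: "x \<in> carrier TR" and z: "\<And>y. y \<in> carrier TR \<Longrightarrow> trace (y \<otimes>\<^bsub>TR\<^esub> x) = 0"
  shows "x = 0"
proof -
  obtain B c where B: "finite B" "B \<subseteq> carrier A" "\<And>b. c b \<in> dual_space A"
    "\<And>x. x \<in> carrier A \<Longrightarrow> x = (\<Sum>b\<in>B. scale A (c b x) b)" by (rule dual_basis, rule that)
  have m: "fst x \<in> carrier A" "snd x \<in> dual_space A" using x by (auto simp: TR_simps)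
  have "v (fst x) = 0" if "v \<in> dual_space A" for v
  proof -
    have "(0, v) \<in> carrier TR" using that by (simp add: TR_simps)
    from z[OF this] trace_mult[OF this x] show ?thesis using m by (simp add: dual_apply_zero)
  qed
  then have "c b (fst x) = 0" for b using B(3) by blast
  then have "(\<Sum>b\<in>B. scale A (c b (fst x)) b) = 0" by simp
  then have "fst x = 0" using B(4)[OF m(1)] by (rule trans[rotated])
  moreover have "snd x = 0"
  proof
    fix a show "snd x a = 0 a"
    proof (cases "a \<in> carrier A")
      case True
      then have "(a, 0) \<in> carrier TR" by (simp add: TR_simps dual_zero)
      from z[OF this] trace_mult[OF this x] show ?thesis by simp
    qed (use m in \<open>simp add: dual_outside\<close>)
  qed
  ultimately show ?thesis by (simp add: prod_eq_iff)
qed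

lemma trace_represents:
  assumes add: "\<And>x y. x \<in> carrier TR \<Longrightarrow> y \<in> carrier TR \<Longrightarrow> l (x + y) = l x + l y"
    and sc: "\<And>c x. x \<in> carrier TR \<Longrightarrow> l (scale TR c x) = c * l x"
  shows "\<exists>z\<in>carrier TR. \<forall>x\<in>carrier TR. l x = trace (x \<otimes>\<^bsub>TR\<^esub> z)"
proof -
  obtain B c where B: "finite B" "B \<subseteq> carrier A" "\<And>b. c b \<in> dual_space A"
    "\<And>x. x \<in> carrier A \<Longrightarrow> x = (\<Sum>b\<in>B. scale A (c b x) b)" by (rule dual_basis, rule that)
  define w where "w = (\<lambda>a. if a \<in> carrier A then l (a, 0) else 0)"
  define z where "z = ((\<Sum>b\<in>B. scale A (l (0, c b)) b), w)"
  have in0: "(a, 0) \<in> carrier TR" if "a \<in> carrier A" for a using that by (simp add: TR_simps dual_zero)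
  have in1: "(0, u) \<in> carrier TR" if "u \<in> dual_space A" for u using that by (simp add: TR_simps)
  have l1: "l (a + b, 0) = l (a, 0) + l (b, 0)" if "a \<in> carrier A" "b \<in> carrier A" for a b
    using add[OF in0[OF that(1)] in0[OF that(2)]] by simp
  have "(scale A c a, 0) = scale TR c (a, 0)" for c a
    by (simp add: TR_simps fun_eq_iff)
  then have l2: "l (scale A c a, 0) = c * l (a, 0)" if "a \<in> carrier A" for c a
    using sc[OF in0[OF that]] by simp
  have "w \<in> dual_space A"
    by (auto simp: dual_space_def w_def l1 l2)
  moreover have "fst z \<in> carrier A" unfolding z_def using B(2) by (auto intro!: sum_closed)
  ultimately have z: "z \<in> carrier TR" by (simp add: TR_simps z_def)
  have "\<forall>x\<in>carrier TR. l x = trace (x \<otimes>\<^bsub>TR\<^esub> z)"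
  proof
    fix x assume x: "x \<in> carrier TR"
    then have m: "fst x \<in> carrier A" "snd x \<in> dual_space A" by (auto simp: TR_simps)
    have u: "snd x (\<Sum>b\<in>B. scale A (l (0, c b)) b) = (\<Sum>b\<in>B. l (0, c b) * snd x b)"
    proof -
      have "snd x (\<Sum>b\<in>B. scale A (l (0, c b)) b) = (\<Sum>b\<in>B. snd x (scale A (l (0, c b)) b))"
        by (rule additive_sum[where C = "carrier A" and l = "snd x"])
          (use B m in \<open>auto simp: dual_apply_add dual_apply_zero\<close>)
      also have "\<dots> = (\<Sum>b\<in>B. l (0, c b) * snd x b)"
        by (rule sum.cong) (use B m in \<open>auto simp: dual_apply_scale\<close>)
      finally show ?thesis .
    qed
    have "(0, snd x) = (\<Sum>b\<in>B. scale TR (snd x b) (0, c b))"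
    proof (rule prod_eqI)
      have "fst (\<Sum>b\<in>K. scale TR (snd x b) (0, c b)) = 0" for K
        by (induction K rule: infinite_finite_induct) (auto simp: TR_simps)
      then show "fst (0, snd x) = fst (\<Sum>b\<in>B. scale TR (snd x b) (0, c b))" by simp
      have s: "snd (\<Sum>b\<in>K. scale TR (snd x b) (0, c b)) a = (\<Sum>b\<in>K. snd x b * c b a)" for K a
        by (induction K rule: infinite_finite_induct) (auto simp: TR_simps)
      show "snd (0, snd x) = snd (\<Sum>b\<in>B. scale TR (snd x b) (0, c b))"
      proof
        fix a show "snd (0, snd x) a = snd (\<Sum>b\<in>B. scale TR (snd x b) (0, c b)) a"
        proof (cases "a \<in> carrier A")
          case True
          then show ?thesis using dual_expand[OF B(1,2,4) m(2) True] by (simp add: s mult.commute)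
        next
          case False
          then show ?thesis using m B(3) by (simp add: s dual_outside)
        qed
      qed
    qed
    then have "l (0, snd x) = l (\<Sum>b\<in>B. scale TR (snd x b) (0, c b))" by simp
    also have "\<dots> = (\<Sum>b\<in>B. l (scale TR (snd x b) (0, c b)))"
    proof (rule additive_sum[where C = "carrier TR"])
      interpret T: kalgebra TR by (rule TR_kalgebra)
      show "l 0 = 0" using sc[OF T.zero_closed, of 0] by simp
      show "scale TR (snd x k) (0, c k) \<in> carrier TR" for k using in1[OF B(3)] by simp
      show "x + y \<in> carrier TR" if "x \<in> carrier TR" "y \<in> carrier TR" for x y using that by simp
    qed (use add B(1) TR_kalgebra in \<open>auto intro: kalgebra.zero_closed\<close>)
    also have "\<dots> = (\<Sum>b\<in>B. l (0, c b) * snd x b)" by (simp add: sc[OF in1[OF B(3)]] mult.commute)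
    finally have "l (0, snd x) = snd x (fst z)" by (simp add: z_def u)
    moreover have "l x = l (fst x, 0) + l (0, snd x)"
      using add[OF in0[OF m(1)] in1[OF m(2)]] by simp
    ultimately show "l x = trace (x \<otimes>\<^bsub>TR\<^esub> z)"
      using trace_mult[OF x z] m by (simp add: z_def w_def)
  qed
  with z show ?thesis by blast
qed

lemma grading_eq:
  assumes n: "n \<ge> 2"
  shows "trivial_ext_cyclic_grading A n c =
    (if c = 0 then carrier A \<times> {0} else if c = 1 then {0} \<times> dual_space A else {0})"
proof -
  interpret T: kalgebra TR by (rule TR_kalgebra)
  let ?U = "\<Union>i\<in>{i. i mod int n = c}. trivial_ext_grading A i"
  note z = zero_prod_def
  have s0: "T.vs.subspace (carrier A \<times> {0})"
    by (auto simp: T.vs.subspace_def z TR_simps zero_fun_def)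
  have s1: "T.vs.subspace ({0} \<times> dual_space A)"
    by (auto simp: T.vs.subspace_def z TR_simps dual_zero dual_add dual_scale)
  have "T.vs.span ?U = (if c = 0 then carrier A \<times> {0} else if c = 1 then {0} \<times> dual_space A else {0})"
  proof -
    consider "c = 0" | "c = 1" | "c \<noteq> 0" "c \<noteq> 1" by blast
    then show ?thesis
    proof cases
      case 1
      have "?U = carrier A \<times> {0}"
        using 1 n by (auto simp: trivial_ext_grading_def z split: if_splits intro!: exI[of _ 0])
      then show ?thesis using s0 by (simp only: 1 T.vs.span_eq_iff if_True refl simp_thms)
    next
      case 2
      have "?U = {0} \<times> dual_space A"
        using 2 n by (auto simp: trivial_ext_grading_def z dual_zero split: if_splits intro!: exI[of _ 1])
      then show ?thesis using s1 by (simp only: 2 T.vs.span_eq_iff) (simp add: T.vs.span_eq_iff)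
    next
      case 3
      have "?U \<subseteq> {0}"
        using 3 n by (auto simp: trivial_ext_grading_def z split: if_splits)
      then have "T.vs.span ?U \<subseteq> T.vs.span {0}" by (rule T.vs.span_mono)
      then show ?thesis using 3 T.vs.span_zero by (auto simp: T.vs.span_insert_0)
    qed
  qed
  then show ?thesis unfolding trivial_ext_cyclic_grading_def push_grading_def .
qed

lemma component_eq:
  assumes n: "n \<ge> 2" and t: "t \<in> carrier TR" and c: "c \<in> {0..<int n}"
  shows "component (integer_mod_group n) (trivial_ext_cyclic_grading A n) c t =
    (if c = 0 then q0 t else if c = 1 then q1 t else 0)"
proof -
  let ?s = "\<lambda>c :: int. if c = 0 then q0 t else if c = 1 then q1 t else 0"
  have carr: "carrier (integer_mod_group n) = {0..<int n}" using n by (simp add: carrier_integer_mod_group)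
  have m: "fst t \<in> carrier A" "snd t \<in> dual_space A" using t by (auto simp: TR_simps)
  have sum2: "(\<Sum>\<alpha>\<in>{0..<int n}. s \<alpha>) = s 0 + s 1"
    if "\<And>\<alpha>. \<alpha> \<noteq> 0 \<Longrightarrow> \<alpha> \<noteq> 1 \<Longrightarrow> s \<alpha> = 0" for s
  proof -
    have "(\<Sum>\<alpha>\<in>{0..<int n}. s \<alpha>) = (\<Sum>\<alpha>\<in>{0, 1}. s \<alpha>)"
      by (rule sum.mono_neutral_right) (use n that in auto)
    then show ?thesis by simp
  qed
  have "(THE s. (\<forall>\<alpha>\<in>carrier (integer_mod_group n). s \<alpha> \<in> trivial_ext_cyclic_grading A n \<alpha>)
      \<and> (\<forall>\<alpha>. \<alpha> \<notin> carrier (integer_mod_group n) \<longrightarrow> s \<alpha> = 0)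
      \<and> (\<Sum>\<alpha>\<in>carrier (integer_mod_group n). s \<alpha>) = t) = ?s"
  proof (rule the_equality)
    show "(\<forall>\<alpha>\<in>carrier (integer_mod_group n). ?s \<alpha> \<in> trivial_ext_cyclic_grading A n \<alpha>)
      \<and> (\<forall>\<alpha>. \<alpha> \<notin> carrier (integer_mod_group n) \<longrightarrow> ?s \<alpha> = 0)
      \<and> (\<Sum>\<alpha>\<in>carrier (integer_mod_group n). ?s \<alpha>) = t"
      unfolding carr using n m by (subst sum2) (auto simp: grading_eq[OF n] q0_def q1_def)
  next
    fix s
    assume s: "(\<forall>\<alpha>\<in>carrier (integer_mod_group n). s \<alpha> \<in> trivial_ext_cyclic_grading A n \<alpha>)
      \<and> (\<forall>\<alpha>. \<alpha> \<notin> carrier (integer_mod_group n) \<longrightarrow> s \<alpha> = 0)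
      \<and> (\<Sum>\<alpha>\<in>carrier (integer_mod_group n). s \<alpha>) = t"
    have s2: "s \<alpha> = 0" if "\<alpha> \<noteq> 0" "\<alpha> \<noteq> 1" for \<alpha>
    proof (cases "\<alpha> \<in> {0..<int n}")
      case True
      then have "s \<alpha> \<in> trivial_ext_cyclic_grading A n \<alpha>" using s unfolding carr by blast
      then show ?thesis using that by (simp add: grading_eq[OF n])
    qed (use s in \<open>simp add: carr\<close>)
    have t2: "t = s 0 + s 1" using s sum2[OF s2] unfolding carr by simp
    have "s 0 \<in> carrier A \<times> {0}" "s 1 \<in> {0} \<times> dual_space A"
      using s n unfolding carr by (auto simp: grading_eq[OF n] dest: bspec[of _ _ 0] bspec[of _ _ 1])
    then have "s 0 = q0 t" "s 1 = q1 t" unfolding t2 by (auto simp: q0_def q1_def)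
    then show "s = ?s" using s2 by (intro ext) simp
  qed
  then show ?thesis unfolding component_def by simp
qed

lemma smash_cover:
  assumes n: "n \<ge> 2"
  shows "symmetric_cover TR q0 q1 n (smash_trivial_ext A n) trace"
proof -
  interpret T: two_step_algebra TR q0 q1 by (rule TR_two_step)
  let ?L = "smash_trivial_ext A n"
  have carr: "carrier (integer_mod_group n) = {0..<int n}" using n by (simp add: carrier_integer_mod_group)
  have Lc: "carrier ?L = {\<phi>. (\<forall>b\<in>{0..<int n}. \<phi> b \<in> carrier TR) \<and> (\<forall>b. b \<notin> {0..<int n} \<longrightarrow> \<phi> b = 0)}"
    by (simp add: smash_trivial_ext_def smash_def carr)
  have cov: "cyclic_cover TR q0 q1 n ?L"
  proof (unfold_locales, goal_cases)
    case 1 show ?case by (rule n)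
  next
    case 2 show ?case by (rule Lc)
  next
    case (3 x y)
    show ?case
    proof
      fix b
      show "(x \<otimes>\<^bsub>?L\<^esub> y) b = (if b \<in> {0..<int n} then x b \<otimes>\<^bsub>TR\<^esub> q0 (y b) + x ((b + 1) mod int n) \<otimes>\<^bsub>TR\<^esub> q1 (y b) else 0)"
      proof (cases "b \<in> {0..<int n}")
        case False
        then show ?thesis by (auto simp add: smash_trivial_ext_def smash_def carr)
      next
        case True
        have yb: "y b \<in> carrier TR" using 3 True unfolding Lc by blast
        have xc: "x c \<in> carrier TR" for c
          using 3(1) unfolding Lc by (cases "c \<in> {0..<int n}") auto
        have ne: "(b + 1) mod int n \<noteq> b"
        proof
          assume "(b + 1) mod int n = b"
          then show False using True n by (cases "b + 1 = int n") auto
        qed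
        have inv: "inv\<^bsub>integer_mod_group n\<^esub> b = (- b) mod int n"
          by (rule inv_integer_mod_group) (use True carr in simp)
        have e0: "(a - b) mod int n = 0 \<longleftrightarrow> a = b" if "a \<in> {0..<int n}" for a
          using that True mod_eq_dvd_iff[of a "int n" b] by (simp add: dvd_eq_mod_eq_0)
        have e1: "(a - b) mod int n = 1 \<longleftrightarrow> a = (b + 1) mod int n" if "a \<in> {0..<int n}" for a
          using that n mod_eq_dvd_iff[of a "int n" "b + 1"] mod_eq_dvd_iff[of "a - b" "int n" 1] by (simp add: algebra_simps)
        have md: "(a + - b mod int n) mod int n = (a - b) mod int n" for a
          using mod_add_right_eq[of a "- b" "int n"] by simp
        have "(x \<otimes>\<^bsub>?L\<^esub> y) b = (\<Sum>a\<in>{0..<int n}. x a \<otimes>\<^bsub>TR\<^esub>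
            component (integer_mod_group n) (trivial_ext_cyclic_grading A n) ((a - b) mod int n) (y b))"
          using True by (simp add: smash_trivial_ext_def smash_def carr inv md)
        also have "\<dots> = (\<Sum>a\<in>{0..<int n}. (if a = b then x a \<otimes>\<^bsub>TR\<^esub> q0 (y b) else 0)
            + (if a = (b + 1) mod int n then x a \<otimes>\<^bsub>TR\<^esub> q1 (y b) else 0))"
        proof (rule sum.cong[OF refl])
          fix a assume a: "a \<in> {0..<int n}"
          have "(a - b) mod int n \<in> {0..<int n}" using n by simp
          from component_eq[OF n yb this]
          show "x a \<otimes>\<^bsub>TR\<^esub> component (integer_mod_group n) (trivial_ext_cyclic_grading A n) ((a - b) mod int n) (y b) =
            (if a = b then x a \<otimes>\<^bsub>TR\<^esub> q0 (y b) else 0) + (if a = (b + 1) mod int n then x a \<otimes>\<^bsub>TR\<^esub> q1 (y b) else 0)"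
            unfolding e0[OF a] e1[OF a] using ne xc by auto
        qed
        also have "\<dots> = x b \<otimes>\<^bsub>TR\<^esub> q0 (y b) + x ((b + 1) mod int n) \<otimes>\<^bsub>TR\<^esub> q1 (y b)"
          using True n by (simp add: sum.distrib)
        finally show ?thesis using True by simp
      qed
    qed
  next
    case 4 show ?case by (simp add: smash_trivial_ext_def smash_def carr)
  next
    case (5 c x) show ?case by (simp add: smash_trivial_ext_def smash_def)
  qed
  interpret C: cyclic_cover TR q0 q1 n ?L by (rule cov)
  show ?thesis
  proof (unfold_locales, goal_cases)
    case (1 x y) show ?case by (simp add: trace_def)
  next
    case (2 x c) show ?case by (simp add: trace_def TR_simps)
  next
    case (3 x y) then show ?case by (simp add: trace_mult)
  next
    case (4 x) show ?case by (simp add: trace_def q0_def)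
  next
    case (5 x) then show ?case by (rule trace_nondegenerate)
  next
    case (6 l) then show ?case by (rule trace_represents)
  qed
qed

lemma grading_preserving_iff:
  assumes n: "n \<ge> 2"
  shows "grading_preserving (integer_mod_group n) (trivial_ext_cyclic_grading A n) f \<longleftrightarrow>
    cyclic_cover.degree_preserving TR q0 q1 n 0 f"
proof -
  interpret C: symmetric_cover TR q0 q1 n "smash_trivial_ext A n" trace by (rule smash_cover[OF n])
  have carr: "carrier (integer_mod_group n) = {0..<int n}" using n by (simp add: carrier_integer_mod_group)
  have pc: "C.piece c = trivial_ext_cyclic_grading A n (c mod int n)" for c
    using n unfolding grading_eq[OF n] C.piece_def C.hpart_def
    by (auto simp: q0_def q1_def TR_simps dual_zero zero_prod_def)
  have fold: "foldr (\<lambda>x y. (x + y) mod int n) cs 0 mod int n = sum_list cs mod int n" for cs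
    by (induction cs) (auto simp: mod_add_right_eq, metis mod_add_right_eq)
  have fold': "foldr (\<lambda>x y. (x + y) mod int n) cs 0 = sum_list cs mod int n" for cs
    using fold[of cs] by (cases cs) auto
  show ?thesis
  proof
    assume g: "grading_preserving (integer_mod_group n) (trivial_ext_cyclic_grading A n) f"
    show "C.degree_preserving 0 f"
      unfolding C.degree_preserving_def
    proof (intro allI impI)
      fix cs xs assume "list_all2 (\<lambda>x c. x \<in> C.piece c) xs cs"
      then have "list_all2 (\<lambda>x c. x \<in> trivial_ext_cyclic_grading A n c) xs (map (\<lambda>c. c mod int n) cs)"
        by (simp add: list_all2_map2 pc)
      moreover have "set (map (\<lambda>c. c mod int n) cs) \<subseteq> carrier (integer_mod_group n)"
        using n by (auto simp: carr)
      ultimately have "f xs \<in> trivial_ext_cyclic_grading A n (foldr (\<lambda>x y. (x + y) mod int n) (map (\<lambda>c. c mod int n) cs) 0)"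
        using g unfolding grading_preserving_def by auto
      also have "foldr (\<lambda>x y. (x + y) mod int n) (map (\<lambda>c. c mod int n) cs) 0 = sum_list cs mod int n"
        unfolding fold' by (induction cs) (auto, metis mod_add_cong mod_mod_trivial)
      finally show "f xs \<in> C.piece (0 + sum_list cs)" by (simp add: pc)
    qed
  next
    assume d: "C.degree_preserving 0 f"
    show "grading_preserving (integer_mod_group n) (trivial_ext_cyclic_grading A n) f"
      unfolding grading_preserving_def
    proof (intro allI impI)
      fix cs xs assume c: "set cs \<subseteq> carrier (integer_mod_group n)"
        and l: "list_all2 (\<lambda>x c. x \<in> trivial_ext_cyclic_grading A n c) xs cs"
      have "list_all2 (\<lambda>x c. x \<in> C.piece c) xs cs"
        using l c by (auto simp: list_all2_conv_all_nth pc carr subset_iff)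
      then have "f xs \<in> C.piece (sum_list cs)" using d unfolding C.degree_preserving_def by force
      then show "f xs \<in> trivial_ext_cyclic_grading A n (foldr (monoid.mult (integer_mod_group n)) cs \<one>\<^bsub>integer_mod_group n\<^esub>)"
        by (simp add: pc fold')
    qed
  qed
qed

end

section \<open>Degree-preserving periodic families\<close>

text \<open>
  Partial sums in both directions, starting at zero; they stay in every subgroup that contains
  the sequence.
\<close>

lemma antidifference:
  fixes h :: "int \<Rightarrow> 'c::ab_group_add"
  assumes "0 \<in> S" "\<And>x y. x \<in> S \<Longrightarrow> y \<in> S \<Longrightarrow> x + y \<in> S" "\<And>x. x \<in> S \<Longrightarrow> - x \<in> S" "\<And>b. h b \<in> S"
  obtains g where "\<And>b. g (b + 1) = g b + h b" "\<And>b. g b \<in> S"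
proof
  define g where "g = (\<lambda>b. (\<Sum>i<nat b. h (int i)) - (\<Sum>i<nat (- b). h (- int i - 1)))"
  have s: "(\<Sum>i<k. f i) \<in> S" if "\<And>i. f i \<in> S" for f :: "nat \<Rightarrow> 'c" and k
    using that by (induction k) (auto simp: assms)
  have "g b \<in> S" for b
    using assms(2)[OF s assms(3)[OF s], of "\<lambda>i. h (int i)" "\<lambda>i. h (- int i - 1)" "nat b" "nat (- b)"] assms(4)
    by (simp add: g_def)
  then show "g b \<in> S" for b .
  show "g (b + 1) = g b + h b" for b
  proof (cases "b \<ge> 0")
    case True
    then have "nat (b + 1) = Suc (nat b)" "nat (- b) = 0" "nat (- (b + 1)) = 0" by auto
    then show ?thesis using True by (simp add: g_def)
  next
    case False
    then have "nat (- b) = Suc (nat (- (b + 1)))" "nat b = 0" "nat (b + 1) = 0" "- int (nat (- (b + 1))) - 1 = b" by auto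
    then show ?thesis by (simp add: g_def)
  qed
qed

context two_step_algebra
begin

text \<open>
  Right multiplication with the cocycle of the grading derivation. On cohomology its kernel and
  image describe the singular extension of the base.
\<close>

definition R :: "nat \<Rightarrow> ('t list \<Rightarrow> 't) \<Rightarrow> 't list \<Rightarrow> 't" where "R m v = hcup T m 1 v E.D1"
definition sm :: "'k \<Rightarrow> ('t list \<Rightarrow> 't) \<Rightarrow> 't list \<Rightarrow> 't" where "sm c f = (\<lambda>xs. scale T c (f xs))"
definition sg :: "nat \<Rightarrow> ('t list \<Rightarrow> 't) \<Rightarrow> 't list \<Rightarrow> 't" where "sg m f = (if even m then - f else f)"

lemma sg_sg [simp]: "sg m (sg m f) = f"
  by (simp add: sg_def)

lemma sg_closed: "f \<in> hcochains T m \<Longrightarrow> sg k f \<in> hcochains T m"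
  by (simp add: sg_def T.hc_neg)

lemma sg_add: "sg m (f + g) = sg m f + sg m g"
  by (simp add: sg_def)

lemma sg_Suc: "sg (Suc m) f = - sg m f"
  by (simp add: sg_def)

lemma sg_neg: "sg m (- f) = - sg m f"
  by (simp add: sg_def)

lemma sg_zero [simp]: "sg m 0 = 0"
  by (simp add: sg_def)

lemma sm_closed: "f \<in> hcochains T m \<Longrightarrow> sm c f \<in> hcochains T m"
  unfolding sm_def by (rule T.hc_scale)

lemma sm_add: "sm (c + d) f = sm c f + sm d f"
  by (rule ext) (simp add: sm_def T.vs.scale_left_distrib)

lemma sm_0 [simp]: "sm 0 f = 0" and sm_1 [simp]: "sm 1 f = f"
  by (auto simp: sm_def)

lemma R_closed: "v \<in> hcochains T m \<Longrightarrow> R m v \<in> hcochains T (Suc m)"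
  using T.hcup_closed[OF _ E.D1_closed, of v m] by (simp add: R_def)

lemma R_add: "f \<in> hcochains T m \<Longrightarrow> g \<in> hcochains T m \<Longrightarrow> R m (f + g) = R m f + R m g"
  unfolding R_def by (rule T.hcup_add_l[OF _ _ E.D1_closed])

lemma R_sm: "f \<in> hcochains T m \<Longrightarrow> R m (sm c f) = sm c (R m f)"
  unfolding R_def sm_def by (rule T.hcup_scale_l[OF _ E.D1_closed])

lemma R_zero [simp]: "R m 0 = 0"
  using R_sm[OF T.hc_zero, of m 0] by simp

lemma R_neg: "f \<in> hcochains T m \<Longrightarrow> R m (- f) = - R m f"
  using R_add[of f m "- f"] by (simp add: T.hc_neg eq_neg_iff_add_eq_0 add.commute)

lemma R_diff: "f \<in> hcochains T m \<Longrightarrow> g \<in> hcochains T m \<Longrightarrow> R m (f - g) = R m f - R m g"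
  using R_add[of f m "- g"] by (simp add: T.hc_neg R_neg)

lemma R_sg: "f \<in> hcochains T m \<Longrightarrow> R m (sg k f) = sg k (R m f)"
  by (simp add: sg_def R_neg)

lemma hdiff_sg: "f \<in> hcochains T m \<Longrightarrow> hdiff T m (sg k f) = sg k (hdiff T m f)"
  by (simp add: sg_def T.hdiff_neg)

lemma hdiff_sm: "f \<in> hcochains T m \<Longrightarrow> hdiff T m (sm c f) = sm c (hdiff T m f)"
  unfolding sm_def by (rule T.hdiff_scale)

lemma hcup_zero_r: "f \<in> hcochains T m \<Longrightarrow> hcup T m k f 0 = 0"
  using T.hcup_add_r[OF _ T.hc_zero T.hc_zero, of f m k] by simp

lemma R_hdiff: "f \<in> hcochains T m \<Longrightarrow> hdiff T (Suc m) (R m f) = R (Suc m) (hdiff T m f)"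
  using T.hdiff_cup[OF _ E.D1_closed, of f m] by (simp add: R_def E.D1_cocycle[simplified] hcup_zero_r)

lemma R_R: "f \<in> hcochains T m \<Longrightarrow> R (Suc m) (R m f) = 0"
  using T.hcup_assoc[OF _ E.D1_closed E.D1_closed, of f m] E_cup_E
  by (simp add: R_def hcup_zero_r)

end

context cyclic_cover
begin

lemma dl_eq: "dl m f b = hdiff T m (f b) + sg m (R m (f (b + 1) - f b))"
  by (simp add: dl_def sg_def R_def)

lemma dl_in: "(\<And>b. f b \<in> hcochains T m) \<Longrightarrow> dl m f b \<in> hcochains T (Suc m)"
  unfolding dl_eq by (intro T.hc_add T.hdiff_closed sg_closed R_closed T.hc_diff)

lemma dl_add:
  assumes "\<And>b. f b \<in> hcochains T m" "\<And>b. g b \<in> hcochains T m"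
  shows "dl m (\<lambda>b. f b + g b) b = dl m f b + dl m g b"
proof -
  have "f (b + 1) + g (b + 1) - (f b + g b) = (f (b + 1) - f b) + (g (b + 1) - g b)" by simp
  then show ?thesis
    unfolding dl_eq using assms by (simp only: T.hdiff_add R_add T.hc_diff sg_add) (simp add: add_ac)
qed

lemma dl_neg:
  assumes "\<And>b. f b \<in> hcochains T m"
  shows "dl m (\<lambda>b. - f b) b = - dl m f b"
proof -
  have "- f (b + 1) - - f b = - (f (b + 1) - f b)" by simp
  then show ?thesis
    unfolding dl_eq using assms by (simp only: T.hdiff_neg R_neg T.hc_diff sg_neg) (simp add: add_ac)
qed

lemma dl_diff:
  assumes "\<And>b. f b \<in> hcochains T m" "\<And>b. g b \<in> hcochains T m"
  shows "dl m (\<lambda>b. f b - g b) b = dl m f b - dl m g b"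
  using dl_add[of f m "\<lambda>b. - g b" b] assms by (simp add: T.hc_neg dl_neg)

lemma dl_zero: "dl m (\<lambda>b. 0) b = 0"
  by (simp add: dl_eq)

lemma dl_sum:
  assumes "\<And>i b. i \<in> K \<Longrightarrow> f i b \<in> hcochains T m"
  shows "dl m (\<lambda>b. \<Sum>i\<in>K. f i b) b = (\<Sum>i\<in>K. dl m (f i) b)"
  using assms
  by (induction K rule: infinite_finite_induct) (auto simp: dl_zero dl_add T.hc_sum)

lemma dl_sg:
  assumes "\<And>b. f b \<in> hcochains T m"
  shows "dl m (\<lambda>b. sg k (f b)) b = sg k (dl m f b)"
  using assms by (simp add: sg_def dl_neg)

lemma dl_shift: "dl m (\<lambda>b. f (b + c)) b = dl m f (b + c)"
  by (simp add: dl_eq add_ac)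

lemma dl_const: "dl m (\<lambda>b. f) b = hdiff T m f"
  by (simp add: dl_eq)

lemma dl_dl:
  assumes "\<And>b. f b \<in> hcochains T m"
  shows "dl (Suc m) (dl m f) b = 0"
proof -
  have d: "f (b + 1) - f b \<in> hcochains T m" for b using assms by (simp add: T.hc_diff)
  have 1: "hdiff T (Suc m) (dl m f b) = sg m (R (Suc m) (hdiff T m (f (b + 1) - f b)))"
    unfolding dl_eq using assms d
    by (simp add: T.hdiff_add T.hdiff_closed sg_closed R_closed T.hdiff_hdiff hdiff_sg R_hdiff)
  have 2: "R (Suc m) (dl m f b) = R (Suc m) (hdiff T m (f b))" for b
    unfolding dl_eq using assms d
    by (simp add: R_add T.hdiff_closed sg_closed R_closed R_sg R_R)
  show ?thesis
    unfolding dl_eq[of "Suc m"] 1 sg_Suc using assms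
    by (simp add: R_diff dl_in 2 T.hdiff_diff T.hdiff_closed)
qed

lemma dl_mult:
  assumes v: "v \<in> hcochains T m" "hdiff T m v = 0"
  shows "dl m (\<lambda>b. sm (c b) v) b = sg m (sm (c (b + 1) - c b) (R m v))"
proof -
  have "sm (c (b + 1)) v - sm (c b) v = sm (c (b + 1) - c b) v"
    using sm_add[of "c (b + 1) - c b" "c b" v] by simp
  moreover have "sm x 0 = 0" for x by (simp add: sm_def zero_fun_def)
  ultimately show ?thesis using v by (simp add: dl_eq hdiff_sm R_sm)
qed

lemma pr_hdiff: "f \<in> hcochains T m \<Longrightarrow> pr (Suc m) (hdiff T m f) = hdiff T m (pr m f)"
  using dl_pr[of "\<lambda>b. f" m 0] by (simp add: families_def dl_const)

lemma pr_zero [simp]: "pr m 0 = 0"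
  using pr_diff[of m 0 0] by simp

lemma pr_sg: "pr m (sg k f) = sg k (pr m f)"
  by (simp add: sg_def pr_neg)

lemma pr_R:
  assumes f: "f \<in> hcochains T m"
  shows "pr (Suc m) (R m f) = R m (pr m f)"
proof -
  define F where "F = (\<lambda>b. if b mod int n = 0 then f else 0)"
  have F: "F \<in> families m" using f by (simp add: families_def F_def T.hc_zero)
  have n1: "(- 1 :: int) mod int n \<noteq> 0"
    using n2 by (simp add: zmod_minus1)
  have "sg m (R m (pr m f)) = pr (Suc m) (sg m (R m f))"
    using dl_pr[OF F, of "-1"] n1 f by (simp add: dl_eq F_def)
  then have "sg m (sg m (R m (pr m f))) = sg m (sg m (pr (Suc m) (R m f)))" by (simp add: pr_sg)
  then show ?thesis by simp
qed

definition graded :: "nat \<Rightarrow> ('t list \<Rightarrow> 't) set" where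
  "graded m = {f \<in> hcochains T m. pr m f = f}"

lemma graded_hc: "f \<in> graded m \<Longrightarrow> f \<in> hcochains T m"
  by (simp add: graded_def)

lemma graded_zero: "0 \<in> graded m" by (simp add: graded_def T.hc_zero)
lemma graded_add: "f \<in> graded m \<Longrightarrow> g \<in> graded m \<Longrightarrow> f + g \<in> graded m"
  by (simp add: graded_def T.hc_add pr_add)
lemma graded_neg: "f \<in> graded m \<Longrightarrow> - f \<in> graded m"
  by (simp add: graded_def T.hc_neg pr_neg)
lemma graded_diff: "f \<in> graded m \<Longrightarrow> g \<in> graded m \<Longrightarrow> f - g \<in> graded m"
  by (simp add: graded_def T.hc_diff pr_diff)
lemma graded_sg: "f \<in> graded m \<Longrightarrow> sg k f \<in> graded m"
  by (simp add: sg_def graded_neg)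
lemma graded_sum: "(\<And>i. i \<in> K \<Longrightarrow> f i \<in> graded m) \<Longrightarrow> (\<Sum>i\<in>K. f i) \<in> graded m"
  by (induction K rule: infinite_finite_induct) (auto simp: graded_zero graded_add)
lemma graded_pr: "f \<in> hcochains T m \<Longrightarrow> pr m f \<in> graded m"
  by (simp add: graded_def pr_closed pr_pr)
lemma graded_R: "f \<in> graded m \<Longrightarrow> R m f \<in> graded (Suc m)"
  by (simp add: graded_def R_closed pr_R)
lemma graded_hdiff: "f \<in> graded m \<Longrightarrow> hdiff T m f \<in> graded (Suc m)"
  by (simp add: graded_def T.hdiff_closed pr_hdiff)

lemma graded_sm: 
  assumes "f \<in> graded m" shows "sm c f \<in> graded m"
proof -
  have "part e (\<lambda>xs. scale T c (g xs)) xs = scale T c (part e g xs)" for e g xs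
    by (induction xs arbitrary: e g) (auto simp: hpart_def p0_scale p1_scale T.vs.scale_right_distrib)
  then have "pr m (sm c f) = sm c (pr m f)"
    by (auto simp: pr_def sm_def fun_eq_iff)
  then show ?thesis using assms by (simp add: graded_def sm_closed)
qed

lemma graded_dl: "(\<And>b. f b \<in> graded m) \<Longrightarrow> dl m f b \<in> graded (Suc m)"
  unfolding dl_eq by (intro graded_add graded_hdiff graded_sg graded_R graded_diff)

definition gfamilies :: "nat \<Rightarrow> (int \<Rightarrow> 't list \<Rightarrow> 't) set" where
  "gfamilies m = {f. (\<forall>b. f b \<in> graded m) \<and> (\<forall>b. f (b + int n) = f b)}"

lemma gfamilies_families: "f \<in> gfamilies m \<Longrightarrow> f \<in> families m"
  by (simp add: gfamilies_def families_def graded_hc)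

lemma gfamilies_graded: "f \<in> gfamilies m \<Longrightarrow> f b \<in> graded m"
  by (simp add: gfamilies_def)

lemma gfamilies_hc: "f \<in> gfamilies m \<Longrightarrow> f b \<in> hcochains T m"
  by (simp add: gfamilies_def graded_hc)

lemma gfamilies_period: "f \<in> gfamilies m \<Longrightarrow> f (b + int n) = f b"
  by (simp add: gfamilies_def)

lemma gfamilies_pr: "f \<in> families m \<Longrightarrow> (\<lambda>b. pr m (f b)) \<in> gfamilies m"
  by (simp add: gfamilies_def families_def graded_pr)

definition at_turn :: "int \<Rightarrow> 'k" where
  "at_turn b = (if (b + 1) mod int n = 0 then 1 else 0)"

text \<open>
  The indicator of the last index is a difference, but of a function that fails to be periodic;
  this failure is the reason why counting turns yields a new cohomology class.
\<close>

lemma floor_step: "of_int ((b + 1) div int n) - of_int (b div int n) = at_turn b"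
proof (cases "(b + 1) mod int n = 0")
  case True
  then obtain q where q: "b + 1 = int n * q" by auto
  then have b: "b = int n * (q - 1) + (int n - 1)" by (simp add: algebra_simps)
  have "b div int n = q - 1" by (rule int_div_pos_eq[of _ _ _ "int n - 1"]) (use n2 b in auto)
  moreover have "(b + 1) div int n = q" using n2 by (simp add: q)
  ultimately show ?thesis using True by (simp add: at_turn_def)
next
  case False
  have "b mod int n < int n - 1"
  proof (rule ccontr)
    assume "\<not> ?thesis"
    then have "b mod int n = int n - 1" using mod_I(2)[of b] by linarith
    then have "(b + 1) mod int n = 0" by (metis mod_add_left_eq diff_add_cancel mod_self)
    with False show False by simp
  qed
  then have "(b + 1) div int n = b div int n"
    by (intro int_div_pos_eq[of _ _ _ "b mod int n + 1"]) (use mod_I(1)[of b] in \<open>auto simp: add.assoc[symmetric]\<close>)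
  then show ?thesis using False by (simp add: at_turn_def)
qed

end

section \<open>Periodic families when the characteristic divides the period\<close>

locale char_cover = symmetric_cover T p0 p1 n L tr
  for T :: "('k::field, 't::ab_group_add, 'y) kalg_scheme" and p0 p1 n
    and L :: "('k, int \<Rightarrow> 't, 'z) kalg_scheme" and tr +
  assumes char_n: "of_nat n = (0 :: 'k)"
begin

lemma gfamilies_shift_trivial_0:
  assumes "f \<in> gfamilies 0" "\<And>b. dl 0 f b = 0"
  shows "f b = f 0"
proof -
  have "f (b + 1) = f b" for b
    by (rule shift_trivial_0[OF gfamilies_families[OF assms(1)]])
      (use assms in \<open>auto simp: gfamilies_def graded_def fun_eq_iff\<close>)
  note s = this
  show ?thesis
    by (induction b rule: int_induct[where k = 0]) (use s in simp, simp only: s, metis diff_add_cancel s)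
qed

lemma gfamilies_shift_trivial:
  assumes "f \<in> gfamilies (Suc k)" "\<And>b. dl (Suc k) f b = 0"
  obtains h where "h \<in> gfamilies k" "\<And>b. dl k h b = f (b + 1) - f b"
proof -
  have "\<exists>h\<in>families k. (\<forall>b. pr k (h b) = h b) \<and> (\<forall>b. dl k h b = f (b + 1) - f b)"
    by (rule shift_trivial[OF gfamilies_families[OF assms(1)]])
      (use assms in \<open>auto simp: gfamilies_def graded_def fun_eq_iff\<close>)
  then show ?thesis using that by (auto simp: gfamilies_def graded_def families_def)
qed

lemma graded_antidifference:
  fixes h :: "int \<Rightarrow> 't list \<Rightarrow> 't"
  assumes "\<And>b. h b \<in> graded m"
  obtains g where "\<And>b. g (b + 1) = g b + h b" "\<And>b. g b \<in> graded m"
  using antidifference[of "graded m" h] assms by (auto simp: graded_zero graded_add graded_neg)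

lemma sum_telescope: "(\<Sum>i<k. f (b + int i + 1) - f (b + int i)) = f (b + int k) - f b"
  for f :: "int \<Rightarrow> 'c::ab_group_add"
  by (induction k) (auto simp: algebra_simps)

lemma cocycle_decomposition_0:
  assumes "z \<in> gfamilies 0" "\<And>b. dl 0 z b = 0"
  shows "z b = z 0" and "hdiff T 0 (z 0) = 0"
  using gfamilies_shift_trivial_0[OF assms, of b] gfamilies_shift_trivial_0[OF assms, of 1] assms(2)[of 0] by (auto simp: dl_eq)

text \<open>
  By triviality of the shift, \<open>z (b + 1) - z b\<close> is the boundary of some \<open>h b\<close>. If \<open>g\<close> has the
  differences \<open>- h b\<close>, then \<open>z + dl g\<close> is a constant \<open>w\<close>. The drift of \<open>g\<close> over one period is minus
  the sum of \<open>h\<close> over that period, a cocycle; subtracting the drift from \<open>g\<close> at every turn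
  makes it periodic and leaves the term with \<open>at_turn\<close> behind.
\<close>

lemma cocycle_decomposition:
  assumes z: "z \<in> gfamilies (Suc k)" "\<And>b. dl (Suc k) z b = 0"
  obtains w v g where "w \<in> graded (Suc k)" "hdiff T (Suc k) w = 0" "v \<in> graded k" "hdiff T k v = 0"
    "g \<in> gfamilies k" "\<And>b. z b = w + sm (at_turn b) (R k v) + dl k g b"
proof -
  obtain h where h: "h \<in> gfamilies k" "\<And>b. dl k h b = z (b + 1) - z b"
    using gfamilies_shift_trivial[OF z] by blast
  note hg = gfamilies_graded[OF h(1)] and hc = gfamilies_hc[OF h(1)]
  obtain g where g: "\<And>b. g (b + 1) = g b + - h b" "\<And>b. g b \<in> graded k"
    using graded_antidifference[of "\<lambda>b. - h b" k] graded_neg[OF hg] by blast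
  note gc = graded_hc[OF g(2)]
  define W where "W = (\<lambda>b. z b + dl k g b)"
  have "W (b + 1) = W b" for b
  proof -
    have "dl k g (b + 1) - dl k g b = dl k (\<lambda>b. g (b + 1) - g b) b"
      by (subst dl_diff) (auto simp: gc dl_shift)
    also have "\<dots> = - dl k h b" unfolding g(1) using hc by (simp add: dl_neg)
    finally show ?thesis using h(2)[of b] by (simp add: W_def algebra_simps)
  qed
  then have W: "W b = W 0" for b
    by (induction b rule: int_induct[where k = 0]) (simp, metis, metis diff_add_cancel)
  have W0: "W 0 \<in> graded (Suc k)"
    unfolding W_def by (intro graded_add gfamilies_graded[OF z(1)] graded_dl g(2))
  have "hdiff T (Suc k) (W 0) = dl (Suc k) W 0" using W[of 1] by (simp add: dl_eq)
  also have "\<dots> = 0"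
    unfolding W_def using dl_dl[OF gc] z(2)
    by (subst dl_add) (auto simp: gfamilies_hc[OF z(1)] dl_in gc)
  finally have dW: "hdiff T (Suc k) (W 0) = 0" .
  define V where "V = (\<Sum>i<n. h (int i))"
  have V: "V \<in> graded k" unfolding V_def by (intro graded_sum hg)
  have Vb: "(\<Sum>i<n. h (b + int i)) = V" for b
  proof -
    have "(\<Sum>i<n. h (b + 1 + int i)) = (\<Sum>i<n. h (b + int i))" for b
    proof -
      have "(\<Sum>i<n. h (b + 1 + int i)) - (\<Sum>i<n. h (b + int i)) = (\<Sum>i<n. h (b + int i + 1) - h (b + int i))"
        by (simp add: sum_subtractf add_ac)
      then show ?thesis using gfamilies_period[OF h(1)] by (simp add: sum_telescope)
    qed
    note s = this
    have "(\<Sum>i<n. h (b + int i)) = (\<Sum>i<n. h (0 + int i))"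
      by (induction b rule: int_induct[where k = 0]) (simp, metis s, metis s diff_add_cancel)
    then show ?thesis by (simp add: V_def)
  qed
  have "hdiff T k V = (\<Sum>i<n. dl k h (0 + int i))"
  proof -
    have "hdiff T k V = dl k (\<lambda>b. \<Sum>i<n. h (b + int i)) 0" by (simp add: Vb dl_const)
    also have "\<dots> = (\<Sum>i<n. dl k (\<lambda>b. h (b + int i)) 0)" by (rule dl_sum) (rule hc)
    finally show ?thesis by (simp add: dl_shift[of k h])
  qed
  also have "\<dots> = 0" using gfamilies_period[OF z(1), of 0] by (simp only: h(2) sum_telescope) simp
  finally have dV: "hdiff T k V = 0" .
  have gn: "g (b + int n) = g b - V" for b
  proof -
    have "g (b + int n) - g b = (\<Sum>i<n. g (b + int i + 1) - g (b + int i))" by (simp add: sum_telescope)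
    also have "\<dots> = - V" unfolding g(1) by (simp add: sum_negf Vb)
    finally show ?thesis by (simp add: algebra_simps)
  qed
  \<comment> \<open>subtract the drift of \<open>g\<close> to make it periodic\<close>
  define g' where "g' = (\<lambda>b. - (g b + sm (of_int (b div int n)) V))"
  have g': "g' \<in> gfamilies k"
  proof -
    have "(b + int n) div int n = b div int n + 1" for b using n2 by simp
    then show ?thesis
      using g(2) V by (auto simp: gfamilies_def g'_def gn sm_add intro!: graded_diff graded_neg graded_sm)
  qed
  show ?thesis
  proof (rule that[OF W0 dW graded_sg[OF V, of k] _ g'])
    show "hdiff T k (sg k V) = 0" using V dV by (simp add: hdiff_sg graded_hc)
    fix b
    have "dl k g' b = - (dl k g b + dl k (\<lambda>b. sm (of_int (b div int n)) V) b)"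
      unfolding g'_def using gc V by (subst dl_neg, auto simp: graded_hc T.hc_add sm_closed, subst dl_add, auto simp: graded_hc sm_closed)
    also have "dl k (\<lambda>b. sm (of_int (b div int n)) V) b = sm (at_turn b) (R k (sg k V))"
      using dl_mult[OF graded_hc[OF V] dV, of "\<lambda>b. of_int (b div int n)" b] V
      by (simp add: floor_step R_sg graded_hc) (simp add: sg_def sm_def fun_Compl_def)
    finally have dg': "dl k g' b = - (dl k g b + sm (at_turn b) (R k (sg k V)))" .
    have "z b = W b - dl k g b" unfolding W_def by (rule add_diff_cancel_right'[symmetric])
    moreover have "p - d = p + s + - (d + s)" for p d s :: "'t list \<Rightarrow> 't" by (simp add: algebra_simps)
    ultimately show "z b = W 0 + sm (at_turn b) (R k (sg k V)) + dl k g' b"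
      unfolding dg' W[of b] by (rule trans)
  qed
qed

text \<open>
  The differences \<open>G (b + 1) - G b\<close> form a cocycle family. Changing \<open>G\<close> by a correction that need
  not be periodic makes these differences equal to a single cocycle, and then the definition of
  \<open>dl\<close> at one index splits \<open>f\<close> into a product with \<open>E.D1\<close> and a coboundary of \<open>T\<close>.
\<close>

lemma constant_coboundary:
  assumes f: "f \<in> graded (Suc k)" and G: "G \<in> families k" "\<And>b. dl k G b = f"
  obtains v u where "v \<in> graded k" "hdiff T k v = 0" "u \<in> hcochains T k" "f = R k v + hdiff T k u"
proof -
  define G1 where "G1 = (\<lambda>b. pr k (G b))"
  have G1: "G1 \<in> gfamilies k" unfolding G1_def by (rule gfamilies_pr[OF G(1)])
  note G1c = gfamilies_hc[OF G1]
  have dG1: "dl k G1 b = f" for b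
    unfolding G1_def using dl_pr[OF G(1)] G(2) f by (simp add: graded_def)
  define z where "z = (\<lambda>b. G1 (b + 1) - G1 b)"
  have z: "z \<in> gfamilies k"
  proof -
    have "G1 (b + int n + 1) = G1 (b + 1)" for b using gfamilies_period[OF G1, of "b + 1"] by (simp add: add_ac)
    then show ?thesis using G1 by (auto simp: gfamilies_def z_def graded_diff)
  qed
  have dz: "dl k z b = 0" for b
    unfolding z_def using G1c dl_shift[of k G1 1] by (subst dl_diff) (auto simp: dG1)
  note main = that
  have *: ?thesis if w: "w \<in> graded k" "hdiff T k w = 0" and X: "\<And>b. X b \<in> hcochains T k" "\<And>b. dl k X b = f"
    "\<And>b. X (b + 1) = X b + w" for w X
  proof (rule main)
    have "f = hdiff T k (X 0) + sg k (R k w)" using X(2)[of 0] X(3)[of 0] by (simp add: dl_eq)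
    then show "f = R k (sg k w) + hdiff T k (X 0)" using w by (simp add: R_sg graded_hc add.commute)
  qed (use w X in \<open>auto simp: graded_sg hdiff_sg graded_hc\<close>)
  show ?thesis
  proof (cases k)
    case 0
    have zc: "z b = z 0" for b by (rule cocycle_decomposition_0(1)[OF z[unfolded 0] dz[unfolded 0]])
    have dz0: "hdiff T k (z 0) = 0"
      unfolding 0 by (rule cocycle_decomposition_0(2)[OF z[unfolded 0] dz[unfolded 0]])
    have "G1 (b + 1) = G1 b + z 0" for b
      unfolding zc[of b, symmetric] by (simp add: z_def)
    then show ?thesis
      by (intro *[of "z 0" G1] gfamilies_graded[OF z] G1c dG1 dz0)
  next
    case (Suc l)
    have z': "z \<in> gfamilies (Suc l)" "\<And>b. dl (Suc l) z b = 0" using z dz Suc by auto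
    obtain w v g where wvg: "w \<in> graded (Suc l)" "hdiff T (Suc l) w = 0" "v \<in> graded l" "hdiff T l v = 0"
      "g \<in> gfamilies l" "\<And>b. z b = w + sm (at_turn b) (R l v) + dl l g b"
      by (rule cocycle_decomposition[OF z'], rule that)
    define y where "y = (\<lambda>b. g b + sm (of_int (b div int n)) (sg l v))"
    have y: "y b \<in> graded l" for b
      unfolding y_def by (intro graded_add graded_sm graded_sg gfamilies_graded[OF wvg(5)] wvg(3))
    have dy: "dl l y b = dl l g b + sm (at_turn b) (R l v)" for b
    proof -
      have "dl l (\<lambda>b. sm (of_int (b div int n)) (sg l v)) b = sm (at_turn b) (R l v)"
        using dl_mult[of "sg l v" l "\<lambda>b. of_int (b div int n)" b] wvg(3,4)
        by (simp add: floor_step R_sg hdiff_sg graded_hc sg_closed) (simp add: sg_def sm_def fun_Compl_def)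
      then show ?thesis unfolding y_def
        using gfamilies_hc[OF wvg(5)] wvg(3) by (subst dl_add) (auto simp: sm_closed sg_closed graded_hc)
    qed
    obtain Y where Y: "\<And>b. Y (b + 1) = Y b + y b" "\<And>b. Y b \<in> graded l"
      by (rule graded_antidifference[of y l, OF y], rule that)
    note Yc = graded_hc[OF Y(2)]
    define X where "X = (\<lambda>b. G1 b - dl l Y b)"
    show ?thesis
    proof (rule *[of w X])
      show "X b \<in> hcochains T k" for b unfolding X_def by (intro T.hc_diff G1c) (use dl_in[OF Yc] Suc in simp)
      show "dl k X b = f" for b
        unfolding X_def using G1c dl_in[OF Yc] dl_dl[OF Yc] by (subst dl_diff) (auto simp: Suc dG1[unfolded Suc])
      show "X (b + 1) = X b + w" for b
      proof -
        have "dl l Y (b + 1) - dl l Y b = dl l (\<lambda>b. Y (b + 1) - Y b) b"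
          by (subst dl_diff) (auto simp: Yc dl_shift)
        also have "\<dots> = dl l y b" unfolding Y(1) by simp
        finally show ?thesis using wvg(6)[of b] dy[of b] by (simp add: X_def z_def algebra_simps)
      qed
    qed (use wvg Suc in auto)
  qed
qed

text \<open>
  Up to sign the family \<open>b \<mapsto> b v\<close> is a primitive; it is periodic since the characteristic
  divides \<open>n\<close>.
\<close>

lemma R_coboundary:
  assumes v: "v \<in> hcochains T m" "hdiff T m v = 0"
  obtains F where "F \<in> families m" "\<And>b. dl m F b = R m v"
proof
  show "(\<lambda>b. sm (of_int b) (sg m v)) \<in> families m"
    using v char_n by (simp add: families_def sm_closed sg_closed)
  show "dl m (\<lambda>b. sm (of_int b) (sg m v)) b = R m v" for b
    using dl_mult[of "sg m v" m of_int b] v by (simp add: hdiff_sg sg_closed R_sg)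
qed

text \<open>
  Up to sign \<open>b \<mapsto> b v\<close>, and also the degree-preserving part of the constant \<open>u\<close>, is a primitive of
  the constant family \<open>R k v\<close>, so the two differ by a cocycle family. By triviality of the shift its successive
  differences, which are \<open>v\<close> up to sign, are coboundaries.
\<close>

lemma R_boundary_imp_0:
  "\<lbrakk>v \<in> graded 0; hdiff T 0 v = 0; u \<in> hcochains T 0; R 0 v = hdiff T 0 u\<rbrakk> \<Longrightarrow> v = 0"
  and R_boundary_imp:
  "\<lbrakk>v \<in> graded (Suc k); hdiff T (Suc k) v = 0; u \<in> hcochains T (Suc k); R (Suc k) v = hdiff T (Suc k) u\<rbrakk> \<Longrightarrow>
    \<exists>h\<in>gfamilies k. \<forall>b. dl k h b = v"
proof -
  have z: "(\<lambda>b. sm (of_int b) (sg m v) - pr m u) \<in> gfamilies m \<and>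
      (\<forall>b. dl m (\<lambda>b. sm (of_int b) (sg m v) - pr m u) b = 0)"
    if v: "v \<in> graded m" "hdiff T m v = 0" and u: "u \<in> hcochains T m" "R m v = hdiff T m u" for m v u
  proof
    show "(\<lambda>b. sm (of_int b) (sg m v) - pr m u) \<in> gfamilies m"
      using v u char_n by (simp add: gfamilies_def graded_diff graded_sm graded_sg graded_pr)
    have "hdiff T m (pr m u) = R m v"
      using v u pr_hdiff[OF u(1)] pr_R[OF graded_hc[OF v(1)]] by (simp add: graded_def)
    moreover have "dl m (\<lambda>b. sm (of_int b) (sg m v)) b = R m v" for b
      using dl_mult[of "sg m v" m of_int b] v by (simp add: hdiff_sg sg_closed R_sg graded_hc)
    ultimately show "\<forall>b. dl m (\<lambda>b. sm (of_int b) (sg m v) - pr m u) b = 0"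
      using v u by (subst dl_diff) (auto simp: sm_closed sg_closed graded_hc pr_closed dl_const)
  qed
  {
    assume v: "v \<in> graded 0" "hdiff T 0 v = 0" and u: "u \<in> hcochains T 0" "R 0 v = hdiff T 0 u"
    from z[OF v u] have "sm (of_int 1) (sg 0 v) - pr 0 u = sm (of_int 0) (sg 0 v) - pr 0 u"
      using gfamilies_shift_trivial_0[of "\<lambda>b. sm (of_int b) (sg 0 v) - pr 0 u" 1] by blast
    then show "v = 0" by (simp add: sg_def)
  }
  {
    fix v u assume v: "v \<in> graded (Suc k)" "hdiff T (Suc k) v = 0" "u \<in> hcochains T (Suc k)" "R (Suc k) v = hdiff T (Suc k) u"
    from z[OF v] obtain h where h: "h \<in> gfamilies k" "\<And>b. dl k h b =
        (sm (of_int (b + 1)) (sg (Suc k) v) - pr (Suc k) u) - (sm (of_int b) (sg (Suc k) v) - pr (Suc k) u)"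
      using gfamilies_shift_trivial[of "\<lambda>b. sm (of_int b) (sg (Suc k) v) - pr (Suc k) u" k] by blast
    have "dl k h b = sg (Suc k) v" for b
      unfolding h(2) by (simp add: sm_add)
    then have "dl k (\<lambda>b. sg (Suc k) (h b)) b = v" for b
      using gfamilies_hc[OF h(1)] by (simp add: dl_sg)
    moreover have "(\<lambda>b. sg (Suc k) (h b)) \<in> gfamilies k"
      using h(1) by (simp add: gfamilies_def graded_sg)
    ultimately show "\<exists>h\<in>gfamilies k. \<forall>b. dl k h b = v" by blast
  }
qed

text \<open>
  After a correction at the turns the differences of \<open>g\<close> form a periodic cocycle family whose sum
  over one period is \<open>v\<close> up to sign. Up to coboundaries this family is constant, so its sum over
  \<open>n\<close> indices is a coboundary in this characteristic.
\<close>

lemma turn_boundary_imp_0: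
  "\<lbrakk>w \<in> graded 1; v \<in> graded 0; hdiff T 0 v = 0; g \<in> families 0;
    \<And>b. w + sm (at_turn b) (R 0 v) = dl 0 g b\<rbrakk> \<Longrightarrow> v = 0"
  and turn_boundary_imp:
  "\<lbrakk>w \<in> graded (Suc (Suc k)); v \<in> graded (Suc k); hdiff T (Suc k) v = 0; g \<in> families (Suc k);
    \<And>b. w + sm (at_turn b) (R (Suc k) v) = dl (Suc k) g b\<rbrakk> \<Longrightarrow>
    \<exists>h\<in>gfamilies k. \<forall>b. dl k h b = v"
proof -
  define Z where "Z = (\<lambda>m v g b. pr m (g (b + 1)) - pr m (g b) - sm (at_turn b) (sg m v))"
  have z: "Z m v g \<in> gfamilies m \<and> (\<forall>b. dl m (Z m v g) b = 0) \<and> (\<Sum>i<n. Z m v g (int i)) = - sg m v"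
    if w: "w \<in> graded (Suc m)" and v: "v \<in> graded m" "hdiff T m v = 0"
      and g: "g \<in> families m" "\<And>b. w + sm (at_turn b) (R m v) = dl m g b" for m w v g
  proof -
    define G where "G = (\<lambda>b. pr m (g b))"
    have G: "G \<in> gfamilies m" unfolding G_def by (rule gfamilies_pr[OF g(1)])
    note Gc = gfamilies_hc[OF G]
    have dG: "dl m G b = w + sm (at_turn b) (R m v)" for b
    proof -
      have "w + sm (at_turn b) (R m v) \<in> graded (Suc m)" by (intro graded_add graded_sm graded_R w v)
      then show ?thesis unfolding G_def using dl_pr[OF g(1)] by (simp add: g(2)[symmetric] graded_def)
    qed
    define X where "X = (\<lambda>b. G b - sm (of_int (b div int n)) (sg m v))"
    have Xg: "X b \<in> graded m" for b
      unfolding X_def by (intro graded_diff graded_sm graded_sg v gfamilies_graded[OF G])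
    have "dl m (\<lambda>b. sm (of_int (b div int n)) (sg m v)) b = sm (at_turn b) (R m v)" for b
      using dl_mult[of "sg m v" m "\<lambda>b. of_int (b div int n)" b] v
      by (simp add: floor_step R_sg hdiff_sg graded_hc sg_closed) (simp add: sg_def sm_def fun_Compl_def)
    then have dX: "dl m X b = w" for b
      unfolding X_def using Gc v by (subst dl_diff) (auto simp: sm_closed sg_closed graded_hc dG)
    have ZX: "Z m v g b = X (b + 1) - X b" for b
      unfolding Z_def X_def G_def floor_step[symmetric] using sm_add[of "of_int ((b + 1) div int n) - of_int (b div int n)" "of_int (b div int n)" "sg m v"]
      by (simp add: algebra_simps)
    have per: "Z m v g (b + int n) = Z m v g b" for b
    proof -
      have "at_turn (b + int n) = (at_turn b :: 'k)" by (simp add: at_turn_def algebra_simps mod_simps) (metis mod_add_self2 add.assoc add.commute)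
      moreover have "g (b + int n + 1) = g (b + 1)" "g (b + int n) = g b"
        using g(1) by (auto simp: families_def) (metis add.assoc add.commute)
      ultimately show ?thesis by (simp add: Z_def)
    qed
    show ?thesis
    proof (intro conjI allI)
      show "Z m v g \<in> gfamilies m" using Xg per by (simp add: gfamilies_def) (simp add: ZX graded_diff)
      show "dl m (Z m v g) b = 0" for b
        unfolding ZX[abs_def] using graded_hc[OF Xg] dl_shift[of m X 1] by (subst dl_diff) (auto simp: dX)
      have "(\<Sum>i<n. Z m v g (int i)) = X (int n) - X 0"
        unfolding ZX using sum_telescope[of X 0 n] by simp
      also have "\<dots> = - sg m v"
        using gfamilies_period[OF G, of 0] n2 by (simp add: X_def)
      finally show "(\<Sum>i<n. Z m v g (int i)) = - sg m v" .
    qed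
  qed
  have nsum: "(\<Sum>i<n. c) = 0" for c :: "'t list \<Rightarrow> 't"
  proof -
    have s: "(\<Sum>i<m. c) = sm (of_nat m) c" for m by (induction m) (auto simp: sm_add)
    show ?thesis unfolding s char_n by simp
  qed
  {
    assume w: "w \<in> graded 1" and v: "v \<in> graded 0" "hdiff T 0 v = 0"
      and g: "g \<in> families 0" "\<And>b. w + sm (at_turn b) (R 0 v) = dl 0 g b"
    have "(\<Sum>i<n. Z 0 v g (int i)) = (\<Sum>i<n. Z 0 v g 0)"
      by (rule sum.cong[OF refl], rule gfamilies_shift_trivial_0) (use z[of w 0 v g] w v g in auto)
    then show "v = 0" using z[of w 0 v g] w v g by (simp add: nsum sg_def)
  }
  {
    fix w v g
    assume a: "w \<in> graded (Suc (Suc k))" "v \<in> graded (Suc k)" "hdiff T (Suc k) v = 0" "g \<in> families (Suc k)"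
      "\<And>b. w + sm (at_turn b) (R (Suc k) v) = dl (Suc k) g b"
    let ?Z = "Z (Suc k) v g"
    note zz = z[OF a]
    obtain h where h: "h \<in> gfamilies k" "\<And>b. dl k h b = ?Z (b + 1) - ?Z b"
      using gfamilies_shift_trivial[of ?Z k] zz by blast
    note hc = gfamilies_hc[OF h(1)]
    define H where "H = (\<lambda>b. \<Sum>i<n. \<Sum>l<i. h (b + int l))"
    have H: "H \<in> gfamilies k"
    proof -
      have "h (b + int n + int l) = h (b + int l)" for b l
        using gfamilies_period[OF h(1), of "b + int l"] by (simp add: add_ac)
      then show ?thesis
        using gfamilies_graded[OF h(1)] by (simp add: gfamilies_def H_def graded_sum)
    qed
    have "dl k H b = (\<Sum>i<n. \<Sum>l<i. dl k (\<lambda>b. h (b + int l)) b)" for b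
      unfolding H_def using hc by (subst dl_sum, auto intro: T.hc_sum, subst dl_sum, auto)
    then have "dl k H b = (\<Sum>i<n. ?Z (b + int i) - ?Z b)" for b
      unfolding dl_shift h(2) sum_telescope .
    then have dH: "dl k H b = (\<Sum>i<n. ?Z (b + int i))" for b
      by (simp add: sum_subtractf nsum)
    have per: "?Z (b + int n) = ?Z b" for b using zz gfamilies_period by blast
    have "(\<Sum>i<n. ?Z (b + int i)) = - sg (Suc k) v" for b
    proof -
      have s: "(\<Sum>i<n. ?Z (b + 1 + int i)) = (\<Sum>i<n. ?Z (b + int i))" for b
      proof -
        have "(\<Sum>i<n. ?Z (b + 1 + int i)) - (\<Sum>i<n. ?Z (b + int i)) = (\<Sum>i<n. ?Z (b + int i + 1) - ?Z (b + int i))"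
          by (simp add: sum_subtractf add_ac)
        then show ?thesis using per by (simp add: sum_telescope)
      qed
      have "(\<Sum>i<n. ?Z (b + int i)) = (\<Sum>i<n. ?Z (0 + int i))"
        by (induction b rule: int_induct[where k = 0]) (simp, metis s, metis s diff_add_cancel)
      then show ?thesis using zz by simp
    qed
    then have "dl k (\<lambda>b. sg (Suc k) (- H b)) b = v" for b
      using gfamilies_hc[OF H] dH by (simp add: dl_sg dl_neg T.hc_neg) 
    moreover have "(\<lambda>b. sg (Suc k) (- H b)) \<in> gfamilies k"
      using H by (simp add: gfamilies_def graded_sg graded_neg)
    ultimately show "\<exists>h\<in>gfamilies k. \<forall>b. dl k h b = v" by blast
  }
qed

end

section \<open>Graded algebras\<close>

definition gneg :: "('k::field, 'a, 'z) gvs_scheme \<Rightarrow> int \<Rightarrow> 'a \<Rightarrow> 'a" where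
  "gneg V m x = gscale V m (-1) x"

context graded_vector_space
begin

lemma gadd_closed [simp]: "x \<in> gcomp V m \<Longrightarrow> y \<in> gcomp V m \<Longrightarrow> gadd V m x y \<in> gcomp V m"
  and gzero_closed [simp]: "gzero V m \<in> gcomp V m"
  and gadd_assoc: "\<lbrakk>x \<in> gcomp V m; y \<in> gcomp V m; z \<in> gcomp V m\<rbrakk> \<Longrightarrow>
    gadd V m (gadd V m x y) z = gadd V m x (gadd V m y z)"
  and gadd_comm: "\<lbrakk>x \<in> gcomp V m; y \<in> gcomp V m\<rbrakk> \<Longrightarrow> gadd V m x y = gadd V m y x"
  and gadd_zero_l [simp]: "x \<in> gcomp V m \<Longrightarrow> gadd V m (gzero V m) x = x"
  using comm_groupE[OF comm_group_ggroup[of m]] by (simp_all add: ggroup_def)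

lemma gadd_zero_r [simp]: "x \<in> gcomp V m \<Longrightarrow> gadd V m x (gzero V m) = x"
  using gadd_comm[of x m "gzero V m"] by simp

lemma gadd_left_comm: "\<lbrakk>x \<in> gcomp V m; y \<in> gcomp V m; z \<in> gcomp V m\<rbrakk> \<Longrightarrow>
    gadd V m x (gadd V m y z) = gadd V m y (gadd V m x z)"
  using gadd_assoc[of x m y z] gadd_assoc[of y m x z] gadd_comm[of x m y] by simp

declare gscale_closed [simp] gscale_one [simp]

lemma gadd_cancel: "\<lbrakk>x \<in> gcomp V m; y \<in> gcomp V m; z \<in> gcomp V m; gadd V m x y = gadd V m x z\<rbrakk> \<Longrightarrow> y = z"
proof -
  assume *: "x \<in> gcomp V m" "y \<in> gcomp V m" "z \<in> gcomp V m" "gadd V m x y = gadd V m x z"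
  obtain x' where x': "x' \<in> gcomp V m" "gadd V m x' x = gzero V m"
    using comm_groupE(6)[OF comm_group_ggroup[of m]] *(1) by (auto simp: ggroup_def)
  have "gadd V m (gadd V m x' x) y = gadd V m (gadd V m x' x) z"
    using * x'(1) by (simp add: gadd_assoc)
  then show "y = z" using * x'(2) by simp
qed

lemma gscale_zero [simp]: "x \<in> gcomp V m \<Longrightarrow> gscale V m 0 x = gzero V m"
  using gscale_add[of x m 0 0] gadd_cancel[of "gscale V m 0 x" m "gscale V m 0 x" "gzero V m"] by simp

lemma gneg_closed [simp]: "x \<in> gcomp V m \<Longrightarrow> gneg V m x \<in> gcomp V m"
  by (simp add: gneg_def)

lemma gadd_gneg [simp]: "x \<in> gcomp V m \<Longrightarrow> gadd V m x (gneg V m x) = gzero V m"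
  using gscale_add[of x m 1 "-1"] by (simp add: gneg_def)

lemma gneg_gadd [simp]: "x \<in> gcomp V m \<Longrightarrow> gadd V m (gneg V m x) x = gzero V m"
  using gadd_comm[of "gneg V m x" m x] by simp

lemma gscale_gzero [simp]: "gscale V m c (gzero V m) = gzero V m"
  using gscale_gscale[of "gzero V m" m c 0] by simp

lemma gneg_gneg [simp]: "x \<in> gcomp V m \<Longrightarrow> gneg V m (gneg V m x) = x"
  by (simp add: gneg_def gscale_gscale)

lemma gneg_cong_add: "\<lbrakk>x \<in> gcomp V m; y \<in> gcomp V m\<rbrakk> \<Longrightarrow> gneg V m (gadd V m x y) = gadd V m (gneg V m x) (gneg V m y)"
  by (simp add: gneg_def gscale_gadd)

lemma gneg_gzero [simp]: "gneg V m (gzero V m) = gzero V m"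
  by (simp add: gneg_def)

lemma gadd_gneg_eq: "\<lbrakk>x \<in> gcomp V m; y \<in> gcomp V m\<rbrakk> \<Longrightarrow> gadd V m x (gneg V m y) = gzero V m \<longleftrightarrow> x = y"
proof
  assume *: "x \<in> gcomp V m" "y \<in> gcomp V m" "gadd V m x (gneg V m y) = gzero V m"
  then have "gadd V m (gneg V m y) x = gadd V m (gneg V m y) y"
    using gadd_comm[of x m "gneg V m y"] by simp
  then show "x = y" using gadd_cancel[of "gneg V m y" m x y] * by simp
qed simp

lemma gadd_gneg_cancel: "\<lbrakk>x \<in> gcomp V m; y \<in> gcomp V m\<rbrakk> \<Longrightarrow> gadd V m y (gadd V m x (gneg V m y)) = x"
  using gadd_left_comm[of y m x "gneg V m y"] by simp

end

lemma UN_const_eq: "X \<noteq> {} \<Longrightarrow> (\<And>x. x \<in> X \<Longrightarrow> F x = c) \<Longrightarrow> (\<Union>x\<in>X. F x) = c"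
  by auto

locale graded_subspace = graded_vector_space V
  for V :: "('k::field, 'a, 'z) gvs_scheme" +
  fixes J :: "int \<Rightarrow> 'a set"
  assumes J_sub: "J m \<subseteq> gcomp V m" and J_zero: "gzero V m \<in> J m"
    and J_add: "x \<in> J m \<Longrightarrow> y \<in> J m \<Longrightarrow> gadd V m x y \<in> J m"
    and J_scale: "x \<in> J m \<Longrightarrow> gscale V m c x \<in> J m"
begin

abbreviation cls where "cls \<equiv> gcoset V J"

lemma J_in: "x \<in> J m \<Longrightarrow> x \<in> gcomp V m"
  using J_sub by blast

lemma J_neg: "x \<in> J m \<Longrightarrow> gneg V m x \<in> J m"
  by (simp add: gneg_def J_scale)

lemma cls_mem: "x \<in> gcomp V m \<Longrightarrow> y \<in> cls m x \<longleftrightarrow> y \<in> gcomp V m \<and> gadd V m y (gneg V m x) \<in> J m"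
proof
  assume x: "x \<in> gcomp V m" and "y \<in> cls m x"
  then obtain j where j: "j \<in> J m" "y = gadd V m x j" by (auto simp: gcoset_def)
  then show "y \<in> gcomp V m \<and> gadd V m y (gneg V m x) \<in> J m"
    using x J_in[OF j(1)] gadd_comm[of x m j] by (simp add: gadd_assoc)
next
  assume x: "x \<in> gcomp V m" and y: "y \<in> gcomp V m \<and> gadd V m y (gneg V m x) \<in> J m"
  then have "y = gadd V m x (gadd V m y (gneg V m x))" by (simp add: gadd_gneg_cancel)
  then show "y \<in> cls m x" using y unfolding gcoset_def by blast
qed

lemma cls_self: "x \<in> gcomp V m \<Longrightarrow> x \<in> cls m x"
  by (simp add: cls_mem J_zero)

lemma cls_eq: "\<lbrakk>x \<in> gcomp V m; y \<in> gcomp V m\<rbrakk> \<Longrightarrow> cls m x = cls m y \<longleftrightarrow> gadd V m x (gneg V m y) \<in> J m"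
proof
  assume x: "x \<in> gcomp V m" and y: "y \<in> gcomp V m" and "cls m x = cls m y"
  then show "gadd V m x (gneg V m y) \<in> J m" using cls_self[OF x] cls_mem[OF y] by simp
next
  assume x: "x \<in> gcomp V m" and y: "y \<in> gcomp V m" and d: "gadd V m x (gneg V m y) \<in> J m"
  have d': "gadd V m y (gneg V m x) \<in> J m"
    using J_neg[OF d] x y gadd_comm[of "gneg V m x" m y] by (simp add: gneg_cong_add)
  have 1: "gadd V m z (gneg V m y) = gadd V m (gadd V m z (gneg V m x)) (gadd V m x (gneg V m y))"
    if "z \<in> gcomp V m" "x \<in> gcomp V m" "y \<in> gcomp V m" for x y z
    using that by (simp add: gadd_assoc) (simp flip: gadd_assoc)
  show "cls m x = cls m y"
  proof (rule Set.set_eqI, rule iffI)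
    fix z assume "z \<in> cls m x"
    then show "z \<in> cls m y" using x y J_add[OF _ d, of "gadd V m z (gneg V m x)"] 1[of z x y] by (simp add: cls_mem)
  next
    fix z assume "z \<in> cls m y"
    then show "z \<in> cls m x" using x y J_add[OF _ d', of "gadd V m z (gneg V m y)"] 1[of z y x] by (simp add: cls_mem)
  qed
qed

lemma cls_add:
  assumes "x \<in> gcomp V m" "y \<in> gcomp V m"
  shows "(\<Union>x'\<in>cls m x. \<Union>y'\<in>cls m y. cls m (gadd V m x' y')) = cls m (gadd V m x y)"
proof (intro UN_const_eq)
  show "cls m x \<noteq> {}" "cls m y \<noteq> {}" using cls_self assms by blast+
  fix x' y' assume m: "x' \<in> cls m x" "y' \<in> cls m y"
  then have c: "x' \<in> gcomp V m" "y' \<in> gcomp V m" and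
    d: "gadd V m x' (gneg V m x) \<in> J m" "gadd V m y' (gneg V m y) \<in> J m"
    using assms by (auto simp: cls_mem)
  have "gadd V m (gadd V m x' y') (gneg V m (gadd V m x y)) =
      gadd V m (gadd V m x' (gneg V m x)) (gadd V m y' (gneg V m y))"
    using c assms by (simp add: gneg_cong_add gadd_assoc gadd_left_comm)
  then show "cls m (gadd V m x' y') = cls m (gadd V m x y)"
    using J_add[OF d] c assms by (simp add: cls_eq)
qed

lemma cls_scale:
  assumes "x \<in> gcomp V m"
  shows "(\<Union>x'\<in>cls m x. cls m (gscale V m c x')) = cls m (gscale V m c x)"
proof (intro UN_const_eq)
  show "cls m x \<noteq> {}" using cls_self assms by blast
  fix x' assume m: "x' \<in> cls m x"
  then have c: "x' \<in> gcomp V m" and d: "gadd V m x' (gneg V m x) \<in> J m"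
    using assms by (auto simp: cls_mem)
  have "gadd V m (gscale V m c x') (gneg V m (gscale V m c x)) = gscale V m c (gadd V m x' (gneg V m x))"
    using c assms by (simp add: gneg_def gscale_gadd gscale_gscale mult.commute)
  then show "cls m (gscale V m c x') = cls m (gscale V m c x)"
    using J_scale[OF d] c assms by (simp add: cls_eq)
qed

end

locale graded_quotient = A: graded_algebra A + graded_subspace A J
  for A :: "('k::field, 'a, 'z) galg_scheme" and J +
  assumes J_mult_l: "a \<in> gcomp A i \<Longrightarrow> x \<in> J j \<Longrightarrow> gmult A i j a x \<in> J (i + j)"
    and J_mult_r: "a \<in> gcomp A i \<Longrightarrow> x \<in> J j \<Longrightarrow> gmult A j i x a \<in> J (j + i)"

context graded_algebra
begin

lemma gmult_closed [simp]: "\<lbrakk>x \<in> gcomp A i; y \<in> gcomp A j\<rbrakk> \<Longrightarrow> gmult A i j x y \<in> gcomp A (i + j)"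
  and gmult_add_l: "\<lbrakk>x \<in> gcomp A i; x' \<in> gcomp A i; y \<in> gcomp A j\<rbrakk> \<Longrightarrow>
    gmult A i j (gadd A i x x') y = gadd A (i + j) (gmult A i j x y) (gmult A i j x' y)"
  and gmult_add_r: "\<lbrakk>x \<in> gcomp A i; y \<in> gcomp A j; y' \<in> gcomp A j\<rbrakk> \<Longrightarrow>
    gmult A i j x (gadd A j y y') = gadd A (i + j) (gmult A i j x y) (gmult A i j x y')"
  and gmult_scale_l: "\<lbrakk>x \<in> gcomp A i; y \<in> gcomp A j\<rbrakk> \<Longrightarrow>
    gmult A i j (gscale A i c x) y = gscale A (i + j) c (gmult A i j x y)"
  and gmult_scale_r: "\<lbrakk>x \<in> gcomp A i; y \<in> gcomp A j\<rbrakk> \<Longrightarrow>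
    gmult A i j x (gscale A j c y) = gscale A (i + j) c (gmult A i j x y)"
  using gmult_bilinear unfolding bilinear_graded_def by blast+

declare gone_closed [simp]

lemma gmult_zero_l [simp]: "y \<in> gcomp A j \<Longrightarrow> gmult A i j (gzero A i) y = gzero A (i + j)"
  using gmult_scale_l[of "gzero A i" i y j 0] by simp

lemma gmult_zero_r [simp]: "x \<in> gcomp A i \<Longrightarrow> gmult A i j x (gzero A j) = gzero A (i + j)"
  using gmult_scale_r[of x i "gzero A j" j 0] by simp

lemma gmult_neg_l: "\<lbrakk>x \<in> gcomp A i; y \<in> gcomp A j\<rbrakk> \<Longrightarrow> gmult A i j (gneg A i x) y = gneg A (i + j) (gmult A i j x y)"
  by (simp add: gneg_def gmult_scale_l)

lemma gmult_neg_r: "\<lbrakk>x \<in> gcomp A i; y \<in> gcomp A j\<rbrakk> \<Longrightarrow> gmult A i j x (gneg A j y) = gneg A (i + j) (gmult A i j x y)"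
  by (simp add: gneg_def gmult_scale_r)

lemma graded_subalgebra:
  assumes S: "\<And>m. S m \<subseteq> gcomp A m" "\<And>m. gzero A m \<in> S m"
    "\<And>m x y. x \<in> S m \<Longrightarrow> y \<in> S m \<Longrightarrow> gadd A m x y \<in> S m"
    "\<And>m c x. x \<in> S m \<Longrightarrow> gscale A m c x \<in> S m"
    "\<And>i j x y. x \<in> S i \<Longrightarrow> y \<in> S j \<Longrightarrow> gmult A i j x y \<in> S (i + j)" "gone A \<in> S 0"
  shows "graded_algebra (A\<lparr>gcomp := S\<rparr>)"
proof -
  have c: "x \<in> S m \<Longrightarrow> x \<in> gcomp A m" for x m using S(1) by blast
  show ?thesis
  proof (intro graded_algebra.intro graded_vector_space.intro graded_algebra_axioms.intro)
    fix m
    show "comm_group (ggroup (A\<lparr>gcomp := S\<rparr>) m)"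
    proof (rule comm_groupI)
      fix x assume x: "x \<in> carrier (ggroup (A\<lparr>gcomp := S\<rparr>) m)"
      then have "gneg A m x \<in> S m" using S(4)[of x m "-1"] by (simp add: ggroup_def gneg_def)
      then show "\<exists>y\<in>carrier (ggroup (A\<lparr>gcomp := S\<rparr>) m). y \<otimes>\<^bsub>ggroup (A\<lparr>gcomp := S\<rparr>) m\<^esub> x = \<one>\<^bsub>ggroup (A\<lparr>gcomp := S\<rparr>) m\<^esub>"
        using x c by (intro bexI[of _ "gneg A m x"]) (auto simp: ggroup_def)
    next
      fix x y assume "x \<in> carrier (ggroup (A\<lparr>gcomp := S\<rparr>) m)" "y \<in> carrier (ggroup (A\<lparr>gcomp := S\<rparr>) m)"
      then show "x \<otimes>\<^bsub>ggroup (A\<lparr>gcomp := S\<rparr>) m\<^esub> y = y \<otimes>\<^bsub>ggroup (A\<lparr>gcomp := S\<rparr>) m\<^esub> x"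
        using c gadd_comm by (auto simp: ggroup_def)
    qed (auto simp: ggroup_def S c gadd_assoc)
  qed (auto simp: S c gscale_gadd gscale_add gscale_gscale gmult_assoc gone_l gone_r bilinear_graded_def
        gmult_add_l gmult_add_r gmult_scale_l gmult_scale_r)
qed

end

context graded_quotient
begin

lemma cls_mult:
  assumes "x \<in> gcomp A i" "y \<in> gcomp A j"
  shows "(\<Union>x'\<in>cls i x. \<Union>y'\<in>cls j y. cls (i + j) (gmult A i j x' y')) = cls (i + j) (gmult A i j x y)"
proof (intro UN_const_eq)
  show "cls i x \<noteq> {}" "cls j y \<noteq> {}" using cls_self assms by blast+
  fix x' y' assume m: "x' \<in> cls i x" "y' \<in> cls j y"
  then have c: "x' \<in> gcomp A i" "y' \<in> gcomp A j" and
    d: "gadd A i x' (gneg A i x) \<in> J i" "gadd A j y' (gneg A j y) \<in> J j"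
    using assms by (auto simp: cls_mem)
  have "gadd A (i + j) (gmult A i j (gadd A i x' (gneg A i x)) y') (gmult A i j x (gadd A j y' (gneg A j y))) =
      gadd A (i + j) (gmult A i j x' y') (gneg A (i + j) (gmult A i j x y))"
    using c assms
    by (simp add: A.gmult_add_l A.gmult_add_r A.gmult_neg_l A.gmult_neg_r A.gadd_assoc)
      (simp flip: A.gadd_assoc)
  moreover have "gadd A (i + j) (gmult A i j (gadd A i x' (gneg A i x)) y') (gmult A i j x (gadd A j y' (gneg A j y))) \<in> J (i + j)"
    by (intro J_add J_mult_l J_mult_r assms c d)
  ultimately show "cls (i + j) (gmult A i j x' y') = cls (i + j) (gmult A i j x y)"
    using c assms by (simp add: cls_eq)
qed

abbreviation Qt where "Qt \<equiv> gquotient A J"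

lemma Qt_comp: "gcomp Qt m = cls m ` gcomp A m"
  and Qt_zero: "gzero Qt m = cls m (gzero A m)"
  and Qt_one: "gone Qt = cls 0 (gone A)"
  by (simp_all add: gquotient_def)

lemma Qt_add: "\<lbrakk>x \<in> gcomp A m; y \<in> gcomp A m\<rbrakk> \<Longrightarrow> gadd Qt m (cls m x) (cls m y) = cls m (gadd A m x y)"
  using cls_add by (simp add: gquotient_def)

lemma Qt_scale: "x \<in> gcomp A m \<Longrightarrow> gscale Qt m c (cls m x) = cls m (gscale A m c x)"
  using cls_scale by (simp add: gquotient_def)

lemma Qt_mult: "\<lbrakk>x \<in> gcomp A i; y \<in> gcomp A j\<rbrakk> \<Longrightarrow> gmult Qt i j (cls i x) (cls j y) = cls (i + j) (gmult A i j x y)"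
  using cls_mult by (simp add: gquotient_def)

theorem graded_algebra_quotient: "graded_algebra Qt"
proof (intro graded_algebra.intro graded_vector_space.intro graded_algebra_axioms.intro)
  fix m
  show "comm_group (ggroup Qt m)"
  proof (rule comm_groupI)
    fix x assume "x \<in> carrier (ggroup Qt m)"
    then obtain a where a: "a \<in> gcomp A m" "x = cls m a" by (auto simp: ggroup_def Qt_comp)
    then show "\<exists>y\<in>carrier (ggroup Qt m). y \<otimes>\<^bsub>ggroup Qt m\<^esub> x = \<one>\<^bsub>ggroup Qt m\<^esub>"
      by (intro bexI[of _ "cls m (gneg A m a)"]) (auto simp: ggroup_def Qt_comp Qt_add Qt_zero)
  qed (auto simp: ggroup_def Qt_comp Qt_add Qt_zero A.gadd_assoc, auto simp: A.gadd_comm)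
next
  show "bilinear_graded Qt Qt Qt (gmult Qt)"
    by (auto simp: bilinear_graded_def Qt_comp Qt_add Qt_scale Qt_mult
        A.gmult_add_l A.gmult_add_r A.gmult_scale_l A.gmult_scale_r)
next
  fix x y z i j k assume "x \<in> gcomp Qt i" "y \<in> gcomp Qt j" "z \<in> gcomp Qt k"
  then show "gmult Qt (i + j) k (gmult Qt i j x y) z = gmult Qt i (j + k) x (gmult Qt j k y z)"
    by (auto simp: Qt_comp Qt_mult A.gmult_assoc add.assoc)
next
  fix x i assume "x \<in> gcomp Qt i"
  then show "gmult Qt 0 i (gone Qt) x = x" "gmult Qt i 0 x (gone Qt) = x"
    using Qt_mult[of "gone A" 0 _ i] Qt_mult[of _ i "gone A" 0] by (auto simp: Qt_comp Qt_one A.gone_l A.gone_r)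
qed (auto simp: Qt_comp Qt_add Qt_scale Qt_one A.gscale_gadd A.gscale_add A.gscale_gscale)

end

section \<open>Isomorphisms of graded algebras\<close>

lemma galg_isomorphic_sym:
  assumes "A \<cong>\<^sub>g B" and gone: "gone A \<in> gcomp A 0"
    and add: "\<And>m x y. x \<in> gcomp A m \<Longrightarrow> y \<in> gcomp A m \<Longrightarrow> gadd A m x y \<in> gcomp A m"
    and scale: "\<And>m c x. x \<in> gcomp A m \<Longrightarrow> gscale A m c x \<in> gcomp A m"
    and mult: "\<And>i j x y. x \<in> gcomp A i \<Longrightarrow> y \<in> gcomp A j \<Longrightarrow> gmult A i j x y \<in> gcomp A (i + j)"
  shows "B \<cong>\<^sub>g A"
proof -
  obtain h where h: "galg_hom A B h" "\<And>m. bij_betw (h m) (gcomp A m) (gcomp B m)"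
    using assms(1) by (auto simp: galg_isomorphic_def)
  define k where "k = (\<lambda>m. inv_into (gcomp A m) (h m))"
  have kh: "k m (h m x) = x" if "x \<in> gcomp A m" for m x
    using h(2)[of m] that by (simp add: k_def bij_betw_def)
  have hk: "\<exists>x\<in>gcomp A m. y = h m x" if "y \<in> gcomp B m" for m y
    using h(2)[of m] that by (auto simp: bij_betw_def)
  have H: "h m (gadd A m x y) = gadd B m (h m x) (h m y)" "h m (gscale A m c x) = gscale B m c (h m x)"
    if "x \<in> gcomp A m" "y \<in> gcomp A m" for m x y c
    using h(1) that by (auto simp: galg_hom_def linear_graded_def)
  have M: "h (i + j) (gmult A i j x y) = gmult B i j (h i x) (h j y)"
    if "x \<in> gcomp A i" "y \<in> gcomp A j" for i j x y
    using h(1) that by (auto simp: galg_hom_def)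
  have O: "h 0 (gone A) = gone B" using h(1) by (simp add: galg_hom_def)
  have "galg_hom B A k"
    unfolding galg_hom_def linear_graded_def
  proof (intro conjI allI ballI)
    fix m x y c assume "x \<in> gcomp B m" "y \<in> gcomp B m"
    then obtain a b where "a \<in> gcomp A m" "x = h m a" "b \<in> gcomp A m" "y = h m b" using hk by metis
    then show "k m (gadd B m x y) = gadd A m (k m x) (k m y)" by (simp add: kh add flip: H)
  next
    fix m x c assume "x \<in> gcomp B m"
    then obtain a where "a \<in> gcomp A m" "x = h m a" using hk by metis
    then show "k m (gscale B m c x) = gscale A m c (k m x)" "k m x \<in> gcomp A m" by (simp_all add: kh scale flip: H(2))
  next
    show "k 0 (gone B) = gone A" using kh[OF gone] by (simp add: O)
  next
    fix i j x y assume "x \<in> gcomp B i" "y \<in> gcomp B j"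
    then obtain a b where "a \<in> gcomp A i" "x = h i a" "b \<in> gcomp A j" "y = h j b" using hk by metis
    then show "k (i + j) (gmult B i j x y) = gmult A i j (k i x) (k j y)" by (simp add: kh mult flip: M)
  qed
  moreover have "bij_betw (k m) (gcomp B m) (gcomp A m)" for m
    unfolding k_def by (rule bij_betw_inv_into[OF h(2)])
  ultimately show ?thesis unfolding galg_isomorphic_def by blast
qed

lemma galg_isomorphic_trans:
  assumes "A \<cong>\<^sub>g B" "B \<cong>\<^sub>g C"
  shows "A \<cong>\<^sub>g C"
proof -
  obtain h k where h: "galg_hom A B h" "\<And>m. bij_betw (h m) (gcomp A m) (gcomp B m)"
    and k: "galg_hom B C k" "\<And>m. bij_betw (k m) (gcomp B m) (gcomp C m)"
    using assms by (auto simp: galg_isomorphic_def)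
  have "galg_hom A C (\<lambda>m. k m \<circ> h m)"
    using h(1) k(1) by (simp add: galg_hom_def linear_graded_def)
  moreover have "bij_betw (k m \<circ> h m) (gcomp A m) (gcomp C m)" for m
    by (rule bij_betw_trans[OF h(2) k(2)])
  ultimately show ?thesis unfolding galg_isomorphic_def by blast
qed

section \<open>The shifted regular bimodule\<close>

lemma sign_powi: "(-1 :: 'k::field) powi i = (if even i then 1 else -1)"
  by (simp add: power_int_minus_left)

context graded_algebra
begin

abbreviation X where "X \<equiv> gshift (-1) (regular_bimodule A)"

lemma X_simps:
  "gcomp X m = gcomp A (m - 1)" "gadd X m = gadd A (m - 1)" "gzero X m = gzero A (m - 1)"
  "gscale X m = gscale A (m - 1)" "lact X i j = gmult A i (j - 1)"
  "ract X j i l b = gscale A (j + i - 1) (if even i then 1 else -1) (gmult A (j - 1) i l b)"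
  by (simp_all add: gshift_def regular_bimodule_def sign_powi power_int_minus_one_minus)

lemma X_bimodule: "graded_bimodule A X"
proof -
  have deg: "i + (j - 1) = i + j - 1" "j - 1 + i = j + i - 1" for i j :: int by auto
  show ?thesis
  proof (intro graded_bimodule.intro graded_vector_space.intro graded_bimodule_axioms.intro)
    fix m
    show "comm_group (ggroup X m)"
      using comm_group_ggroup[of "m - 1"] by (simp add: ggroup_def X_simps)
  next
    show "bilinear_graded A X X (lact X)"
      using gmult_closed gmult_add_l gmult_add_r gmult_scale_l gmult_scale_r
      by (simp add: bilinear_graded_def X_simps flip: deg(1))
  next
    have c: "gmult A (i - 1) j x y \<in> gcomp A (i + j - 1)" if "x \<in> gcomp A (i - 1)" "y \<in> gcomp A j" for i j x y
      using gmult_closed[OF that] by (simp add: deg)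
    show "bilinear_graded X A X (ract X)"
      unfolding bilinear_graded_def X_simps
      using gmult_add_l[of _ "i - 1" for i] gmult_add_r[of _ "i - 1" for i]
        gmult_scale_l[of _ "i - 1" for i] gmult_scale_r[of _ "i - 1" for i]
      by (auto simp: deg c gscale_gadd gscale_gscale mult.commute)
  next
    fix a i b j l k assume *: "a \<in> gcomp A i" "b \<in> gcomp A j" "l \<in> gcomp X k"
    then show "lact X (i + j) k (gmult A i j a b) l = lact X i (j + k) a (lact X j k b l)"
      using gmult_assoc[of a i b j l "k - 1"] by (simp add: X_simps deg)
  next
    fix l k a i b j assume *: "l \<in> gcomp X k" "a \<in> gcomp A i" "b \<in> gcomp A j"
    then show "ract X k (i + j) l (gmult A i j a b) = ract X (k + i) j (ract X k i l a) b"
      using gmult_assoc[of l "k - 1" a i b j] gmult_closed[of l "k - 1" a i]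
        gmult_scale_l[of "gmult A (k - 1) i l a" "k + i - 1" b j]
        gmult_closed[of "gmult A (k - 1) i l a" "k + i - 1" b j]
      by (auto simp: X_simps deg gscale_gscale add.assoc diff_add_eq)
  next
    fix l k a i b j assume *: "a \<in> gcomp A i" "l \<in> gcomp X k" "b \<in> gcomp A j"
    then show "ract X (i + k) j (lact X i k a l) b = lact X i (k + j) a (ract X k j l b)"
      using gmult_assoc[of a i l "k - 1" b j] gmult_closed[of l "k - 1" b j]
        gmult_scale_r[of a i "gmult A (k - 1) j l b" "k + j - 1"]
      by (auto simp: X_simps deg add.assoc)
  qed (auto simp: X_simps gscale_gadd gscale_add gscale_gscale gone_l gone_r deg intro: graded_algebra_axioms)
qed

end

section \<open>Assembling singular extensions\<close>

context graded_algebra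
begin

lemma gmult_deg: "\<lbrakk>x \<in> gcomp A i; y \<in> gcomp A j; m = i + j\<rbrakk> \<Longrightarrow> gmult A i j x y \<in> gcomp A m"
  by simp

lemma gmult_assoc_deg: "\<lbrakk>x \<in> gcomp A i; y \<in> gcomp A j; z \<in> gcomp A k; ij = i + j; jk = j + k\<rbrakk> \<Longrightarrow>
    gmult A ij k (gmult A i j x y) z = gmult A i jk x (gmult A j k y z)"
  by (simp add: gmult_assoc)

lemma gmult_scale_l_deg: "\<lbrakk>x \<in> gcomp A i; y \<in> gcomp A j; m = i + j\<rbrakk> \<Longrightarrow>
    gmult A i j (gscale A i c x) y = gscale A m c (gmult A i j x y)"
  by (simp add: gmult_scale_l)

lemma gmult_scale_r_deg: "\<lbrakk>x \<in> gcomp A i; y \<in> gcomp A j; m = i + j\<rbrakk> \<Longrightarrow>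
    gmult A i j x (gscale A j c y) = gscale A m c (gmult A i j x y)"
  by (simp add: gmult_scale_r)

lemma gmult_add_l_deg: "\<lbrakk>x \<in> gcomp A i; x' \<in> gcomp A i; y \<in> gcomp A j; m = i + j\<rbrakk> \<Longrightarrow>
    gmult A i j (gadd A i x x') y = gadd A m (gmult A i j x y) (gmult A i j x' y)"
  by (simp add: gmult_add_l)

text \<open>
  Moving \<open>t\<close> to the right past an element costs the sign of the degree of that element; in the
  second product both copies of \<open>t\<close> meet.
\<close>

lemma sq_zero_products:
  assumes t: "t \<in> gcomp A 1" "gmult A 1 1 t t = gzero A 2"
    and comm: "\<And>i b. b \<in> S i \<Longrightarrow> gmult A 1 i t b = gscale A (1 + i) (if even i then 1 else -1) (gmult A i 1 b t)"
    and S: "\<And>i. S i \<subseteq> gcomp A i"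
  shows "\<lbrakk>v \<in> gcomp A (j - 1); b \<in> S i\<rbrakk> \<Longrightarrow>
      gmult A j i (gmult A (j - 1) 1 v t) b =
      gmult A (j + i - 1) 1 (gscale A (j + i - 1) (if even i then 1 else -1) (gmult A (j - 1) i v b)) t"
    and "\<lbrakk>v \<in> gcomp A (j - 1); b \<in> S (i - 1)\<rbrakk> \<Longrightarrow>
      gmult A j i (gmult A (j - 1) 1 v t) (gmult A (i - 1) 1 b t) = gzero A (j + i)"
proof -
  let ?s = "\<lambda>i. if even i then 1 else -1 :: 'k"
  have c: "gmult A j i (gmult A (j - 1) 1 v t) b =
      gmult A (j + i - 1) 1 (gscale A (j + i - 1) (?s i) (gmult A (j - 1) i v b)) t"
    if v: "v \<in> gcomp A (j - 1)" and b: "b \<in> S i" for v b i j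
  proof -
    have b': "b \<in> gcomp A i" using b S by blast
    have "gmult A j i (gmult A (j - 1) 1 v t) b = gmult A (j - 1) (1 + i) v (gmult A 1 i t b)"
      using v t b' by (intro gmult_assoc_deg) auto
    also have "\<dots> = gscale A (j + i) (?s i) (gmult A (j - 1) (1 + i) v (gmult A i 1 b t))"
      unfolding comm[OF b] using v t b' by (intro gmult_scale_r_deg gmult_deg) auto
    also have "gmult A (j - 1) (1 + i) v (gmult A i 1 b t) = gmult A (j + i - 1) 1 (gmult A (j - 1) i v b) t"
      using v t b' by (intro gmult_assoc_deg[symmetric]) auto
    also have "gscale A (j + i) (?s i) \<dots> = gmult A (j + i - 1) 1 (gscale A (j + i - 1) (?s i) (gmult A (j - 1) i v b)) t"
      using v t b' by (intro gmult_scale_l_deg[symmetric] gmult_deg) auto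
    finally show ?thesis .
  qed
  then show "\<lbrakk>v \<in> gcomp A (j - 1); b \<in> S i\<rbrakk> \<Longrightarrow>
      gmult A j i (gmult A (j - 1) 1 v t) b =
      gmult A (j + i - 1) 1 (gscale A (j + i - 1) (?s i) (gmult A (j - 1) i v b)) t" .
  assume v: "v \<in> gcomp A (j - 1)" and b: "b \<in> S (i - 1)"
  have b': "b \<in> gcomp A (i - 1)" using b S by blast
  have vt: "gmult A (j - 1) 1 v t \<in> gcomp A j" using v t by (intro gmult_deg) auto
  define u where "u = gscale A (j + (i - 1) - 1) (?s (i - 1)) (gmult A (j - 1) (i - 1) v b)"
  have u: "u \<in> gcomp A (j + i - 2)"
  proof -
    have "gmult A (j - 1) (i - 1) v b \<in> gcomp A (j + i - 2)" using v b' by (intro gmult_deg) auto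
    moreover have "j + (i - 1) - 1 = j + i - 2" by simp
    ultimately show ?thesis unfolding u_def by simp
  qed
  have deg: "j + (i - 1) = j + i - 1" "j + i - 1 - 1 = j + i - 2" by auto
  have "gmult A j i (gmult A (j - 1) 1 v t) (gmult A (i - 1) 1 b t) =
      gmult A (j + (i - 1)) 1 (gmult A j (i - 1) (gmult A (j - 1) 1 v t) b) t"
    using vt b' t by (intro gmult_assoc_deg[symmetric]) auto
  also have "\<dots> = gmult A (j + (i - 1)) 1 (gmult A (j + (i - 1) - 1) 1 u t) t"
    unfolding u_def c[OF v b] ..
  also have "\<dots> = gmult A (j + i - 2) 2 u (gmult A 1 1 t t)"
    unfolding deg by (rule gmult_assoc_deg[OF u t(1) t(1)]) auto
  also have "\<dots> = gzero A (j + i)" unfolding t(2) using gmult_zero_r[OF u, of 2] by simp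
  finally show "gmult A j i (gmult A (j - 1) 1 v t) (gmult A (i - 1) 1 b t) = gzero A (j + i)" .
qed

end

text \<open>
  The algebra \<open>E0\<close> maps onto the subalgebra \<open>A\<close> of \<open>E1\<close>. The kernel of this map is generated by
  the class \<open>eu\<close>, whose annihilator is the kernel again, while \<open>E1\<close> is the direct sum of \<open>A\<close> and
  \<open>A y\<close>, on which the coefficients are unique. Both \<open>eu\<close> and \<open>y\<close> have degree one
  and square zero and commute up to sign, so multiplication by them identifies the bimodule \<open>A\<close>,
  shifted by one degree, with the kernel of \<open>E0\<close> over \<open>A\<close> and with a square-zero ideal
  of \<open>E1\<close>.
\<close>

locale extension_data = E0: graded_algebra E0 + E1: graded_algebra E1
  for E0 :: "('k::field, 'e, 'w) galg_scheme" and E1 :: "('k, 'a) galg" +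
  fixes p :: "int \<Rightarrow> 'e \<Rightarrow> 'a" and eu :: 'e and y :: 'a
  assumes p_hom: "galg_hom E0 E1 p"
    and eu: "eu \<in> gcomp E0 1" and y: "y \<in> gcomp E1 1"
    and eu_eu: "gmult E0 1 1 eu eu = gzero E0 2" and y_y: "gmult E1 1 1 y y = gzero E1 2"
    and eu_comm: "b \<in> gcomp E0 i \<Longrightarrow>
      gmult E0 1 i eu b = gscale E0 (1 + i) (if even i then 1 else -1) (gmult E0 i 1 b eu)"
    and y_comm: "a \<in> p i ` gcomp E0 i \<Longrightarrow>
      gmult E1 1 i y a = gscale E1 (1 + i) (if even i then 1 else -1) (gmult E1 i 1 a y)"
    and p_eu: "p 1 eu = gzero E1 1"
    and ker_p: "\<lbrakk>x \<in> gcomp E0 m; p m x = gzero E1 m\<rbrakk> \<Longrightarrow> \<exists>v\<in>gcomp E0 (m - 1). x = gmult E0 (m - 1) 1 v eu"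
    and ann_eu: "\<lbrakk>v \<in> gcomp E0 m; gmult E0 m 1 v eu = gzero E0 (m + 1)\<rbrakk> \<Longrightarrow> p m v = gzero E1 m"
    and decomp: "z \<in> gcomp E1 m \<Longrightarrow> \<exists>w\<in>gcomp E0 m. \<exists>v\<in>gcomp E0 (m - 1).
      z = gadd E1 m (p m w) (gmult E1 (m - 1) 1 (p (m - 1) v) y)"
    and indep: "\<lbrakk>w \<in> gcomp E0 m; v \<in> gcomp E0 (m - 1);
      gadd E1 m (p m w) (gmult E1 (m - 1) 1 (p (m - 1) v) y) = gzero E1 m\<rbrakk> \<Longrightarrow> p (m - 1) v = gzero E1 (m - 1)"
begin

definition A :: "('k, 'a) galg" where "A = E1\<lparr>gcomp := \<lambda>m. p m ` gcomp E0 m\<rparr>"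

lemma A_simps: "gcomp A m = p m ` gcomp E0 m" "gadd A = gadd E1" "gzero A = gzero E1" "gscale A = gscale E1"
  "gmult A = gmult E1" "gone A = gone E1"
  by (simp_all add: A_def)

lemma p_closed: "x \<in> gcomp E0 m \<Longrightarrow> p m x \<in> gcomp E1 m"
  and p_add: "\<lbrakk>x \<in> gcomp E0 m; x' \<in> gcomp E0 m\<rbrakk> \<Longrightarrow> p m (gadd E0 m x x') = gadd E1 m (p m x) (p m x')"
  and p_scale: "x \<in> gcomp E0 m \<Longrightarrow> p m (gscale E0 m c x) = gscale E1 m c (p m x)"
  and p_mult: "\<lbrakk>x \<in> gcomp E0 i; z \<in> gcomp E0 j\<rbrakk> \<Longrightarrow> p (i + j) (gmult E0 i j x z) = gmult E1 i j (p i x) (p j z)"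
  and p_one: "p 0 (gone E0) = gone E1"
  using p_hom unfolding galg_hom_def linear_graded_def by blast+

lemma p_zero: "p m (gzero E0 m) = gzero E1 m"
  using p_scale[OF E0.gzero_closed, of m 0] p_closed[OF E0.gzero_closed, of m] by simp

lemma p_mult_deg: "\<lbrakk>x \<in> gcomp E0 i; z \<in> gcomp E0 j; m = i + j\<rbrakk> \<Longrightarrow> p m (gmult E0 i j x z) = gmult E1 i j (p i x) (p j z)"
  by (simp add: p_mult)

lemma A_sub: "gcomp A m \<subseteq> gcomp E1 m"
  by (auto simp: A_simps p_closed)

lemma A_in: "x \<in> gcomp A m \<Longrightarrow> x \<in> gcomp E1 m"
  using A_sub by blast

lemma A_algebra: "graded_algebra A"
  unfolding A_def
proof (rule E1.graded_subalgebra)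
  fix m
  show "p m ` gcomp E0 m \<subseteq> gcomp E1 m" by (auto simp: p_closed)
  show "gzero E1 m \<in> p m ` gcomp E0 m" using p_zero[of m] by (intro image_eqI[of _ _ "gzero E0 m"]) auto
next
  fix m x z assume "x \<in> p m ` gcomp E0 m" "z \<in> p m ` gcomp E0 m"
  then show "gadd E1 m x z \<in> p m ` gcomp E0 m" by (auto simp flip: p_add)
next
  fix m c x assume "x \<in> p m ` gcomp E0 m"
  then show "gscale E1 m c x \<in> p m ` gcomp E0 m" by (auto simp flip: p_scale)
next
  fix i j x z assume "x \<in> p i ` gcomp E0 i" "z \<in> p j ` gcomp E0 j"
  then show "gmult E1 i j x z \<in> p (i + j) ` gcomp E0 (i + j)" by (auto simp flip: p_mult)
next
  show "gone E1 \<in> p 0 ` gcomp E0 0" by (simp flip: p_one)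
qed

sublocale A: graded_algebra A by (rule A_algebra)

lemma p_hom_A: "galg_hom E0 A p"
  by (auto simp: galg_hom_def linear_graded_def A_simps p_add p_scale p_mult p_one)

lemma v_eu: "v \<in> gcomp E0 (m - 1) \<Longrightarrow> gmult E0 (m - 1) 1 v eu \<in> gcomp E0 m"
  using eu by (intro E0.gmult_deg) auto

lemma x_y: "x \<in> gcomp E1 (m - 1) \<Longrightarrow> gmult E1 (m - 1) 1 x y \<in> gcomp E1 m"
  using y by (intro E1.gmult_deg) auto

lemma E0_products:
  "\<lbrakk>v \<in> gcomp E0 (j - 1); b \<in> gcomp E0 i\<rbrakk> \<Longrightarrow>
    gmult E0 j i (gmult E0 (j - 1) 1 v eu) b =
    gmult E0 (j + i - 1) 1 (gscale E0 (j + i - 1) (if even i then 1 else -1) (gmult E0 (j - 1) i v b)) eu"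
  "\<lbrakk>v \<in> gcomp E0 (j - 1); b \<in> gcomp E0 (i - 1)\<rbrakk> \<Longrightarrow>
    gmult E0 j i (gmult E0 (j - 1) 1 v eu) (gmult E0 (i - 1) 1 b eu) = gzero E0 (j + i)"
  by (rule E0.sq_zero_products[where S = "gcomp E0", OF eu eu_eu eu_comm], assumption, simp, assumption, assumption)+

lemma E1_products:
  "\<lbrakk>v \<in> gcomp E1 (j - 1); b \<in> gcomp A i\<rbrakk> \<Longrightarrow>
    gmult E1 j i (gmult E1 (j - 1) 1 v y) b =
    gmult E1 (j + i - 1) 1 (gscale E1 (j + i - 1) (if even i then 1 else -1) (gmult E1 (j - 1) i v b)) y"
  "\<lbrakk>v \<in> gcomp E1 (j - 1); b \<in> gcomp A (i - 1)\<rbrakk> \<Longrightarrow>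
    gmult E1 j i (gmult E1 (j - 1) 1 v y) (gmult E1 (i - 1) 1 b y) = gzero E1 (j + i)"
  by (rule E1.sq_zero_products[where S = "gcomp A", OF y y_y y_comm], simp add: A_simps, rule A_sub, assumption, assumption)+

lemma v_eu_zero_iff:
  assumes v: "v \<in> gcomp E0 (m - 1)"
  shows "gmult E0 (m - 1) 1 v eu = gzero E0 m \<longleftrightarrow> p (m - 1) v = gzero E1 (m - 1)"
proof
  assume "gmult E0 (m - 1) 1 v eu = gzero E0 m"
  then show "p (m - 1) v = gzero E1 (m - 1)" using ann_eu[OF v] by simp
next
  assume "p (m - 1) v = gzero E1 (m - 1)"
  then obtain u where u: "u \<in> gcomp E0 (m - 2)" "v = gmult E0 (m - 2) 1 u eu"
    using ker_p[OF v] by auto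
  have "gmult E0 (m - 1) 1 v eu = gmult E0 (m - 2) 2 u (gmult E0 1 1 eu eu)"
    unfolding u(2) using u(1) eu by (intro E0.gmult_assoc_deg) auto
  then show "gmult E0 (m - 1) 1 v eu = gzero E0 m"
    using E0.gmult_zero_r[OF u(1), of 2] by (simp add: eu_eu)
qed

lemma v_eu_eq_iff:
  assumes v: "v \<in> gcomp E0 (m - 1)" "v' \<in> gcomp E0 (m - 1)"
  shows "gmult E0 (m - 1) 1 v eu = gmult E0 (m - 1) 1 v' eu \<longleftrightarrow> p (m - 1) v = p (m - 1) v'"
proof -
  let ?d = "gadd E0 (m - 1) v (gneg E0 (m - 1) v')"
  have d: "?d \<in> gcomp E0 (m - 1)" using v by simp
  have "gmult E0 (m - 1) 1 ?d eu = gadd E0 m (gmult E0 (m - 1) 1 v eu) (gneg E0 m (gmult E0 (m - 1) 1 v' eu))"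
    using v eu by (simp add: E0.gmult_add_l_deg[of _ _ _ _ _ m] E0.gmult_neg_l)
  moreover have "p (m - 1) ?d = gadd E1 (m - 1) (p (m - 1) v) (gneg E1 (m - 1) (p (m - 1) v'))"
    using v by (simp add: p_add) (simp add: gneg_def p_scale)
  ultimately show ?thesis
    using v_eu_zero_iff[OF d] v by (simp add: E0.gadd_gneg_eq E1.gadd_gneg_eq v_eu p_closed)
qed

text \<open>
  By \<open>v_eu_eq_iff\<close> the product with \<open>eu\<close> depends only on the image under \<open>p\<close>, so the choice of the
  preimage is immaterial.
\<close>

definition theta :: "int \<Rightarrow> 'a \<Rightarrow> 'e" where
  "theta m x = gmult E0 (m - 1) 1 (SOME v. v \<in> gcomp E0 (m - 1) \<and> p (m - 1) v = x) eu"

lemma theta_p: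
  assumes v: "v \<in> gcomp E0 (m - 1)"
  shows "theta m (p (m - 1) v) = gmult E0 (m - 1) 1 v eu"
proof -
  have "\<exists>u. u \<in> gcomp E0 (m - 1) \<and> p (m - 1) u = p (m - 1) v" using v by blast
  from someI_ex[OF this] show ?thesis unfolding theta_def using v v_eu_eq_iff by blast
qed

theorem singular_E0: "singular_extension E0 A A.X"
  unfolding singular_extension_def
proof (intro conjI exI[of _ p] exI[of _ theta])
  show "graded_algebra E0" by (rule E0.graded_algebra_axioms)
  show "graded_bimodule A A.X" by (rule A.X_bimodule)
  show "galg_hom E0 A p" by (rule p_hom_A)
  show "\<forall>m. p m ` gcomp E0 m = gcomp A m" by (simp add: A_simps)
  have ker: "\<exists>v\<in>gcomp E0 (m - 1). x = gmult E0 (m - 1) 1 v eu" if "x \<in> gkernel E0 A p m" for x m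
    using that ker_p by (simp add: gkernel_def A_simps)
  show "\<forall>i j. \<forall>x\<in>gkernel E0 A p i. \<forall>y\<in>gkernel E0 A p j. gmult E0 i j x y = gzero E0 (i + j)"
  proof (intro allI ballI)
    fix i j x z assume "x \<in> gkernel E0 A p i" "z \<in> gkernel E0 A p j"
    then obtain v u where "v \<in> gcomp E0 (i - 1)" "x = gmult E0 (i - 1) 1 v eu"
      "u \<in> gcomp E0 (j - 1)" "z = gmult E0 (j - 1) 1 u eu" using ker by metis
    then show "gmult E0 i j x z = gzero E0 (i + j)" using E0_products(2) by blast
  qed
  show "linear_graded A.X E0 theta"
    unfolding linear_graded_def A.X_simps A_simps
  proof (intro allI ballI conjI)
    fix m x assume "x \<in> p (m - 1) ` gcomp E0 (m - 1)"
    then obtain v where v: "v \<in> gcomp E0 (m - 1)" "x = p (m - 1) v" by blast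
    show "theta m x \<in> gcomp E0 m" using v by (simp add: theta_p v_eu)
    show "theta m (gscale E1 (m - 1) c x) = gscale E0 m c (theta m x)" for c
      using v eu by (simp add: theta_p E0.gmult_scale_l_deg[of _ _ _ _ m] flip: p_scale)
    fix z assume "z \<in> p (m - 1) ` gcomp E0 (m - 1)"
    then obtain u where u: "u \<in> gcomp E0 (m - 1)" "z = p (m - 1) u" by blast
    show "theta m (gadd E1 (m - 1) x z) = gadd E0 m (theta m x) (theta m z)"
      using v u eu by (simp add: theta_p E0.gmult_add_l_deg[of _ _ _ _ _ m] flip: p_add)
  qed
  show "\<forall>m. bij_betw (theta m) (gcomp A.X m) (gkernel E0 A p m)"
    unfolding A.X_simps A_simps
  proof
    fix m
    have "inj_on (theta m) (p (m - 1) ` gcomp E0 (m - 1))"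
      by (auto simp: inj_on_def theta_p v_eu_eq_iff)
    moreover have "theta m ` p (m - 1) ` gcomp E0 (m - 1) = gkernel E0 A p m"
    proof
      show "theta m ` p (m - 1) ` gcomp E0 (m - 1) \<subseteq> gkernel E0 A p m"
      proof
        fix x assume "x \<in> theta m ` p (m - 1) ` gcomp E0 (m - 1)"
        then obtain v where v: "v \<in> gcomp E0 (m - 1)" "x = gmult E0 (m - 1) 1 v eu" by (auto simp: theta_p)
        have "p m x = gzero E1 m"
          using v eu E1.gmult_zero_r[OF p_closed[OF v(1)], of 1] by (simp add: p_mult_deg[of _ _ _ _ m] p_eu)
        then show "x \<in> gkernel E0 A p m" using v by (simp add: gkernel_def v_eu A_simps)
      qed
      show "gkernel E0 A p m \<subseteq> theta m ` p (m - 1) ` gcomp E0 (m - 1)"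
        using ker by (force simp: theta_p image_iff)
    qed
    ultimately show "bij_betw (theta m) (p (m - 1) ` gcomp E0 (m - 1)) (gkernel E0 A p m)"
      by (simp add: bij_betw_def)
  qed
  show "\<forall>i j. \<forall>e\<in>gcomp E0 i. \<forall>x\<in>gcomp A.X j. theta (i + j) (lact A.X i j (p i e) x) = gmult E0 i j e (theta j x)"
    unfolding A.X_simps A_simps
  proof (intro allI ballI)
    fix i j e x assume e: "e \<in> gcomp E0 i" and "x \<in> p (j - 1) ` gcomp E0 (j - 1)"
    then obtain v where v: "v \<in> gcomp E0 (j - 1)" "x = p (j - 1) v" by blast
    have ev: "gmult E0 i (j - 1) e v \<in> gcomp E0 (i + j - 1)" using e v by (intro E0.gmult_deg) auto
    have "gmult E1 i (j - 1) (p i e) x = p (i + j - 1) (gmult E0 i (j - 1) e v)"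
      unfolding v(2) using e v by (intro p_mult_deg[symmetric]) auto
    then have "theta (i + j) (gmult E1 i (j - 1) (p i e) x) = gmult E0 (i + j - 1) 1 (gmult E0 i (j - 1) e v) eu"
      using theta_p[OF ev] by simp
    also have "\<dots> = gmult E0 i j e (gmult E0 (j - 1) 1 v eu)"
      using e v eu by (intro E0.gmult_assoc_deg) auto
    finally show "theta (i + j) (gmult E1 i (j - 1) (p i e) x) = gmult E0 i j e (theta j x)"
      using v by (simp add: theta_p)
  qed
  show "\<forall>i j. \<forall>e\<in>gcomp E0 i. \<forall>x\<in>gcomp A.X j. theta (j + i) (ract A.X j i x (p i e)) = gmult E0 j i (theta j x) e"
    unfolding A.X_simps A_simps
  proof (intro allI ballI)
    fix i j e x assume e: "e \<in> gcomp E0 i" and "x \<in> p (j - 1) ` gcomp E0 (j - 1)"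
    then obtain v where v: "v \<in> gcomp E0 (j - 1)" "x = p (j - 1) v" by blast
    let ?s = "if even i then 1 else -1 :: 'k"
    have ve: "gmult E0 (j - 1) i v e \<in> gcomp E0 (j + i - 1)" using e v by (intro E0.gmult_deg) auto
    have "gmult E1 (j - 1) i x (p i e) = p (j + i - 1) (gmult E0 (j - 1) i v e)"
      unfolding v(2) using e v by (intro p_mult_deg[symmetric]) auto
    then have "gscale E1 (j + i - 1) ?s (gmult E1 (j - 1) i x (p i e)) =
        p (j + i - 1) (gscale E0 (j + i - 1) ?s (gmult E0 (j - 1) i v e))"
      using ve by (simp only: p_scale)
    then have "theta (j + i) (gscale E1 (j + i - 1) ?s (gmult E1 (j - 1) i x (p i e))) =
        gmult E0 (j + i - 1) 1 (gscale E0 (j + i - 1) ?s (gmult E0 (j - 1) i v e)) eu"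
      using theta_p[OF E0.gscale_closed[OF ve]] by (simp only:)
    also have "\<dots> = gmult E0 j i (gmult E0 (j - 1) 1 v eu) e"
      by (rule E0_products(1)[OF v(1) e, symmetric])
    finally show "theta (j + i) (gscale E1 (j + i - 1) ?s (gmult E1 (j - 1) i x (p i e))) = gmult E0 j i (theta j x) e"
      using v by (simp only: theta_p)
  qed
qed

definition kap :: "int \<Rightarrow> 'a \<times> 'a \<Rightarrow> 'a" where
  "kap m c = gadd E1 m (fst c) (gmult E1 (m - 1) 1 (snd c) y)"

abbreviation TX where "TX \<equiv> galg_trivial_ext A A.X"

lemma TX_simps: "gcomp TX m = gcomp A m \<times> gcomp A (m - 1)"
  "gadd TX m c d = (gadd E1 m (fst c) (fst d), gadd E1 (m - 1) (snd c) (snd d))"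
  "gscale TX m s c = (gscale E1 m s (fst c), gscale E1 (m - 1) s (snd c))"
  "gmult TX i j c d = (gmult E1 i j (fst c) (fst d),
     gadd E1 (i + j - 1) (gmult E1 i (j - 1) (fst c) (snd d))
       (gscale E1 (i + j - 1) (if even j then 1 else -1) (gmult E1 (i - 1) j (snd c) (fst d))))"
  "gone TX = (gone E1, gzero E1 (-1))"
  by (simp_all add: galg_trivial_ext_def A.X_simps A_simps case_prod_beta)

lemma kap_closed: "c \<in> gcomp TX m \<Longrightarrow> kap m c \<in> gcomp E1 m"
  by (auto simp: kap_def TX_simps x_y A_in)

lemma kap_bij: "bij_betw (kap m) (gcomp TX m) (gcomp E1 m)"
proof -
  have inj: "c = d" if c: "c \<in> gcomp TX m" and d: "d \<in> gcomp TX m" and e: "kap m c = kap m d" for c d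
  proof -
    obtain w v where wv: "w \<in> gcomp E0 m" "v \<in> gcomp E0 (m - 1)" "c = (p m w, p (m - 1) v)"
      using c by (auto simp: TX_simps A_simps)
    obtain w' v' where wv': "w' \<in> gcomp E0 m" "v' \<in> gcomp E0 (m - 1)" "d = (p m w', p (m - 1) v')"
      using d by (auto simp: TX_simps A_simps)
    note pc = p_closed[OF wv(1)] p_closed[OF wv(2)] p_closed[OF wv'(1)] p_closed[OF wv'(2)]
    note xy = x_y[OF pc(2)] x_y[OF pc(4)]
    let ?w = "gadd E0 m w (gneg E0 m w')" and ?v = "gadd E0 (m - 1) v (gneg E0 (m - 1) v')"
    have pw: "p m ?w = gadd E1 m (p m w) (gneg E1 m (p m w'))"
      using wv wv' by (simp add: p_add) (simp add: gneg_def p_scale)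
    have pv: "p (m - 1) ?v = gadd E1 (m - 1) (p (m - 1) v) (gneg E1 (m - 1) (p (m - 1) v'))"
      using wv wv' by (simp add: p_add) (simp add: gneg_def p_scale)
    have "gmult E1 (m - 1) 1 (p (m - 1) ?v) y =
        gadd E1 m (gmult E1 (m - 1) 1 (p (m - 1) v) y) (gneg E1 m (gmult E1 (m - 1) 1 (p (m - 1) v') y))"
      unfolding pv using pc y by (simp add: E1.gmult_add_l_deg[of _ _ _ _ _ m] E1.gmult_neg_l)
    then have "gadd E1 m (p m ?w) (gmult E1 (m - 1) 1 (p (m - 1) ?v) y) = gadd E1 m (kap m c) (gneg E1 m (kap m d))"
      unfolding pw kap_def wv(3) wv'(3) using pc xy
      by (simp add: E1.gneg_cong_add E1.gadd_assoc E1.gadd_left_comm)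
    also have "\<dots> = gzero E1 m" unfolding e using kap_closed[OF d] by simp
    finally have z: "gadd E1 m (p m ?w) (gmult E1 (m - 1) 1 (p (m - 1) ?v) y) = gzero E1 m" .
    have v0: "p (m - 1) ?v = gzero E1 (m - 1)" by (rule indep[OF _ _ z]) (use wv wv' in auto)
    then have "p m ?w = gzero E1 m"
      using z E1.gmult_zero_l[OF y, of "m - 1"] pc by (simp add: pw)
    then show "c = d" using v0 pc by (simp add: pw pv E1.gadd_gneg_eq wv(3) wv'(3))
  qed
  have "\<exists>c\<in>gcomp TX m. x = kap m c" if "x \<in> gcomp E1 m" for x
    using decomp[OF that] by (force simp: TX_simps A_simps kap_def)
  then show ?thesis unfolding bij_betw_def inj_on_def using inj kap_closed by blast
qed

lemma kap_hom: "galg_hom TX E1 kap"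
  unfolding galg_hom_def linear_graded_def
proof (intro conjI allI ballI)
  fix m c d s assume c: "c \<in> gcomp TX m"
  then have c': "fst c \<in> gcomp E1 m" "snd c \<in> gcomp E1 (m - 1)" by (auto simp: TX_simps A_in)
  show "kap m c \<in> gcomp E1 m" by (rule kap_closed[OF c])
  show "kap m (gscale TX m s c) = gscale E1 m s (kap m c)"
    using c' x_y[OF c'(2)] y by (simp add: kap_def TX_simps E1.gscale_gadd E1.gmult_scale_l_deg[of _ _ _ _ m])
  assume d: "d \<in> gcomp TX m"
  then have d': "fst d \<in> gcomp E1 m" "snd d \<in> gcomp E1 (m - 1)" by (auto simp: TX_simps A_in)
  show "kap m (gadd TX m c d) = gadd E1 m (kap m c) (kap m d)"
    using c' d' x_y[OF c'(2)] x_y[OF d'(2)] y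
    by (simp add: kap_def TX_simps E1.gmult_add_l_deg[of _ _ _ _ _ m] E1.gadd_assoc E1.gadd_left_comm)
next
  show "kap 0 (gone TX) = gone E1"
    using E1.gmult_zero_l[OF y, of "-1"] E1.gone_closed by (simp add: kap_def TX_simps del: E1.gone_closed)
next
  fix i j c d assume c: "c \<in> gcomp TX i" and d: "d \<in> gcomp TX j"
  obtain a x where c': "c = (a, x)" "a \<in> gcomp A i" "x \<in> gcomp A (i - 1)" using c by (auto simp: TX_simps)
  obtain b z where d': "d = (b, z)" "b \<in> gcomp A j" "z \<in> gcomp A (j - 1)" using d by (auto simp: TX_simps)
  note in1 = c'(2,3)[THEN A_in] d'(2,3)[THEN A_in]
  let ?s = "if even j then 1 else -1 :: 'k"
  let ?az = "gmult E1 i (j - 1) a z" and ?xb = "gscale E1 (i + j - 1) ?s (gmult E1 (i - 1) j x b)"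
  have az: "?az \<in> gcomp E1 (i + j - 1)" using in1 by (intro E1.gmult_deg) auto
  have xb: "?xb \<in> gcomp E1 (i + j - 1)" using in1 by (intro E1.gscale_closed E1.gmult_deg) auto
  note xy = x_y[OF in1(2)] and zy = x_y[OF in1(4)]
  note azy = x_y[OF az] and xby = x_y[OF xb]
  have ab: "gmult E1 i j a b \<in> gcomp E1 (i + j)" using in1 by simp
  have "gmult E1 i j (kap i c) (kap j d) =
      gadd E1 (i + j) (gadd E1 (i + j) (gmult E1 i j a b) (gmult E1 i j (gmult E1 (i - 1) 1 x y) b))
        (gadd E1 (i + j) (gmult E1 i j a (gmult E1 (j - 1) 1 z y))
          (gmult E1 i j (gmult E1 (i - 1) 1 x y) (gmult E1 (j - 1) 1 z y)))"
    unfolding kap_def c' d' using in1 xy zy by (simp add: E1.gmult_add_l E1.gmult_add_r)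
  also have "gmult E1 i j (gmult E1 (i - 1) 1 x y) (gmult E1 (j - 1) 1 z y) = gzero E1 (i + j)"
    by (rule E1_products(2)) (use in1 d' in \<open>auto simp: A_simps\<close>)
  also have "gmult E1 i j (gmult E1 (i - 1) 1 x y) b = gmult E1 (i + j - 1) 1 ?xb y"
    by (rule E1_products(1)) (use in1 d' in \<open>auto simp: A_simps\<close>)
  also have "gmult E1 i j a (gmult E1 (j - 1) 1 z y) = gmult E1 (i + j - 1) 1 ?az y"
    using in1 y by (intro E1.gmult_assoc_deg[symmetric]) auto
  finally have "gmult E1 i j (kap i c) (kap j d) =
      gadd E1 (i + j) (gmult E1 i j a b) (gadd E1 (i + j) (gmult E1 (i + j - 1) 1 ?az y) (gmult E1 (i + j - 1) 1 ?xb y))"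
    using ab azy xby E1.gadd_comm[OF azy xby] by (simp add: E1.gadd_assoc)
  also have "gadd E1 (i + j) (gmult E1 (i + j - 1) 1 ?az y) (gmult E1 (i + j - 1) 1 ?xb y) =
      gmult E1 (i + j - 1) 1 (gadd E1 (i + j - 1) ?az ?xb) y"
    using az xb y by (intro E1.gmult_add_l_deg[symmetric]) auto
  finally show "kap (i + j) (gmult TX i j c d) = gmult E1 i j (kap i c) (kap j d)"
    unfolding c' d' kap_def TX_simps by simp
qed

lemma TX_iso: "E1 \<cong>\<^sub>g TX"
proof (rule galg_isomorphic_sym)
  show "TX \<cong>\<^sub>g E1" unfolding galg_isomorphic_def using kap_hom kap_bij by blast
  note AX = A.gadd_closed[unfolded A_simps(2)] A.gscale_closed[unfolded A_simps(4)]
    A.gmult_deg[unfolded A_simps(5)]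
  show "gone TX \<in> gcomp TX 0"
    using A.gone_closed A.gzero_closed[of "-1"] by (simp add: TX_simps A_simps(3,6))
  show "gadd TX m x z \<in> gcomp TX m" if "x \<in> gcomp TX m" "z \<in> gcomp TX m" for m x z
    using that AX by (auto simp: TX_simps)
  show "gscale TX m c x \<in> gcomp TX m" if "x \<in> gcomp TX m" for m c x
    using that AX by (auto simp: TX_simps)
  show "gmult TX i j x z \<in> gcomp TX (i + j)" if "x \<in> gcomp TX i" "z \<in> gcomp TX j" for i j x z
    using that by (auto simp: TX_simps intro!: AX)
qed

theorem singular_E1: "singular_extension E1 A A.X"
proof -
  define q where "q = (\<lambda>m. inv_into (gcomp TX m) (kap m))"
  have qk: "q m (kap m c) = c" if "c \<in> gcomp TX m" for m c
    using kap_bij[of m] that by (simp add: q_def bij_betw_def)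
  have kq: "\<exists>c\<in>gcomp TX m. x = kap m c" if "x \<in> gcomp E1 m" for m x
    using kap_bij[of m] that by (auto simp: bij_betw_def)
  have H: "kap m (gadd TX m c d) = gadd E1 m (kap m c) (kap m d)" "kap m (gscale TX m s c) = gscale E1 m s (kap m c)"
    if "c \<in> gcomp TX m" "d \<in> gcomp TX m" for m c d s
    using kap_hom that by (auto simp: galg_hom_def linear_graded_def)
  have M: "kap (i + j) (gmult TX i j c d) = gmult E1 i j (kap i c) (kap j d)"
    if "c \<in> gcomp TX i" "d \<in> gcomp TX j" for i j c d
    using kap_hom that by (auto simp: galg_hom_def)
  have O: "kap 0 (gone TX) = gone E1" using kap_hom by (simp add: galg_hom_def)
  note AX = A.gadd_closed[unfolded A_simps(2)] A.gscale_closed[unfolded A_simps(4)]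
    A.gmult_deg[unfolded A_simps(5)]
  have TXc: "gadd TX m c d \<in> gcomp TX m" "gscale TX m s c \<in> gcomp TX m"
    if "c \<in> gcomp TX m" "d \<in> gcomp TX m" for m c d s
    using that AX by (auto simp: TX_simps)
  have TXm: "gmult TX i j c d \<in> gcomp TX (i + j)" if "c \<in> gcomp TX i" "d \<in> gcomp TX j" for i j c d
    using that by (auto simp: TX_simps intro!: AX)
  have TXo: "gone TX \<in> gcomp TX 0"
    using A.gone_closed A.gzero_closed[of "-1"] by (simp add: TX_simps A_simps(3,6))
  have A0: "gzero E1 m \<in> gcomp A m" for m using A.gzero_closed[of m] by (simp add: A_simps(3))
  have k0: "kap m (gzero E1 m, x) = gmult E1 (m - 1) 1 x y" if "x \<in> gcomp A (m - 1)" for m x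
    using x_y[OF A_in[OF that]] by (simp add: kap_def)
  have ker: "\<exists>u\<in>gcomp A (m - 1). x = gmult E1 (m - 1) 1 u y" if "x \<in> gkernel E1 A (\<lambda>m x. fst (q m x)) m" for m x
  proof -
    have x: "x \<in> gcomp E1 m" "fst (q m x) = gzero E1 m" using that by (auto simp: gkernel_def A_simps(3))
    obtain c where c: "c \<in> gcomp TX m" "x = kap m c" using kq[OF x(1)] by blast
    have "fst c = gzero E1 m" using x(2) by (simp add: c qk)
    then show ?thesis using c k0[of "snd c" m] by (intro bexI[of _ "snd c"]) (auto simp: TX_simps)
  qed
  show ?thesis
    unfolding singular_extension_def
  proof (rule conjI[OF E1.graded_algebra_axioms], rule conjI[OF A.X_bimodule],
      rule exI[of _ "\<lambda>m x. fst (q m x)"], rule exI[of _ "\<lambda>m x. gmult E1 (m - 1) 1 x y"], intro conjI)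
    show "galg_hom E1 A (\<lambda>m x. fst (q m x))"
      unfolding galg_hom_def linear_graded_def
    proof (intro conjI allI ballI)
      fix m x s assume "x \<in> gcomp E1 m"
      then obtain c where c: "c \<in> gcomp TX m" "x = kap m c" using kq by blast
      then show "fst (q m x) \<in> gcomp A m" by (auto simp: qk TX_simps)
      show "fst (q m (gscale E1 m s x)) = gscale A m s (fst (q m x))"
        using c TXc[OF c(1) c(1)] by (simp add: qk A_simps flip: H(2)) (simp add: TX_simps)
      fix z assume "z \<in> gcomp E1 m"
      then obtain d where d: "d \<in> gcomp TX m" "z = kap m d" using kq by blast
      show "fst (q m (gadd E1 m x z)) = gadd A m (fst (q m x)) (fst (q m z))"
        using c d TXc[OF c(1) d(1)] by (simp add: qk A_simps flip: H(1)) (simp add: TX_simps)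
    next
      show "fst (q 0 (gone E1)) = gone A" using qk[OF TXo] by (simp add: O A_simps(6)) (simp add: TX_simps)
    next
      fix i j x z assume "x \<in> gcomp E1 i" "z \<in> gcomp E1 j"
      then obtain c d where c: "c \<in> gcomp TX i" "x = kap i c" "d \<in> gcomp TX j" "z = kap j d" using kq by metis
      show "fst (q (i + j) (gmult E1 i j x z)) = gmult A i j (fst (q i x)) (fst (q j z))"
        using c TXm[OF c(1,3)] by (simp add: qk A_simps flip: M) (simp add: TX_simps)
    qed
    show "\<forall>m. (\<lambda>x. fst (q m x)) ` gcomp E1 m = gcomp A m"
    proof (intro allI equalityI subsetI)
      fix m a assume "a \<in> (\<lambda>x. fst (q m x)) ` gcomp E1 m"
      then show "a \<in> gcomp A m" using kq by (force simp: qk TX_simps)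
    next
      fix m a assume a: "a \<in> gcomp A m"
      then have c: "(a, gzero E1 (m - 1)) \<in> gcomp TX m" using A0 by (simp add: TX_simps)
      show "a \<in> (\<lambda>x. fst (q m x)) ` gcomp E1 m"
        by (rule image_eqI[of _ _ "kap m (a, gzero E1 (m - 1))"]) (simp_all add: qk[OF c] kap_closed[OF c])
    qed
    show "\<forall>i j. \<forall>x\<in>gkernel E1 A (\<lambda>m x. fst (q m x)) i. \<forall>z\<in>gkernel E1 A (\<lambda>m x. fst (q m x)) j.
        gmult E1 i j x z = gzero E1 (i + j)"
    proof (intro allI ballI)
      fix i j x z assume "x \<in> gkernel E1 A (\<lambda>m x. fst (q m x)) i" "z \<in> gkernel E1 A (\<lambda>m x. fst (q m x)) j"
      then obtain v u where vu: "v \<in> gcomp A (i - 1)" "x = gmult E1 (i - 1) 1 v y"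
        "u \<in> gcomp A (j - 1)" "z = gmult E1 (j - 1) 1 u y" using ker by metis
      show "gmult E1 i j x z = gzero E1 (i + j)"
        unfolding vu(2,4) by (rule E1_products(2)[OF A_in[OF vu(1)]]) (use vu(3) in \<open>simp add: A_simps\<close>)
    qed
    show "linear_graded A.X E1 (\<lambda>m x. gmult E1 (m - 1) 1 x y)"
      unfolding linear_graded_def A.X_simps A_simps(2,4)
      using y by (auto simp: x_y A_in E1.gmult_add_l_deg[of _ _ _ _ _ m for m] intro!: E1.gmult_add_l_deg E1.gmult_scale_l_deg dest: A_in)
    show "\<forall>m. bij_betw (\<lambda>x. gmult E1 (m - 1) 1 x y) (gcomp A.X m) (gkernel E1 A (\<lambda>m x. fst (q m x)) m)"
      unfolding A.X_simps
    proof
      fix m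
      have c: "(gzero E1 m, x) \<in> gcomp TX m" if "x \<in> gcomp A (m - 1)" for x using that A0 by (simp add: TX_simps)
      have "inj_on (\<lambda>x. gmult E1 (m - 1) 1 x y) (gcomp A (m - 1))"
        by (rule inj_onI) (metis c k0 qk snd_conv)
      moreover have "gmult E1 (m - 1) 1 x y \<in> gkernel E1 A (\<lambda>m x. fst (q m x)) m" if "x \<in> gcomp A (m - 1)" for x
        using qk[OF c[OF that]] k0[OF that] x_y[OF A_in[OF that]] by (simp add: gkernel_def A_simps(3))
      ultimately show "bij_betw (\<lambda>x. gmult E1 (m - 1) 1 x y) (gcomp A (m - 1)) (gkernel E1 A (\<lambda>m x. fst (q m x)) m)"
        using ker unfolding bij_betw_def by blast
    qed
    show "\<forall>i j. \<forall>e\<in>gcomp E1 i. \<forall>x\<in>gcomp A.X j. gmult E1 (i + j - 1) 1 (lact A.X i j (fst (q i e)) x) y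
        = gmult E1 i j e (gmult E1 (j - 1) 1 x y)"
    proof (intro allI ballI)
      fix i j e x assume "e \<in> gcomp E1 i" and x: "x \<in> gcomp A.X j"
      then obtain c where c: "c \<in> gcomp TX i" "e = kap i c" using kq by blast
      have x': "x \<in> gcomp A (j - 1)" using x by (simp add: A.X_simps)
      have d: "(gzero E1 j, x) \<in> gcomp TX j" using x' A0 by (simp add: TX_simps)
      have cc: "fst c \<in> gcomp E1 i" "snd c \<in> gcomp E1 (i - 1)" using c by (auto simp: TX_simps A_in)
      have g: "gmult E1 i (j - 1) (fst c) x \<in> gcomp E1 (i + j - 1)" using cc A_in[OF x'] by (intro E1.gmult_deg) auto
      have z: "gmult E1 (i - 1) j (snd c) (gzero E1 j) = gzero E1 (i + j - 1)"
        using E1.gmult_zero_r[OF cc(2), of j] by (simp add: algebra_simps)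
      have "gmult E1 i j e (gmult E1 (j - 1) 1 x y) = kap (i + j) (gmult TX i j c (gzero E1 j, x))"
        unfolding M[OF c(1) d] by (simp add: c k0[OF x'])
      also have "\<dots> = gmult E1 (i + j - 1) 1 (gmult E1 i (j - 1) (fst c) x) y"
        using cc g x_y[OF g] by (simp add: kap_def TX_simps z)
      finally show "gmult E1 (i + j - 1) 1 (lact A.X i j (fst (q i e)) x) y = gmult E1 i j e (gmult E1 (j - 1) 1 x y)"
        by (simp add: A.X_simps A_simps(5) c qk)
    qed
    show "\<forall>i j. \<forall>e\<in>gcomp E1 i. \<forall>x\<in>gcomp A.X j. gmult E1 (j + i - 1) 1 (ract A.X j i x (fst (q i e))) y
        = gmult E1 j i (gmult E1 (j - 1) 1 x y) e"
    proof (intro allI ballI)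
      fix i j e x assume "e \<in> gcomp E1 i" and x: "x \<in> gcomp A.X j"
      then obtain c where c: "c \<in> gcomp TX i" "e = kap i c" using kq by blast
      have x': "x \<in> gcomp A (j - 1)" using x by (simp add: A.X_simps)
      have d: "(gzero E1 j, x) \<in> gcomp TX j" using x' A0 by (simp add: TX_simps)
      have cc: "fst c \<in> gcomp E1 i" "snd c \<in> gcomp E1 (i - 1)" using c by (auto simp: TX_simps A_in)
      have g: "gscale E1 (j + i - 1) (if even i then 1 else -1) (gmult E1 (j - 1) i x (fst c)) \<in> gcomp E1 (j + i - 1)"
        using cc A_in[OF x'] by (intro E1.gscale_closed E1.gmult_deg) auto
      have z: "gmult E1 j (i - 1) (gzero E1 j) (snd c) = gzero E1 (j + i - 1)"
        using E1.gmult_zero_l[OF cc(2), of j] by (simp add: algebra_simps)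
      have "gmult E1 j i (gmult E1 (j - 1) 1 x y) e = kap (j + i) (gmult TX j i (gzero E1 j, x) c)"
        unfolding M[OF d c(1)] by (simp add: c k0[OF x'])
      also have "\<dots> = gmult E1 (j + i - 1) 1 (gscale E1 (j + i - 1) (if even i then 1 else -1) (gmult E1 (j - 1) i x (fst c))) y"
        using cc g x_y[OF g] by (simp add: kap_def TX_simps z del: if_split)
      finally show "gmult E1 (j + i - 1) 1 (ract A.X j i x (fst (q i e))) y = gmult E1 j i (gmult E1 (j - 1) 1 x y) e"
        by (simp add: A.X_simps A_simps(4,5) c qk)
    qed
  qed
qed

end

section \<open>Skew polynomials modulo the square of the variable\<close>

context graded_algebra
begin

lemma ggroup_comm_monoid: "comm_monoid (ggroup A d)"
  using comm_group_ggroup comm_group.axioms(1) by blast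

lemma ggroup_simps: "carrier (ggroup A d) = gcomp A d" "monoid.mult (ggroup A d) = gadd A d" "one (ggroup A d) = gzero A d"
  by (simp_all add: ggroup_def)

lemma finprod_all_zero: "(\<And>i. i \<in> I \<Longrightarrow> h i = gzero A d) \<Longrightarrow> finprod (ggroup A d) h I = gzero A d"
  using comm_monoid.finprod_one_eqI[OF ggroup_comm_monoid, of I h d] by (simp add: ggroup_simps)

lemma finprod_one_term:
  assumes i: "i \<in> I" "finite I" and z: "\<And>j. j \<in> I \<Longrightarrow> j \<noteq> i \<Longrightarrow> h j = gzero A d" and v: "h i \<in> gcomp A d"
  shows "finprod (ggroup A d) h I = h i"
proof -
  interpret G: comm_monoid "ggroup A d" by (rule ggroup_comm_monoid)
  have I: "insert i (I - {i}) = I" using i by auto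
  have "finprod (ggroup A d) h (insert i (I - {i})) = h i \<otimes>\<^bsub>ggroup A d\<^esub> finprod (ggroup A d) h (I - {i})"
    using i z v by (intro G.finprod_insert) (auto simp: ggroup_simps)
  also have "finprod (ggroup A d) h (I - {i}) = gzero A d" by (rule finprod_all_zero) (use z in auto)
  finally show ?thesis unfolding I using v by (simp add: ggroup_simps)
qed

lemma finprod_gcomp: "(\<And>i. i \<in> I \<Longrightarrow> h i \<in> gcomp A d) \<Longrightarrow> finprod (ggroup A d) h I \<in> gcomp A d"
  using comm_monoid.finprod_closed[OF ggroup_comm_monoid, of h I d] by (auto simp: ggroup_simps)

abbreviation P where "P \<equiv> gpoly A"

lemma P_simps:
  "gadd P m f g j = gadd A (m - int j) (f j) (g j)" "gzero P m j = gzero A (m - int j)"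
  "gscale P m c f j = gscale A (m - int j) c (f j)"
  "gone P j = (if j = 0 then gone A else gzero A (- int j))"
  by (simp_all add: gpoly_def)

lemma P_comp: "f \<in> gcomp P m \<longleftrightarrow> (\<forall>j. f j \<in> gcomp A (m - int j)) \<and> (\<exists>N. \<forall>j>N. f j = gzero A (m - int j))"
proof -
  have "finite {j. f j \<noteq> gzero A (m - int j)} \<longleftrightarrow> (\<exists>N. \<forall>j>N. f j = gzero A (m - int j))"
    unfolding finite_nat_set_iff_bounded_le by (metis (mono_tags, lifting) mem_Collect_eq not_le)
  then show ?thesis by (simp add: gpoly_def)
qed

lemma P_in: "f \<in> gcomp P m \<Longrightarrow> f j \<in> gcomp A (m - int j)"
  by (simp add: P_comp)

definition pterm :: "int \<Rightarrow> int \<Rightarrow> (nat \<Rightarrow> 'a) \<Rightarrow> (nat \<Rightarrow> 'a) \<Rightarrow> nat \<Rightarrow> nat \<Rightarrow> 'a" where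
  "pterm m k f g l i = gscale A (m + k - int l) ((-1) powi (int i * (k - int (l - i))))
     (gmult A (m - int i) (k - int (l - i)) (f i) (g (l - i)))"

lemma P_mult: "gmult P m k f g l = finprod (ggroup A (m + k - int l)) (pterm m k f g l) {..l}"
  by (simp add: gpoly_def pterm_def[abs_def])

lemma pterm_closed:
  assumes "f \<in> gcomp P m" "g \<in> gcomp P k" "i \<le> l"
  shows "pterm m k f g l i \<in> gcomp A (m + k - int l)"
  unfolding pterm_def using assms(3)
  by (intro gscale_closed gmult_deg P_in[OF assms(1)] P_in[OF assms(2)]) simp

lemma pterm_zero_l:
  assumes "f i = gzero A (m - int i)" "g \<in> gcomp P k" "i \<le> l"
  shows "pterm m k f g l i = gzero A (m + k - int l)"
proof -
  have "gmult A (m - int i) (k - int (l - i)) (f i) (g (l - i)) = gzero A (m - int i + (k - int (l - i)))"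
    unfolding assms(1) by (intro gmult_zero_l P_in[OF assms(2)])
  moreover have "m - int i + (k - int (l - i)) = m + k - int l" using assms(3) by simp
  ultimately show ?thesis unfolding pterm_def by (simp only: gscale_gzero)
qed

lemma pterm_zero_r:
  assumes "f \<in> gcomp P m" "g (l - i) = gzero A (k - int (l - i))" "i \<le> l"
  shows "pterm m k f g l i = gzero A (m + k - int l)"
proof -
  have "gmult A (m - int i) (k - int (l - i)) (f i) (g (l - i)) = gzero A (m - int i + (k - int (l - i)))"
    unfolding assms(2) by (intro gmult_zero_r P_in[OF assms(1)])
  moreover have "m - int i + (k - int (l - i)) = m + k - int l" using assms(3) by simp
  ultimately show ?thesis unfolding pterm_def by (simp only: gscale_gzero)
qed

lemma P_mult_closed:
  assumes f: "f \<in> gcomp P m" and g: "g \<in> gcomp P k"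
  shows "gmult P m k f g \<in> gcomp P (m + k)"
proof -
  obtain M N where M: "\<And>j. j > M \<Longrightarrow> f j = gzero A (m - int j)" and N: "\<And>j. j > N \<Longrightarrow> g j = gzero A (k - int j)"
    using f g by (auto simp: P_comp)
  have "gmult P m k f g l = gzero A (m + k - int l)" if l: "l > M + N" for l
    unfolding P_mult
  proof (rule finprod_all_zero)
    fix i assume i: "i \<in> {..l}"
    show "pterm m k f g l i = gzero A (m + k - int l)"
    proof (cases "i > M")
      case True
      then show ?thesis using M i g by (intro pterm_zero_l) auto
    next
      case False
      then show ?thesis using N[of "l - i"] i l f by (intro pterm_zero_r) auto
    qed
  qed
  moreover have "gmult P m k f g l \<in> gcomp A (m + k - int l)" for l
    unfolding P_mult using pterm_closed[OF f g] by (intro finprod_gcomp) auto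
  ultimately show ?thesis unfolding P_comp by blast
qed

lemma P_mult_0:
  assumes f: "f \<in> gcomp P m" and g: "g \<in> gcomp P k"
  shows "gmult P m k f g 0 = gmult A m k (f 0) (g 0)"
proof -
  have v: "pterm m k f g 0 0 \<in> gcomp A (m + k - int 0)" by (rule pterm_closed[OF f g]) simp
  have c: "f 0 \<in> gcomp A m" "g 0 \<in> gcomp A k"
    using f g unfolding P_comp by (metis diff_zero of_nat_0)+
  have "gmult P m k f g 0 = pterm m k f g 0 0"
    unfolding P_mult by (rule finprod_one_term) (use v in auto)
  then show ?thesis using c by (simp add: pterm_def)
qed

lemma P_mult_1:
  assumes f: "f \<in> gcomp P m" and g: "g \<in> gcomp P k"
  shows "gmult P m k f g 1 = gadd A (m + k - 1) (gmult A m (k - 1) (f 0) (g 1))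
    (gscale A (m + k - 1) (if even k then 1 else -1) (gmult A (m - 1) k (f 1) (g 0)))"
proof -
  interpret G: comm_monoid "ggroup A (m + k - 1)" by (rule ggroup_comm_monoid)
  have v: "pterm m k f g 1 i \<in> gcomp A (m + k - 1)" if "i \<le> 1" for i
    using pterm_closed[OF f g that] by simp
  have c: "f 0 \<in> gcomp A m" "g 1 \<in> gcomp A (k - 1)"
    using f g unfolding P_comp by (metis diff_zero of_nat_0 of_nat_1)+
  have g01: "gmult A m (k - 1) (f 0) (g 1) \<in> gcomp A (m + k - 1)" using c by (intro gmult_deg) auto
  have "gmult P m k f g 1 = finprod (ggroup A (m + k - 1)) (pterm m k f g 1) {..Suc 0}"
    unfolding P_mult by simp
  also have "\<dots> = gadd A (m + k - 1) (pterm m k f g 1 1) (pterm m k f g 1 0)"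
    using v[of 0] v[of 1] G.finprod_Suc[of "pterm m k f g 1" 0]
    by (subst G.finprod_Suc) (auto simp: ggroup_simps le_Suc_eq gadd_comm)
  also have "\<dots> = gadd A (m + k - 1) (pterm m k f g 1 0) (pterm m k f g 1 1)"
    using v[of 0] v[of 1] by (intro gadd_comm) auto
  also have "pterm m k f g 1 0 = gmult A m (k - 1) (f 0) (g 1)" using g01 by (simp add: pterm_def)
  also have "pterm m k f g 1 1 = gscale A (m + k - 1) (if even k then 1 else -1) (gmult A (m - 1) k (f 1) (g 0))"
    by (simp add: pterm_def sign_powi)
  finally show ?thesis .
qed

text \<open>
  Elements without constant and linear term; they turn out to be the multiples of the square of
  the variable.
\<close>

definition low_zero :: "int \<Rightarrow> (nat \<Rightarrow> 'a) set" where
  "low_zero m = {f \<in> gcomp P m. f 0 = gzero A m \<and> f 1 = gzero A (m - 1)}"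

lemma P_at_0: "f \<in> gcomp P m \<Longrightarrow> f 0 \<in> gcomp A m"
  unfolding P_comp by (metis diff_zero of_nat_0)

lemma P_at_1: "f \<in> gcomp P m \<Longrightarrow> f 1 \<in> gcomp A (m - 1)"
  unfolding P_comp by (metis of_nat_1)

lemma P_add_closed:
  assumes "f \<in> gcomp P m" "g \<in> gcomp P m"
  shows "gadd P m f g \<in> gcomp P m"
proof -
  obtain M N where "\<And>j. j > M \<Longrightarrow> f j = gzero A (m - int j)" and "\<And>j. j > N \<Longrightarrow> g j = gzero A (m - int j)"
    using assms by (auto simp: P_comp)
  then have "\<forall>j>max M N. gadd P m f g j = gzero A (m - int j)" by (simp add: P_simps)
  moreover have "\<forall>j. gadd P m f g j \<in> gcomp A (m - int j)" using P_in[OF assms(1)] P_in[OF assms(2)] by (simp add: P_simps)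
  ultimately show ?thesis unfolding P_comp by blast
qed

lemma P_scale_closed: "f \<in> gcomp P m \<Longrightarrow> gscale P m c f \<in> gcomp P m"
  unfolding P_comp by (metis P_simps(3) gscale_closed gscale_gzero)

lemma P_zero_closed: "gzero P m \<in> gcomp P m"
  by (auto simp: P_comp P_simps)

lemma low_zero_ideal: "graded_ideal P low_zero"
  unfolding graded_ideal_def
proof (intro conjI allI ballI)
  fix m f g c
  show "low_zero m \<subseteq> gcomp P m" by (auto simp: low_zero_def)
  show "gzero P m \<in> low_zero m" by (simp add: low_zero_def P_zero_closed P_simps)
  assume f: "f \<in> low_zero m"
  show "gscale P m c f \<in> low_zero m" using f by (simp add: low_zero_def P_scale_closed P_simps)
  assume "g \<in> low_zero m"
  then show "gadd P m f g \<in> low_zero m" using f by (simp add: low_zero_def P_add_closed P_simps)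
next
  fix i j f g assume f: "f \<in> gcomp P i" and "g \<in> low_zero j"
  then have g: "g \<in> gcomp P j" "g 0 = gzero A j" "g 1 = gzero A (j - 1)" by (auto simp: low_zero_def)
  note z = gmult_zero_r[OF P_at_0[OF f]] gmult_zero_r[OF P_at_1[OF f]] gmult_zero_l[OF P_at_0[OF f]] gmult_zero_l[OF P_at_1[OF f]]
  have deg: "i + (j - 1) = i + j - 1" "i - 1 + j = i + j - 1" "j + (i - 1) = j + i - 1" "j - 1 + i = j + i - 1" by auto
  show "gmult P i j f g \<in> low_zero (i + j)"
    using P_mult_0[OF f g(1)] P_mult_1[OF f g(1)] P_mult_closed[OF f g(1)]
    unfolding low_zero_def g(2,3) z deg by simp
  show "gmult P j i g f \<in> low_zero (j + i)"
    using P_mult_0[OF g(1) f] P_mult_1[OF g(1) f] P_mult_closed[OF g(1) f]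
    unfolding low_zero_def g(2,3) z deg by simp
qed

abbreviation x2 where "x2 \<equiv> gmult P 1 1 (gpoly_x A) (gpoly_x A)"

lemma gpoly_x_closed: "gpoly_x A \<in> gcomp P 1"
  unfolding P_comp by (auto simp: gpoly_x_def intro: exI[of _ 1])

lemma x2_eq: "x2 l = (if l = 2 then gone A else gzero A (2 - int l))"
proof (cases "l = 2")
  case True
  have t: "pterm 1 1 (gpoly_x A) (gpoly_x A) 2 1 = gone A"
    by (simp add: pterm_def gpoly_x_def gone_l)
  have "finprod (ggroup A (1 + 1 - int 2)) (pterm 1 1 (gpoly_x A) (gpoly_x A) 2) {..2} = pterm 1 1 (gpoly_x A) (gpoly_x A) 2 1"
  proof (rule finprod_one_term)
    fix i :: nat assume "i \<in> {..2}" "i \<noteq> 1"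
    then show "pterm 1 1 (gpoly_x A) (gpoly_x A) 2 i = gzero A (1 + 1 - int 2)"
      by (intro pterm_zero_l gpoly_x_closed) (auto simp: gpoly_x_def)
  qed (simp_all add: t[simplified])
  then show ?thesis unfolding P_mult True t by simp
next
  case False
  have "pterm 1 1 (gpoly_x A) (gpoly_x A) l i = gzero A (1 + 1 - int l)" if "i \<in> {..l}" for i
  proof (cases "i = 1")
    case True
    then show ?thesis using False that by (intro pterm_zero_r gpoly_x_closed) (auto simp: gpoly_x_def)
  next
    case False
    then show ?thesis using that by (intro pterm_zero_l gpoly_x_closed) (auto simp: gpoly_x_def)
  qed
  then show ?thesis unfolding P_mult using False finprod_all_zero[of "{..l}" _ "1 + 1 - int l"] by simp
qed

text \<open>
  Every \<open>f\<close> in \<open>low_zero\<close> is \<open>h\<close> times the square of the variable, where \<open>h j = f (j + 2)\<close>. No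
  sign appears because the unit, which is the coefficient of the square, has degree zero.
\<close>

lemma ideal_x2: "gideal_generated P 2 x2 = low_zero"
proof
  fix m
  have x2c: "x2 \<in> gcomp P 2" using P_mult_closed[OF gpoly_x_closed gpoly_x_closed] by simp
  have "x2 \<in> low_zero 2" using x2c by (simp add: low_zero_def x2_eq)
  then have "gideal_generated P 2 x2 m \<subseteq> low_zero m"
    unfolding gideal_generated_def using low_zero_ideal by blast
  moreover have "f \<in> J m" if J: "graded_ideal P J" "x2 \<in> J 2" and f: "f \<in> low_zero m" for f J
  proof -
    define h where "h = (\<lambda>j. f (j + 2))"
    have f': "f \<in> gcomp P m" "f 0 = gzero A m" "f 1 = gzero A (m - 1)" using f by (auto simp: low_zero_def)
    obtain N where N: "\<And>j. j > N \<Longrightarrow> f j = gzero A (m - int j)" using f' by (auto simp: P_comp)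
    have hc: "h j \<in> gcomp A (m - 2 - int j)" for j
    proof -
      have "f (j + 2) \<in> gcomp A (m - int (j + 2))" using f'(1) unfolding P_comp by blast
      moreover have "m - int (j + 2) = m - 2 - int j" by simp
      ultimately show ?thesis by (simp only: h_def)
    qed
    have hz: "h j = gzero A (m - 2 - int j)" if "j > N" for j
      using N[of "j + 2"] that by (simp add: h_def algebra_simps)
    have h: "h \<in> gcomp P (m - 2)" unfolding P_comp using hc hz by blast
    have "gmult P (m - 2) 2 h x2 l = f l" for l
    proof (cases "l < 2")
      case True
      have "gmult P (m - 2) 2 h x2 l = gzero A (m - 2 + 2 - int l)"
        unfolding P_mult[of "m - 2" 2 h x2 l]
        by (rule finprod_all_zero, rule pterm_zero_r[OF h]) (use True in \<open>auto simp: x2_eq simp del: of_nat_diff\<close>)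
      moreover have "l = 0 \<or> l = 1" using True by auto
      ultimately show ?thesis using f' by auto
    next
      case False
      have fl: "f l \<in> gcomp A (m - int l)" using f'(1) by (simp add: P_comp)
      have e: "h (l - 2) = f l" "l - (l - 2) = 2" "m - 2 - int (l - 2) = m - int l" "m - 2 + 2 - int l = m - int l"
        using False le_add_diff_inverse2[of 2 l] by (simp_all add: h_def del: add_2_eq_Suc add_2_eq_Suc')
      have t: "pterm (m - 2) 2 h x2 l (l - 2) = f l"
        unfolding pterm_def e x2_eq using fl by (simp add: gone_r)
      have "gmult P (m - 2) 2 h x2 l = pterm (m - 2) 2 h x2 l (l - 2)"
        unfolding P_mult[of "m - 2" 2 h x2 l]
      proof (rule finprod_one_term)
        fix i assume "i \<in> {..l}" "i \<noteq> l - 2"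
        then show "pterm (m - 2) 2 h x2 l i = gzero A (m - 2 + 2 - int l)"
          using False by (intro pterm_zero_r[OF h]) (auto simp: x2_eq simp del: of_nat_diff)
      qed (use False fl e in \<open>simp_all add: t\<close>)
      then show ?thesis by (simp add: t)
    qed
    then have "f = gmult P (m - 2) 2 h x2" by auto
    also have "\<dots> \<in> J (m - 2 + 2)" using J h unfolding graded_ideal_def by blast
    finally show ?thesis by simp
  qed
  ultimately show "gideal_generated P 2 x2 m = low_zero m"
    unfolding gideal_generated_def by blast
qed

text \<open>
  Cosets are determined by the coefficients of \<open>1\<close> and of the variable, so only \<open>P_mult_0\<close> and
  \<open>P_mult_1\<close> enter the multiplication of the quotient.
\<close>

lemma gpoly_coset:
  assumes f: "f \<in> gcomp P m"
  shows "gcoset P low_zero m f = {g \<in> gcomp P m. g 0 = f 0 \<and> g 1 = f 1}"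
proof (intro Set.set_eqI iffI)
  fix g assume "g \<in> gcoset P low_zero m f"
  then obtain h where h: "h \<in> low_zero m" "g = gadd P m f h" by (auto simp: gcoset_def)
  then show "g \<in> {g \<in> gcomp P m. g 0 = f 0 \<and> g 1 = f 1}"
    using f P_at_0[OF f] P_at_1[OF f] by (auto simp: low_zero_def P_add_closed P_simps)
next
  fix g assume "g \<in> {g \<in> gcomp P m. g 0 = f 0 \<and> g 1 = f 1}"
  then have g: "g \<in> gcomp P m" "g 0 = f 0" "g 1 = f 1" by auto
  let ?h = "gadd P m g (gscale P m (-1) f)"
  have c: "f j \<in> gcomp A (m - int j)" "g j \<in> gcomp A (m - int j)" for j using f g(1) by (auto simp: P_comp)
  have "?h \<in> low_zero m"
    using f g P_at_0[OF f] P_at_1[OF f] gadd_gneg[unfolded gneg_def]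
    by (simp add: low_zero_def P_add_closed P_scale_closed P_simps)
  moreover have "g = gadd P m f ?h"
    using gadd_gneg_cancel[OF c(2) c(1)] by (simp add: fun_eq_iff P_simps gneg_def)
  ultimately show "g \<in> gcoset P low_zero m f" unfolding gcoset_def by blast
qed

definition lin :: "int \<Rightarrow> 'a \<times> 'a \<Rightarrow> nat \<Rightarrow> 'a" where
  "lin m c = (\<lambda>j. if j = 0 then fst c else if j = 1 then snd c else gzero A (m - int j))"

abbreviation TX where "TX \<equiv> galg_trivial_ext A X"

lemma TX_simps: "gcomp TX m = gcomp A m \<times> gcomp A (m - 1)"
  "gadd TX m c d = (gadd A m (fst c) (fst d), gadd A (m - 1) (snd c) (snd d))"
  "gscale TX m s c = (gscale A m s (fst c), gscale A (m - 1) s (snd c))"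
  "gmult TX i j c d = (gmult A i j (fst c) (fst d),
     gadd A (i + j - 1) (gmult A i (j - 1) (fst c) (snd d))
       (gscale A (i + j - 1) (if even j then 1 else -1) (gmult A (i - 1) j (snd c) (fst d))))"
  "gone TX = (gone A, gzero A (-1))"
  by (simp_all add: galg_trivial_ext_def X_simps case_prod_beta)

lemma lin_closed: "c \<in> gcomp TX m \<Longrightarrow> lin m c \<in> gcomp P m"
  unfolding P_comp by (auto simp: lin_def TX_simps intro: exI[of _ 1])

lemma gpoly_ops:
  assumes f: "f \<in> gcomp P m" and g: "g \<in> gcomp P k"
  shows "m = k \<Longrightarrow> (\<Union>f'\<in>gcoset P low_zero m f. \<Union>g'\<in>gcoset P low_zero k g. gcoset P low_zero m (gadd P m f' g'))
      = gcoset P low_zero m (gadd P m f g)"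
    and "(\<Union>f'\<in>gcoset P low_zero m f. gcoset P low_zero m (gscale P m s f')) = gcoset P low_zero m (gscale P m s f)"
    and "(\<Union>f'\<in>gcoset P low_zero m f. \<Union>g'\<in>gcoset P low_zero k g. gcoset P low_zero (m + k) (gmult P m k f' g'))
      = gcoset P low_zero (m + k) (gmult P m k f g)"
proof -
  have n: "f \<in> gcoset P low_zero m f" "g \<in> gcoset P low_zero k g" using f g by (auto simp: gpoly_coset)
  note d = gpoly_coset[OF f] gpoly_coset[OF g]
  show "(\<Union>f'\<in>gcoset P low_zero m f. \<Union>g'\<in>gcoset P low_zero k g. gcoset P low_zero m (gadd P m f' g'))
      = gcoset P low_zero m (gadd P m f g)" if "m = k"
    by (intro UN_const_eq) (use n f g that in \<open>auto simp: d gpoly_coset P_add_closed P_simps\<close>)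
  show "(\<Union>f'\<in>gcoset P low_zero m f. gcoset P low_zero m (gscale P m s f')) = gcoset P low_zero m (gscale P m s f)"
    by (intro UN_const_eq) (use n f in \<open>auto simp: d gpoly_coset P_scale_closed P_simps\<close>)
  show "(\<Union>f'\<in>gcoset P low_zero m f. \<Union>g'\<in>gcoset P low_zero k g. gcoset P low_zero (m + k) (gmult P m k f' g'))
      = gcoset P low_zero (m + k) (gmult P m k f g)"
  proof (intro UN_const_eq)
    fix f' g' assume "f' \<in> gcoset P low_zero m f" "g' \<in> gcoset P low_zero k g"
    then have *: "f' \<in> gcomp P m" "f' 0 = f 0" "f' 1 = f 1" "g' \<in> gcomp P k" "g' 0 = g 0" "g' 1 = g 1"
      by (auto simp: d)
    show "gcoset P low_zero (m + k) (gmult P m k f' g') = gcoset P low_zero (m + k) (gmult P m k f g)"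
      unfolding gpoly_coset[OF P_mult_closed[OF f g]] gpoly_coset[OF P_mult_closed[OF *(1,4)]]
        P_mult_0[OF f g] P_mult_1[OF f g] P_mult_0[OF *(1,4)] P_mult_1[OF *(1,4)] *(2,3,5,6) ..
  qed (use n in auto)
qed

theorem trivial_ext_iso_gpoly_mod_x2: "TX \<cong>\<^sub>g gpoly_mod_x2 A"
proof -
  let ?C = "gcoset P low_zero"
  have q: "gpoly_mod_x2 A = gquotient P low_zero" by (simp add: gpoly_mod_x2_def ideal_x2)
  define h where "h = (\<lambda>m c. ?C m (lin m c))"
  have l01: "lin m c 0 = fst c" "lin m c 1 = snd c" "lin m c (Suc 0) = snd c" for m c by (simp_all add: lin_def)
  have C_eq: "?C m f = ?C m g \<longleftrightarrow> f 0 = g 0 \<and> f 1 = g 1" if f: "f \<in> gcomp P m" "g \<in> gcomp P m" for f g m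
  proof
    assume "?C m f = ?C m g"
    then have "f \<in> {g' \<in> gcomp P m. g' 0 = g 0 \<and> g' 1 = g 1}"
      using f unfolding gpoly_coset[OF f(1)] gpoly_coset[OF f(2)] by blast
    then show "f 0 = g 0 \<and> f 1 = g 1" by simp
  qed (use f in \<open>simp add: gpoly_coset\<close>)
  have hom: "galg_hom TX (gquotient P low_zero) h"
    unfolding galg_hom_def linear_graded_def
  proof (intro conjI allI ballI)
    fix m c d s assume c: "c \<in> gcomp TX m"
    note lc = lin_closed[OF c]
    show "h m c \<in> gcomp (gquotient P low_zero) m" using lc by (simp add: gquotient_def h_def)
    have "gscale TX m s c \<in> gcomp TX m" using c by (auto simp: TX_simps)
    from C_eq[OF lin_closed[OF this] P_scale_closed[OF lc]]
    show "h m (gscale TX m s c) = gscale (gquotient P low_zero) m s (h m c)"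
      by (simp add: gquotient_def h_def gpoly_ops(2)[OF lc lc] l01 P_simps TX_simps)
    assume d: "d \<in> gcomp TX m"
    note ld = lin_closed[OF d]
    have "gadd TX m c d \<in> gcomp TX m" using c d by (auto simp: TX_simps)
    from C_eq[OF lin_closed[OF this] P_add_closed[OF lc ld]]
    show "h m (gadd TX m c d) = gadd (gquotient P low_zero) m (h m c) (h m d)"
      by (simp add: gquotient_def h_def gpoly_ops(1)[OF lc ld] l01 P_simps TX_simps)
  next
    have o: "gone TX \<in> gcomp TX 0" by (simp add: TX_simps)
    have "gone P = lin 0 (gone TX)" by (simp add: fun_eq_iff lin_def P_simps TX_simps)
    then show "h 0 (gone TX) = gone (gquotient P low_zero)" by (simp add: h_def gquotient_def)
  next
    fix i j c d assume c: "c \<in> gcomp TX i" and d: "d \<in> gcomp TX j"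
    note lc = lin_closed[OF c] and ld = lin_closed[OF d]
    have "gmult TX i j c d \<in> gcomp TX (i + j)"
      using c d by (auto simp: TX_simps intro!: gadd_closed gscale_closed gmult_deg)
    from C_eq[OF lin_closed[OF this] P_mult_closed[OF lc ld]]
    have "h (i + j) (gmult TX i j c d) = ?C (i + j) (gmult P i j (lin i c) (lin j d))"
      unfolding h_def P_mult_0[OF lc ld] P_mult_1[OF lc ld] l01 by (simp add: TX_simps)
    then show "h (i + j) (gmult TX i j c d) = gmult (gquotient P low_zero) i j (h i c) (h j d)"
      by (simp add: gquotient_def h_def gpoly_ops(3)[OF lc ld])
  qed
  have "bij_betw (h m) (gcomp TX m) (gcomp (gquotient P low_zero) m)" for m
    unfolding bij_betw_def
  proof
    show "inj_on (h m) (gcomp TX m)"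
      by (rule inj_onI) (simp add: h_def C_eq lin_closed l01 prod_eq_iff)
    show "h m ` gcomp TX m = gcomp (gquotient P low_zero) m"
    proof (intro equalityI subsetI)
      fix x assume "x \<in> gcomp (gquotient P low_zero) m"
      then obtain f where f: "f \<in> gcomp P m" "x = ?C m f" by (auto simp: gquotient_def)
      have c: "(f 0, f 1) \<in> gcomp TX m" using P_at_0[OF f(1)] P_at_1[OF f(1)] by (simp add: TX_simps)
      have "x = h m (f 0, f 1)"
        using C_eq[OF f(1) lin_closed[OF c]] unfolding h_def f(2) l01 by simp
      then show "x \<in> h m ` gcomp TX m" using c by blast
    qed (auto simp: gquotient_def h_def lin_closed)
  qed
  then show ?thesis using hom unfolding q galg_isomorphic_def by blast
qed

end

section \<open>The Hochschild cohomology algebra\<close>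

lemma int_degree_cases:
  obtains "(m :: int) < 0" | k where "m = int k"
  by (metis nonneg_int_cases not_le)

lemma lambda_zero [simp]: "(\<lambda>_. 0) = (0 :: 'a \<Rightarrow> 'b::zero)"
  by (simp add: zero_fun_def)

context kalgebra
begin

lemma hcocycles_neg [simp]: "m < 0 \<Longrightarrow> hcocycles A m = {0}"
  and hcocycles_int: "f \<in> hcocycles A (int k) \<longleftrightarrow> f \<in> hcochains A k \<and> hdiff A k f = 0"
  and hcoboundaries_nonpos [simp]: "m \<le> 0 \<Longrightarrow> hcoboundaries A m = {0}"
  and hcoboundaries_Suc: "hcoboundaries A (int (Suc k)) = hdiff A k ` hcochains A k"
  by (simp_all add: hcocycles_def hcoboundaries_def)

lemma hcocycles_zero: "0 \<in> hcocycles A m"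
  by (cases m rule: int_degree_cases) (auto simp: hcocycles_int hc_zero)

lemma hcocycles_add: "f \<in> hcocycles A m \<Longrightarrow> g \<in> hcocycles A m \<Longrightarrow> f + g \<in> hcocycles A m"
  by (cases m rule: int_degree_cases) (auto simp: hcocycles_int hc_add hdiff_add)

lemma scale_zero_fun: "(\<lambda>xs. scale A c (0 xs)) = 0"
  by (simp add: fun_eq_iff)

lemma hcocycles_scale: "f \<in> hcocycles A m \<Longrightarrow> (\<lambda>xs. scale A c (f xs)) \<in> hcocycles A m"
proof (cases m rule: int_degree_cases)
  case 1
  assume "f \<in> hcocycles A m"
  then show ?thesis using 1 scale_zero_fun by simp
next
  case (2 k)
  assume "f \<in> hcocycles A m"
  then show ?thesis by (simp add: 2 hcocycles_int hc_scale hdiff_scale scale_zero_fun)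
qed

lemma hcup_zero_l [simp]: "g \<in> hcochains A k \<Longrightarrow> hcup A m k 0 g = 0"
  using hcup_scale_l[of 0 m g k 0] hc_zero by (simp add: fun_eq_iff)

lemma hcup_zero_r' [simp]: "f \<in> hcochains A m \<Longrightarrow> hcup A m k f 0 = 0"
  using hcup_scale_r[of f m 0 k 0] hc_zero by (simp add: fun_eq_iff)

lemma hcup_cocycle:
  assumes "f \<in> hcochains A m" "hdiff A m f = 0" "g \<in> hcochains A k" "hdiff A k g = 0"
  shows "hdiff A (m + k) (hcup A m k f g) = 0"
  using assms by (simp add: hdiff_cup)

lemma hcup_boundary_r:
  assumes f: "f \<in> hcochains A m" "hdiff A m f = 0" and h: "h \<in> hcochains A k"
  shows "hcup A m (Suc k) f (hdiff A k h) \<in> hdiff A (m + k) ` hcochains A (m + k)"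
proof -
  have c: "hcup A m k f h \<in> hcochains A (m + k)" by (rule hcup_closed[OF f(1) h])
  have "hcup A m (Suc k) f (hdiff A k h) = hdiff A (m + k) ((if even m then id else uminus) (hcup A m k f h))"
    using hdiff_cup[OF f(1) h] f(2) h c by (auto simp: hdiff_neg)
  then show ?thesis using c hc_neg[OF c] by auto
qed

lemma hcup_boundary_l:
  assumes f: "f \<in> hcochains A m" "hdiff A m f = 0" and h: "h \<in> hcochains A k"
  shows "hcup A (Suc k) m (hdiff A k h) f \<in> hdiff A (k + m) ` hcochains A (k + m)"
proof -
  have "hcup A (Suc k) m (hdiff A k h) f = hdiff A (k + m) (hcup A k m h f)"
    using hdiff_cup[OF h f(1)] f(2) h by simp
  then show ?thesis using hcup_closed[OF h f(1)] by simp
qed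

lemma cocycle_algebra_simps:
  "gcomp (cocycle_algebra A) = hcocycles A" "gadd (cocycle_algebra A) m f g = f + g"
  "gzero (cocycle_algebra A) m = 0" "gscale (cocycle_algebra A) m c f = (\<lambda>xs. scale A c (f xs))"
  "gone (cocycle_algebra A) = (\<lambda>xs. if xs = [] then \<one> else 0)"
  by (simp_all add: cocycle_algebra_def)

lemma cocycle_algebra_mult [simp]:
  "i < 0 \<Longrightarrow> gmult (cocycle_algebra A) i j f g = 0" "j < 0 \<Longrightarrow> gmult (cocycle_algebra A) i j f g = 0"
  "gmult (cocycle_algebra A) (int m) (int k) f g = hcup A m k f g"
  by (simp_all add: cocycle_algebra_def)

lemma hcocycles_mult:
  assumes "f \<in> hcocycles A i" "g \<in> hcocycles A j"
  shows "gmult (cocycle_algebra A) i j f g \<in> hcocycles A (i + j)"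
proof (cases i rule: int_degree_cases; cases j rule: int_degree_cases)
  fix m k assume "i = int m" "j = int k"
  then show ?thesis using assms hcup_closed[of f m g k] hcup_cocycle[of f m g k]
    by (simp add: hcocycles_int flip: of_nat_add)
qed (use hcocycles_zero in auto)

lemma gone_cocycle: "(\<lambda>xs. if xs = [] then \<one> else 0) \<in> hcocycles A 0"
proof -
  have m: "(\<lambda>xs. if xs \<in> hargs A 0 then \<one> else 0) \<in> hcochains A 0"
    by (rule hc_mlinI) (simp add: mlin_def hargs_def)
  have e: "(\<lambda>xs. if xs \<in> hargs A 0 then \<one> else 0) = (\<lambda>xs. if xs = [] then \<one> else (0 :: 'a))"
    by (auto simp: hargs_def fun_eq_iff)
  have "hdiff A 0 (\<lambda>xs. if xs = [] then \<one> else 0) xs = 0" for xs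
    by (cases "xs \<in> hargs A (Suc 0)") (auto simp: hdiff_def hargs_def length_Suc_conv)
  then show ?thesis using m e hcocycles_int[of _ 0] by (simp add: fun_eq_iff)
qed

lemma hcup_one: "f \<in> hcochains A m \<Longrightarrow> hcup A 0 m (\<lambda>xs. if xs = [] then \<one> else 0) f = f"
  "f \<in> hcochains A m \<Longrightarrow> hcup A m 0 f (\<lambda>xs. if xs = [] then \<one> else 0) = f"
  using hc_out[of f m] hc_closed[of f m] by (auto simp: hcup_def fun_eq_iff hargs_def)

theorem cocycle_algebra: "graded_algebra (cocycle_algebra A)"
proof (intro graded_algebra.intro graded_vector_space.intro graded_algebra_axioms.intro)
  fix m
  show "comm_group (ggroup (cocycle_algebra A) m)"
  proof (rule comm_groupI)
    fix f assume f: "f \<in> carrier (ggroup (cocycle_algebra A) m)"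
    then have "- f \<in> hcocycles A m"
      using hcocycles_scale[of f m "-1"] by (simp add: ggroup_def cocycle_algebra_simps fun_Compl_def)
    then show "\<exists>g\<in>carrier (ggroup (cocycle_algebra A) m). g \<otimes>\<^bsub>ggroup (cocycle_algebra A) m\<^esub> f = \<one>\<^bsub>ggroup (cocycle_algebra A) m\<^esub>"
      by (intro bexI[of _ "- f"]) (auto simp: ggroup_def cocycle_algebra_simps)
  qed (auto simp: ggroup_def cocycle_algebra_simps hcocycles_zero hcocycles_add add_ac)
next
  show "bilinear_graded (cocycle_algebra A) (cocycle_algebra A) (cocycle_algebra A) (gmult (cocycle_algebra A))"
    unfolding bilinear_graded_def cocycle_algebra_simps
  proof (intro allI ballI)
    fix i j f g assume f: "f \<in> hcocycles A i" and g: "g \<in> hcocycles A j"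
    show "gmult (cocycle_algebra A) i j f g \<in> hcocycles A (i + j) \<and>
       (\<forall>f'\<in>hcocycles A i. gmult (cocycle_algebra A) i j (f + f') g = gmult (cocycle_algebra A) i j f g + gmult (cocycle_algebra A) i j f' g) \<and>
       (\<forall>g'\<in>hcocycles A j. gmult (cocycle_algebra A) i j f (g + g') = gmult (cocycle_algebra A) i j f g + gmult (cocycle_algebra A) i j f g') \<and>
       (\<forall>c. gmult (cocycle_algebra A) i j (\<lambda>xs. scale A c (f xs)) g = (\<lambda>xs. scale A c (gmult (cocycle_algebra A) i j f g xs)) \<and>
            gmult (cocycle_algebra A) i j f (\<lambda>xs. scale A c (g xs)) = (\<lambda>xs. scale A c (gmult (cocycle_algebra A) i j f g xs)))"
    proof (cases i rule: int_degree_cases; cases j rule: int_degree_cases)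
      fix m k assume "i = int m" "j = int k"
      then show ?thesis using f g hcocycles_mult[OF f g]
        by (auto simp: hcocycles_int hcup_add_l hcup_add_r hcup_scale_l hcup_scale_r)
    qed (use hcocycles_mult[OF f g] scale_zero_fun in auto)
  qed
next
  fix f g h i j k assume "f \<in> gcomp (cocycle_algebra A) i" "g \<in> gcomp (cocycle_algebra A) j" "h \<in> gcomp (cocycle_algebra A) k"
  then have *: "f \<in> hcocycles A i" "g \<in> hcocycles A j" "h \<in> hcocycles A k" by (auto simp: cocycle_algebra_simps)
  let ?m = "gmult (cocycle_algebra A)"
  have z: "?m i' j' 0 x = 0" if "x \<in> hcocycles A j'" for i' j' x
    using that by (cases i' rule: int_degree_cases; cases j' rule: int_degree_cases) (auto simp: hcocycles_int)
  have z': "?m i' j' x 0 = 0" if "x \<in> hcocycles A i'" for i' j' x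
    using that by (cases i' rule: int_degree_cases; cases j' rule: int_degree_cases) (auto simp: hcocycles_int)
  consider "i < 0" | "j < 0" | "k < 0" | a b c where "i = int a" "j = int b" "k = int c"
    by (metis nonneg_int_cases not_le)
  then show "?m (i + j) k (?m i j f g) h = ?m i (j + k) f (?m j k g h)"
  proof cases
    case 1
    then show ?thesis using z[OF *(3)] by simp
  next
    case 2
    then show ?thesis using z[OF *(3)] z'[OF *(1)] by simp
  next
    case 3
    then show ?thesis using z'[OF *(1)] by simp
  next
    case (4 a b c)
    then show ?thesis using * hcup_assoc[of f a g b h c] by (simp add: hcocycles_int flip: of_nat_add)
  qed
next
  fix f i assume "f \<in> gcomp (cocycle_algebra A) i"
  then have f: "f \<in> hcocycles A i" by (simp add: cocycle_algebra_simps)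
  show "gmult (cocycle_algebra A) 0 i (gone (cocycle_algebra A)) f = f"
    "gmult (cocycle_algebra A) i 0 f (gone (cocycle_algebra A)) = f"
    using f hcup_one[of f] cocycle_algebra_mult(3)[of 0] cocycle_algebra_mult(3)[of _ 0]
    by (cases i rule: int_degree_cases; simp add: cocycle_algebra_simps hcocycles_int)+
qed (auto simp: cocycle_algebra_simps hcocycles_scale gone_cocycle vs.scale_right_distrib vs.scale_left_distrib)

lemma hcoboundaries_cases:
  assumes "f \<in> hcoboundaries A m"
  obtains "f = 0" | k h where "m = int (Suc k)" "h \<in> hcochains A k" "f = hdiff A k h"
proof (cases "m \<le> 0")
  case True
  then show thesis using assms that by simp
next
  case False
  then obtain k where "m = int (Suc k)" by (metis gr0_implies_Suc not_le zero_less_imp_eq_int of_nat_0_less_iff)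
  then show thesis using assms that by (auto simp: hcoboundaries_Suc simp del: of_nat_Suc)
qed

sublocale HH: graded_quotient "cocycle_algebra A" "hcoboundaries A"
proof (intro graded_quotient.intro cocycle_algebra graded_subspace.intro graded_subspace_axioms.intro
    graded_quotient_axioms.intro graded_algebra.axioms(1)[OF cocycle_algebra])
  fix m
  show "hcoboundaries A m \<subseteq> gcomp (cocycle_algebra A) m"
  proof
    fix f assume "f \<in> hcoboundaries A m"
    then show "f \<in> gcomp (cocycle_algebra A) m"
      by (cases rule: hcoboundaries_cases)
        (auto simp: cocycle_algebra_simps hcocycles_zero hcocycles_int hdiff_closed hdiff_hdiff simp del: of_nat_Suc)
  qed
  show z: "gzero (cocycle_algebra A) m \<in> hcoboundaries A m" for m
    using hc_zero hdiff_zero by (cases m rule: int_degree_cases)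
      (auto simp: cocycle_algebra_simps hcoboundaries_def intro!: image_eqI[of _ _ 0])
  fix f assume f: "f \<in> hcoboundaries A m"
  show "gscale (cocycle_algebra A) m c f \<in> hcoboundaries A m" for c
    using f
  proof (cases rule: hcoboundaries_cases)
    case 1
    then show ?thesis using z[of m] scale_zero_fun by (simp add: cocycle_algebra_simps)
  next
    case (2 k h)
    then show ?thesis using hc_scale[OF 2(2), of c]
      by (auto simp: cocycle_algebra_simps hcoboundaries_Suc simp flip: hdiff_scale simp del: of_nat_Suc)
  qed
  fix g assume g: "g \<in> hcoboundaries A m"
  show "gadd (cocycle_algebra A) m f g \<in> hcoboundaries A m"
    using f
  proof (cases rule: hcoboundaries_cases)
    case 1
    then show ?thesis using g by (simp add: cocycle_algebra_simps)
  next
    case (2 k h)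
    obtain h' where "h' \<in> hcochains A k" "g = hdiff A k h'"
      using g unfolding 2(1) hcoboundaries_Suc by blast
    then show ?thesis using 2 hc_add[OF 2(2), of h']
      by (auto simp: cocycle_algebra_simps hcoboundaries_Suc simp flip: hdiff_add simp del: of_nat_Suc)
  qed
next
  fix f g i j assume "f \<in> gcomp (cocycle_algebra A) i" and g: "g \<in> hcoboundaries A j"
  then have f: "f \<in> hcocycles A i" by (simp add: cocycle_algebra_simps)
  have z: "0 \<in> hcoboundaries A m" for m
    using hc_zero hdiff_zero by (auto simp: hcoboundaries_def intro!: image_eqI[of _ _ 0])
  have "gmult (cocycle_algebra A) i j f g \<in> hcoboundaries A (i + j) \<and> gmult (cocycle_algebra A) j i g f \<in> hcoboundaries A (j + i)"
    using g
  proof (cases rule: hcoboundaries_cases)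
    case 1
    then show ?thesis using z f
      by (cases i rule: int_degree_cases; cases j rule: int_degree_cases) (auto simp: hcocycles_int)
  next
    case (2 k h)
    show ?thesis
    proof (cases i rule: int_degree_cases)
      case 1
      then show ?thesis using z by simp
    next
      case i: (2 m)
      have "f \<in> hcochains A m" "hdiff A m f = 0" using f i by (auto simp: hcocycles_int)
      note b = hcup_boundary_r[OF this 2(2)] hcup_boundary_l[OF this 2(2)]
      have e: "int m + int (Suc k) = int (Suc (m + k))" "int (Suc k) + int m = int (Suc (k + m))" by simp_all
      show ?thesis unfolding i 2(1,3) cocycle_algebra_mult(3) unfolding e hcoboundaries_Suc using b by blast
    qed
  qed
  then show "gmult (cocycle_algebra A) i j f g \<in> hcoboundaries A (i + j)"
    "gmult (cocycle_algebra A) j i g f \<in> hcoboundaries A (j + i)" by auto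
qed

abbreviation hclass where "hclass \<equiv> gcoset (cocycle_algebra A) (hcoboundaries A)"

lemma HH_algebra: "graded_algebra (HH A)"
  unfolding HH_def by (rule HH.graded_algebra_quotient)

lemma HH_comp: "gcomp (HH A) m = hclass m ` hcocycles A m"
  and HH_zero: "gzero (HH A) m = hclass m 0"
  and HH_one: "gone (HH A) = hclass 0 (\<lambda>xs. if xs = [] then \<one> else 0)"
  and HH_add: "\<lbrakk>f \<in> hcocycles A m; g \<in> hcocycles A m\<rbrakk> \<Longrightarrow> gadd (HH A) m (hclass m f) (hclass m g) = hclass m (f + g)"
  and HH_scale: "f \<in> hcocycles A m \<Longrightarrow> gscale (HH A) m c (hclass m f) = hclass m (\<lambda>xs. scale A c (f xs))"
  and HH_mult: "\<lbrakk>f \<in> hcocycles A i; g \<in> hcocycles A j\<rbrakk> \<Longrightarrow>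
    gmult (HH A) i j (hclass i f) (hclass j g) = hclass (i + j) (gmult (cocycle_algebra A) i j f g)"
  unfolding HH_def using HH.Qt_comp HH.Qt_zero HH.Qt_one HH.Qt_add HH.Qt_scale HH.Qt_mult
  by (simp_all add: cocycle_algebra_simps)

lemma HH_eq:
  assumes "f \<in> hcocycles A m" "g \<in> hcocycles A m"
  shows "hclass m f = hclass m g \<longleftrightarrow> f - g \<in> hcoboundaries A m"
proof -
  have "gneg (cocycle_algebra A) m g = - g" by (simp add: gneg_def cocycle_algebra_simps fun_Compl_def)
  then show ?thesis using HH.cls_eq[of f m g] assms by (simp add: cocycle_algebra_simps)
qed

lemma HH_eq_zero: "f \<in> hcocycles A m \<Longrightarrow> hclass m f = gzero (HH A) m \<longleftrightarrow> f \<in> hcoboundaries A m"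
  using HH_eq[of f m 0] by (simp add: HH_zero hcocycles_zero)

lemma hcoboundaries_zero: "0 \<in> hcoboundaries A m"
  using HH.J_zero[of m] by (simp add: cocycle_algebra_simps)

end

context derivation
begin

lemma derivation_class: "D1 \<in> hcocycles A 1"
  using D1_closed D1_cocycle hcocycles_int[of D1 1] by simp

text \<open>
  The homotopy of \<open>derivation_cup_commute\<close>, on the level of classes.
\<close>

theorem derivation_class_commutes:
  assumes "x \<in> gcomp (HH A) i"
  shows "gmult (HH A) 1 i (hclass 1 D1) x = gscale (HH A) (1 + i) (if even i then 1 else -1) (gmult (HH A) i 1 x (hclass 1 D1))"
proof -
  obtain f where f: "f \<in> hcocycles A i" "x = hclass i f" using assms by (auto simp: HH_comp)
  let ?m = "gmult (cocycle_algebra A)"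
  have m: "?m 1 i D1 f \<in> hcocycles A (1 + i)" "?m i 1 f D1 \<in> hcocycles A (1 + i)"
    using hcocycles_mult[OF derivation_class f(1)] hcocycles_mult[OF f(1) derivation_class] by (simp_all add: add.commute)
  have "?m 1 i D1 f - (\<lambda>xs. scale A (if even i then 1 else -1) (?m i 1 f D1 xs)) \<in> hcoboundaries A (1 + i)"
  proof (cases i rule: int_degree_cases)
    case 1
    then show ?thesis using hcoboundaries_zero scale_zero_fun by (simp add: fun_diff_def)
  next
    case (2 k)
    have fc: "f \<in> hcochains A k" "hdiff A k f = 0" using f(1) 2 by (auto simp: hcocycles_int)
    have e: "1 + int k = int (Suc k)" by simp
    have "hcup A 1 k D1 f - (\<lambda>xs. scale A (if even i then 1 else -1) (hcup A k 1 f D1 xs)) = hdiff A k (- (\<lambda>xs. D (f xs)))"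
      using derivation_cup_commute[OF fc] 2 by (auto simp: hdiff_neg D_post fc fun_eq_iff)
    then show ?thesis
      using hc_neg[OF D_post[OF fc(1)]] cocycle_algebra_mult(3)[of 1] cocycle_algebra_mult(3)[of _ 1]
      unfolding 2 e hcoboundaries_Suc by auto
  qed
  then have "hclass (1 + i) (?m 1 i D1 f) = hclass (1 + i) (\<lambda>xs. scale A (if even i then 1 else -1) (?m i 1 f D1 xs))"
    using m hcocycles_scale by (simp add: HH_eq)
  then show ?thesis
    using m f(1) derivation_class HH_scale[OF m(2), of "if even i then 1 else -1"]
    by (simp add: f(2) HH_mult add.commute[of i 1])
qed

end

section \<open>The cohomology of the smash product\<close>

context char_cover
begin

definition gcocycles :: "int \<Rightarrow> ('t list \<Rightarrow> 't) set" where
  "gcocycles m = {f \<in> hcocycles T m. degree_preserving 0 f}"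

lemma gcocycles_neg [simp]: "m < 0 \<Longrightarrow> gcocycles m = {0}"
  by (auto simp: gcocycles_def degree_preserving_def)

lemma gcocycles_int: "f \<in> gcocycles (int k) \<longleftrightarrow> f \<in> graded k \<and> hdiff T k f = 0"
  using pr_id[of f k] pr_degree_preserving[of f k]
  by (auto simp: gcocycles_def T.hcocycles_int graded_def)

lemma gcocycles_hc: "f \<in> gcocycles m \<Longrightarrow> f \<in> hcocycles T m"
  by (simp add: gcocycles_def)

definition const :: "int \<Rightarrow> ('t list \<Rightarrow> 't) \<Rightarrow> (int \<Rightarrow> 't) list \<Rightarrow> int \<Rightarrow> 't" where
  "const m f = (if m < 0 then 0 else J (nat m) (\<lambda>_. f))"

lemma const_simps [simp]: "m < 0 \<Longrightarrow> const m f = 0" "const (int k) f = J k (\<lambda>_. f)"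
  by (simp_all add: const_def)

lemma const_family: "f \<in> hcochains T m \<Longrightarrow> (\<lambda>_. f) \<in> families m"
  by (simp add: families_def)

lemma J_const_hdiff: "f \<in> hcochains T k \<Longrightarrow> J (Suc k) (\<lambda>_. hdiff T k f) = hdiff L k (J k (\<lambda>_. f))"
proof -
  assume f: "f \<in> hcochains T k"
  have "(\<lambda>_. hdiff T k f) = dl k (\<lambda>_. f)" by (simp add: dl_const fun_eq_iff)
  then show ?thesis using J_dl[OF const_family[OF f]] by simp
qed

lemma const_closed: "f \<in> hcocycles T m \<Longrightarrow> const m f \<in> hcocycles L m"
proof (cases m rule: int_degree_cases)
  case (2 k)
  assume "f \<in> hcocycles T m"
  then have f: "f \<in> hcochains T k" "hdiff T k f = 0" by (auto simp: 2 T.hcocycles_int)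
  have "(\<lambda>_. 0) \<in> families (Suc k)" by (rule const_family[OF T.hc_zero])
  then have "hdiff L k (J k (\<lambda>_. f)) = 0" using J_const_hdiff[OF f(1)] f(2) J_zero[of "Suc k"] by simp
  then show ?thesis using J_closed[OF const_family[OF f(1)]] by (simp add: 2 L.hcocycles_int)
qed (auto simp: L.hcocycles_zero)

lemma const_add: "f \<in> hcocycles T m \<Longrightarrow> g \<in> hcocycles T m \<Longrightarrow> const m (f + g) = const m f + const m g"
  using J_add[OF const_family const_family, of f "nat m" g]
  by (cases m rule: int_degree_cases) (auto simp: T.hcocycles_int plus_fun_def)

lemma const_scale: "f \<in> hcocycles T m \<Longrightarrow> const m (\<lambda>xs. scale T c (f xs)) = (\<lambda>xs. scale L c (const m f xs))"
  using J_scale[OF const_family, of f "nat m" c]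
  by (cases m rule: int_degree_cases) (auto simp: T.hcocycles_int)

lemma const_boundary: "f \<in> hcoboundaries T m \<Longrightarrow> const m f \<in> hcoboundaries L m"
proof (erule T.hcoboundaries_cases)
  assume "f = 0"
  then show ?thesis
    using const_scale[OF T.hcocycles_zero, of m 0] L.hcoboundaries_zero by simp
next
  fix k h assume "m = int (Suc k)" "h \<in> hcochains T k" "f = hdiff T k h"
  then show ?thesis
    using J_const_hdiff[of h k] J_closed[OF const_family[of h k]]
    by (auto simp: L.hcoboundaries_Suc simp del: of_nat_Suc)
qed

lemma const_diff:
  assumes f: "f \<in> hcocycles T m" and g: "g \<in> hcocycles T m"
  shows "const m (f - g) = const m f - const m g"
proof -
  have "- g \<in> hcocycles T m" "const m (- g) = - const m g"
    using T.hcocycles_scale[OF g, of "-1"] const_scale[OF g, of "-1"] by (simp_all add: fun_Compl_def)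
  then show ?thesis using const_add[OF f, of "- g"] by simp
qed

lemma Q_add: "Q m (F + G) b = Q m F b + Q m G b" and Q_diff: "Q m (F - G) b = Q m F b - Q m G b"
  by (auto simp: Q_def fun_eq_iff)

text \<open>
  Restriction followed by extension is homotopic to the identity, and restricting once more
  projects onto the degree-preserving part. Hence a cocycle bounds as soon as the
  degree-preserving part of its restriction does.
\<close>

lemma coboundary_if_Q:
  assumes F: "F \<in> hcocycles L (int (Suc k))" and g: "g \<in> families k" "\<And>b. pr (Suc k) (Q (Suc k) F b) = dl k g b"
  shows "F \<in> hcoboundaries L (int (Suc k))"
proof -
  have Fc: "F \<in> hcochains L (Suc k)" "hdiff L (Suc k) F = 0" using F by (auto simp: L.hcocycles_int simp del: of_nat_Suc)
  have QF: "Q (Suc k) F \<in> families (Suc k)" by (rule Q_closed[OF Fc(1)])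
  have JF: "J (Suc k) (Q (Suc k) F) \<in> hcochains L (Suc k)" by (rule J_closed[OF QF])
  have dQ: "dl (Suc k) (Q (Suc k) F) = 0"
  proof -
    have "Q (Suc (Suc k)) 0 = 0" by (auto simp: Q_def fun_eq_iff)
    then show ?thesis using Q_hdiff[OF Fc(1)] Fc(2) by simp
  qed
  have dJ: "hdiff L (Suc k) (J (Suc k) (Q (Suc k) F)) = 0" by (rule J_cocycle[OF QF dQ])
  obtain H where H: "H \<in> hcochains L k" "J (Suc k) (Q (Suc k) F) = F + hdiff L k H"
    using J_Q_cocycle[OF Fc] by blast
  obtain H' where H': "H' \<in> hcochains L k" "J (Suc k) (Q (Suc k) (J (Suc k) (Q (Suc k) F))) = J (Suc k) (Q (Suc k) F) + hdiff L k H'"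
    using J_Q_cocycle[OF JF dJ] by blast
  have "Q (Suc k) (J (Suc k) (Q (Suc k) F)) = dl k g"
    using Q_J[OF QF] g(2) by (simp add: fun_eq_iff)
  then have "hdiff L k (J k g) = F + hdiff L k H + hdiff L k H'"
    using H H' J_dl[OF g(1)] by simp
  moreover have "hdiff L k (J k g - H - H') = hdiff L k (J k g) - hdiff L k H - hdiff L k H'"
    using J_closed[OF g(1)] H(1) H'(1) by (simp add: L.hdiff_diff L.hc_diff)
  ultimately have "F = hdiff L k (J k g - H - H')" by simp
  then show ?thesis
    unfolding L.hcoboundaries_Suc using J_closed[OF g(1)] H H' by (auto intro!: L.hc_diff)
qed

lemma zero_if_Q:
  assumes F: "F \<in> hcocycles L 0" and z: "\<And>b. pr 0 (Q 0 F b) = 0"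
  shows "F = 0"
proof -
  have Fc: "F \<in> hcochains L 0" "hdiff L 0 F = 0" using F L.hcocycles_int[of F 0] by auto
  have QF: "Q 0 F \<in> families 0" by (rule Q_closed[OF Fc(1)])
  have J: "J 0 (Q 0 F) = F" by (rule J_Q_cocycle_0[OF Fc])
  have "Q 0 F = 0" using Q_J[OF QF] z J by (simp add: fun_eq_iff)
  then show ?thesis using J J_zero[of 0] by simp
qed

lemma coboundary_if_Q_zero:
  assumes F: "F \<in> hcocycles L (int m)" and z: "\<And>b. pr m (Q m F b) = 0"
  shows "F \<in> hcoboundaries L (int m)"
proof (cases m)
  case 0
  then show ?thesis using zero_if_Q F z by simp
next
  case (Suc k)
  show ?thesis
    using coboundary_if_Q[of F k "\<lambda>_. 0"] F z const_family[OF T.hc_zero] dl_zero[of k] by (simp add: Suc del: of_nat_Suc)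
qed

lemma Q_of_coboundary:
  assumes "F \<in> hcoboundaries L (int (Suc k))"
  obtains g where "g \<in> families k" "\<And>b. Q (Suc k) F b = dl k g b"
proof -
  obtain H where "H \<in> hcochains L k" "F = hdiff L k H" using assms by (auto simp: L.hcoboundaries_Suc simp del: of_nat_Suc)
  then show thesis using that[OF Q_closed] Q_hdiff by metis
qed

lemma Q_const: "f \<in> graded m \<Longrightarrow> Q m (const (int m) f) b = f"
  using Q_J[OF const_family[OF graded_hc]] by (simp add: graded_def)

lemma diag_hargs: "as \<in> hargs T m \<Longrightarrow> map diag as \<in> hargs L m"
  using diag_closed by (auto simp: hargs_def)

text \<open>
  If the restriction of \<open>F\<close> is constant, both terms of the product in \<open>L\<close> carry the same left
  factor and the two parts of the right factor recombine.
\<close>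

lemma Q_cup:
  assumes F: "F \<in> hcochains L m" and G: "G \<in> hcochains L k" and f: "f \<in> hcochains T m" "\<And>b. Q m F b = f"
  shows "Q (m + k) (hcup L m k F G) b = hcup T m k f (Q k G b)"
proof
  fix as
  show "Q (m + k) (hcup L m k F G) b as = hcup T m k f (Q k G b) as"
  proof (cases "as \<in> hargs T (m + k)")
    case True
    have a: "take m as \<in> hargs T m" "drop m as \<in> hargs T k"
      using True set_take_subset[of m as] set_drop_subset[of m as] by (auto simp: hargs_def)
    have c: "F (map diag (take m as)) \<in> carrier L" "G (map diag (drop m as)) \<in> carrier L"
      using F G diag_hargs[OF a(1)] diag_hargs[OF a(2)] L.hc_closed by blast+
    have Fc: "F (map diag (take m as)) (c mod int n) = f (take m as)" for c
      using fun_cong[OF f(2)[of c], of "take m as"] a by (simp add: Q_def)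
    have g: "G (map diag (drop m as)) (b mod int n) \<in> carrier T" using L_in[OF c(2)] .
    have ft: "f (take m as) \<in> carrier T" using T.hc_closed[OF f(1) a(1)] .
    have "hcup L m k F G (map diag as) (b mod int n) =
        f (take m as) \<otimes>\<^bsub>T\<^esub> G (map diag (drop m as)) (b mod int n)"
      using Fc[of b] Fc[of "b mod int n + 1"] mult_p01[OF ft g] diag_hargs[OF True] c
      by (simp add: hcup_def take_map drop_map L_mult_apply)
    then show ?thesis using True a by (simp add: Q_def hcup_def)
  qed (simp add: Q_def hcup_def)
qed

lemma Q_turn: "Q 1 Y.D1 b = sm (at_turn b) E.D1"
proof
  fix as
  have "(b + 1) mod int n = 0 \<longleftrightarrow> b mod int n = int n - 1"
  proof
    assume "(b + 1) mod int n = 0"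
    then have "(b mod int n + 1) mod int n = 0" by (simp add: mod_add_left_eq)
    moreover have "0 \<le> b mod int n" "b mod int n < int n" by simp_all
    ultimately show "b mod int n = int n - 1" by (smt (verit) mod_pos_pos_trivial)
  next
    assume "b mod int n = int n - 1"
    then show "(b + 1) mod int n = 0" using mod_add_left_eq[of b "int n" 1] by simp
  qed
  then show "Q 1 Y.D1 b as = sm (at_turn b) E.D1 as"
    using diag_hargs[of as 1] n2
    by (cases "as \<in> hargs T 1")
      (auto simp: Q_def Y.D1_def E.D1_def sm_def at_turn_def hargs_Suc_iff turn_def diag_def)
qed

lemma Q_cup_turn:
  assumes v: "v \<in> graded m"
  shows "Q (Suc m) (hcup L m 1 (const (int m) v) Y.D1) b = sm (at_turn b) (R m v)"
proof -
  note vc = graded_hc[OF v]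
  have "Q (m + 1) (hcup L m 1 (const (int m) v) Y.D1) b = hcup T m 1 v (Q 1 Y.D1 b)"
    using J_closed[OF const_family[OF vc]] Q_const[OF v] by (intro Q_cup Y.D1_closed vc) auto
  also have "\<dots> = sm (at_turn b) (R m v)"
    unfolding Q_turn R_def sm_def using T.hcup_scale_r[OF vc E.D1_closed] .
  finally show ?thesis by simp
qed

abbreviation HH0 where
  "HH0 \<equiv> (HH T)\<lparr>gcomp := \<lambda>m. T.hclass m ` gcocycles m\<rparr>"

text \<open>
  A class is represented by a degree-preserving cocycle, which is extended as a constant family.
\<close>

definition to_cover :: "int \<Rightarrow> ('t list \<Rightarrow> 't) set \<Rightarrow> ((int \<Rightarrow> 't) list \<Rightarrow> int \<Rightarrow> 't) set" where
  "to_cover m X = L.hclass m (const m (SOME f. f \<in> gcocycles m \<and> T.hclass m f = X))"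

lemma to_cover_class:
  assumes f: "f \<in> gcocycles m"
  shows "to_cover m (T.hclass m f) = L.hclass m (const m f)"
proof -
  define g where "g = (SOME g. g \<in> gcocycles m \<and> T.hclass m g = T.hclass m f)"
  have "\<exists>g. g \<in> gcocycles m \<and> T.hclass m g = T.hclass m f" using f by blast
  from someI_ex[OF this] have g: "g \<in> gcocycles m" "T.hclass m g = T.hclass m f" by (auto simp: g_def)
  note c = gcocycles_hc[OF g(1)] gcocycles_hc[OF f]
  have "g - f \<in> hcoboundaries T m" using g(2) T.HH_eq[OF c] by simp
  then have "const m g - const m f \<in> hcoboundaries L m" using const_boundary const_diff[OF c] by metis
  then show ?thesis using L.HH_eq[OF c[THEN const_closed]] by (simp add: to_cover_def g_def)
qed

lemma gcocycles_zero: "0 \<in> gcocycles m"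
  by (cases m rule: int_degree_cases) (auto simp: gcocycles_int graded_zero)

lemma gcocycles_add: "f \<in> gcocycles m \<Longrightarrow> g \<in> gcocycles m \<Longrightarrow> f + g \<in> gcocycles m"
  using T.hdiff_add graded_hc by (cases m rule: int_degree_cases) (auto simp: gcocycles_int graded_add)

lemma gcocycles_scale: "f \<in> gcocycles m \<Longrightarrow> (\<lambda>xs. scale T c (f xs)) \<in> gcocycles m"
proof (cases m rule: int_degree_cases)
  case (2 k)
  assume "f \<in> gcocycles m"
  then have f: "f \<in> graded k" "hdiff T k f = 0" by (auto simp: 2 gcocycles_int)
  then show ?thesis using graded_sm[OF f(1), of c] hdiff_sm[OF graded_hc[OF f(1)], of c]
    by (simp add: 2 gcocycles_int sm_def)
qed auto

lemma Q_hcup_const: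
  assumes "f \<in> graded m" "g \<in> graded k"
  shows "Q (m + k) (hcup L m k (const (int m) f) (const (int k) g)) b = hcup T m k f g"
  using assms Q_const J_closed[OF const_family] graded_hc
  by (subst Q_cup[where f = f]) auto

lemma piece_cases:
  assumes "x \<in> piece c"
  obtains "x = 0" | "c mod int n = 0" "p0 x = x" | "c mod int n = 1" "p1 x = x"
  using assms by (auto simp: piece_def hpart_def split: if_splits)

lemma piece_mult:
  assumes x: "x \<in> piece c" and y: "y \<in> piece d"
  shows "x \<otimes>\<^bsub>T\<^esub> y \<in> piece (c + d)"
proof -
  have cl: "x \<in> carrier T" "y \<in> carrier T" using x y by (auto simp: piece_def)
  have m: "(c + d) mod int n = (c mod int n + d mod int n) mod int n" by (simp add: mod_simps)
  note pm = p0_mult[OF cl] p1_mult[OF cl] p1_mult_p1[OF cl] p1_mult_l[OF cl] p1_mult_r[OF cl]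
  have z: "x \<otimes>\<^bsub>T\<^esub> 0 = 0" "0 \<otimes>\<^bsub>T\<^esub> y = 0" using cl by simp_all
  show ?thesis using x
  proof (cases rule: piece_cases)
    case 1
    then show ?thesis using z by simp
  next
    case x': 2
    have px: "p1 x = 0" using p0_p1[of x] x'(2) by simp
    show ?thesis using y
    proof (cases rule: piece_cases)
      case 2
      then show ?thesis using x' cl m pm by (simp add: piece_def hpart_def)
    next
      case 3
      then show ?thesis using x' cl m pm px n2 by (simp add: piece_def hpart_def)
    qed (use z in simp)
  next
    case x': 3
    show ?thesis using y
    proof (cases rule: piece_cases)
      case 2
      have "p1 y = 0" using p0_p1[of y] 2(2) by simp
      then show ?thesis using 2 x' cl m pm n2 by (simp add: piece_def hpart_def)
    next
      case 3
      then have "x \<otimes>\<^bsub>T\<^esub> y = 0" using x' pm by simp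
      then show ?thesis by simp
    qed (use z in simp)
  qed
qed

lemma graded_cup:
  assumes f: "f \<in> graded m" and g: "g \<in> graded k"
  shows "pr (m + k) (hcup T m k f g) = hcup T m k f g"
proof (rule pr_id)
  have d: "degree_preserving 0 f" "degree_preserving 0 g"
    using pr_degree_preserving[OF graded_hc[OF f]] pr_degree_preserving[OF graded_hc[OF g]] f g
    by (auto simp: graded_def)
  show "hcup T m k f g \<in> hcochains T (m + k)" by (rule T.hcup_closed[OF f[THEN graded_hc] g[THEN graded_hc]])
  show "degree_preserving 0 (hcup T m k f g)"
    unfolding degree_preserving_def
  proof (intro allI impI)
    fix cs xs assume a: "list_all2 (\<lambda>x c. x \<in> piece c) xs cs"
    show "hcup T m k f g xs \<in> piece (0 + sum_list cs)"
    proof (cases "xs \<in> hargs T (m + k)")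
      case True
      have "list_all2 (\<lambda>x c. x \<in> piece c) (take m xs) (take m cs)"
        "list_all2 (\<lambda>x c. x \<in> piece c) (drop m xs) (drop m cs)" using a by auto
      then have "f (take m xs) \<in> piece (0 + sum_list (take m cs))" "g (drop m xs) \<in> piece (0 + sum_list (drop m cs))"
        using d unfolding degree_preserving_def by blast+
      then have "f (take m xs) \<otimes>\<^bsub>T\<^esub> g (drop m xs) \<in> piece (sum_list (take m cs) + sum_list (drop m cs))"
        using piece_mult by simp
      moreover have "sum_list (take m cs) + sum_list (drop m cs) = sum_list cs"
        by (metis append_take_drop_id sum_list_append)
      ultimately show ?thesis using True by (simp add: hcup_def)
    qed (simp add: hcup_def)
  qed
qed

lemma gcocycles_mult:
  assumes f: "f \<in> gcocycles i" and g: "g \<in> gcocycles j"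
  shows "gmult (cocycle_algebra T) i j f g \<in> gcocycles (i + j)"
proof (cases i rule: int_degree_cases; cases j rule: int_degree_cases)
  fix m k assume ij: "i = int m" "j = int k"
  have *: "f \<in> graded m" "hdiff T m f = 0" "g \<in> graded k" "hdiff T k g = 0"
    using f g by (auto simp: ij gcocycles_int)
  have "hcup T m k f g \<in> graded (m + k)"
    using graded_cup[OF *(1,3)] T.hcup_closed[OF *(1,3)[THEN graded_hc]] by (simp add: graded_def)
  then show ?thesis using T.hcup_cocycle[OF graded_hc[OF *(1)] *(2) graded_hc[OF *(3)] *(4)]
    by (simp add: ij gcocycles_int flip: of_nat_add)
qed (use gcocycles_zero in auto)

lemma gcocycles_one: "(\<lambda>xs. if xs = [] then \<one>\<^bsub>T\<^esub> else 0) \<in> gcocycles 0"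
proof -
  have "pr 0 (\<lambda>xs. if xs = [] then \<one>\<^bsub>T\<^esub> else 0) = (\<lambda>xs. if xs = [] then \<one>\<^bsub>T\<^esub> else 0)"
    by (auto simp: pr_def hargs_def hpart_def fun_eq_iff)
  then show ?thesis
    using T.gone_cocycle T.hcocycles_int[of _ 0] gcocycles_int[of _ 0] by (simp add: graded_def)
qed

lemma gcocycles_E: "E.D1 \<in> gcocycles 1"
proof -
  have "pr 1 E.D1 = E.D1"
    by (auto simp: pr_def E.D1_def fun_eq_iff hargs_Suc_iff hpart_def p0_closed p1_closed)
  then show ?thesis using E.D1_closed E.D1_cocycle gcocycles_int[of _ 1] by (simp add: graded_def)
qed

lemma HH0_algebra: "graded_algebra HH0"
proof (rule graded_algebra.graded_subalgebra[OF T.HH_algebra])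
  fix m
  show "T.hclass m ` gcocycles m \<subseteq> gcomp (HH T) m" using gcocycles_hc by (auto simp: T.HH_comp)
  show "gzero (HH T) m \<in> T.hclass m ` gcocycles m" using gcocycles_zero by (simp add: T.HH_zero)
next
  fix m x y assume "x \<in> T.hclass m ` gcocycles m" "y \<in> T.hclass m ` gcocycles m"
  then show "gadd (HH T) m x y \<in> T.hclass m ` gcocycles m"
    using gcocycles_add by (auto simp: T.HH_add gcocycles_hc)
next
  fix m c x assume "x \<in> T.hclass m ` gcocycles m"
  then show "gscale (HH T) m c x \<in> T.hclass m ` gcocycles m"
    using gcocycles_scale by (auto simp: T.HH_scale gcocycles_hc)
next
  fix i j x y assume "x \<in> T.hclass i ` gcocycles i" "y \<in> T.hclass j ` gcocycles j"
  then show "gmult (HH T) i j x y \<in> T.hclass (i + j) ` gcocycles (i + j)"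
    using gcocycles_mult by (auto simp: T.HH_mult gcocycles_hc)
next
  show "gone (HH T) \<in> T.hclass 0 ` gcocycles 0" using gcocycles_one by (simp add: T.HH_one)
qed

text \<open>
  Extension is multiplicative only up to homotopy: both sides have the same restriction to
  constant arguments.
\<close>

lemma const_mult:
  assumes f: "f \<in> gcocycles i" and g: "g \<in> gcocycles j"
  shows "const (i + j) (gmult (cocycle_algebra T) i j f g) - gmult (cocycle_algebra L) i j (const i f) (const j g)
    \<in> hcoboundaries L (i + j)"
proof -
  have z: "const m 0 = 0" for m using const_scale[OF T.hcocycles_zero, of m 0] by simp
  show ?thesis
  proof (cases i rule: int_degree_cases; cases j rule: int_degree_cases)
    fix m k assume ij: "i = int m" "j = int k"
    have *: "f \<in> graded m" "g \<in> graded k" using f g by (auto simp: ij gcocycles_int)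
    have c: "hcup T m k f g \<in> graded (m + k)"
      using gcocycles_mult[OF f g] by (simp add: ij gcocycles_int flip: of_nat_add)
    let ?F = "const (int (m + k)) (hcup T m k f g) - hcup L m k (const (int m) f) (const (int k) g)"
    have F: "?F \<in> hcocycles L (int (m + k))"
    proof -
      have "const (i + j) (gmult (cocycle_algebra T) i j f g) \<in> hcocycles L (i + j)"
        by (intro const_closed gcocycles_hc gcocycles_mult f g)
      moreover have "gmult (cocycle_algebra L) i j (const i f) (const j g) \<in> hcocycles L (i + j)"
        by (intro L.hcocycles_mult const_closed gcocycles_hc f g)
      ultimately show ?thesis
        unfolding ij T.cocycle_algebra_mult(3) L.cocycle_algebra_mult(3) L.hcocycles_int[of _ "m + k"] of_nat_add[symmetric]
        by (auto simp: L.hc_diff L.hdiff_diff)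
    qed
    have "?F \<in> hcoboundaries L (int (m + k))"
      by (rule coboundary_if_Q_zero[OF F])
        (simp only: Q_diff Q_const[OF c] Q_hcup_const[OF *] diff_self pr_zero)
    then show ?thesis unfolding ij T.cocycle_algebra_mult(3) L.cocycle_algebra_mult(3) of_nat_add .
  qed (auto simp: z L.hcoboundaries_zero simp del: const_simps)
qed

lemma const_one: "const 0 (\<lambda>xs. if xs = [] then \<one>\<^bsub>T\<^esub> else 0) = (\<lambda>xs. if xs = [] then \<one>\<^bsub>L\<^esub> else 0)"
proof -
  let ?T = "\<lambda>xs. if xs = [] then \<one>\<^bsub>T\<^esub> else 0" and ?L = "\<lambda>xs. if xs = [] then \<one>\<^bsub>L\<^esub> else 0"
  have L1: "\<one>\<^bsub>L\<^esub> (b mod int n) = \<one>\<^bsub>T\<^esub>" for b using L_one by simp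
  have g: "?T \<in> graded 0" using gcocycles_one gcocycles_int[of _ 0] by simp
  have d: "const 0 ?T - ?L \<in> hcocycles L 0"
    using const_closed[OF gcocycles_hc[OF gcocycles_one]] L.gone_cocycle
      L.hcocycles_int[of _ 0] by (simp add: L.hc_diff L.hdiff_diff del: const_simps)
  have "Q 0 ?L b = ?T" for b using L1 by (auto simp: Q_def hargs_def fun_eq_iff)
  then have "const 0 ?T - ?L = 0"
    using zero_if_Q[OF d] Q_const[OF g] by (simp add: Q_diff del: const_simps)
  then show ?thesis by simp
qed

lemma to_cover_hom: "galg_hom HH0 (HH L) to_cover"
  unfolding galg_hom_def linear_graded_def
proof (intro conjI allI ballI)
  fix m X assume "X \<in> gcomp HH0 m"
  then obtain f where f: "f \<in> gcocycles m" "X = T.hclass m f" by auto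
  note fc = gcocycles_hc[OF f(1)]
  show "to_cover m X \<in> gcomp (HH L) m" using const_closed[OF fc] by (auto simp: f to_cover_class L.HH_comp)
  show "to_cover m (gscale HH0 m c X) = gscale (HH L) m c (to_cover m X)" for c
    using fc const_closed[OF fc] gcocycles_scale[OF f(1)]
    by (simp add: f to_cover_class T.HH_scale L.HH_scale const_scale)
  fix Y assume "Y \<in> gcomp HH0 m"
  then obtain g where g: "g \<in> gcocycles m" "Y = T.hclass m g" by auto
  note gc = gcocycles_hc[OF g(1)]
  show "to_cover m (gadd HH0 m X Y) = gadd (HH L) m (to_cover m X) (to_cover m Y)"
    using fc gc const_closed[OF fc] const_closed[OF gc] gcocycles_add[OF f(1) g(1)] f(1) g(1)
    by (simp add: f(2) g(2) to_cover_class T.HH_add L.HH_add const_add)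
next
  show "to_cover 0 (gone HH0) = gone (HH L)"
    using to_cover_class[OF gcocycles_one] by (simp add: T.HH_one L.HH_one const_one)
next
  fix i j X Y assume "X \<in> gcomp HH0 i" "Y \<in> gcomp HH0 j"
  then obtain f g where f: "f \<in> gcocycles i" "X = T.hclass i f" and g: "g \<in> gcocycles j" "Y = T.hclass j g" by auto
  note c = f(1)[THEN gcocycles_hc] g(1)[THEN gcocycles_hc]
  note m = gcocycles_mult[OF f(1) g(1)]
  have "L.hclass (i + j) (const (i + j) (gmult (cocycle_algebra T) i j f g)) =
      L.hclass (i + j) (gmult (cocycle_algebra L) i j (const i f) (const j g))"
    using const_mult[OF f(1) g(1)] const_closed[OF gcocycles_hc[OF m]] L.hcocycles_mult[OF c[THEN const_closed]]
    by (simp add: L.HH_eq)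
  then show "to_cover (i + j) (gmult HH0 i j X Y) = gmult (HH L) i j (to_cover i X) (to_cover j Y)"
    using c m f(1) g(1) c[THEN const_closed]
    by (simp add: f(2) g(2) to_cover_class T.HH_mult L.HH_mult)
qed

lemma Y_class: "Y.D1 \<in> hcocycles L 1"
  using Y.D1_closed Y.D1_cocycle L.hcocycles_int[of _ 1] by simp

lemma turn_cup_cocycle:
  assumes "v \<in> gcocycles (int k)"
  shows "hcup L k 1 (const (int k) v) Y.D1 \<in> hcocycles L (int (Suc k))"
proof -
  have "gmult (cocycle_algebra L) (int k) (int 1) (const (int k) v) Y.D1 \<in> hcocycles L (int k + int 1)"
    using const_closed[OF gcocycles_hc[OF assms]] Y_class by (intro L.hcocycles_mult) auto
  then show ?thesis unfolding L.cocycle_algebra_mult(3) by (simp add: add.commute)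
qed

text \<open>
  If the constant family \<open>f\<close> is a boundary, \<open>constant_coboundary\<close> splits off a multiple
  of \<open>E.D1\<close>.
\<close>

lemma E_kernel:
  assumes f: "f \<in> gcocycles m" and z: "const m f \<in> hcoboundaries L m"
  obtains v where "v \<in> gcocycles (m - 1)" "f - gmult (cocycle_algebra T) (m - 1) 1 v E.D1 \<in> hcoboundaries T m"
proof (cases m rule: int_degree_cases)
  case 1
  then show thesis using that[of 0] f T.hcoboundaries_zero by simp
next
  case (2 k)
  show thesis
  proof (cases k)
    case 0
    have fg: "f \<in> graded 0" using f gcocycles_int[of f 0] 2 0 by simp
    have "Q 0 (const 0 f) b = 0" for b using z by (simp add: 2 0 Q_def fun_eq_iff del: const_simps)
    then have "f = 0" using Q_const[OF fg] by simp
    then show thesis using that[of 0] by (simp add: 2 0)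
  next
    case (Suc l)
    have fg: "f \<in> graded (Suc l)" using f unfolding 2 Suc gcocycles_int by simp
    obtain g where g: "g \<in> families l" "\<And>b. Q (Suc l) (const (int (Suc l)) f) b = dl l g b"
      by (rule Q_of_coboundary[OF z[unfolded 2 Suc]], rule that)
    obtain v u where v: "v \<in> graded l" "hdiff T l v = 0" "u \<in> hcochains T l" "f = R l v + hdiff T l u"
      by (rule constant_coboundary[OF fg g(1)]) (use g(2) Q_const[OF fg] in metis)
    have m1: "m - 1 = int l" by (simp add: 2 Suc)
    show thesis
    proof (rule that)
      show "v \<in> gcocycles (m - 1)" using v by (simp add: m1 gcocycles_int)
      have "gmult (cocycle_algebra T) (m - 1) 1 v E.D1 = R l v"
        unfolding m1 R_def using T.cocycle_algebra_mult(3)[of l 1] by simp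
      then have "f - gmult (cocycle_algebra T) (m - 1) 1 v E.D1 = hdiff T l u" using v(4) by simp
      then show "f - gmult (cocycle_algebra T) (m - 1) 1 v E.D1 \<in> hcoboundaries T m"
        unfolding 2 Suc T.hcoboundaries_Suc using v(3) by simp
    qed
  qed
qed

lemma E_annihilator:
  assumes v: "v \<in> gcocycles m" and z: "gmult (cocycle_algebra T) m 1 v E.D1 \<in> hcoboundaries T (m + 1)"
  shows "const m v \<in> hcoboundaries L m"
proof (cases m rule: int_degree_cases)
  case 1
  then show ?thesis by simp
next
  case (2 k)
  have vk: "v \<in> graded k" "hdiff T k v = 0" using v by (auto simp: 2 gcocycles_int)
  have "R k v \<in> hcoboundaries T (int (Suc k))"
    using z T.cocycle_algebra_mult(3)[of k 1] by (simp add: 2 R_def add.commute)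
  then obtain u where u: "u \<in> hcochains T k" "R k v = hdiff T k u"
    unfolding T.hcoboundaries_Suc by blast
  show ?thesis
  proof (cases k)
    case 0
    have "v = 0" by (rule R_boundary_imp_0) (use vk u 0 in auto)
    then show ?thesis using const_boundary[OF T.hcoboundaries_zero] by simp
  next
    case (Suc l)
    obtain h where h: "h \<in> gfamilies l" "\<And>b. dl l h b = v"
      using R_boundary_imp[OF vk[unfolded Suc] u[unfolded Suc]] by blast
    show ?thesis
      unfolding 2 Suc
    proof (rule coboundary_if_Q)
      show "const (int (Suc l)) v \<in> hcocycles L (int (Suc l))"
        using const_closed[OF gcocycles_hc[OF v]] by (simp only: 2 Suc)
      show "h \<in> families l" by (rule gfamilies_families[OF h(1)])
      show "pr (Suc l) (Q (Suc l) (const (int (Suc l)) v) b) = dl l h b" for b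
        using Q_const[OF vk(1)[unfolded Suc]] vk(1)[unfolded Suc] h(2) by (simp add: graded_def)
    qed
  qed
qed

lemma cover_decomposition:
  assumes F: "F \<in> hcocycles L m"
  obtains w v where "w \<in> gcocycles m" "v \<in> gcocycles (m - 1)"
    "F - (const m w + gmult (cocycle_algebra L) (m - 1) 1 (const (m - 1) v) Y.D1) \<in> hcoboundaries L m"
proof (cases m rule: int_degree_cases)
  case 1
  then show thesis using that[of 0 0] F by simp
next
  case (2 k)
  have Fc: "F \<in> hcochains L k" "hdiff L k F = 0" using F by (auto simp: 2 L.hcocycles_int)
  define z where "z = (\<lambda>b. pr k (Q k F b))"
  have QF: "Q k F \<in> families k" by (rule Q_closed[OF Fc(1)])
  have z: "z \<in> gfamilies k" unfolding z_def by (rule gfamilies_pr[OF QF])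
  have "Q (Suc k) 0 = 0" by (auto simp: Q_def fun_eq_iff)
  then have dQ: "dl k (Q k F) = 0" using Q_hdiff[OF Fc(1)] Fc(2) by simp
  have dz: "dl k z b = 0" for b
    unfolding z_def dl_pr[OF QF] dQ by simp
  show thesis
  proof (cases k)
    case 0
    note zc = cocycle_decomposition_0[OF z[unfolded 0] dz[unfolded 0]]
    have w: "z 0 \<in> gcocycles 0" using gcocycles_int[of "z 0" 0] zc(2) gfamilies_graded[OF z] by (simp add: 0)
    then have wg: "z 0 \<in> graded 0" using gcocycles_int[of "z 0" 0] by simp
    have c: "const (int 0) (z 0) \<in> hcocycles L (int 0)"
      using const_closed[OF gcocycles_hc[OF w]] by simp
    have "F - const (int 0) (z 0) \<in> hcoboundaries L (int 0)"
    proof (rule coboundary_if_Q_zero)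
      show "F - const (int 0) (z 0) \<in> hcocycles L (int 0)"
        using F c unfolding 2 0 L.hcocycles_int by (simp add: L.hc_diff L.hdiff_diff del: const_simps)
      show "pr 0 (Q 0 (F - const (int 0) (z 0)) b) = 0" for b
      proof -
        have "pr 0 (Q 0 F b) = z 0" using zc(1)[of b] unfolding z_def 0 .
        moreover have "pr 0 (z 0) = z 0" using wg by (simp add: graded_def)
        ultimately show ?thesis unfolding Q_diff Q_const[OF wg] pr_diff by simp
      qed
    qed
    then show thesis using that[of "z 0" 0] w by (simp add: 2 0 del: const_simps(2))
  next
    case (Suc l)
    obtain w v g where d: "w \<in> graded (Suc l)" "hdiff T (Suc l) w = 0" "v \<in> graded l" "hdiff T l v = 0"
      "g \<in> gfamilies l" "\<And>b. z b = w + sm (at_turn b) (R l v) + dl l g b"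
      by (rule cocycle_decomposition[OF z[unfolded Suc] dz[unfolded Suc]], rule that)
    have w: "w \<in> gcocycles (int (Suc l))" and v: "v \<in> gcocycles (int l)"
      using d unfolding gcocycles_int by auto
    let ?G = "F - (const (int (Suc l)) w + hcup L l 1 (const (int l) v) Y.D1)"
    have "?G \<in> hcoboundaries L (int (Suc l))"
    proof (rule coboundary_if_Q)
      show "?G \<in> hcocycles L (int (Suc l))"
        using F const_closed[OF gcocycles_hc[OF w]] turn_cup_cocycle[OF v] unfolding 2 Suc L.hcocycles_int
        by (simp add: L.hc_diff L.hdiff_diff L.hc_add L.hdiff_add del: const_simps)
      show "g \<in> families l" by (rule gfamilies_families[OF d(5)])
      fix b
      have pw: "pr (Suc l) w = w" using d(1) by (simp add: graded_def)
      have pv: "pr (Suc l) (sm (at_turn b) (R l v)) = sm (at_turn b) (R l v)"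
        using graded_sm[OF graded_R[OF d(3)]] by (simp add: graded_def)
      have "pr (Suc l) (Q (Suc l) F b) = w + sm (at_turn b) (R l v) + dl l g b"
        using d(6)[of b] unfolding z_def Suc .
      then show "pr (Suc l) (Q (Suc l) ?G b) = dl l g b"
        unfolding Q_diff Q_add Q_const[OF d(1)] Q_cup_turn[OF d(3)] pr_diff pr_add pw pv by simp
    qed
    moreover have "m - 1 = int l" by (simp add: 2 Suc)
    moreover have "gmult (cocycle_algebra L) (int l) 1 (const (int l) v) Y.D1 = hcup L l 1 (const (int l) v) Y.D1"
      using L.cocycle_algebra_mult(3)[of l 1] by simp
    ultimately show thesis using that[of w v] w v unfolding 2 Suc by (simp only:)
  qed
qed

lemma cover_independence:
  assumes w: "w \<in> gcocycles m" and v: "v \<in> gcocycles (m - 1)"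
    and z: "const m w + gmult (cocycle_algebra L) (m - 1) 1 (const (m - 1) v) Y.D1 \<in> hcoboundaries L m"
  shows "const (m - 1) v \<in> hcoboundaries L (m - 1)"
proof (cases "m \<le> 0")
  case True
  then show ?thesis by simp
next
  case False
  then obtain l where m: "m = int (Suc l)" by (metis gr0_implies_Suc not_le of_nat_0_less_iff zero_less_imp_eq_int)
  have m1: "m - 1 = int l" by (simp add: m)
  have wg: "w \<in> graded (Suc l)" using w unfolding m gcocycles_int by simp
  have vg: "v \<in> graded l" "hdiff T l v = 0" using v unfolding m1 gcocycles_int by auto
  have zl: "const (int (Suc l)) w + hcup L l 1 (const (int l) v) Y.D1 \<in> hcoboundaries L (int (Suc l))"
    using z L.cocycle_algebra_mult(3)[of l 1] unfolding m1 by (simp add: m del: const_simps)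
  obtain g where g: "g \<in> families l"
    "\<And>b. Q (Suc l) (const (int (Suc l)) w + hcup L l 1 (const (int l) v) Y.D1) b = dl l g b"
    by (rule Q_of_coboundary[OF zl], rule that)
  have e: "w + sm (at_turn b) (R l v) = dl l g b" for b
    using g(2)[of b] unfolding Q_add Q_const[OF wg] Q_cup_turn[OF vg(1)] .
  show ?thesis
  proof (cases l)
    case 0
    have "v = 0" by (rule turn_boundary_imp_0[OF _ _ _ _ e[unfolded 0]]) (use wg vg g(1) 0 in auto)
    then show ?thesis using const_boundary[OF T.hcoboundaries_zero] by simp
  next
    case (Suc k)
    obtain h where h: "h \<in> gfamilies k" "\<And>b. dl k h b = v"
      using turn_boundary_imp[OF wg[unfolded Suc] vg[unfolded Suc] g(1)[unfolded Suc] e[unfolded Suc]] by blast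
    show ?thesis
      unfolding m1 Suc
    proof (rule coboundary_if_Q)
      show "const (int (Suc k)) v \<in> hcocycles L (int (Suc k))"
        using const_closed[OF gcocycles_hc[OF v]] by (simp only: m1 Suc)
      show "h \<in> families k" by (rule gfamilies_families[OF h(1)])
      show "pr (Suc k) (Q (Suc k) (const (int (Suc k)) v) b) = dl k h b" for b
        using Q_const[OF vg(1)[unfolded Suc]] vg(1)[unfolded Suc] h(2) by (simp add: graded_def)
    qed
  qed
qed

text \<open>
  The cocycle \<open>E.D1\<close> becomes a coboundary on the cover, by \<open>R_coboundary\<close> for the unit, while
  \<open>Y.D1\<close>, which counts only the arrows that close the cycle, contributes a complement.
\<close>

theorem cover_extension: "extension_data HH0 (HH L) to_cover (T.hclass 1 E.D1) (L.hclass 1 Y.D1)"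
proof (intro extension_data.intro extension_data_axioms.intro HH0_algebra L.HH_algebra to_cover_hom)
  note Ec = gcocycles_hc[OF gcocycles_E]
  have Ec': "E.D1 \<in> hcocycles T 1" by (rule Ec)
  show "T.hclass 1 E.D1 \<in> gcomp HH0 1" using gcocycles_E by simp
  show "L.hclass 1 Y.D1 \<in> gcomp (HH L) 1" using Y_class by (simp add: L.HH_comp)
  show "gmult HH0 1 1 (T.hclass 1 E.D1) (T.hclass 1 E.D1) = gzero HH0 2"
    using T.HH_mult[OF Ec Ec] T.cocycle_algebra_mult(3)[of 1 1] E_cup_E by (simp add: T.HH_zero)
  show "gmult (HH L) 1 1 (L.hclass 1 Y.D1) (L.hclass 1 Y.D1) = gzero (HH L) 2"
    using L.HH_mult[OF Y_class Y_class] L.cocycle_algebra_mult(3)[of 1 1] Y_cup_Y by (simp add: L.HH_zero)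
  show "gmult HH0 1 i (T.hclass 1 E.D1) b = gscale HH0 (1 + i) (if even i then 1 else - 1) (gmult HH0 i 1 b (T.hclass 1 E.D1))"
    if "b \<in> gcomp HH0 i" for b i
  proof -
    have "b \<in> gcomp (HH T) i" using that gcocycles_hc by (auto simp: T.HH_comp)
    from E.derivation_class_commutes[OF this] show ?thesis by simp
  qed
  show "gmult (HH L) 1 i (L.hclass 1 Y.D1) a = gscale (HH L) (1 + i) (if even i then 1 else - 1) (gmult (HH L) i 1 a (L.hclass 1 Y.D1))"
    if "a \<in> to_cover i ` gcomp HH0 i" for a i
  proof (rule Y.derivation_class_commutes)
    show "a \<in> gcomp (HH L) i" using that to_cover_hom unfolding galg_hom_def linear_graded_def by blast
  qed
  show "to_cover 1 (T.hclass 1 E.D1) = gzero (HH L) 1"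
  proof -
    let ?one = "\<lambda>xs. if xs = [] then \<one>\<^bsub>T\<^esub> else 0"
    have o: "?one \<in> hcochains T 0" "hdiff T 0 ?one = 0" using T.gone_cocycle T.hcocycles_int[of _ 0] by auto
    have R: "R 0 ?one = E.D1" unfolding R_def using T.hcup_one(1)[OF E.D1_closed] .
    obtain g where g: "g \<in> families 0" "\<And>b. dl 0 g b = R 0 ?one" by (rule R_coboundary[OF o], rule that)
    have Eg: "E.D1 \<in> graded (Suc 0)" using gcocycles_E gcocycles_int[of E.D1 1] by simp
    have "const (int (Suc 0)) E.D1 \<in> hcoboundaries L (int (Suc 0))"
    proof (rule coboundary_if_Q[OF _ g(1)])
      show "const (int (Suc 0)) E.D1 \<in> hcocycles L (int (Suc 0))" using const_closed[OF Ec] by simp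
      show "pr (Suc 0) (Q (Suc 0) (const (int (Suc 0)) E.D1) b) = dl 0 g b" for b
        unfolding Q_const[OF Eg] g(2) R using Eg by (simp add: graded_def)
    qed
    then show ?thesis
      using const_closed[OF Ec] by (simp add: to_cover_class[OF gcocycles_E] L.HH_eq_zero del: const_simps)
  qed
  show "\<exists>v\<in>gcomp HH0 (m - 1). x = gmult HH0 (m - 1) 1 v (T.hclass 1 E.D1)"
    if "x \<in> gcomp HH0 m" "to_cover m x = gzero (HH L) m" for x m
  proof -
    have "x \<in> T.hclass m ` gcocycles m" using that(1) by simp
    then obtain f where f: "f \<in> gcocycles m" "x = T.hclass m f" by blast
    have "const m f \<in> hcoboundaries L m"
      using that(2) const_closed[OF gcocycles_hc[OF f(1)]] by (simp add: f(2) to_cover_class[OF f(1)] L.HH_eq_zero)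
    then obtain v where v: "v \<in> gcocycles (m - 1)" "f - gmult (cocycle_algebra T) (m - 1) 1 v E.D1 \<in> hcoboundaries T m"
      using E_kernel[OF f(1)] by blast
    have "gmult (cocycle_algebra T) (m - 1) 1 v E.D1 \<in> hcocycles T m"
      using T.hcocycles_mult[OF gcocycles_hc[OF v(1)] Ec] by simp
    then have "x = T.hclass m (gmult (cocycle_algebra T) (m - 1) 1 v E.D1)"
      using v(2) gcocycles_hc[OF f(1)] by (simp add: f(2) T.HH_eq)
    then have "x = gmult HH0 (m - 1) 1 (T.hclass (m - 1) v) (T.hclass 1 E.D1)"
      using T.HH_mult[OF gcocycles_hc[OF v(1)] Ec] by simp
    then show ?thesis using v(1) by auto
  qed
  show "to_cover m x = gzero (HH L) m"
    if "x \<in> gcomp HH0 m" "gmult HH0 m 1 x (T.hclass 1 E.D1) = gzero HH0 (m + 1)" for x m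
  proof -
    have "x \<in> T.hclass m ` gcocycles m" using that(1) by simp
    then obtain v where v: "v \<in> gcocycles m" "x = T.hclass m v" by blast
    have "gmult (cocycle_algebra T) m 1 v E.D1 \<in> hcoboundaries T (m + 1)"
      using that(2) T.HH_mult[OF gcocycles_hc[OF v(1)] Ec] T.hcocycles_mult[OF gcocycles_hc[OF v(1)] Ec]
      by (simp add: v(2) T.HH_eq_zero)
    then show ?thesis
      using E_annihilator[OF v(1)] const_closed[OF gcocycles_hc[OF v(1)]]
      by (simp add: v(2) to_cover_class[OF v(1)] L.HH_eq_zero)
  qed
  have sum: "gadd (HH L) m (to_cover m (T.hclass m w)) (gmult (HH L) (m - 1) 1 (to_cover (m - 1) (T.hclass (m - 1) v)) (L.hclass 1 Y.D1))
      = L.hclass m (const m w + gmult (cocycle_algebra L) (m - 1) 1 (const (m - 1) v) Y.D1)"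
    and sum_closed: "const m w + gmult (cocycle_algebra L) (m - 1) 1 (const (m - 1) v) Y.D1 \<in> hcocycles L m"
    if w: "w \<in> gcocycles m" and v: "v \<in> gcocycles (m - 1)" for w v m
  proof -
    note wc = const_closed[OF gcocycles_hc[OF w]] and vc = const_closed[OF gcocycles_hc[OF v]]
    have m: "gmult (cocycle_algebra L) (m - 1) 1 (const (m - 1) v) Y.D1 \<in> hcocycles L m"
      using L.hcocycles_mult[OF vc Y_class] by simp
    show "const m w + gmult (cocycle_algebra L) (m - 1) 1 (const (m - 1) v) Y.D1 \<in> hcocycles L m"
      by (rule L.hcocycles_add[OF wc m])
    show "gadd (HH L) m (to_cover m (T.hclass m w)) (gmult (HH L) (m - 1) 1 (to_cover (m - 1) (T.hclass (m - 1) v)) (L.hclass 1 Y.D1))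
      = L.hclass m (const m w + gmult (cocycle_algebra L) (m - 1) 1 (const (m - 1) v) Y.D1)"
      using L.HH_mult[OF vc Y_class] L.HH_add[OF wc m] by (simp add: to_cover_class[OF w] to_cover_class[OF v])
  qed
  show "\<exists>w\<in>gcomp HH0 m. \<exists>v\<in>gcomp HH0 (m - 1).
      z = gadd (HH L) m (to_cover m w) (gmult (HH L) (m - 1) 1 (to_cover (m - 1) v) (L.hclass 1 Y.D1))"
    if "z \<in> gcomp (HH L) m" for z m
  proof -
    have "z \<in> L.hclass m ` hcocycles L m" using \<open>z \<in> gcomp (HH L) m\<close> by (simp add: L.HH_comp)
    then obtain F where F: "F \<in> hcocycles L m" "z = L.hclass m F" by blast
    obtain w v where wv: "w \<in> gcocycles m" "v \<in> gcocycles (m - 1)"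
      "F - (const m w + gmult (cocycle_algebra L) (m - 1) 1 (const (m - 1) v) Y.D1) \<in> hcoboundaries L m"
      using cover_decomposition[OF F(1)] by blast
    have "z = gadd (HH L) m (to_cover m (T.hclass m w)) (gmult (HH L) (m - 1) 1 (to_cover (m - 1) (T.hclass (m - 1) v)) (L.hclass 1 Y.D1))"
      unfolding sum[OF wv(1,2)] F(2) using L.HH_eq[OF F(1) sum_closed[OF wv(1,2)]] wv(3) by simp
    then show ?thesis using wv(1,2) by auto
  qed
  show "to_cover (m - 1) x' = gzero (HH L) (m - 1)"
    if "x \<in> gcomp HH0 m" "x' \<in> gcomp HH0 (m - 1)"
      "gadd (HH L) m (to_cover m x) (gmult (HH L) (m - 1) 1 (to_cover (m - 1) x') (L.hclass 1 Y.D1)) = gzero (HH L) m" for x x' m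
  proof -
    have "x \<in> T.hclass m ` gcocycles m" "x' \<in> T.hclass (m - 1) ` gcocycles (m - 1)" using that(1,2) by simp_all
    then obtain w v where w: "w \<in> gcocycles m" "x = T.hclass m w" and v: "v \<in> gcocycles (m - 1)" "x' = T.hclass (m - 1) v" by blast
    have "const m w + gmult (cocycle_algebra L) (m - 1) 1 (const (m - 1) v) Y.D1 \<in> hcoboundaries L m"
      using that(3) L.HH_eq_zero[OF sum_closed[OF w(1) v(1)]] unfolding w(2) v(2) sum[OF w(1) v(1)] by simp
    then show ?thesis
      using cover_independence[OF w(1) v(1)] const_closed[OF gcocycles_hc[OF v(1)]]
      by (simp add: v(2) to_cover_class[OF v(1)] L.HH_eq_zero)
  qed
qed

end

theorem theorem14p4:
  fixes R :: "('k::field, 'r::ab_group_add) kalg" and n :: nat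
  assumes "fd_kalgebra R" and "n \<ge> 1" and "CHAR('k) dvd n"
  shows "\<exists>A :: ('k, ((int \<Rightarrow> 'r \<times> ('r \<Rightarrow> 'k)) list \<Rightarrow> (int \<Rightarrow> 'r \<times> ('r \<Rightarrow> 'k))) set) galg.
    graded_algebra A
    \<and> trivial_singular_extension (HH (smash_trivial_ext R n)) A (gshift (-1) (regular_bimodule A))
    \<and> singular_extension
        (HH_0 (integer_mod_group n) (trivial_ext_cyclic_grading R n) (trivial_ext R))
        A (gshift (-1) (regular_bimodule A))
    \<and> HH (smash_trivial_ext R n) \<cong>\<^sub>g gpoly_mod_x2 A"
proof -
  interpret R: fd_kalgebra R by fact
  let ?T = "trivial_ext R" and ?L = "smash_trivial_ext R n"
  have "n \<noteq> 1" using assms(3) CHAR_not_1 by auto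
  then have n: "n \<ge> 2" using assms(2) by simp
  have "of_nat n = (0 :: 'k)" using assms(3) by (simp add: of_nat_eq_0_iff_char_dvd)
  then interpret C: char_cover ?T q0 q1 n ?L R.trace
    by (intro char_cover.intro char_cover_axioms.intro R.smash_cover[OF n])
  interpret X: extension_data C.HH0 "HH ?L" C.to_cover "C.T.hclass 1 C.E.D1" "C.L.hclass 1 C.Y.D1"
    by (rule C.cover_extension)
  have H0: "HH_0 (integer_mod_group n) (trivial_ext_cyclic_grading R n) ?T = C.HH0"
    unfolding HH_0_def C.gcocycles_def R.grading_preserving_iff[OF n] ..
  show ?thesis
  proof (intro exI[of _ X.A] conjI)
    show "graded_algebra X.A" by (rule X.A_algebra)
    show "trivial_singular_extension (HH ?L) X.A (gshift (-1) (regular_bimodule X.A))"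
      unfolding trivial_singular_extension_def using X.singular_E1 X.TX_iso by blast
    show "singular_extension (HH_0 (integer_mod_group n) (trivial_ext_cyclic_grading R n) ?T) X.A
        (gshift (-1) (regular_bimodule X.A))"
      unfolding H0 by (rule X.singular_E0)
    show "HH ?L \<cong>\<^sub>g gpoly_mod_x2 X.A"
      by (rule galg_isomorphic_trans[OF X.TX_iso X.A.trivial_ext_iso_gpoly_mod_x2])
  qed
qed

end
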